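(* Let $G_{\triangle}$ and $G_{Y}$ be finite graphs such that $G_{Y}$ is obtained from $G_{\triangle}$ by a single $\triangle Y$-exchange at a $3$-cycle $\triangle$ of $G_\triangle$. Let $A$ be an additive (abelian) group, and suppose that to each $\gamma'\in\bar{\Gamma}(G_{\triangle})$ an $A$-valued unoriented link invariant $\alpha_{\gamma'}$ is assigned. For each $\gamma\in\bar{\Gamma}(G_{Y})$ define an $A$-valued unoriented link invariant $\tilde{\alpha}_\gamma$ by $$\tilde{\alpha}_\gamma(L)=\sum_{\gamma'\in\bar{\Phi}^{-1}(\gamma)}\alpha_{\gamma'}(L),$$ where $\bar\Phi:\bar{\Gamma}(G_{\triangle})\setminus \bar{\Gamma}_{\triangle}(G_{\triangle})\to \bar{\Gamma}(G_{Y})$ is the map defined in the context. Suppose that $\alpha_{\gamma'}$ is compressible for each $\gamma'\in\bar{\Gamma}_\triangle(G_\triangle)$, and that there exists a fixed element $c\in A$ such that $$\sum_{\gamma'\in\bar{\Gamma}(G_{\triangle})}\alpha_{\gamma'}(g(\gamma'))=c$$ for every $g\in {\rm SE}(G_{\triangle})$. Then $$\sum_{\gamma\in\bar{\Gamma}(G_{Y})}\tilde{\alpha}_\gamma(f(\gamma))=c$$ for every $f\in {\rm SE}(G_{Y})$.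
   Context: Everything is in the piecewise linear category. For a finite graph $G$, a spatial embedding of $G$ is an embedding of $G$ into the $3$-sphere $S^3$; ${\rm SE}(G)$ denotes the set of all spatial embeddings of $G$. A cycle of $G$ is a subgraph homeomorphic to a circle; a $k$-cycle is a cycle with exactly $k$ edges. $\Gamma^{(1)}(G)=\Gamma(G)$ is the set of all cycles of $G$; for $n\ge 2$, $\Gamma^{(n)}(G)$ is the set of all unions of $n$ mutually disjoint cycles of $G$; $\bar{\Gamma}(G)=\bigcup_{n\ge1}\Gamma^{(n)}(G)$. For $\gamma\in\Gamma^{(n)}(G)$ and $f\in{\rm SE}(G)$, $f(\gamma)$ is an $n$-component link (a knot if $n=1$). $\triangle Y$-exchange: given a graph $G_{\triangle}$ with a $3$-cycle $\triangle$ with edges $uv,vw,wu$, the graph $G_{Y}$ is obtained by removing the three edges $uv,vw,wu$, adding a new vertex $x$, and connecting $x$ to each of $u,v,w$ by an edge. Write $Y=ux\cup vx\cup wx$. $\bar{\Gamma}_{\triangle}(G_{\triangle})$ is the set of all elements of $\bar{\Gamma}(G_{\triangle})$ containing $\triangle$. For $\gamma'\in\bar{\Gamma}(G_{\triangle})\setminus\bar{\Gamma}_{\triangle}(G_{\triangle})$, $\bar{\Phi}(\gamma')$ is the element of $\bar{\Gamma}(G_{Y})$ with $\gamma'\setminus\triangle=\bar{\Phi}(\gamma')\setminus Y$ (as point sets, identifying $G_\triangle\setminus\triangle$ with $G_Y\setminus Y$). Explicitly: if $\gamma'$ uses no edge of $\triangle$ then $\bar\Phi(\gamma')=\gamma'$;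 if $\gamma'$ meets the edges of $\triangle$ in a path with two endpoints $a,b\in\{u,v,w\}$ (of one or two edges), then this path is replaced by $ax\cup xb$. The map $\bar\Phi$ is surjective. An $A$-valued unoriented link invariant $\alpha$ is an assignment of an element $\alpha(L)\in A$ to each unoriented link $L$ in $S^3$ (with one or more components), depending only on the ambient isotopy class of $L$. It is compressible if $\alpha(L)=0$ for every unoriented link $L$ having a component $K$ that bounds a disk $D$ in $S^3$ with $D\cap L=\partial D=K$; in particular $\alpha(L)=0$ when $L$ is a trivial knot. *)

theory Defs
  imports "HOL-Analysis.Analysis" "Graph_Theory.Digraph_Component"
begin

section \<open>The piecewise linear category\<close>

text \<open>
  A map on a compact polyhedron is piecewise linear if the polyhedron is a finite union of
  (compact, convex) polytopes on each of which the map is affine.  Since polytopes are closed,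
  such a map is automatically continuous on \<open>X\<close>.
\<close>

definition pl_on :: "'a::euclidean_space set \<Rightarrow> ('a \<Rightarrow> 'b::euclidean_space) \<Rightarrow> bool" where
  "pl_on X f \<longleftrightarrow>
     (\<exists>\<P>. finite \<P> \<and> \<Union>\<P> = X \<and>
        (\<forall>P\<in>\<P>. polytope P \<and> (\<exists>h c. linear h \<and> (\<forall>x\<in>P. f x = h x + c))))"

text \<open>
  The PL 3-sphere, modelled by the boundary of the cube \<open>[-1,1]\<^sup>4\<close>.  (The round sphere
  is not a polyhedron.)
\<close>

definition S3 :: "(real^4) set" where
  "S3 = {x. infnorm x = 1}"

section \<open>Links\<close>

text \<open>
  Knots and links are unoriented: they are point sets.  The PL parametrisation of a knot is only
  required to exist.
\<close>

definition knot :: "(real^4) set \<Rightarrow> bool" where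
  "knot K \<longleftrightarrow> K \<subseteq> S3 \<and>
     (\<exists>p. pl_on {0..1} p \<and> simple_path p \<and> pathfinish p = pathstart p \<and> path_image p = K)"

definition link :: "(real^4) set \<Rightarrow> bool" where
  "link L \<longleftrightarrow>
     (\<exists>\<K>. finite \<K> \<and> \<K> \<noteq> {} \<and> (\<forall>K\<in>\<K>. knot K) \<and> pairwise disjnt \<K> \<and> L = \<Union>\<K>)"

text \<open>
  A PL ambient isotopy is a PL map \<open>H\<close> on \<open>S3 \<times> [0,1]\<close> starting at the identity,
  all of whose levels are bijections of \<open>S3\<close>; by compactness every level (and the
  level-preserving map \<open>(x,t) \<mapsto> (H(x,t),t)\<close>) is then a PL homeomorphism.
\<close>

definition ambient_isotopic :: "(real^4) set \<Rightarrow> (real^4) set \<Rightarrow> bool" where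
  "ambient_isotopic L L' \<longleftrightarrow>
     (\<exists>H. pl_on (S3 \<times> {0..1::real}) H \<and>
          (\<forall>t\<in>{0..1}. bij_betw (\<lambda>x. H (x, t)) S3 S3) \<and>
          (\<forall>x\<in>S3. H (x, 0) = x) \<and>
          (\<lambda>x. H (x, 1)) ` L = L')"

definition link_invariant :: "((real^4) set \<Rightarrow> 'a) \<Rightarrow> bool" where
  "link_invariant \<alpha> \<longleftrightarrow>
     (\<forall>L L'. link L \<and> link L' \<and> ambient_isotopic L L' \<longrightarrow> \<alpha> L = \<alpha> L')"

text \<open>\<open>D\<close> is a PL disk in \<open>S3\<close> with boundary circle \<open>K\<close>; the model disk is the unit square.\<close>

definition pl_disk_with_boundary :: "(real^4) set \<Rightarrow> (real^4) set \<Rightarrow> bool" where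
  "pl_disk_with_boundary D K \<longleftrightarrow> D \<subseteq> S3 \<and>
     (\<exists>\<phi> :: real \<times> real \<Rightarrow> real^4.
        pl_on (cbox (0,0) (1,1)) \<phi> \<and> inj_on \<phi> (cbox (0,0) (1,1)) \<and>
        \<phi> ` cbox (0,0) (1,1) = D \<and> \<phi> ` frontier (cbox (0,0) (1,1)) = K)"

definition compressible :: "((real^4) set \<Rightarrow> 'a::ab_group_add) \<Rightarrow> bool" where
  "compressible \<alpha> \<longleftrightarrow>
     (\<forall>L K D. link L \<and> K \<in> components L \<and> pl_disk_with_boundary D K \<and> D \<inter> L = K
        \<longrightarrow> \<alpha> L = 0)"

section \<open>Graphs, cycles and spatial embeddings\<close>

text \<open>
  A finite graph (loops and multiple edges allowed) is given by a \<^const>\<open>fin_digraph\<close>.  The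
  direction of an edge carries no graph-theoretic meaning here: it only fixes the
  identification of the closed edge with \<open>[0,1]\<close> used to define the underlying space.

  Points of the underlying space are vertices and interior points of edges, so that
  subgraphs are subsets, and graphs with common vertices and edges share the
  corresponding points.
\<close>

datatype ('v, 'e) gpoint = Vertex 'v | Inner 'e real

definition realization :: "('v, 'e) pre_digraph \<Rightarrow> ('v, 'e) gpoint set" where
  "realization G = Vertex ` verts G \<union> {Inner e t | e t. e \<in> arcs G \<and> 0 < t \<and> t < 1}"

definition edge_param :: "('v, 'e) pre_digraph \<Rightarrow> 'e \<Rightarrow> real \<Rightarrow> ('v, 'e) gpoint" where
  "edge_param G e t =
     (if t = 0 then Vertex (tail G e) else if t = 1 then Vertex (head G e) else Inner e t)"

text \<open>The quotient topology coming from the disjoint union of the vertices and closed edges.\<close>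

definition realization_topology :: "('v, 'e) pre_digraph \<Rightarrow> ('v, 'e) gpoint topology" where
  "realization_topology G =
     topology (\<lambda>U. U \<subseteq> realization G \<and>
       (\<forall>e\<in>arcs G. openin (top_of_set {0..1}) {t\<in>{0..1}. edge_param G e t \<in> U}))"

lemma openin_realization_topology:
  "openin (realization_topology G) U \<longleftrightarrow> U \<subseteq> realization G \<and>
     (\<forall>e\<in>arcs G. openin (top_of_set {0..1}) {t\<in>{0..1}. edge_param G e t \<in> U})"
proof -
  let ?O = "\<lambda>e U. openin (top_of_set {0..1::real}) {t\<in>{0..1}. edge_param G e t \<in> U}"
  have int: "?O e (S \<inter> T)" if "?O e S" "?O e T" for e S T
  proof -
    have "{t\<in>{0..1}. edge_param G e t \<in> S \<inter> T} =
          {t\<in>{0..1}. edge_param G e t \<in> S} \<inter> {t\<in>{0..1}. edge_param G e t \<in> T}" by auto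
    then show ?thesis using openin_Int[OF that] by simp
  qed
  have un: "?O e (\<Union>\<U>)" if "\<forall>S\<in>\<U>. ?O e S" for e \<U>
  proof -
    have "{t\<in>{0..1}. edge_param G e t \<in> \<Union>\<U>} =
          (\<Union>S\<in>\<U>. {t\<in>{0..1}. edge_param G e t \<in> S})" by auto
    moreover have "openin (top_of_set {0..1}) (\<Union>S\<in>\<U>. {t\<in>{0..1}. edge_param G e t \<in> S})"
      by (rule openin_Union) (use that in blast)
    ultimately show ?thesis by simp
  qed
  have "istopology (\<lambda>U. U \<subseteq> realization G \<and> (\<forall>e\<in>arcs G. ?O e U))"
    unfolding istopology_def
  proof (intro conjI allI impI ballI)
    fix \<U> e
    assume "\<forall>S\<in>\<U>. S \<subseteq> realization G \<and> (\<forall>e\<in>arcs G. ?O e S)" "e \<in> arcs G"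
    then show "?O e (\<Union>\<U>)" by (intro un) blast
  qed (use int in blast)+
  then show ?thesis
    unfolding realization_topology_def by (simp add: topology_inverse')
qed

definition cycles :: "('v, 'e) pre_digraph \<Rightarrow> ('v, 'e) pre_digraph set" where
  "cycles G = {C. subgraph C G \<and>
     realization_topology C homeomorphic_space top_of_set (sphere (0::complex) 1)}"

text \<open>\<open>\<Gamma>\<^sup>(\<^sup>n\<^sup>)(G)\<close>; for \<open>n = 1\<close> these are the cycles themselves.\<close>

definition cycle_unions :: "nat \<Rightarrow> ('v, 'e) pre_digraph \<Rightarrow> ('v, 'e) pre_digraph set" where
  "cycle_unions n G =
     {\<lparr>verts = (\<Union>C\<in>\<C>. verts C), arcs = (\<Union>C\<in>\<C>. arcs C), tail = tail G, head = head G\<rparr> | \<C>.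
        \<C> \<subseteq> cycles G \<and> finite \<C> \<and> card \<C> = n \<and>
        pairwise (\<lambda>C C'. disjnt (verts C) (verts C')) \<C>}"

definition Gamma_bar :: "('v, 'e) pre_digraph \<Rightarrow> ('v, 'e) pre_digraph set" where
  "Gamma_bar G = (\<Union>n\<in>{1..}. cycle_unions n G)"

definition spatial_embedding :: "('v, 'e) pre_digraph \<Rightarrow> (('v, 'e) gpoint \<Rightarrow> real^4) \<Rightarrow> bool" where
  "spatial_embedding G f \<longleftrightarrow>
     f ` realization G \<subseteq> S3 \<and> inj_on f (realization G) \<and>
     (\<forall>e\<in>arcs G. pl_on {0..1} (\<lambda>t. f (edge_param G e t)))"

section \<open>The triangle-Y exchange\<close>

definition ends :: "('v, 'e) pre_digraph \<Rightarrow> 'e \<Rightarrow> 'v set" where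
  "ends G e = {tail G e, head G e}"

text \<open>
  \<open>GY\<close> arises from \<open>Gtri\<close> by exchanging the 3-cycle \<open>T = uv \<union> vw \<union> wu\<close> for
  \<open>Y = ux \<union> vx \<union> wx\<close>.  Edges outside \<open>T\<close> keep their names, ends and parametrisation, which
  identifies \<open>Gtri \<setminus> T\<close> with \<open>GY \<setminus> Y\<close>.
\<close>

definition delta_Y_exchange ::
  "('v, 'e) pre_digraph \<Rightarrow> ('v, 'e) pre_digraph \<Rightarrow> ('v, 'e) pre_digraph \<Rightarrow> ('v, 'e) pre_digraph \<Rightarrow> bool"
where
  "delta_Y_exchange Gtri T GY Y \<longleftrightarrow>
     (\<exists>u v w x uv vw wu ux vx wx.
        {u, v, w} \<subseteq> verts Gtri \<and> u \<noteq> v \<and> v \<noteq> w \<and> w \<noteq> u \<and>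
        {uv, vw, wu} \<subseteq> arcs Gtri \<and>
        ends Gtri uv = {u, v} \<and> ends Gtri vw = {v, w} \<and> ends Gtri wu = {w, u} \<and>
        T = \<lparr>verts = {u, v, w}, arcs = {uv, vw, wu}, tail = tail Gtri, head = head Gtri\<rparr> \<and>
        x \<notin> verts Gtri \<and>
        {ux, vx, wx} \<inter> arcs Gtri = {} \<and>
        verts GY = insert x (verts Gtri) \<and>
        arcs GY = (arcs Gtri - {uv, vw, wu}) \<union> {ux, vx, wx} \<and>
        ends GY ux = {u, x} \<and> ends GY vx = {v, x} \<and> ends GY wx = {w, x} \<and>
        (\<forall>e \<in> arcs Gtri - {uv, vw, wu}. tail GY e = tail Gtri e \<and> head GY e = head Gtri e) \<and>
        Y = \<lparr>verts = {u, v, w, x}, arcs = {ux, vx, wx}, tail = tail GY, head = head GY\<rparr>)"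

definition Gamma_bar_containing ::
  "('v, 'e) pre_digraph \<Rightarrow> ('v, 'e) pre_digraph \<Rightarrow> ('v, 'e) pre_digraph set" where
  "Gamma_bar_containing T Gtri = {\<gamma> \<in> Gamma_bar Gtri. subgraph T \<gamma>}"

text \<open>Only meaningful for \<open>\<gamma>' \<in> Gamma_bar Gtri - Gamma_bar_containing T Gtri\<close>.\<close>

definition Phi_bar ::
  "('v, 'e) pre_digraph \<Rightarrow> ('v, 'e) pre_digraph \<Rightarrow> ('v, 'e) pre_digraph \<Rightarrow>
   ('v, 'e) pre_digraph \<Rightarrow> ('v, 'e) pre_digraph"
where
  "Phi_bar T GY Y \<gamma>' =
     (THE \<gamma>. \<gamma> \<in> Gamma_bar GY \<and>
        realization \<gamma>' - realization T = realization \<gamma> - realization Y)"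

definition alpha_tilde ::
  "('v, 'e) pre_digraph \<Rightarrow> ('v, 'e) pre_digraph \<Rightarrow> ('v, 'e) pre_digraph \<Rightarrow> ('v, 'e) pre_digraph \<Rightarrow>
   (('v, 'e) pre_digraph \<Rightarrow> (real^4) set \<Rightarrow> 'a::ab_group_add) \<Rightarrow>
   ('v, 'e) pre_digraph \<Rightarrow> (real^4) set \<Rightarrow> 'a"
where
  "alpha_tilde Gtri T GY Y \<alpha> \<gamma> L =
     (\<Sum>\<gamma>' \<in> {\<gamma>' \<in> Gamma_bar Gtri - Gamma_bar_containing T Gtri. Phi_bar T GY Y \<gamma>' = \<gamma>}. \<alpha> \<gamma>' L)"

end

theory Submission
  imports Defs
begin

text \<open>
  Given \<open>f \<in> SE(GY)\<close>, a PL homeomorphism of the sphere carries the tripod \<open>f(Y)\<close> to a small planar tripod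
  and pushes the rest of \<open>f(GY)\<close> off the triangle \<open>D\<close> spanned by the three ends.  Replacing the tripod
  by \<open>\<partial>D\<close> gives \<open>g \<in> SE(Gtri)\<close>.  If \<open>\<gamma>'\<close> does not contain the 3-cycle, then \<open>g(\<gamma>')\<close> and
  \<open>f(\<Phi>(\<gamma>'))\<close> differ by sliding a side (or two sides) of \<open>D\<close> across \<open>D\<close> to two legs of the tripod, hence are
  ambient isotopic.  If \<open>\<gamma>'\<close> contains the 3-cycle, then \<open>D\<close> is a compressing disk for \<open>g(\<gamma>')\<close>, so this term
  vanishes.  Summing over \<open>\<gamma>'\<close> gives the claim.  All isotopies and most homeomorphisms are built from maps
  \<open>x \<mapsto> x + \<mu>(x) d\<close> supported near the centre of the upper face of the cube, and the elements of
  \<open>\<Gamma>\<close> are handled as the nonempty edge sets in which every vertex has degree 0 or 2.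
\<close>


section \<open>Piecewise linear maps\<close>

text \<open>One \<open>g\<close> has to serve all \<gamma>' at once, so the disk is cleared of the
  entire rest of the graph. The homeomorphism that standardises the tripod may reverse orientation,
  so a link and its image need not be isotopic; for this reason its inverse is applied to the
  embedding built in the standard picture, and the isotopies are conjugated accordingly. In the PL
  category a displacement cannot be multiplied by the time parameter, which would be quadratic;
  isotopies arise by truncating displacements instead. Near the centre of a face of the cube the
  sphere is flat, so explicit piecewise linear formulas stay on it. The remaining edges may run into
  the corners of the triangle, hence there is no fixed distance by which a shear could avoid them,
  only a distance proportional to that from the corner; it comes from a linear comparison of PL
  functions. Cycles are defined topologically, while \<Phi> and its fibres have to be computed,
  which is the reason for the detour through degrees.\<close>

definition affine_fun_on :: "'a::euclidean_space set \<Rightarrow> ('a \<Rightarrow> 'b::euclidean_space) \<Rightarrow> bool" where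
  "affine_fun_on P f \<longleftrightarrow> (\<exists>h c. linear h \<and> (\<forall>x\<in>P. f x = h x + c))"

definition polyhedral :: "'a::euclidean_space set \<Rightarrow> bool" where
  "polyhedral X \<longleftrightarrow> (\<exists>\<P>. finite \<P> \<and> \<Union>\<P> = X \<and> (\<forall>P\<in>\<P>. polytope P))"

lemma pl_on_alt:
  "pl_on X f \<longleftrightarrow> (\<exists>\<P>. finite \<P> \<and> \<Union>\<P> = X \<and> (\<forall>P\<in>\<P>. polytope P \<and> affine_fun_on P f))"
  by (simp add: pl_on_def affine_fun_on_def)

lemma affine_fun_on_subset: "affine_fun_on P f \<Longrightarrow> Q \<subseteq> P \<Longrightarrow> affine_fun_on Q f"
  unfolding affine_fun_on_def by blast

lemma affine_fun_on_cong: "affine_fun_on P f \<Longrightarrow> (\<And>x. x \<in> P \<Longrightarrow> f x = g x) \<Longrightarrow> affine_fun_on P g"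
  unfolding affine_fun_on_def by metis

lemma affine_fun_on_linear: "linear h \<Longrightarrow> affine_fun_on P (\<lambda>x. h x + c)"
  unfolding affine_fun_on_def by blast

lemma affine_fun_on_Pair:
  assumes "affine_fun_on P f" "affine_fun_on P g"
  shows "affine_fun_on P (\<lambda>x. (f x, g x))"
proof -
  obtain h c k d where "linear h" "linear k" "\<forall>x\<in>P. f x = h x + c" "\<forall>x\<in>P. g x = k x + d"
    using assms unfolding affine_fun_on_def by blast
  then have "linear (\<lambda>x. (h x, k x))" "\<forall>x\<in>P. (f x, g x) = (h x, k x) + (c, d)"
    by (auto simp: linear_iff)
  then show ?thesis unfolding affine_fun_on_def by blast
qed

lemma affine_fun_on_compose:
  assumes "affine_fun_on P f" "affine_fun_on Q g" "f ` P \<subseteq> Q"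
  shows "affine_fun_on P (\<lambda>x. g (f x))"
proof -
  obtain h c k d where *: "linear h" "linear k" "\<forall>x\<in>P. f x = h x + c" "\<forall>x\<in>Q. g x = k x + d"
    using assms unfolding affine_fun_on_def by blast
  then have "linear (\<lambda>x. k (h x))" using linear_compose[of h k] by (simp add: o_def)
  moreover have "\<forall>x\<in>P. g (f x) = k (h x) + (k c + d)"
    using * assms(3) by (auto simp: image_subset_iff linear_add)
  ultimately show ?thesis unfolding affine_fun_on_def by blast
qed

section \<open>Polytopes under affine maps\<close>

lemma affine_set_graph:
  assumes "linear h" shows "affine {z. snd z = h (fst z) + c}"
  unfolding affine_def using assms
  by (auto simp: linear_add linear_scale algebra_simps simp flip: scaleR_add_left)

text \<open>A preimage is the projection of the intersection of \<open>P \<times> Q\<close> with the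
  graph of \<open>f\<close>. The graph is an affine set, hence a polyhedron, and projections of
  polytopes are polytopes. This supplies the pieces of a composition.\<close>

lemma polytope_vimage:
  fixes f :: "'a::euclidean_space \<Rightarrow> 'b::euclidean_space"
  assumes "polytope P" "polytope Q" "affine_fun_on P f"
  shows "polytope {x \<in> P. f x \<in> Q}"
proof -
  obtain h c where h: "linear h" "\<forall>x\<in>P. f x = h x + c"
    using assms(3) unfolding affine_fun_on_def by blast
  let ?S = "(P \<times> Q) \<inter> {z. snd z = h (fst z) + c}"
  have "polytope ?S"
    by (intro polytope_Int_polyhedron polytope_Times assms affine_imp_polyhedron affine_set_graph h)
  then have "polytope (fst ` ?S)" by (intro polytope_linear_image linear_fst)
  moreover have "fst ` ?S = {x \<in> P. f x \<in> Q}" using h(2) by (force simp: image_iff)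
  ultimately show ?thesis by simp
qed

lemma polytope_affine_image:
  assumes "polytope P" "affine_fun_on P f"
  shows "polytope (f ` P)"
proof -
  obtain h c where h: "linear h" "\<forall>x\<in>P. f x = h x + c"
    using assms(2) unfolding affine_fun_on_def by blast
  then have "f ` P = (+) c ` (h ` P)" by (force simp: image_iff add.commute)
  then show ?thesis using h assms(1) by (simp add: polytope_translation_eq polytope_linear_image)
qed

lemma polytope_affine_ge:
  fixes f :: "'a::euclidean_space \<Rightarrow> real"
  assumes "polytope P" "affine_fun_on P f"
  shows "polytope {x \<in> P. 0 \<le> f x}"
proof -
  obtain h c where h: "linear h" "\<forall>x\<in>P. f x = h x + c"
    using assms(2) unfolding affine_fun_on_def by blast
  \<comment> \<open>A linear functional is the inner product with \<open>adjoint h 1\<close>, so the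
    condition cuts out a halfspace.\<close>
  have "h x = adjoint h 1 \<bullet> x" for x
    using adjoint_works[OF h(1), of x 1] by (simp add: inner_commute)
  then have "{x \<in> P. 0 \<le> f x} = P \<inter> {x. adjoint h 1 \<bullet> x \<ge> - c}" using h(2) by auto
  then show ?thesis using polytope_Int_polyhedron[OF assms(1) polyhedron_halfspace_ge] by simp
qed

text \<open>\<open>P\<close> may have positive codimension, so the linear part \<open>h\<close> can
  have a kernel. It is injective on the directions of the affine hull of \<open>P\<close>, and a
  left inverse of \<open>h\<close> there is the linear part of \<open>g\<close>.\<close>

lemma affine_fun_on_inverse:
  fixes f :: "'a::euclidean_space \<Rightarrow> 'b::euclidean_space"
  assumes P: "polytope P" and f: "affine_fun_on P f" and inj: "inj_on f P" and g: "\<And>x. x \<in> P \<Longrightarrow> g (f x) = x"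
  shows "affine_fun_on (f ` P) g"
proof (cases "P = {}")
  case True
  then show ?thesis by (auto simp: affine_fun_on_def intro: linear_zero)
next
  case False
  obtain h c where h: "linear h" "\<forall>x\<in>P. f x = h x + c"
    using f unfolding affine_fun_on_def by blast
  have cv: "convex P" using P polytope_imp_convex by blast
  obtain a where a: "a \<in> rel_interior P" using rel_interior_eq_empty[OF cv] False by blast
  then have aP: "a \<in> P" using rel_interior_subset by blast
  let ?V = "span ((\<lambda>x. x - a) ` (P - {a}))"
  have aff: "affine hull P = {a + v | v. v \<in> ?V}"
    using affine_hull_span2[OF aP] by (auto simp: algebra_simps)
  obtain e where e: "e > 0" "cball a e \<inter> affine hull P \<subseteq> P"
    using a by (auto simp: mem_rel_interior_cball)
  \<comment> \<open>A kernel direction, scaled to length \<open>e\<close>, leads from the relative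
    interior point \<open>a\<close> to a second point of \<open>P\<close> with the same
    image.\<close>
  have "v = 0" if "v \<in> ?V" "h v = 0" for v
  proof (rule ccontr)
    assume v: "v \<noteq> 0"
    let ?w = "(e / norm v) *\<^sub>R v"
    have "a + ?w \<in> affine hull P" unfolding aff using span_scale[OF that(1)] by blast
    moreover have "a + ?w \<in> cball a e" using e v by (auto simp: dist_norm)
    ultimately have m: "a + ?w \<in> P" using e by blast
    then have "f (a + ?w) = f a" using h aP that by (simp add: linear_add linear_scale)
    then have "?w = 0" using inj m aP by (auto dest: inj_onD)
    then show False using v e by simp
  qed
  then have "inj_on h ?V"
    using linear_inj_on_iff_eq_0[OF h(1) subspace_span] by blast
  then obtain k where k: "linear k" "\<And>v. v \<in> ?V \<Longrightarrow> k (h v) = v"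
    using linear_exists_left_inverse_on[OF h(1), of ?V] subspace_span by blast
  have "g y = k y + (a - k (f a))" if y: "y \<in> f ` P" for y
  proof -
    obtain x where x: "x \<in> P" "y = f x" using y by blast
    have "x - a \<in> ?V"
    proof (cases "x = a")
      case True then show ?thesis using span_zero by simp
    qed (use x in \<open>auto intro!: span_base\<close>)
    then have "k (h (x - a)) = x - a" using k by blast
    moreover have "h (x - a) = y - f a" using h x aP by (simp add: linear_diff)
    ultimately show ?thesis using k(1) x g by (simp add: linear_diff algebra_simps)
  qed
  then show ?thesis using k(1) unfolding affine_fun_on_def by blast
qed

section \<open>Finite unions of polytopes\<close>

lemma polyhedral_polytope: "polytope P \<Longrightarrow> polyhedral P"
  unfolding polyhedral_def by (intro exI[of _ "{P}"]) auto

lemma polyhedral_empty [simp]: "polyhedral {}"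
  by (simp add: polyhedral_polytope polytope_empty)

lemma polyhedral_Un: assumes "polyhedral X" "polyhedral Y" shows "polyhedral (X \<union> Y)"
proof -
  obtain P Q where "finite P" "\<Union>P = X" "\<forall>p\<in>P. polytope p" "finite Q" "\<Union>Q = Y" "\<forall>p\<in>Q. polytope p"
    using assms unfolding polyhedral_def by auto
  then show ?thesis unfolding polyhedral_def by (intro exI[of _ "P \<union> Q"]) auto
qed

lemma polyhedral_UN: "finite I \<Longrightarrow> (\<And>i. i \<in> I \<Longrightarrow> polyhedral (X i)) \<Longrightarrow> polyhedral (\<Union>i\<in>I. X i)"
  by (induction I rule: finite_induct) (auto intro: polyhedral_Un)

lemma polyhedral_closed: "polyhedral X \<Longrightarrow> closed X"
  unfolding polyhedral_def using closed_Union polytope_imp_closed by metis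

lemma polyhedral_compact: "polyhedral X \<Longrightarrow> compact X"
  unfolding polyhedral_def using compact_Union polytope_imp_compact by metis

lemma pl_on_imp_polyhedral: "pl_on X f \<Longrightarrow> polyhedral X"
  unfolding pl_on_alt polyhedral_def by blast

section \<open>Closure properties of piecewise linear maps\<close>

lemma pl_on_affine:
  assumes "polyhedral X" "affine_fun_on X f" shows "pl_on X f"
proof -
  obtain \<P> where "finite \<P>" "\<Union>\<P> = X" "\<forall>P\<in>\<P>. polytope P"
    using assms(1) unfolding polyhedral_def by blast
  moreover have "affine_fun_on P f" if "P \<in> \<P>" for P
    using affine_fun_on_subset[OF assms(2), of P] that calculation(2) by blast
  ultimately show ?thesis unfolding pl_on_alt by blast
qed

lemma pl_on_cong:
  assumes "pl_on X f" "\<And>x. x \<in> X \<Longrightarrow> f x = g x" shows "pl_on X g"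
proof -
  obtain P where P: "finite P" "\<Union>P = X" "\<forall>p\<in>P. polytope p \<and> affine_fun_on p f"
    using assms(1) unfolding pl_on_alt by blast
  then have "affine_fun_on p g" if "p \<in> P" for p
    using affine_fun_on_cong[of p f g] that P assms(2) by blast
  then show ?thesis using P unfolding pl_on_alt by blast
qed

lemma pl_on_Un: assumes "pl_on X f" "pl_on Y f" shows "pl_on (X \<union> Y) f"
proof -
  obtain P Q where "finite P" "\<Union>P = X" "\<forall>p\<in>P. polytope p \<and> affine_fun_on p f"
    "finite Q" "\<Union>Q = Y" "\<forall>p\<in>Q. polytope p \<and> affine_fun_on p f"
    using assms unfolding pl_on_alt by auto
  then show ?thesis unfolding pl_on_alt by (intro exI[of _ "P \<union> Q"]) auto
qed

text \<open>Intersecting the pieces of \<open>f\<close> with those of \<open>g\<close> gives a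
  subdivision that serves both maps.\<close>

lemma pl_on_pieces2:
  assumes "pl_on X f" "pl_on X g"
  obtains \<P> where "finite \<P>" "\<Union>\<P> = X"
    "\<And>P. P \<in> \<P> \<Longrightarrow> polytope P \<and> affine_fun_on P f \<and> affine_fun_on P g"
proof -
  obtain P Q where P: "finite P" "\<Union>P = X" "\<forall>p\<in>P. polytope p \<and> affine_fun_on p f"
    and Q: "finite Q" "\<Union>Q = X" "\<forall>p\<in>Q. polytope p \<and> affine_fun_on p g"
    using assms unfolding pl_on_alt by auto
  let ?R = "(\<lambda>(p, q). p \<inter> q) ` (P \<times> Q)"
  show thesis
  proof (rule that[of ?R])
    show "finite ?R" using P Q by auto
    show "\<Union>?R = X"
      unfolding P(2)[symmetric] using P(2) Q(2) by (auto simp: set_eq_iff)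
    show "polytope S \<and> affine_fun_on S f \<and> affine_fun_on S g" if "S \<in> ?R" for S
      using that P Q by (auto intro: polytope_Int affine_fun_on_subset)
  qed
qed

lemma pl_on_Pair: assumes "pl_on X f" "pl_on X g" shows "pl_on X (\<lambda>x. (f x, g x))"
  by (rule pl_on_pieces2[OF assms]) (auto simp: pl_on_alt intro: affine_fun_on_Pair)

lemma pl_on_compose:
  assumes "pl_on X f" "pl_on Y g" "f ` X \<subseteq> Y"
  shows "pl_on X (\<lambda>x. g (f x))"
proof -
  obtain P Q where P: "finite P" "\<Union>P = X" "\<forall>p\<in>P. polytope p \<and> affine_fun_on p f"
    and Q: "finite Q" "\<Union>Q = Y" "\<forall>p\<in>Q. polytope p \<and> affine_fun_on p g"
    using assms unfolding pl_on_alt by auto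
  let ?R = "(\<lambda>(p, q). {x \<in> p. f x \<in> q}) ` (P \<times> Q)"
  have "finite ?R" using P Q by auto
  moreover have "\<Union>?R = X"
  proof
    show "\<Union>?R \<subseteq> X" using P(2) by auto
    show "X \<subseteq> \<Union>?R"
    proof
      fix x assume "x \<in> X"
      then obtain p q where "p \<in> P" "x \<in> p" "q \<in> Q" "f x \<in> q" using P(2) Q(2) assms(3) by blast
      then show "x \<in> \<Union>?R" by (intro UnionI[of "{x \<in> p. f x \<in> q}"]) auto
    qed
  qed
  moreover have "polytope S \<and> affine_fun_on S (\<lambda>x. g (f x))" if "S \<in> ?R" for S
  proof -
    from that obtain p q where S: "p \<in> P" "q \<in> Q" "S = {x \<in> p. f x \<in> q}" by auto
    have p: "polytope p" "affine_fun_on p f" "polytope q" "affine_fun_on q g" using S P(3) Q(3) by auto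
    then have "affine_fun_on S f" using S(3) affine_fun_on_subset[of p f S] by blast
    then have "affine_fun_on S (\<lambda>x. g (f x))" by (rule affine_fun_on_compose[OF _ p(4)]) (use S in auto)
    then show ?thesis using S(3) polytope_vimage[OF p(1,3,2)] by simp
  qed
  ultimately show ?thesis unfolding pl_on_alt by blast
qed

lemma pl_on_compose_linear:
  assumes "pl_on X f" "linear k" shows "pl_on X (\<lambda>x. k (f x))"
proof -
  have "affine_fun_on UNIV k" using affine_fun_on_linear[OF assms(2), of UNIV 0] by simp
  then have "affine_fun_on P (\<lambda>x. k (f x))" if "affine_fun_on P f" for P
    using affine_fun_on_compose[OF that] by blast
  then show ?thesis using assms(1) unfolding pl_on_alt by blast
qed

lemma pl_on_linear: "polyhedral X \<Longrightarrow> linear h \<Longrightarrow> pl_on X h"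
  using pl_on_affine affine_fun_on_linear[of h X 0] by fastforce

lemma pl_on_const: "polyhedral X \<Longrightarrow> pl_on X (\<lambda>x. c)"
  using pl_on_affine affine_fun_on_linear[OF linear_zero, of X c] by fastforce

lemma pl_on_id: "polyhedral X \<Longrightarrow> pl_on X (\<lambda>x. x)"
  by (rule pl_on_linear) (simp_all add: linear_iff)

lemma pl_on_add: assumes "pl_on X f" "pl_on X g" shows "pl_on X (\<lambda>x. f x + g x)"
  using pl_on_compose_linear[OF pl_on_Pair[OF assms], of "\<lambda>z. fst z + snd z"]
  by (simp add: linear_iff algebra_simps)

lemma pl_on_scaleR: "pl_on X f \<Longrightarrow> pl_on X (\<lambda>x. c *\<^sub>R f x)"
  by (erule pl_on_compose_linear) (simp add: linear_iff algebra_simps)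

lemma pl_on_mult: "pl_on X f \<Longrightarrow> pl_on X (\<lambda>x. c * f x)" for f :: "'a::euclidean_space \<Rightarrow> real"
  using pl_on_scaleR[of X f c] by simp

lemma pl_on_vector: "pl_on X f \<Longrightarrow> pl_on X (\<lambda>x. f x *\<^sub>R d)"
  by (erule pl_on_compose_linear[where k="\<lambda>m. m *\<^sub>R d"]) (simp add: linear_iff algebra_simps)

lemma pl_on_minus: "pl_on X f \<Longrightarrow> pl_on X (\<lambda>x. - f x)"
  by (erule pl_on_compose_linear) (simp add: linear_iff)

lemma pl_on_diff: assumes "pl_on X f" "pl_on X g" shows "pl_on X (\<lambda>x. f x - g x)"
  using pl_on_add[OF assms(1) pl_on_minus[OF assms(2)]] by simp

lemma pl_on_nth: "pl_on X f \<Longrightarrow> pl_on X (\<lambda>x. f x $ i)" for f :: "'a::euclidean_space \<Rightarrow> real^'n"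
  by (erule pl_on_compose_linear) (simp add: linear_iff)

lemma pl_on_inner: "pl_on X f \<Longrightarrow> pl_on X (\<lambda>x. d \<bullet> f x)"
  by (erule pl_on_compose_linear) (simp add: linear_iff inner_right_distrib)

lemma pl_on_inner_left: "pl_on X f \<Longrightarrow> pl_on X (\<lambda>x. f x \<bullet> d)"
  by (erule pl_on_compose_linear) (simp add: linear_iff inner_left_distrib)

text \<open>Each piece is cut along the zero set of \<open>f\<close>; on the two halves the absolute
  value is \<open>f\<close> or \<open>- f\<close>. Maxima, minima and the sup norm are reduced to
  this case.\<close>

lemma pl_on_abs: fixes f :: "'a::euclidean_space \<Rightarrow> real" assumes "pl_on X f" shows "pl_on X (\<lambda>x. \<bar>f x\<bar>)"
proof -
  obtain P where P: "finite P" "\<Union>P = X" "\<forall>p\<in>P. polytope p \<and> affine_fun_on p f"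
    using assms unfolding pl_on_alt by blast
  have m: "affine_fun_on p (\<lambda>x. - f x)" if "p \<in> P" for p
    using that P affine_fun_on_compose[of p f UNIV uminus] affine_fun_on_linear[of uminus UNIV 0]
    by (auto simp: linear_iff)
  let ?R = "(\<lambda>p. {x \<in> p. 0 \<le> f x}) ` P \<union> (\<lambda>p. {x \<in> p. 0 \<le> - f x}) ` P"
  have "finite ?R" using P by auto
  moreover have "\<Union>?R = X" unfolding P(2)[symmetric] using linear[of 0] by auto
  moreover have "polytope S \<and> affine_fun_on S (\<lambda>x. \<bar>f x\<bar>)" if S: "S \<in> ?R" for S
  proof (cases "S \<in> (\<lambda>p. {x \<in> p. 0 \<le> f x}) ` P")
    case True
    then obtain p where p: "p \<in> P" "S = {x \<in> p. 0 \<le> f x}" using S by blast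
    then have "affine_fun_on S f" using P(3) affine_fun_on_subset[of p f S] by blast
    then show ?thesis using P polytope_affine_ge[of p f] p by (auto intro: affine_fun_on_cong)
  next
    case False
    then obtain p where p: "p \<in> P" "S = {x \<in> p. 0 \<le> - f x}" using S by blast
    then have "affine_fun_on S (\<lambda>x. - f x)" using m by (auto intro: affine_fun_on_subset)
    then show ?thesis using P polytope_affine_ge[OF _ m[OF p(1)]] p by (auto intro: affine_fun_on_cong)
  qed
  ultimately show ?thesis unfolding pl_on_alt by blast
qed

lemma pl_on_max:
  fixes f g :: "'a::euclidean_space \<Rightarrow> real"
  assumes "pl_on X f" "pl_on X g" shows "pl_on X (\<lambda>x. max (f x) (g x))"
proof -
  have "pl_on X (\<lambda>x. (1/2) * ((f x + g x) + \<bar>f x - g x\<bar>))"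
    by (intro pl_on_mult pl_on_add pl_on_abs pl_on_diff assms)
  then show ?thesis by (rule pl_on_cong) (auto simp: max_def abs_if)
qed

lemma pl_on_min:
  fixes f g :: "'a::euclidean_space \<Rightarrow> real"
  assumes "pl_on X f" "pl_on X g" shows "pl_on X (\<lambda>x. min (f x) (g x))"
proof -
  have "pl_on X (\<lambda>x. - max (- f x) (- g x))"
    by (intro pl_on_max pl_on_minus assms)
  then show ?thesis by (rule pl_on_cong) (auto simp: max_def min_def)
qed

lemma pl_on_sum:
  assumes "finite I" "polyhedral X" "\<And>i. i \<in> I \<Longrightarrow> pl_on X (f i)"
  shows "pl_on X (\<lambda>x. \<Sum>i\<in>I. f i x)"
  using assms by (induction I rule: finite_induct) (auto intro: pl_on_add pl_on_const)

lemma pl_on_Max: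
  fixes f :: "'i \<Rightarrow> 'a::euclidean_space \<Rightarrow> real"
  assumes "finite I" "I \<noteq> {}" "\<And>i. i \<in> I \<Longrightarrow> pl_on X (f i)"
  shows "pl_on X (\<lambda>x. Max ((\<lambda>i. f i x) ` I))"
  using assms
proof (induction I rule: finite_ne_induct)
  case (insert i I)
  then have "pl_on X (\<lambda>x. max (f i x) (Max ((\<lambda>i. f i x) ` I)))" by (intro pl_on_max) auto
  then show ?case using insert by (auto intro: pl_on_cong)
qed auto

lemma pl_on_infnorm:
  fixes f :: "'a::euclidean_space \<Rightarrow> real^'n"
  assumes "pl_on X f" shows "pl_on X (\<lambda>x. infnorm (f x))"
  unfolding infnorm_Max
  by (intro pl_on_Max pl_on_abs pl_on_inner_left assms) auto

lemma pl_on_vec: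
  fixes f :: "'i::finite \<Rightarrow> 'a::euclidean_space \<Rightarrow> real"
  assumes "\<And>i. pl_on X (f i)" shows "pl_on X (\<lambda>x. (\<chi> i. f i x) :: real^'i)"
proof -
  have "pl_on X (\<lambda>x. (\<Sum>i\<in>UNIV. f i x *\<^sub>R axis i 1) :: real^'i)"
    by (intro pl_on_sum pl_on_vector assms) (use assms pl_on_imp_polyhedral in auto)
  then show ?thesis by (rule pl_on_cong) (simp add: vec_eq_iff axis_def if_distrib cong: if_cong)
qed

lemma polyhedral_image: assumes "pl_on X f" shows "polyhedral (f ` X)"
proof -
  obtain P where P: "finite P" "\<Union>P = X" "\<forall>p\<in>P. polytope p \<and> affine_fun_on p f"
    using assms unfolding pl_on_alt by blast
  then show ?thesis unfolding polyhedral_def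
    by (intro exI[of _ "(`) f ` P"]) (auto intro: polytope_affine_image)
qed

text \<open>The images of the pieces are polytopes, and on each of them the inverse is affine; so a
  PL bijection has a PL inverse.\<close>

lemma pl_on_inverse:
  assumes "pl_on X f" "\<And>x. x \<in> X \<Longrightarrow> g (f x) = x"
  shows "pl_on (f ` X) g"
proof -
  obtain P where P: "finite P" "\<Union>P = X" "\<forall>p\<in>P. polytope p \<and> affine_fun_on p f"
    using assms(1) unfolding pl_on_alt by blast
  have "affine_fun_on (f ` p) g" if "p \<in> P" for p
  proof (rule affine_fun_on_inverse)
    show "g (f x) = x" if "x \<in> p" for x using that \<open>p \<in> P\<close> P assms(2) by blast
    then show "inj_on f p" by (metis inj_onI)
  qed (use that P in auto)
  then show ?thesis unfolding pl_on_alt using P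
    by (intro exI[of _ "(`) f ` P"]) (auto intro: polytope_affine_image)
qed

lemma polyhedral_Times: assumes "polyhedral X" "polyhedral Y" shows "polyhedral (X \<times> Y)"
proof -
  obtain P Q where "finite P" "\<Union>P = X" "\<forall>p\<in>P. polytope p" "finite Q" "\<Union>Q = Y" "\<forall>p\<in>Q. polytope p"
    using assms unfolding polyhedral_def by auto
  then show ?thesis unfolding polyhedral_def
    by (intro exI[of _ "(\<lambda>(p, q). p \<times> q) ` (P \<times> Q)"]) (fastforce intro: polytope_Times)
qed

lemma pl_on_subset:
  assumes "pl_on X f" "polyhedral Y" "Y \<subseteq> X" shows "pl_on Y f"
  using pl_on_compose[OF pl_on_id[OF assms(2)] assms(1)] assms(3) by auto

lemma pl_on_imp_continuous_on: assumes "pl_on X f" shows "continuous_on X f"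
proof -
  obtain P where P: "finite P" "\<Union>P = X" "\<forall>p\<in>P. polytope p \<and> affine_fun_on p f"
    using assms unfolding pl_on_alt by blast
  have "continuous_on (\<Union>p\<in>P. p) f"
  proof (rule continuous_on_closed_Union)
    fix p assume p: "p \<in> P"
    then obtain h c where h: "linear h" "\<forall>x\<in>p. f x = h x + c"
      using P unfolding affine_fun_on_def by blast
    have "continuous_on p (\<lambda>x. h x + c)"
      by (intro continuous_intros linear_continuous_on) (simp add: h linear_linear)
    then show "continuous_on p f" using h(2) by (simp cong: continuous_on_cong)
  qed (use P polytope_imp_closed in auto)
  then show ?thesis using P by simp
qed

text \<open>A Lojasiewicz inequality for piecewise linear functions, with exponent 1.\<close>

lemma pl_on_comparison:
  fixes E B :: "'a::euclidean_space \<Rightarrow> real"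
  assumes "pl_on X E" "pl_on X B" and nonneg: "\<And>x. x \<in> X \<Longrightarrow> 0 \<le> E x"
    and zero: "\<And>x. x \<in> X \<Longrightarrow> E x = 0 \<Longrightarrow> B x \<le> 0"
  obtains m where "m > 0" "\<And>x. x \<in> X \<Longrightarrow> m * B x \<le> E x"
proof -
  obtain P where P: "finite P" "\<Union>P = X"
      "\<And>p. p \<in> P \<Longrightarrow> polytope p \<and> affine_fun_on p E \<and> affine_fun_on p B"
    using pl_on_pieces2[OF assms(1,2)] by metis
  \<comment> \<open>On a piece both functions are affine, so the inequality need only be checked at
    the vertices. It is claimed for all smaller factors as well, so that the constants of finitely
    many vertices and pieces can be replaced by their minimum.\<close>
  have "\<exists>m>0. \<forall>x\<in>p. \<forall>m'\<in>{0<..m}. m' * B x \<le> E x" if p: "p \<in> P" for p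
  proof -
    obtain V where V: "finite V" "p = convex hull V" using P(3)[OF p] polytope_def by blast
    then have VX: "V \<subseteq> X" using hull_subset[of V convex] P p by blast
    have "\<exists>m>0. \<forall>v\<in>W. \<forall>m'\<in>{0<..m}. m' * B v \<le> E v" if "W \<subseteq> V" for W
      using finite_subset[OF that V(1)] that
    proof (induction W rule: finite_induct)
      case empty then show ?case by (auto intro: exI[of _ 1])
    next
      case (insert v W)
      then obtain m where m: "m > 0" "\<forall>v\<in>W. \<forall>m'\<in>{0<..m}. m' * B v \<le> E v" by auto
      have v: "v \<in> X" using insert VX by auto
      have "\<exists>k>0. \<forall>m'\<in>{0<..k}. m' * B v \<le> E v"
      proof (cases "B v \<le> 0")
        case True
        then have "m' * B v \<le> E v" if "m' > 0" for m'
          using mult_nonneg_nonpos[of m' "B v"] that nonneg[OF v] by linarith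
        then show ?thesis by (intro exI[of _ 1]) auto
      next
        case False
        then have "E v > 0" using nonneg[OF v] zero[OF v] by force
        then show ?thesis using False by (intro exI[of _ "E v / B v"]) (auto simp: field_simps)
      qed
      then obtain k where "k > 0" "\<forall>m'\<in>{0<..k}. m' * B v \<le> E v" by blast
      then show ?case using m by (intro exI[of _ "min m k"]) auto
    qed
    then obtain m where m: "m > 0" "\<forall>v\<in>V. \<forall>m'\<in>{0<..m}. m' * B v \<le> E v" by blast
    obtain h c k d where h: "linear h" "\<forall>x\<in>p. E x = h x + c" and k: "linear k" "\<forall>x\<in>p. B x = k x + d"
      using P(3)[OF p] unfolding affine_fun_on_def by blast
    have "m' * B x \<le> E x" if x: "x \<in> p" and m': "m' \<in> {0<..m}" for x m'
    proof -
      let ?l = "\<lambda>x. h x - m' * k x"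
      have l: "linear ?l" using h k by (simp add: linear_iff algebra_simps)
      have "convex {x. m' * d - c \<le> ?l x}"
        using convex_linear_vimage[OF l, of "{m' * d - c..}"] by (simp add: vimage_def)
      moreover have "V \<subseteq> {x. m' * d - c \<le> ?l x}"
      proof
        fix v assume v: "v \<in> V"
        then have "v \<in> p" using V hull_subset[of V convex] by blast
        then have "m' * (k v + d) \<le> h v + c" using m(2) v m' h(2) k(2) by auto
        then show "v \<in> {x. m' * d - c \<le> ?l x}" by (simp add: algebra_simps)
      qed
      ultimately have "p \<subseteq> {x. m' * d - c \<le> ?l x}" using V by (simp add: hull_minimal)
      then show ?thesis using x h(2) k(2) by (auto simp: algebra_simps)
    qed
    then show ?thesis using m(1) by blast
  qed
  then obtain M where M: "\<And>p. p \<in> P \<Longrightarrow> M p > 0 \<and> (\<forall>x\<in>p. \<forall>m'\<in>{0<..M p}. m' * B x \<le> E x)" by metis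
  let ?m = "Min (insert 1 (M ` P))"
  show thesis
  proof
    show "?m > 0" using M P(1) by auto
    show "?m * B x \<le> E x" if "x \<in> X" for x
    proof -
      from that obtain p where p: "p \<in> P" "x \<in> p" unfolding P(2)[symmetric] by blast
      have "?m \<le> M p" using p P(1) by auto
      then show ?thesis using M[OF p(1)] p \<open>?m > 0\<close> by auto
    qed
  qed
qed

lemma polyhedral_closed_segment: "polyhedral (closed_segment a b)"
  by (simp add: segment_convex_hull polyhedral_polytope polytope_convex_hull)

lemma polyhedral_sing: "polyhedral {a}"
  by (simp add: polyhedral_polytope polytope_sing)

lemma polyhedral_interval: "polyhedral {a..b::real}"
  using polyhedral_closed_segment[of a b] by (cases "a \<le> b") (auto simp: closed_segment_eq_real_ivl)


section \<open>Homeomorphisms and isotopies of the sphere\<close>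

lemma infnorm_le_iff: "infnorm (x::real^'n) \<le> b \<longleftrightarrow> (\<forall>i. \<bar>x $ i\<bar> \<le> b)"
proof
  show "infnorm x \<le> b \<Longrightarrow> \<forall>i. \<bar>x $ i\<bar> \<le> b" using component_le_infnorm_cart order_trans by blast
  show "\<forall>i. \<bar>x $ i\<bar> \<le> b \<Longrightarrow> infnorm x \<le> b"
    unfolding infnorm_Max by (subst Max_le_iff) (auto simp: Basis_vec_def inner_axis)
qed

lemma infnorm_attained: obtains i where "infnorm (x::real^'n) = \<bar>x $ i\<bar>"
proof -
  have "infnorm x \<in> (\<lambda>i. \<bar>x \<bullet> i\<bar>) ` Basis" unfolding infnorm_Max by (rule Max_in) auto
  then show thesis using that by (auto simp: Basis_vec_def inner_axis)
qed

lemma mem_S3_iff: "x \<in> S3 \<longleftrightarrow> (\<forall>i. \<bar>x $ i\<bar> \<le> 1) \<and> (\<exists>i. \<bar>x $ i\<bar> = 1)"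
proof
  assume "x \<in> S3"
  then have 1: "infnorm x = 1" by (simp add: S3_def)
  then show "(\<forall>i. \<bar>x $ i\<bar> \<le> 1) \<and> (\<exists>i. \<bar>x $ i\<bar> = 1)"
    using infnorm_le_iff[of x 1] infnorm_attained[of x] by (metis order_refl)
next
  assume *: "(\<forall>i. \<bar>x $ i\<bar> \<le> 1) \<and> (\<exists>i. \<bar>x $ i\<bar> = 1)"
  then show "x \<in> S3"
    using infnorm_le_iff[of x 1] component_le_infnorm_cart[of x] unfolding S3_def by (metis (mono_tags) mem_Collect_eq order_antisym)
qed

lemma polyhedral_S3: "polyhedral S3"
proof -
  \<comment> \<open>The eight facets as degenerate boxes: coordinate \<open>i\<close> is fixed at
    \<open>s\<close> and the others range over \<open>[-1, 1]\<close>.\<close>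
  have "S3 = (\<Union>(i, s)\<in>UNIV \<times> {-1, 1}. cbox (\<chi> j. if j = i then s else -1) (\<chi> j. if j = i then s else 1))"
    (is "_ = ?R")
  proof
    show "S3 \<subseteq> ?R"
    proof
      fix x assume "x \<in> S3"
      then obtain i where i: "\<bar>x $ i\<bar> = 1" "\<forall>i. \<bar>x $ i\<bar> \<le> 1" unfolding mem_S3_iff by blast
      then have "x $ i \<in> {-1, 1}" by auto
      moreover have "x \<in> cbox (\<chi> j. if j = i then x $ i else -1) (\<chi> j. if j = i then x $ i else 1)"
        using i(2) by (auto simp: mem_box_cart abs_le_iff minus_le_iff)
      ultimately show "x \<in> ?R" by blast
    qed
    show "?R \<subseteq> S3"
    proof
      fix x assume "x \<in> ?R"
      then obtain i s where s: "s \<in> {-1, 1}"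
        "x \<in> cbox (\<chi> j. if j = i then s else -1) (\<chi> j. if j = i then s else 1)" by blast
      then have *: "(if j = i then s else -1) \<le> x $ j" "x $ j \<le> (if j = i then s else 1)" for j
        by (auto simp: mem_box_cart)
      have "\<bar>x $ j\<bar> \<le> 1" for j using *[of j] s(1) by (auto split: if_splits)
      moreover have "\<bar>x $ i\<bar> = 1" using *[of i] s(1) by auto
      ultimately show "x \<in> S3" unfolding mem_S3_iff by blast
    qed
  qed
  moreover have "polyhedral ?R"
    by (intro polyhedral_UN) (auto intro: polyhedral_polytope polytope_interval)
  ultimately show ?thesis by simp
qed

lemma compact_S3: "compact S3" using polyhedral_compact[OF polyhedral_S3] .

text \<open>Only the behaviour on \<open>S3\<close> is recorded; values elsewhere are arbitrary, and
  the inverse is automatically PL.\<close>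

definition pl_homeo :: "(real^4 \<Rightarrow> real^4) \<Rightarrow> bool" where
  "pl_homeo h \<longleftrightarrow> pl_on S3 h \<and> bij_betw h S3 S3"

lemma pl_homeo_id: "pl_homeo (\<lambda>x. x)"
  unfolding pl_homeo_def by (simp add: pl_on_id polyhedral_S3 bij_betw_def)

lemma pl_homeo_in: "pl_homeo h \<Longrightarrow> x \<in> S3 \<Longrightarrow> h x \<in> S3"
  unfolding pl_homeo_def bij_betw_def by blast

lemma pl_homeo_subset: "pl_homeo h \<Longrightarrow> X \<subseteq> S3 \<Longrightarrow> h ` X \<subseteq> S3"
  using pl_homeo_in by blast

lemma pl_homeo_inj_on: "pl_homeo h \<Longrightarrow> X \<subseteq> S3 \<Longrightarrow> inj_on h X"
  unfolding pl_homeo_def bij_betw_def using inj_on_subset by blast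

lemma pl_homeo_compose: assumes "pl_homeo h" "pl_homeo k" shows "pl_homeo (\<lambda>x. k (h x))"
proof -
  have "pl_on S3 (\<lambda>x. k (h x))"
    using assms pl_on_compose[of S3 h S3 k] unfolding pl_homeo_def bij_betw_def by auto
  then show ?thesis using assms bij_betw_trans[of h S3 S3 k] unfolding pl_homeo_def by (simp add: o_def)
qed

lemma pl_homeo_inv:
  assumes "pl_homeo h"
  obtains k where "pl_homeo k" "\<And>x. x \<in> S3 \<Longrightarrow> k (h x) = x" "\<And>x. x \<in> S3 \<Longrightarrow> h (k x) = x"
proof
  let ?k = "inv_into S3 h"
  have h: "bij_betw h S3 S3" "pl_on S3 h" using assms unfolding pl_homeo_def by auto
  show 1: "?k (h x) = x" if "x \<in> S3" for x using that h by (simp add: bij_betw_def)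
  show "h (?k x) = x" if "x \<in> S3" for x using that h by (simp add: bij_betw_def f_inv_into_f)
  have "pl_on S3 ?k" using pl_on_inverse[OF h(2), of ?k] 1 h(1) by (simp add: bij_betw_def)
  then show "pl_homeo ?k" unfolding pl_homeo_def using bij_betw_inv_into[OF h(1)] by simp
qed

lemma pl_homeo_polyhedral: "pl_homeo h \<Longrightarrow> polyhedral X \<Longrightarrow> X \<subseteq> S3 \<Longrightarrow> polyhedral (h ` X)"
  unfolding pl_homeo_def using polyhedral_image pl_on_subset by blast

text \<open>The isotopy is conjugated by \<open>h\<close>. The map \<open>h\<close> itself need not
  be isotopic to the identity, so arbitrary homeomorphisms may be used to normalise a
  configuration.\<close>

lemma ambient_isotopic_pl_homeo:
  assumes h: "pl_homeo h" and L: "L \<subseteq> S3" and iso: "ambient_isotopic L L'"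
  shows "ambient_isotopic (h ` L) (h ` L')"
proof -
  obtain k where k: "pl_homeo k" "\<And>x. x \<in> S3 \<Longrightarrow> k (h x) = x" "\<And>x. x \<in> S3 \<Longrightarrow> h (k x) = x"
    using pl_homeo_inv[OF h] by blast
  obtain H where H: "pl_on (S3 \<times> {0..1::real}) H" "\<forall>t\<in>{0..1}. bij_betw (\<lambda>x. H (x, t)) S3 S3"
    "\<forall>x\<in>S3. H (x, 0) = x" "(\<lambda>x. H (x, 1)) ` L = L'"
    using iso unfolding ambient_isotopic_def by blast
  let ?H = "\<lambda>z. h (H (k (fst z), snd z))"
  have poly: "polyhedral (S3 \<times> {0..1::real})"
    by (intro polyhedral_Times polyhedral_S3 polyhedral_interval)
  have 1: "pl_on (S3 \<times> {0..1::real}) (\<lambda>z. (k (fst z), snd z))"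
    by (intro pl_on_Pair pl_on_linear[OF poly linear_snd] pl_on_compose[OF pl_on_linear[OF poly linear_fst], of S3 k])
       (use k(1) in \<open>auto simp: pl_homeo_def\<close>)
  have 2: "pl_on (S3 \<times> {0..1::real}) (\<lambda>z. H (k (fst z), snd z))"
    by (rule pl_on_compose[OF 1 H(1)]) (use k(1) pl_homeo_in in auto)
  have HS: "H (x, t) \<in> S3" if "x \<in> S3" "t \<in> {0..1}" for x t
    using H(2) that unfolding bij_betw_def by blast
  have "pl_on (S3 \<times> {0..1::real}) ?H"
    by (rule pl_on_compose[OF 2, of S3 h]) (use h k(1) HS pl_homeo_in in \<open>auto simp: pl_homeo_def\<close>)
  moreover have "bij_betw (\<lambda>x. ?H (x, t)) S3 S3" if "t \<in> {0..1}" for t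
  proof -
    have "bij_betw (h \<circ> ((\<lambda>x. H (x, t)) \<circ> k)) S3 S3"
      using h k(1) H(2) that unfolding pl_homeo_def by (intro bij_betw_trans[of _ S3 S3]) auto
    then show ?thesis by (simp add: o_def)
  qed
  moreover have "\<forall>x\<in>S3. ?H (x, 0) = x" using H(3) k pl_homeo_in by auto
  moreover have "(\<lambda>x. ?H (x, 1)) ` (h ` L) = h ` L'"
    using k(2) L unfolding H(4)[symmetric] image_image by (intro image_cong) auto
  ultimately show ?thesis unfolding ambient_isotopic_def by blast
qed

section \<open>The centre of the upper face and shears supported near it\<close>

definition north :: "real^4" where "north = axis 4 1"

lemma north_nth [simp]: "north $ i = (if i = 4 then 1 else 0)"
  by (simp add: north_def axis_def)

lemma north_S3 [simp]: "north \<in> S3"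
  by (auto simp: mem_S3_iff)

text \<open>The other three coordinates have absolute value below 1, so the coordinate that puts
  \<open>x\<close> on the boundary of the cube is the fourth, and it is positive. Thus the sphere is
  flat near \<open>north\<close>.\<close>

lemma near_north:
  assumes "x \<in> S3" "infnorm (x - north) < 1"
  shows "x $ 4 = 1"
proof -
  have *: "\<bar>x $ i - north $ i\<bar> < 1" for i
    using component_le_infnorm_cart[of "x - north" i] assms(2) by simp
  obtain i where i: "\<bar>x $ i\<bar> = 1" "\<bar>x $ 4\<bar> \<le> 1" using assms(1) unfolding mem_S3_iff by blast
  then have "i = 4" using *[of i] by (auto split: if_splits)
  then show ?thesis using i *[of 4] by auto
qed

lemma near_north_S3:
  assumes "infnorm (x - north) \<le> 1" "x $ 4 = 1"
  shows "x \<in> S3"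
proof -
  have "\<bar>x $ i\<bar> \<le> 1" for i
    using assms component_le_infnorm_cart[of "x - north" i] by (cases "i = 4") auto
  moreover have "\<bar>x $ 4\<bar> = 1" using assms by simp
  ultimately show ?thesis unfolding mem_S3_iff by blast
qed

lemma infnorm_north_convex:
  assumes "infnorm (x + a *\<^sub>R d - north) \<le> 1" "infnorm (x + b *\<^sub>R d - north) \<le> 1" "a \<le> s" "s \<le> b"
  shows "infnorm (x + s *\<^sub>R d - north :: real^4) \<le> 1"
  unfolding infnorm_le_iff
proof
  fix i
  have "\<bar>(x + a *\<^sub>R d - north) $ i\<bar> \<le> 1" "\<bar>(x + b *\<^sub>R d - north) $ i\<bar> \<le> 1"
    using assms(1,2) unfolding infnorm_le_iff by auto
  moreover have "min (a * d $ i) (b * d $ i) \<le> s * d $ i" "s * d $ i \<le> max (a * d $ i) (b * d $ i)"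
    using assms(3,4) by (cases "d $ i \<ge> 0"; auto simp: min_le_iff_disj le_max_iff_disj mult_right_mono mult_right_mono_neg)+
  ultimately show "\<bar>(x + s *\<^sub>R d - north) $ i\<bar> \<le> 1"
    by (auto simp: min_def max_def abs_le_iff split: if_splits)
qed

lemma shear_exit:
  fixes d :: "real^4"
  assumes x: "infnorm (x - north) < 1" and d: "d \<noteq> 0"
  obtains s where "s > 0" "infnorm (x + s *\<^sub>R d - north) = 1"
proof -
  have d': "infnorm d > 0" using d infnorm_pos_lt by blast
  \<comment> \<open>At this parameter the reverse triangle inequality already gives sup distance at
    least 1 from \<open>north\<close>.\<close>
  let ?S = "(1 + infnorm (x - north)) / infnorm d"
  have S: "?S > 0" using d' infnorm_pos_le[of "x - north"] by (simp add: add_pos_nonneg)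
  have "infnorm (?S *\<^sub>R d) - infnorm (x - north) \<le> infnorm (x + ?S *\<^sub>R d - north)"
    using infnorm_triangle[of "x + ?S *\<^sub>R d - north" "- (x - north)"] infnorm_neg[of "x - north"]
    by (simp add: algebra_simps)
  then have "1 \<le> infnorm (x + ?S *\<^sub>R d - north)" using S d' by (simp add: infnorm_mul)
  moreover have "continuous_on {0..?S} (\<lambda>s. infnorm (x + s *\<^sub>R d - north))"
    by (intro continuous_intros)
  ultimately obtain s where "0 \<le> s" "s \<le> ?S" "infnorm (x + s *\<^sub>R d - north) = 1"
    using IVT'[of "\<lambda>s. infnorm (x + s *\<^sub>R d - north)" 0 1 ?S] x S by auto
  then show thesis using that[of s] x by (cases "s = 0") auto
qed

text \<open>The slope condition says that points sliding along lines parallel to \<open>d\<close> do not overtake each other.\<close>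

lemma shear_homeo:
  assumes pl: "pl_on S3 \<mu>"
    and supp: "\<And>x. x \<in> S3 \<Longrightarrow> infnorm (x - north) \<ge> 1 \<Longrightarrow> \<mu> x = 0"
    and d4: "d $ 4 = 0"
    and slope: "\<And>x s. x \<in> S3 \<Longrightarrow> x + s *\<^sub>R d \<in> S3 \<Longrightarrow> s > 0 \<Longrightarrow> \<mu> x < \<mu> (x + s *\<^sub>R d) + s"
  shows "pl_homeo (\<lambda>x. x + \<mu> x *\<^sub>R d)"
proof (cases "d = 0")
  case True then show ?thesis by (simp add: pl_homeo_id)
next
  case d: False
  let ?h = "\<lambda>x. x + \<mu> x *\<^sub>R d"
  \<comment> \<open>The line through \<open>x\<close> in direction \<open>d\<close> stays in
    \<open>S3\<close> until it leaves the unit ball about \<open>north\<close> on both sides, where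
    the displacement is 0.\<close>
  have pre: "\<exists>a>0. \<exists>b>0. \<mu> (x - a *\<^sub>R d) = 0 \<and> \<mu> (x + b *\<^sub>R d) = 0 \<and>
      (\<forall>s. - a \<le> s \<and> s \<le> b \<longrightarrow> x + s *\<^sub>R d \<in> S3)"
    if x: "x \<in> S3" "infnorm (x - north) < 1" for x
  proof -
    have x4: "x $ 4 = 1" using near_north[OF x] .
    obtain a where a: "a > 0" "infnorm (x - a *\<^sub>R d - north) = 1"
      using shear_exit[OF x(2), of "- d"] d by auto
    obtain b where b: "b > 0" "infnorm (x + b *\<^sub>R d - north) = 1"
      using shear_exit[OF x(2) d] by auto
    have in_S3: "x + s *\<^sub>R d \<in> S3" if "- a \<le> s" "s \<le> b" for s
      using infnorm_north_convex[of x "-a" d b s] that a b x4 d4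
      by (intro near_north_S3) auto
    then have "x - a *\<^sub>R d \<in> S3" "x + b *\<^sub>R d \<in> S3" using in_S3[of "-a"] in_S3[of b] a b by auto
    then show ?thesis using a b supp in_S3 by (intro exI[of _ a] conjI exI[of _ b]) auto
  qed
  have "pl_on S3 ?h" by (intro pl_on_add pl_on_vector pl pl_on_id polyhedral_S3)
  moreover have "inj_on ?h S3"
  proof (rule inj_onI, rule ccontr)
    fix x y assume xy: "x \<in> S3" "y \<in> S3" "?h x = ?h y" "x \<noteq> y"
    \<comment> \<open>Points with the same image differ by a multiple of \<open>d\<close>, and the
      slope condition fails at the one from which the other lies ahead.\<close>
    then have y: "x + (\<mu> x - \<mu> y) *\<^sub>R d = y" by (simp add: algebra_simps)
    then have x: "y + (\<mu> y - \<mu> x) *\<^sub>R d = x" by (auto simp: algebra_simps)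
    have "\<mu> x \<noteq> \<mu> y" using xy(4) y by auto
    then consider "\<mu> x - \<mu> y > 0" | "\<mu> y - \<mu> x > 0" by linarith
    then show False
    proof cases
      case 1 then show False using slope[of x "\<mu> x - \<mu> y"] xy(1,2) unfolding y by simp
    next
      case 2 then show False using slope[of y "\<mu> y - \<mu> x"] xy(1,2) unfolding x by simp
    qed
  qed
  moreover have "?h ` S3 = S3"
  proof
    show "?h ` S3 \<subseteq> S3"
    proof (rule image_subsetI)
      fix x assume x: "x \<in> S3"
      show "?h x \<in> S3"
      proof (cases "infnorm (x - north) < 1")
        case True
        then obtain a b where ab: "a > 0" "b > 0" "\<mu> (x - a *\<^sub>R d) = 0" "\<mu> (x + b *\<^sub>R d) = 0"
          "\<And>s. - a \<le> s \<and> s \<le> b \<Longrightarrow> x + s *\<^sub>R d \<in> S3" using pre[OF x] by blast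
        \<comment> \<open>The two ends of the segment are fixed, so by the slope condition the image
          of \<open>x\<close> lies strictly between them.\<close>
        have "\<mu> x < b" using slope[OF x, of b] ab by simp
        moreover have "- a < \<mu> x" using slope[of "x - a *\<^sub>R d" a] x ab(1,3) ab(5)[of "-a"] ab(2) by simp
        ultimately show ?thesis using ab(5) by simp
      qed (use x supp in simp)
    qed
    show "S3 \<subseteq> ?h ` S3"
    proof
      fix y assume y: "y \<in> S3"
      show "y \<in> ?h ` S3"
      proof (cases "infnorm (y - north) < 1")
        case True
        then obtain a b where ab: "a > 0" "b > 0" "\<mu> (y - a *\<^sub>R d) = 0" "\<mu> (y + b *\<^sub>R d) = 0"
          "\<And>s. - a \<le> s \<and> s \<le> b \<Longrightarrow> y + s *\<^sub>R d \<in> S3" using pre[OF y] by blast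
        \<comment> \<open>A preimage of \<open>y\<close> is sought on the line through
          \<open>y\<close>; the function takes the value \<open>- a\<close> at one end and
          \<open>b\<close> at the other.\<close>
        have "continuous_on {- a..b} (\<lambda>s. s + \<mu> (y + s *\<^sub>R d))"
          by (intro continuous_intros continuous_on_compose2[OF pl_on_imp_continuous_on[OF pl]])
             (use ab(5) in auto)
        then obtain s where s: "- a \<le> s" "s \<le> b" "s + \<mu> (y + s *\<^sub>R d) = 0"
          using IVT'[of "\<lambda>s. s + \<mu> (y + s *\<^sub>R d)" "-a" 0 b] ab by auto
        then have "?h (y + s *\<^sub>R d) = y" by (simp add: add.assoc flip: scaleR_add_left)
        then show ?thesis using ab(5)[of s] s by (intro image_eqI[of _ _ "y + s *\<^sub>R d"]) auto
      qed (use y supp in \<open>auto intro!: image_eqI[of _ _ y]\<close>)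
    qed
  qed
  ultimately show ?thesis unfolding pl_homeo_def bij_betw_def by blast
qed

text \<open>Time enters by truncating the displacement at \<open>C * t\<close>. The product of time
  and displacement would not be piecewise linear, whereas a minimum is, and truncation preserves the
  slope condition. Nonnegativity makes the truncated displacement vanish at time 0.\<close>

lemma shear_isotopy:
  assumes pl: "pl_on S3 \<mu>"
    and supp: "\<And>x. x \<in> S3 \<Longrightarrow> infnorm (x - north) \<ge> 1 \<Longrightarrow> \<mu> x = 0"
    and d4: "d $ 4 = 0"
    and slope: "\<And>x s. x \<in> S3 \<Longrightarrow> x + s *\<^sub>R d \<in> S3 \<Longrightarrow> s > 0 \<Longrightarrow> \<mu> x < \<mu> (x + s *\<^sub>R d) + s"
    and nonneg: "\<And>x. x \<in> S3 \<Longrightarrow> \<mu> x \<ge> 0"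
    and L: "L \<subseteq> S3"
  shows "ambient_isotopic L ((\<lambda>x. x + \<mu> x *\<^sub>R d) ` L)"
proof -
  have "bounded (\<mu> ` S3)"
    using compact_continuous_image[OF pl_on_imp_continuous_on[OF pl] compact_S3] compact_imp_bounded by blast
  then obtain C where "C > 0" "\<forall>y\<in>\<mu> ` S3. norm y \<le> C" unfolding bounded_pos by blast
  then have C: "C > 0" "\<And>x. x \<in> S3 \<Longrightarrow> \<mu> x \<le> C" by (auto simp: abs_le_iff)
  let ?H = "\<lambda>z. fst z + min (\<mu> (fst z)) (C * snd z) *\<^sub>R d"
  have poly: "polyhedral (S3 \<times> {0..1::real})"
    by (intro polyhedral_Times polyhedral_S3 polyhedral_interval)
  have "pl_on (S3 \<times> {0..1::real}) ?H"
    by (intro pl_on_add pl_on_vector pl_on_min pl_on_mult pl_on_linear[OF poly linear_fst]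
          pl_on_linear[OF poly linear_snd] pl_on_compose[OF pl_on_linear[OF poly linear_fst] pl]) auto
  moreover have "bij_betw (\<lambda>x. ?H (x, t)) S3 S3" if "t \<in> {0..1}" for t
  proof -
    have "C * t \<ge> 0" using C that by simp
    have "pl_homeo (\<lambda>x. x + min (\<mu> x) (C * t) *\<^sub>R d)"
    proof (rule shear_homeo[OF _ _ d4])
      show "pl_on S3 (\<lambda>x. min (\<mu> x) (C * t))" by (intro pl_on_min pl pl_on_const polyhedral_S3)
      show "min (\<mu> x) (C * t) = 0" if "x \<in> S3" "1 \<le> infnorm (x - north)" for x
        using supp[OF that] \<open>C * t \<ge> 0\<close> by simp
      show "min (\<mu> x) (C * t) < min (\<mu> (x + s *\<^sub>R d)) (C * t) + s"
        if "x \<in> S3" "x + s *\<^sub>R d \<in> S3" "s > 0" for x s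
        using slope[OF that] that(3) by (auto simp: min_def)
    qed
    then show ?thesis by (simp add: pl_homeo_def)
  qed
  moreover have "\<forall>x\<in>S3. ?H (x, 0) = x" using nonneg by (simp add: min_absorb2)
  moreover have "(\<lambda>x. ?H (x, 1)) ` L = (\<lambda>x. x + \<mu> x *\<^sub>R d) ` L"
    using C(2) L by (intro image_cong) (auto simp: min_def)
  ultimately show ?thesis unfolding ambient_isotopic_def by blast
qed


section \<open>Homogeneity of the sphere\<close>

lemma pl_homeo_to_upper_face:
  assumes c: "c \<in> S3"
  obtains h where "pl_homeo h" "h c $ 4 = 1"
proof -
  obtain i where i: "\<bar>c $ i\<bar> = 1" using c unfolding mem_S3_iff by blast
  define \<sigma> where "\<sigma> = c $ i"
  \<comment> \<open>A signed transposition of the fourth coordinate with coordinate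
    \<open>i\<close>, where \<open>c\<close> has absolute value 1; it is an involution. For
    \<open>i = 4\<close> it is at most a change of sign.\<close>
  define h :: "real^4 \<Rightarrow> real^4" where
    "h x = (\<chi> j. if j = 4 then \<sigma> * x $ i else if j = i then \<sigma> * x $ 4 else x $ j)" for x
  have s: "\<bar>\<sigma>\<bar> = 1" "\<sigma> * \<sigma> = 1" using i unfolding \<sigma>_def by (auto simp: abs_if split: if_splits)
  have hh: "h (h x) = x" for x
    using s by (auto simp: h_def vec_eq_iff mult.assoc[symmetric])
  have hS: "h x \<in> S3" if x: "x \<in> S3" for x
    unfolding mem_S3_iff
  proof (intro conjI allI)
    show "\<bar>h x $ j\<bar> \<le> 1" for j using x s unfolding mem_S3_iff h_def by (auto simp: abs_mult)
    obtain k where k: "\<bar>x $ k\<bar> = 1" using x unfolding mem_S3_iff by blast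
    have "\<bar>h x $ (if k = 4 then i else if k = i then 4 else k)\<bar> = 1"
      using k s by (auto simp: h_def abs_mult)
    then show "\<exists>j. \<bar>h x $ j\<bar> = 1" by blast
  qed
  have "pl_on S3 (\<lambda>x. (\<chi> j. if j = 4 then \<sigma> * x $ i else if j = i then \<sigma> * x $ 4 else x $ j))"
  proof (rule pl_on_vec)
    fix j :: 4
    show "pl_on S3 (\<lambda>x. if j = 4 then \<sigma> * x $ i else if j = i then \<sigma> * x $ 4 else x $ j)"
      by (cases "j = 4"; cases "j = i") (auto intro!: pl_on_mult pl_on_nth pl_on_id polyhedral_S3)
  qed
  then have "pl_on S3 h" unfolding h_def .
  moreover have "bij_betw h S3 S3" by (rule bij_betw_byWitness[where f'=h]) (use hh hS in auto)
  moreover have "h c $ 4 = 1" using s by (simp add: h_def \<sigma>_def)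
  ultimately show thesis using that unfolding pl_homeo_def by blast
qed

text \<open>The upper face is halved, and the upper halves of the adjacent faces move onto the collar left free.\<close>

lemma pl_homeo_shrink_upper_face:
  obtains h where "pl_homeo h"
    "\<And>x. x \<in> S3 \<Longrightarrow> x $ 4 = 1 \<Longrightarrow> h x $ 4 = 1 \<and> (\<forall>j. j \<noteq> 4 \<longrightarrow> \<bar>h x $ j\<bar> \<le> 1/2)"
proof -
  define n where "n x = max \<bar>x $ 1\<bar> (max \<bar>x $ 2\<bar> \<bar>x $ 3\<bar>)" for x :: "real^4"
  have n_le: "\<bar>x $ j\<bar> \<le> n x" if "j \<noteq> 4" for x j
    using that exhaust_4[of j] unfolding n_def by auto
  have n_eq: "\<exists>j. j \<noteq> 4 \<and> n x = \<bar>x $ j\<bar>" for x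
    unfolding n_def max_def by (intro exI[of _ "if \<bar>x $ 2\<bar> \<le> \<bar>x $ 3\<bar> then if \<bar>x $ 1\<bar> \<le> \<bar>x $ 3\<bar> then 3 else 1
      else if \<bar>x $ 1\<bar> \<le> \<bar>x $ 2\<bar> then 2 else 1"]) auto
  have S3n: "x \<in> S3 \<longleftrightarrow> n x \<le> 1 \<and> \<bar>x $ 4\<bar> \<le> 1 \<and> (n x = 1 \<or> \<bar>x $ 4\<bar> = 1)" for x
  proof
    assume "x \<in> S3"
    then show "n x \<le> 1 \<and> \<bar>x $ 4\<bar> \<le> 1 \<and> (n x = 1 \<or> \<bar>x $ 4\<bar> = 1)"
      unfolding mem_S3_iff using n_eq[of x] n_le[of _ x] by (metis order_antisym)
  next
    assume "n x \<le> 1 \<and> \<bar>x $ 4\<bar> \<le> 1 \<and> (n x = 1 \<or> \<bar>x $ 4\<bar> = 1)"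
    then show "x \<in> S3"
      unfolding mem_S3_iff using n_eq[of x] n_le[of _ x] by (metis order_trans)
  qed
  \<comment> \<open>\<open>p\<close> caps the shift of a coordinate towards 0: it is 0 for
    \<open>x $ 4 \<le> 0\<close> and rises to 1/2 at the upper face. On the part of the sphere that
    lands in the upper face, \<open>q\<close> recovers this cap from the image point.\<close>
  define p where "p x = max 0 (x $ 4) / 2" for x :: "real^4"
  define q where "q y = min (1/2) (1 - n y)" for y :: "real^4"
  define h :: "real^4 \<Rightarrow> real^4" where
    "h x = (\<chi> j. if j = 4 then min 1 (1 + 2 * x $ 4) else x $ j - max (- p x) (min (p x) ((1/2) * x $ j)))" for x
  define k :: "real^4 \<Rightarrow> real^4" where
    "k y = (\<chi> j. if j = 4 then if y $ 4 < 1 then (y $ 4 - 1) / 2 else 2 * q y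
        else if y $ 4 < 1 then y $ j else y $ j + max (- q y) (min (q y) (y $ j)))" for y
  have pl: "pl_on S3 h"
  proof -
    have 0: "pl_on S3 (\<lambda>x. x $ j)" for j :: 4 by (intro pl_on_nth pl_on_id polyhedral_S3)
    have "pl_on S3 (\<lambda>x. max 0 (x $ 4))" by (intro pl_on_max 0 pl_on_const polyhedral_S3)
    from pl_on_mult[OF this, of "1/2"] have p: "pl_on S3 p" by (simp add: p_def[abs_def])
    have "pl_on S3 (\<lambda>x. (\<chi> j. if j = 4 then min 1 (1 + 2 * x $ 4) else x $ j - max (- p x) (min (p x) ((1/2) * x $ j))) :: real^4)"
    proof (rule pl_on_vec)
      fix j :: 4
      have "pl_on S3 (\<lambda>x. min 1 (1 + 2 * x $ 4))"
        by (intro pl_on_min pl_on_add pl_on_mult pl_on_const 0 polyhedral_S3)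
      moreover have "pl_on S3 (\<lambda>x. x $ j - max (- p x) (min (p x) ((1/2) * x $ j)))"
        by (intro pl_on_diff pl_on_min pl_on_max pl_on_minus pl_on_mult pl_on_const 0 p polyhedral_S3)
      ultimately show "pl_on S3 (\<lambda>x. if j = 4 then min 1 (1 + 2 * x $ 4) else x $ j - max (- p x) (min (p x) ((1/2) * x $ j)))"
        by (cases "j = 4") auto
    qed
    then show ?thesis unfolding h_def .
  qed
  have habs: "\<bar>h x $ j\<bar> = \<bar>x $ j\<bar> - min (p x) (\<bar>x $ j\<bar> / 2)" if "j \<noteq> 4" for x j
    using that by (auto simp: h_def p_def min_def max_def abs_if)
  have hn: "n (h x) = n x - min (p x) (n x / 2)" for x
  proof -
    have m: "mono (\<lambda>a. a - min (p x) (a / 2))" by (auto intro!: monoI simp: min_def)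
    show ?thesis unfolding n_def by (simp add: habs max_of_mono[OF m])
  qed
  have h4: "h x $ 4 = min 1 (1 + 2 * x $ 4)" for x by (simp add: h_def)
  have hS: "h x \<in> S3" if "x \<in> S3" for x
  proof -
    have x: "n x \<le> 1" "\<bar>x $ 4\<bar> \<le> 1" "n x = 1 \<or> \<bar>x $ 4\<bar> = 1" using that S3n by auto
    have nn: "n x \<ge> 0" unfolding n_def by auto
    show ?thesis unfolding S3n h4 hn using x nn by (auto simp: p_def min_def max_def abs_if)
  qed
  have kS: "k y \<in> S3" if "y \<in> S3" for y
  proof -
    have y: "n y \<le> 1" "\<bar>y $ 4\<bar> \<le> 1" "n y = 1 \<or> \<bar>y $ 4\<bar> = 1" using that S3n by auto
    have nn: "n y \<ge> 0" unfolding n_def by auto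
    show ?thesis
    proof (cases "y $ 4 < 1")
      case True
      then have "n (k y) = n y" "k y $ 4 = (y $ 4 - 1) / 2" by (simp_all add: k_def n_def)
      then show ?thesis unfolding S3n using y True by (auto simp: abs_if split: if_splits)
    next
      case False
      have kabs: "\<bar>k y $ j\<bar> = \<bar>y $ j\<bar> + min (q y) \<bar>y $ j\<bar>" if "j \<noteq> 4" for j
      proof -
        have "q y \<ge> 0" using y(1) by (simp add: q_def)
        then show ?thesis using that False by (auto simp: k_def min_def max_def abs_if)
      qed
      have "n (k y) = n y + min (q y) (n y)"
      proof -
        have m: "mono (\<lambda>a. a + min (q y) a)" by (auto intro!: monoI simp: min_def)
        show ?thesis unfolding n_def by (simp add: kabs max_of_mono[OF m])
      qed
      moreover have "k y $ 4 = 2 * q y" using False by (simp add: k_def)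
      ultimately show ?thesis unfolding S3n using y nn by (auto simp: q_def min_def abs_if)
    qed
  qed
  have hk: "h (k y) = y" if "y \<in> S3" for y
  proof -
    have y: "n y \<le> 1" "\<bar>y $ 4\<bar> \<le> 1" "n y = 1 \<or> \<bar>y $ 4\<bar> = 1" using that S3n by auto
    show ?thesis
      unfolding vec_eq_iff
    proof
      fix j
      show "h (k y) $ j = y $ j"
      proof (cases "y $ 4 < 1")
        case True
        then have "p (k y) = 0" by (simp add: p_def k_def)
        moreover have "min 1 (1 + 2 * ((y $ 4 - 1) / 2)) = y $ 4" using True by (simp add: field_simps)
        ultimately show ?thesis using True by (auto simp: h_def k_def max_def min_def)
      next
        case False
        then have y4: "y $ 4 = 1" using y(2) by (simp add: abs_if split: if_splits)
        have q0: "q y \<ge> 0" using y(1) by (simp add: q_def)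
        then have p: "p (k y) = q y" using y4 by (simp add: p_def k_def)
        have arith: "b - max (- c) (min c ((1/2) * b)) = a" if "b = a + max (- c) (min c a)" "c \<ge> 0"
          for a b c :: real
          using that by (auto simp: min_def max_def split: if_splits)
        show ?thesis
        proof (cases "j = 4")
          case True then show ?thesis using q0 y4 by (simp add: h_def k_def)
        next
          case False
          then show ?thesis using arith[of "k y $ j" "y $ j" "q y"] q0 y4 p by (simp add: h_def k_def)
        qed
      qed
    qed
  qed
  have kh: "k (h x) = x" if "x \<in> S3" for x
  proof -
    have x: "n x \<le> 1" "\<bar>x $ 4\<bar> \<le> 1" "n x = 1 \<or> \<bar>x $ 4\<bar> = 1" using that S3n by auto
    have nn: "n x \<ge> 0" unfolding n_def by auto
    have q: "q (h x) = p x" if "x $ 4 \<ge> 0"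
      using x nn that unfolding q_def hn by (auto simp: p_def min_def max_def)
    show ?thesis
      unfolding vec_eq_iff
    proof
      fix j
      show "k (h x) $ j = x $ j"
      proof (cases "x $ 4 < 0")
        case True
        then show ?thesis by (auto simp: k_def h_def p_def min_def max_def)
      next
        case False
        then have "h x $ 4 = 1" by (simp add: h4)
        then show ?thesis using q False by (auto simp: k_def h_def p_def min_def max_def)
      qed
    qed
  qed
  have "bij_betw h S3 S3" by (rule bij_betw_byWitness[where f'=k]) (use hk kh hS kS in auto)
  then have "pl_homeo h" using pl unfolding pl_homeo_def by blast
  moreover have "h x $ 4 = 1 \<and> (\<forall>j. j \<noteq> 4 \<longrightarrow> \<bar>h x $ j\<bar> \<le> 1/2)" if "x \<in> S3" "x $ 4 = 1" for x
    using that habs unfolding mem_S3_iff h4 by (auto simp: p_def min_def)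
  ultimately show thesis using that by blast
qed

text \<open>A shear with a tent-shaped displacement carries \<open>north\<close> to
  \<open>b\<close>, and its inverse carries \<open>b\<close> to \<open>north\<close>. The slope
  condition asks for a displacement vector of sup norm below the height 1 of the tent, which is why
  the upper face is halved beforehand.\<close>

lemma pl_homeo_to_north:
  assumes c: "c \<in> S3"
  obtains h where "pl_homeo h" "h c = north"
proof -
  obtain h1 where h1: "pl_homeo h1" "h1 c $ 4 = 1" using pl_homeo_to_upper_face[OF c] .
  obtain h2 where h2: "pl_homeo h2"
    "\<And>x. x \<in> S3 \<Longrightarrow> x $ 4 = 1 \<Longrightarrow> h2 x $ 4 = 1 \<and> (\<forall>j. j \<noteq> 4 \<longrightarrow> \<bar>h2 x $ j\<bar> \<le> 1/2)"
    using pl_homeo_shrink_upper_face by blast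
  define b where "b = h2 (h1 c)"
  define d where "d = b - north"
  have b: "b \<in> S3" "b $ 4 = 1" "\<And>j. j \<noteq> 4 \<Longrightarrow> \<bar>b $ j\<bar> \<le> 1/2"
    using h2(2)[OF pl_homeo_in[OF h1(1) c] h1(2)] pl_homeo_in[OF h2(1) pl_homeo_in[OF h1(1) c]]
    unfolding b_def by auto
  have d: "infnorm d \<le> 1/2" "d $ 4 = 0" using b unfolding infnorm_le_iff d_def by auto
  let ?\<mu> = "\<lambda>x. max 0 (1 - infnorm (x - north))"
  have "pl_homeo (\<lambda>x. x + ?\<mu> x *\<^sub>R d)"
  proof (rule shear_homeo[OF _ _ d(2)])
    show "pl_on S3 ?\<mu>"
      by (intro pl_on_max pl_on_diff pl_on_infnorm pl_on_const pl_on_id polyhedral_S3)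
    fix x s assume s: "(s::real) > 0"
    have "infnorm (x + s *\<^sub>R d - north) \<le> infnorm (x - north) + s * infnorm d"
      using infnorm_triangle[of "x - north" "s *\<^sub>R d"] s by (simp add: infnorm_mul algebra_simps)
    moreover have "s * infnorm d < s * 1" using d(1) s by (intro mult_strict_left_mono) auto
    ultimately have "infnorm (x + s *\<^sub>R d - north) < infnorm (x - north) + s" by linarith
    then show "?\<mu> x < ?\<mu> (x + s *\<^sub>R d) + s" using s by (auto simp: max_def)
  qed auto
  then obtain k where k: "pl_homeo k" "\<And>x. x \<in> S3 \<Longrightarrow> k (x + ?\<mu> x *\<^sub>R d) = x"
    using pl_homeo_inv by blast
  have "k b = north" using k(2)[of north] by (simp add: d_def infnorm_0)
  then show thesis
    using that[of "\<lambda>x. k (h2 (h1 x))"] pl_homeo_compose[OF pl_homeo_compose[OF h1(1) h2(1)] k(1)] b_def by simp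
qed


section \<open>Dragging the end of an arc\<close>

text \<open>The pieces that miss \<open>s\<close> form a closed set, so every parameter near
  \<open>s\<close> shares a convex piece with \<open>s\<close>, and \<open>p\<close> is affine in
  between. Each side has its own velocity; \<open>w\<close> is measured backwards in time.\<close>

lemma pl_path_local:
  fixes p :: "real \<Rightarrow> 'a::euclidean_space"
  assumes p: "pl_on {0..1} p" and s: "s \<in> {0..1}"
  obtains \<eta> v w where "\<eta> > 0"
    "\<And>t. t \<in> {0..1} \<Longrightarrow> s \<le> t \<Longrightarrow> t < s + \<eta> \<Longrightarrow> p t = p s + (t - s) *\<^sub>R v"
    "\<And>t. t \<in> {0..1} \<Longrightarrow> t \<le> s \<Longrightarrow> s - \<eta> < t \<Longrightarrow> p t = p s + (s - t) *\<^sub>R w"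
proof -
  obtain \<P> where \<P>: "finite \<P>" "\<Union>\<P> = {0..1}" "\<And>P. P \<in> \<P> \<Longrightarrow> polytope P \<and> affine_fun_on P p"
    using p unfolding pl_on_alt by blast
  have "closed (\<Union>{P \<in> \<P>. s \<notin> P})"
    using \<P> polytope_imp_closed by (intro closed_Union) auto
  then have "open (- \<Union>{P \<in> \<P>. s \<notin> P})" by (simp add: open_Compl)
  then obtain \<eta> where \<eta>: "\<eta> > 0" "ball s \<eta> \<subseteq> - \<Union>{P \<in> \<P>. s \<notin> P}"
    by (rule openE[of _ s]) auto
  have loc: "\<exists>v. \<forall>\<tau>\<in>closed_segment s t. p \<tau> = p s + (\<tau> - s) *\<^sub>R v" if t: "t \<in> {0..1}" "dist s t < \<eta>" for t
  proof -
    obtain P where P: "P \<in> \<P>" "t \<in> P" using \<P>(2) t by blast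
    then have "s \<in> P" using \<eta>(2) t by auto
    then have seg: "closed_segment s t \<subseteq> P"
      using P \<P>(3) polytope_imp_convex by (meson closed_segment_subset)
    obtain h c where h: "linear h" "\<forall>x\<in>P. p x = h x + c" using \<P>(3)[OF P(1)] unfolding affine_fun_on_def by blast
    have "p \<tau> = p s + (\<tau> - s) *\<^sub>R h 1" if "\<tau> \<in> closed_segment s t" for \<tau>
    proof -
      have "h (\<tau> - s) = (\<tau> - s) *\<^sub>R h 1" using linear_scale[OF h(1), of "\<tau> - s" 1] by simp
      then show ?thesis using that seg h \<open>s \<in> P\<close> by (auto simp: linear_diff algebra_simps)
    qed
    then show ?thesis by blast
  qed
  have R: "\<exists>v. \<forall>t\<in>{0..1}. s \<le> t \<and> t < s + \<eta>/2 \<longrightarrow> p t = p s + (t - s) *\<^sub>R v"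
  proof -
    let ?t = "min 1 (s + \<eta>/2)"
    have "?t \<in> {0..1}" "dist s ?t < \<eta>" using \<eta>(1) s by (auto simp: dist_real_def)
    then obtain v where "\<forall>\<tau>\<in>closed_segment s ?t. p \<tau> = p s + (\<tau> - s) *\<^sub>R v"
      using loc[of ?t] by blast
    moreover have "t \<in> closed_segment s ?t" if "t \<in> {0..1}" "s \<le> t" "t < s + \<eta>/2" for t
      using that s \<eta>(1) by (auto simp: closed_segment_eq_real_ivl1)
    ultimately show ?thesis by blast
  qed
  have L: "\<exists>w. \<forall>t\<in>{0..1}. t \<le> s \<and> s - \<eta>/2 < t \<longrightarrow> p t = p s + (s - t) *\<^sub>R w"
  proof -
    let ?t = "max 0 (s - \<eta>/2)"
    have "?t \<in> {0..1}" "dist s ?t < \<eta>" using \<eta>(1) s by (auto simp: dist_real_def)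
    then obtain v where v: "\<forall>\<tau>\<in>closed_segment s ?t. p \<tau> = p s + (\<tau> - s) *\<^sub>R v"
      using loc[of ?t] by blast
    have "p t = p s + (s - t) *\<^sub>R (- v)" if "t \<in> {0..1}" "t \<le> s" "s - \<eta>/2 < t" for t
    proof -
      have "t \<in> closed_segment s ?t" using that s \<eta>(1) by (auto simp: closed_segment_commute[of s] closed_segment_eq_real_ivl1)
      then have "p t = p s + (t - s) *\<^sub>R v" using v by blast
      then show ?thesis by (simp add: algebra_simps)
    qed
    then show ?thesis by blast
  qed
  from R obtain v where "\<forall>t\<in>{0..1}. s \<le> t \<and> t < s + \<eta>/2 \<longrightarrow> p t = p s + (t - s) *\<^sub>R v" by blast
  moreover from L obtain w where "\<forall>t\<in>{0..1}. t \<le> s \<and> s - \<eta>/2 < t \<longrightarrow> p t = p s + (s - t) *\<^sub>R w" by blast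
  ultimately show thesis using that[of "\<eta>/2" v w] \<eta>(1) by auto
qed

lemma image_interval_mono:
  fixes f :: "real \<Rightarrow> real"
  assumes "a \<le> b" "continuous_on {a..b} f" "\<And>x y. x \<le> y \<Longrightarrow> f x \<le> f y"
  shows "f ` {a..b} = {f a..f b}"
proof
  show "f ` {a..b} \<subseteq> {f a..f b}" using assms(3) by auto
  show "{f a..f b} \<subseteq> f ` {a..b}"
  proof
    fix y assume "y \<in> {f a..f b}"
    then obtain x where "a \<le> x" "x \<le> b" "f x = y" using IVT'[of f a y b] assms by auto
    then show "y \<in> f ` {a..b}" by auto
  qed
qed

lemma infnorm_shift:
  "infnorm (x - c) \<le> infnorm (x + s *\<^sub>R d - c) + \<bar>s\<bar> * infnorm d"
proof -
  have "x - c = (x + s *\<^sub>R d - c) + (- s) *\<^sub>R d" by simp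
  then show ?thesis using infnorm_triangle[of "x + s *\<^sub>R d - c" "(- s) *\<^sub>R d"]
    by (metis abs_minus_cancel infnorm_mul)
qed

lemma infnorm_shift':
  "infnorm (x + s *\<^sub>R d - c) \<le> infnorm (x - c) + \<bar>s\<bar> * infnorm d"
  using infnorm_shift[of "x + s *\<^sub>R d" c "-s" d] by simp

text \<open>Folding along the hyperplane orthogonal to \<open>n\<close> through \<open>north\<close>, damped away from \<open>north\<close>.\<close>

lemma fold_homeo:
  assumes n: "n \<bullet> d = 0" and d4: "d $ 4 = 0"
  obtains h \<epsilon> where "pl_homeo h" "\<epsilon> > 0"
    "\<And>x. dist north x < \<epsilon> \<Longrightarrow> h x = x + \<bar>n \<bullet> (x - north)\<bar> *\<^sub>R d"
proof -
  \<comment> \<open>With this factor the damping term changes along \<open>d\<close> at rate at most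
    \<open>K * infnorm d\<close>, which is below 1, while the folding term is constant along
    \<open>d\<close>.\<close>
  define K where "K = 1 / (1 + infnorm d)"
  have K: "K > 0" "K * infnorm d < 1"
    using infnorm_pos_le[of d] by (auto simp: K_def field_simps add_pos_nonneg)
  let ?A = "\<lambda>x. \<bar>n \<bullet> (x - north)\<bar>"
  let ?B = "\<lambda>x. max 0 (K * (1 - infnorm (x - north)))"
  have "pl_homeo (\<lambda>x. x + min (?A x) (?B x) *\<^sub>R d)"
  proof (rule shear_homeo[OF _ _ d4])
    show "pl_on S3 (\<lambda>x. min (?A x) (?B x))"
      by (intro pl_on_min pl_on_max pl_on_mult pl_on_abs pl_on_inner pl_on_infnorm pl_on_diff pl_on_id pl_on_const polyhedral_S3)
    fix x assume "infnorm (x - north) \<ge> 1"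
    then have "K * (1 - infnorm (x - north)) \<le> 0" using K by (simp add: mult_le_0_iff)
    then show "min (?A x) (?B x) = 0" by simp
  next
    fix x s assume s: "(s::real) > 0"
    have "?A (x + s *\<^sub>R d) = ?A x" using n by (simp add: inner_diff_right inner_add_right)
    moreover have "?B x < ?B (x + s *\<^sub>R d) + s"
    proof -
      have "K * infnorm (x + s *\<^sub>R d - north) \<le> K * (infnorm (x - north) + s * infnorm d)"
        using infnorm_shift'[of x s d north] s K(1) by (intro mult_left_mono) auto
      moreover have "s * (K * infnorm d) < s * 1" using K(2) s by (intro mult_strict_left_mono) auto
      ultimately have "K * infnorm (x + s *\<^sub>R d - north) < K * infnorm (x - north) + s"
        by (simp add: algebra_simps)
      then show ?thesis using s by (auto simp: max_def algebra_simps)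
    qed
    moreover have "min a b < min a' b' + s" if "a' = a" "b < b' + s" for a b a' b' :: real
      using that s by (auto simp: min_def)
    ultimately show "min (?A x) (?B x) < min (?A (x + s *\<^sub>R d)) (?B (x + s *\<^sub>R d)) + s" by blast
  qed
  moreover have "open {x. ?A x < K * (1 - infnorm (x - north))}"
    by (intro open_Collect_less continuous_intros)
  then obtain \<epsilon> where "\<epsilon> > 0" "ball north \<epsilon> \<subseteq> {x. ?A x < K * (1 - infnorm (x - north))}"
    by (rule openE[of _ north]) (use K in \<open>auto simp: infnorm_0\<close>)
  moreover from this have "x + min (?A x) (?B x) *\<^sub>R d = x + ?A x *\<^sub>R d" if "dist north x < \<epsilon>" for x
    using that by (auto simp: min_def max_def subset_iff)
  ultimately show thesis using that by blast
qed

text \<open>Distinct unit vectors \<open>a\<close> and \<open>b\<close> are \<open>e + f\<close> and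
  \<open>- e + f\<close> with \<open>e\<close> orthogonal to \<open>f\<close>, because their norms
  agree. A fold that subtracts \<open>f\<close> from both makes the directions opposite, which
  straightens a corner of an arc.\<close>

lemma straighten_homeo:
  assumes v: "v \<noteq> 0" "v $ 4 = 0" and w: "w \<noteq> 0" "w $ 4 = 0" and vw: "v /\<^sub>R norm v \<noteq> w /\<^sub>R norm w"
  obtains h n d e \<epsilon> where "pl_homeo h" "\<epsilon> > 0" "d $ 4 = 0"
    "\<And>x. dist north x < \<epsilon> \<Longrightarrow> h x = x + \<bar>n \<bullet> (x - north)\<bar> *\<^sub>R d"
    "e \<noteq> 0" "e $ 4 = 0" "v + \<bar>n \<bullet> v\<bar> *\<^sub>R d = norm v *\<^sub>R e" "w + \<bar>n \<bullet> w\<bar> *\<^sub>R d = - (norm w *\<^sub>R e)"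
proof -
  define a b where "a = v /\<^sub>R norm v" and "b = w /\<^sub>R norm w"
  have ab: "a \<bullet> a = 1" "b \<bullet> b = 1" "a \<noteq> b" "a $ 4 = 0" "b $ 4 = 0"
    using v w vw by (auto simp: a_def b_def dot_square_norm power2_eq_square)
  have va: "v = norm v *\<^sub>R a" and wb: "w = norm w *\<^sub>R b" using v w by (auto simp: a_def b_def)
  define e f where "e = (1/2) *\<^sub>R (a - b)" and "f = (1/2) *\<^sub>R (a + b)"
  define n where "n = e /\<^sub>R (e \<bullet> e)"
  have e: "e \<noteq> 0" "e $ 4 = 0" "f $ 4 = 0" using ab by (auto simp: e_def f_def)
  have ef: "e \<bullet> f = 0" using ab by (simp add: e_def f_def inner_simps inner_commute)
  have aef: "a = e + f" and bef: "b = - e + f" unfolding e_def f_def by (simp_all add: vec_eq_iff field_simps)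
  have na: "n \<bullet> a = 1" "n \<bullet> b = -1" using e ef unfolding aef bef n_def by (simp_all add: inner_simps)
  obtain h \<epsilon> where h: "pl_homeo h" "\<epsilon> > 0" "\<And>x. dist north x < \<epsilon> \<Longrightarrow> h x = x + \<bar>n \<bullet> (x - north)\<bar> *\<^sub>R (- f)"
    using fold_homeo[of n "- f"] ef e by (auto simp: n_def)
  show thesis
  proof (rule that[OF h(1,2) _ h(3) e(1,2)])
    have "\<bar>n \<bullet> v\<bar> = norm v" by (subst va) (simp add: na(1))
    then show "v + \<bar>n \<bullet> v\<bar> *\<^sub>R (- f) = norm v *\<^sub>R e"
      using va aef by (metis (no_types, lifting) add_diff_cancel_right' add_uminus_conv_diff scaleR_right_distrib scaleR_minus_right)
    have "\<bar>n \<bullet> w\<bar> = norm w" by (subst wb) (simp add: na(2))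
    then show "w + \<bar>n \<bullet> w\<bar> *\<^sub>R (- f) = - (norm w *\<^sub>R e)"
      using wb bef by (metis (no_types, lifting) add_diff_cancel_right' add_uminus_conv_diff scaleR_right_distrib scaleR_minus_right)
  qed (use e in auto)
qed

text \<open>The shear acts in the direction of the segment itself: on the line through
  \<open>north\<close> it is the monotone reparametrisation \<open>\<psi>\<close> with
  \<open>\<psi> 0 = \<kappa> * \<rho>\<close> and \<open>\<psi> A = A\<close>. A positive
  \<open>\<kappa>\<close> shortens the segment, a negative one lengthens it.\<close>

lemma slide_homeo:
  fixes e :: "real^4"
  assumes e: "e \<noteq> 0" "e $ 4 = 0" and \<rho>: "0 < \<rho>" "\<rho> \<le> 1" and \<kappa>: "\<bar>\<kappa>\<bar> * infnorm e < 1"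
    and A: "A * infnorm e \<ge> \<rho>"
  obtains h where "pl_homeo h" "\<And>x. infnorm (x - north) \<ge> \<rho> \<Longrightarrow> h x = x"
    "h north = north + (\<kappa> * \<rho>) *\<^sub>R e"
    "h ` (\<lambda>a. north + a *\<^sub>R e) ` {0..A} = (\<lambda>a. north + a *\<^sub>R e) ` {\<kappa> * \<rho>..A}"
proof -
  define \<mu> where "\<mu> x = max 0 (\<rho> - infnorm (x - north))" for x :: "real^4"
  define h where "h x = x + \<mu> x *\<^sub>R (\<kappa> *\<^sub>R e)" for x
  define \<psi> where "\<psi> a = a + \<kappa> * max 0 (\<rho> - \<bar>a\<bar> * infnorm e)" for a
  have ie: "infnorm e > 0" using e infnorm_pos_lt by blast
  have A0: "A \<ge> 0" using A \<rho> ie by (metis less_le_trans less_imp_le zero_less_mult_pos2)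
  have "pl_homeo (\<lambda>x. x + \<mu> x *\<^sub>R (\<kappa> *\<^sub>R e))"
  proof (rule shear_homeo)
    show "pl_on S3 \<mu>" unfolding \<mu>_def
      by (intro pl_on_max pl_on_infnorm pl_on_diff pl_on_id pl_on_const polyhedral_S3)
    fix x s assume s: "(s::real) > 0"
    have "infnorm (x + s *\<^sub>R (\<kappa> *\<^sub>R e) - north) \<le> infnorm (x - north) + s * (\<bar>\<kappa>\<bar> * infnorm e)"
      using infnorm_shift'[of x s "\<kappa> *\<^sub>R e" north] s by (simp add: infnorm_mul)
    moreover have "s * (\<bar>\<kappa>\<bar> * infnorm e) < s * 1" using \<kappa> s by (intro mult_strict_left_mono) auto
    ultimately have "infnorm (x + s *\<^sub>R (\<kappa> *\<^sub>R e) - north) < infnorm (x - north) + s" by linarith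
    then show "\<mu> x < \<mu> (x + s *\<^sub>R (\<kappa> *\<^sub>R e)) + s" using s by (auto simp: \<mu>_def max_def)
  qed (use \<rho> e in \<open>auto simp: \<mu>_def\<close>)
  then have "pl_homeo h" unfolding h_def .
  moreover have "h x = x" if "infnorm (x - north) \<ge> \<rho>" for x using that by (simp add: h_def \<mu>_def)
  moreover have "h north = north + (\<kappa> * \<rho>) *\<^sub>R e" using \<rho> by (simp add: h_def \<mu>_def infnorm_0 mult.commute)
  moreover have "h ` (\<lambda>a. north + a *\<^sub>R e) ` {0..A} = (\<lambda>a. north + a *\<^sub>R e) ` {\<kappa> * \<rho>..A}"
  proof -
    have h\<psi>: "h (north + a *\<^sub>R e) = north + \<psi> a *\<^sub>R e" for a
      by (simp add: h_def \<mu>_def \<psi>_def infnorm_mul algebra_simps)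
    have \<psi>_mono: "\<psi> a \<le> \<psi> b" if "a \<le> b" for a b
    proof -
      have "\<bar>max 0 (\<rho> - \<bar>a\<bar> * infnorm e) - max 0 (\<rho> - \<bar>b\<bar> * infnorm e)\<bar> \<le> \<bar>\<bar>a\<bar> * infnorm e - \<bar>b\<bar> * infnorm e\<bar>"
        by (auto simp: max_def)
      also have "\<dots> = \<bar>\<bar>a\<bar> - \<bar>b\<bar>\<bar> * infnorm e" using ie by (simp add: abs_mult flip: left_diff_distrib)
      also have "\<dots> \<le> (b - a) * infnorm e" using ie that by (intro mult_right_mono) auto
      finally have "\<bar>\<kappa>\<bar> * \<bar>max 0 (\<rho> - \<bar>a\<bar> * infnorm e) - max 0 (\<rho> - \<bar>b\<bar> * infnorm e)\<bar> \<le> \<bar>\<kappa>\<bar> * ((b - a) * infnorm e)"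
        by (intro mult_left_mono) auto
      also have "\<dots> = (b - a) * (\<bar>\<kappa>\<bar> * infnorm e)" by simp
      also have "\<dots> \<le> (b - a) * 1" using \<kappa> that by (intro mult_left_mono) auto
      finally have "\<bar>\<kappa> * (max 0 (\<rho> - \<bar>a\<bar> * infnorm e) - max 0 (\<rho> - \<bar>b\<bar> * infnorm e))\<bar> \<le> b - a"
        by (simp add: abs_mult)
      then show ?thesis by (simp add: \<psi>_def right_diff_distrib)
    qed
    have \<psi>0: "\<psi> 0 = \<kappa> * \<rho>" and \<psi>A: "\<psi> A = A" using \<rho> A A0 by (auto simp: \<psi>_def)
    have "continuous_on {0..A} \<psi>" unfolding \<psi>_def by (intro continuous_intros)
    then have "\<psi> ` {0..A} = {\<kappa> * \<rho>..A}"
      using image_interval_mono[of 0 A \<psi>] \<psi>_mono A0 unfolding \<psi>0 \<psi>A by blast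
    then have "(\<lambda>a. north + a *\<^sub>R e) ` \<psi> ` {0..A} = (\<lambda>a. north + a *\<^sub>R e) ` {\<kappa> * \<rho>..A}" by simp
    then show ?thesis unfolding image_image h\<psi> .
  qed
  ultimately show thesis using that by blast
qed


text \<open>A point of the sphere at sup distance below 1 from \<open>north\<close> lies in the
  upper face, so a short initial piece of the ray is horizontal.\<close>

lemma north_direction_level:
  assumes "\<tau> > 0" "\<And>t. 0 < t \<Longrightarrow> t < \<tau> \<Longrightarrow> north + t *\<^sub>R v \<in> S3"
  shows "v $ 4 = 0"
proof -
  define t where "t = min (\<tau>/2) (1 / (2 * (1 + infnorm v)))"
  have i: "infnorm v \<ge> 0" by (rule infnorm_pos_le)
  then have t: "t > 0" "t < \<tau>" using assms(1) by (auto simp: t_def)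
  have "t * infnorm v \<le> 1 / (2 * (1 + infnorm v)) * infnorm v" using i by (intro mult_right_mono) (auto simp: t_def)
  also have "\<dots> < 1" using i by (simp add: field_simps)
  finally have "infnorm (north + t *\<^sub>R v - north) < 1" using t by (simp add: infnorm_mul)
  then have "(north + t *\<^sub>R v) $ 4 = 1" using near_north assms(2)[OF t] by blast
  then show ?thesis using t by simp
qed

lemma infnorm_away_from_north:
  assumes "closed Z" "north \<notin> Z"
  obtains \<rho> where "0 < \<rho>" "\<rho> \<le> 1" "\<And>x. x \<in> Z \<Longrightarrow> infnorm (x - north) \<ge> \<rho>"
proof -
  obtain r where r: "r > 0" "ball north r \<subseteq> - Z"
    using assms openE[of "- Z" north] by (auto simp: open_Compl)
  have "infnorm (x - north) \<ge> min 1 (r / 2)" if "x \<in> Z" for x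
  proof -
    have "norm (x - north) \<ge> r" using r that by (auto simp: dist_norm norm_minus_commute subset_iff not_less)
    \<comment> \<open>The factor 2 is the square root of the dimension 4.\<close>
    moreover have "norm (x - north) \<le> 2 * infnorm (x - north)" using norm_le_infnorm[of "x - north"] by simp
    ultimately show ?thesis by linarith
  qed
  then show thesis using that[of "min 1 (r/2)"] r by auto
qed

text \<open>Once \<open>p s\<close> is moved to \<open>north\<close> and the corner there is
  straightened, the arc is a straight segment near \<open>s\<close>. A slide along this segment,
  supported in a ball that misses \<open>Z\<close> and the later part of the arc, moves the end from
  \<open>p s\<close> to \<open>p t\<close>.\<close>

lemma drag_homeo_local:
  fixes p :: "real \<Rightarrow> real^4"
  assumes p: "pl_on {0..1} p" "inj_on p {0..1}" "p ` {0..1} \<subseteq> S3"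
    and Z: "closed Z" "Z \<subseteq> S3" "p ` {0..<1} \<inter> Z = {}" and s: "s \<in> {0..<1}"
  obtains \<epsilon> where "\<epsilon> > 0" "\<And>t. t \<in> {0..<1} \<Longrightarrow> \<bar>t - s\<bar> < \<epsilon> \<Longrightarrow>
    \<exists>h. pl_homeo h \<and> (\<forall>z\<in>Z. h z = z) \<and> h ` p ` {s..1} = p ` {t..1} \<and> h (p s) = p t"
proof -
  have s01: "s \<in> {0..1}" "s < 1" "0 \<le> s" using s by auto
  obtain \<theta> where \<theta>: "pl_homeo \<theta>" "\<theta> (p s) = north"
    using pl_homeo_to_north[of "p s"] p(3) s01 by blast
  define P where "P t = \<theta> (p t)" for t
  have plP: "pl_on {0..1} P" unfolding P_def
    using pl_on_compose[OF p(1)] \<theta>(1) p(3) unfolding pl_homeo_def by blast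
  have PS: "P t \<in> S3" if "t \<in> {0..1}" for t using that p(3) pl_homeo_in[OF \<theta>(1)] unfolding P_def by blast
  have injP: "inj_on P {0..1}"
    using comp_inj_on[OF p(2) pl_homeo_inj_on[OF \<theta>(1) p(3)]] unfolding P_def[abs_def] o_def .
  have Ps: "P s = north" by (simp add: P_def \<theta>)
  obtain \<eta> v w0 where \<eta>: "\<eta> > 0"
    and Pv: "\<And>t. t \<in> {0..1} \<Longrightarrow> s \<le> t \<Longrightarrow> t < s + \<eta> \<Longrightarrow> P t = north + (t - s) *\<^sub>R v"
    and Pw0: "\<And>t. t \<in> {0..1} \<Longrightarrow> t \<le> s \<Longrightarrow> s - \<eta> < t \<Longrightarrow> P t = north + (s - t) *\<^sub>R w0"
    using pl_path_local[OF plP s01(1)] unfolding Ps by metis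
  have v0: "v \<noteq> 0"
  proof
    assume v: "v = 0"
    define m where "m = min \<eta> (1 - s)"
    have "m > 0" "m \<le> \<eta>" "m \<le> 1 - s" using s01 \<eta> by (auto simp: m_def)
    let ?t = "s + m / 2"
    have "?t \<in> {0..1}" "s < ?t" "?t < s + \<eta>" using \<open>m > 0\<close> \<open>m \<le> \<eta>\<close> \<open>m \<le> 1 - s\<close> s01 by auto
    then have "P ?t = P s" using Pv[of ?t] v Ps by simp
    then have "?t = s" using injP \<open>?t \<in> {0..1}\<close> s01(1) by (meson inj_onD)
    then show False using \<open>s < ?t\<close> by simp
  qed
  have v4: "v $ 4 = 0"
  proof (rule north_direction_level[of "min \<eta> (1 - s)"])
    show "north + t *\<^sub>R v \<in> S3" if "0 < t" "t < min \<eta> (1 - s)" for t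
      using Pv[of "s + t"] PS[of "s + t"] that s01 by auto
  qed (use \<eta> s01 in auto)
  obtain w where w: "w \<noteq> 0" "w $ 4 = 0" "v /\<^sub>R norm v \<noteq> w /\<^sub>R norm w"
    and Pw: "\<And>t. t \<in> {0..1} \<Longrightarrow> t \<le> s \<Longrightarrow> s - \<eta> < t \<Longrightarrow> P t = north + (s - t) *\<^sub>R w"
  \<comment> \<open>At \<open>s = 0\<close> no branch arrives, and \<open>- v\<close> serves as
    \<open>w\<close> because its direction differs from that of \<open>v\<close>.\<close>
  proof (cases "s = 0")
    case True
    show thesis
    proof (rule that[of "- v"])
      show "v /\<^sub>R norm v \<noteq> (- v) /\<^sub>R norm (- v)"
      proof
        assume "v /\<^sub>R norm v = (- v) /\<^sub>R norm (- v)"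
        then have "v $ i / norm v = - (v $ i / norm v)" for i
          by (simp add: vec_eq_iff divide_inverse mult.commute)
        moreover obtain i where "v $ i \<noteq> 0" using v0 by (auto simp: vec_eq_iff)
        ultimately show False using v0 by (metis divide_eq_0_iff equal_neg_zero norm_eq_zero)
      qed
    qed (use True v0 v4 Ps in auto)
  next
    case False
    then have s0: "s > 0" using s01 by simp
    show thesis
    proof (rule that[OF _ _ _ Pw0])
      show w0: "w0 \<noteq> 0"
      proof
        assume w: "w0 = 0"
        define m where "m = min \<eta> s"
        have "m > 0" "m \<le> \<eta>" "m \<le> s" using s0 \<eta> by (auto simp: m_def)
        let ?t = "s - m / 2"
        have t: "?t \<in> {0..1}" "s > ?t" "s - \<eta> < ?t" using \<open>m > 0\<close> \<open>m \<le> \<eta>\<close> \<open>m \<le> s\<close> s01 by auto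
        then have "P ?t = P s" using Pw0[of ?t] w Ps by simp
        then have "?t = s" using injP t(1) s01(1) by (meson inj_onD)
        then show False using t by simp
      qed
      show "w0 $ 4 = 0"
      proof (rule north_direction_level[of "min \<eta> s"])
        show "north + t *\<^sub>R w0 \<in> S3" if "0 < t" "t < min \<eta> s" for t
          using Pw0[of "s - t"] PS[of "s - t"] that s01 by auto
      qed (use \<eta> s0 in auto)
      show "v /\<^sub>R norm v \<noteq> w0 /\<^sub>R norm w0"
      proof
        assume eq: "v /\<^sub>R norm v = w0 /\<^sub>R norm w0"
        \<comment> \<open>Branches with the same direction would both pass through the point at
          distance \<tau> from \<open>north\<close>, at parameters on different sides of
          \<open>s\<close>.\<close>
        define \<tau> where "\<tau> = min (norm v * min \<eta> (1 - s)) (norm w0 * min \<eta> s) / 2"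
        have nv: "norm v > 0" "norm w0 > 0" using v0 w0 by auto
        have m: "min \<eta> (1 - s) > 0" "min \<eta> s > 0" using \<eta> s01 s0 by auto
        have \<tau>: "\<tau> > 0" "\<tau> < norm v * min \<eta> (1 - s)" "\<tau> < norm w0 * min \<eta> s"
          using nv m mult_pos_pos[OF nv(1) m(1)] mult_pos_pos[OF nv(2) m(2)] unfolding \<tau>_def by linarith+
        have a: "\<tau> / norm v > 0" "\<tau> / norm v < min \<eta> (1 - s)" "\<tau> / norm w0 > 0" "\<tau> / norm w0 < min \<eta> s"
          using \<tau> nv by (simp, metis pos_divide_less_eq mult.commute, simp, metis pos_divide_less_eq mult.commute)
        have "(\<tau> / norm v) *\<^sub>R v = (\<tau> / norm w0) *\<^sub>R w0"
          using arg_cong[OF eq, of "\<lambda>x. \<tau> *\<^sub>R x"] by (simp add: divide_inverse)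
        then have "P (s + \<tau> / norm v) = P (s - \<tau> / norm w0)"
          using Pv[of "s + \<tau> / norm v"] Pw0[of "s - \<tau> / norm w0"] a s01 by auto
        then have "s + \<tau> / norm v = s - \<tau> / norm w0"
          by (rule inj_onD[OF injP]) (use a s01 in auto)
        then show False using a by simp
      qed
    qed
  qed
  obtain \<sigma> n d e \<epsilon> where \<sigma>: "pl_homeo \<sigma>" "\<epsilon> > 0" "d $ 4 = 0"
    "\<And>x. dist north x < \<epsilon> \<Longrightarrow> \<sigma> x = x + \<bar>n \<bullet> (x - north)\<bar> *\<^sub>R d"
    and e: "e \<noteq> 0" "e $ 4 = 0" "v + \<bar>n \<bullet> v\<bar> *\<^sub>R d = norm v *\<^sub>R e" "w + \<bar>n \<bullet> w\<bar> *\<^sub>R d = - (norm w *\<^sub>R e)"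
    using straighten_homeo[OF v0 v4 w] by metis
  define \<Theta> where "\<Theta> x = \<sigma> (\<theta> x)" for x
  have \<Theta>: "pl_homeo \<Theta>" unfolding \<Theta>_def using pl_homeo_compose[OF \<theta>(1) \<sigma>(1)] .
  define Q where "Q t = \<Theta> (p t)" for t
  have QP: "Q t = \<sigma> (P t)" for t by (simp add: Q_def \<Theta>_def P_def)
  define M where "M = norm v + norm w + 1"
  have M: "M > 0" "norm v \<le> M" "norm w \<le> M" by (auto simp: M_def add_nonneg_pos)
  define \<epsilon>1 where "\<epsilon>1 = min \<eta> (\<epsilon> / M)"
  have \<epsilon>1: "\<epsilon>1 > 0" "\<epsilon>1 \<le> \<eta>" "\<epsilon>1 \<le> \<epsilon> / M" using \<eta> \<sigma>(2) M by (auto simp: \<epsilon>1_def)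
  \<comment> \<open>The signed position along \<open>e\<close>: the outgoing branch has speed
    \<open>norm v\<close>, the incoming one speed \<open>norm w\<close>.\<close>
  define \<omega> where "\<omega> t = norm v * max 0 (t - s) - norm w * max 0 (s - t)" for t
  have Q\<omega>: "Q t = north + \<omega> t *\<^sub>R e" if t: "t \<in> {0..1}" "\<bar>t - s\<bar> < \<epsilon>1" for t
  proof -
    have small: "\<tau> * norm x < \<epsilon>" if "\<tau> = \<bar>t - s\<bar>" "norm x \<le> M" for \<tau> and x :: "real^4"
    proof -
      have "\<tau> * norm x \<le> \<tau> * M" using that by (intro mult_left_mono) auto
      also have "\<dots> < \<epsilon>" using t(2) \<epsilon>1(3) that(1) M(1) by (simp add: pos_less_divide_eq[symmetric])
      finally show ?thesis .
    qed
    show ?thesis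
    proof (cases "s \<le> t")
      case True
      then have Pt: "P t = north + (t - s) *\<^sub>R v" using Pv t \<epsilon>1(2) by auto
      have "dist north (P t) < \<epsilon>" using small[of "t - s" v] True M by (simp add: Pt dist_norm)
      then have "Q t = P t + \<bar>n \<bullet> (P t - north)\<bar> *\<^sub>R d" using \<sigma>(4) QP by simp
      also have "\<dots> = north + (t - s) *\<^sub>R (v + \<bar>n \<bullet> v\<bar> *\<^sub>R d)"
        using True by (simp add: Pt abs_mult scaleR_add_right)
      finally show ?thesis using True by (simp add: e(3) \<omega>_def mult.commute)
    next
      case False
      then have Pt: "P t = north + (s - t) *\<^sub>R w" using Pw t \<epsilon>1(2) by auto
      have "dist north (P t) < \<epsilon>" using small[of "s - t" w] False M by (simp add: Pt dist_norm)
      then have "Q t = P t + \<bar>n \<bullet> (P t - north)\<bar> *\<^sub>R d" using \<sigma>(4) QP by simp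
      also have "\<dots> = north + (s - t) *\<^sub>R (w + \<bar>n \<bullet> w\<bar> *\<^sub>R d)"
        using False by (simp add: Pt abs_mult scaleR_add_right)
      finally show ?thesis using False by (simp add: e(4) \<omega>_def mult.commute)
    qed
  qed
  have \<omega>_mono: "\<omega> a \<le> \<omega> b" if "a \<le> b" for a b
  proof -
    have "norm v * max 0 (a - s) \<le> norm v * max 0 (b - s)" "norm w * max 0 (s - b) \<le> norm w * max 0 (s - a)"
      using that by (auto intro!: mult_left_mono)
    then show ?thesis by (simp add: \<omega>_def)
  qed
  have \<omega>_cont: "continuous_on A \<omega>" for A unfolding \<omega>_def by (intro continuous_intros)
  have \<omega>s: "\<omega> s = 0" by (simp add: \<omega>_def)
  define s1 where "s1 = s + min \<epsilon>1 (1 - s) / 2"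
  have s1: "s < s1" "s1 < 1" "s1 < s + \<epsilon>1"
  proof -
    define m where "m = min \<epsilon>1 (1 - s)"
    have "m > 0" "m \<le> \<epsilon>1" "m \<le> 1 - s" using s01 \<epsilon>1 by (auto simp: m_def)
    moreover have "s1 = s + m / 2" by (simp add: s1_def m_def)
    ultimately show "s < s1" "s1 < 1" "s1 < s + \<epsilon>1" using s01 by auto
  qed
  \<comment> \<open>Everything that the slide has to leave fixed: the image of \<open>Z\<close> and
    the arc from \<open>s1\<close> onwards.\<close>
  define Y where "Y = \<Theta> ` Z \<union> Q ` {s1..1}"
  have "Q ` {s1..1} = \<Theta> ` p ` {s1..1}" by (auto simp: Q_def)
  moreover have "compact (\<Theta> ` p ` {s1..1})"
  proof (intro compact_continuous_image)
    show "continuous_on {s1..1} p" using pl_on_imp_continuous_on[OF p(1)] s1 s01 by (rule_tac continuous_on_subset) auto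
    show "continuous_on (p ` {s1..1}) \<Theta>" using pl_on_imp_continuous_on \<Theta> p(3) s1 s01 unfolding pl_homeo_def
      by (rule_tac continuous_on_subset[of S3]) (auto simp: image_subset_iff)
  qed auto
  moreover have "compact (\<Theta> ` Z)"
  proof (intro compact_continuous_image)
    show "continuous_on Z \<Theta>" using pl_on_imp_continuous_on \<Theta> Z(2) unfolding pl_homeo_def
      by (auto intro: continuous_on_subset)
    show "compact Z" using closed_Int_compact[OF Z(1) compact_S3] Z(2) by (simp add: Int_absorb2)
  qed
  ultimately have "closed Y" unfolding Y_def by (simp add: compact_imp_closed closed_Un)
  moreover have "north \<notin> Y"
  proof
    have nQ: "north = \<Theta> (p s)" using Q\<omega>[of s] s01 \<epsilon>1 \<omega>s by (simp add: Q_def)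
    assume "north \<in> Y"
    then consider z where "z \<in> Z" "\<Theta> (p s) = \<Theta> z" | t where "t \<in> {s1..1}" "\<Theta> (p s) = \<Theta> (p t)"
      unfolding Y_def nQ Q_def by blast
    then show False
    proof cases
      case 1
      then have "p s = z" using pl_homeo_inj_on[OF \<Theta> order_refl] p(3) s01(1) Z(2) by (meson imageI inj_onD subsetD)
      then show False using Z(3) 1(1) s by blast
    next
      case 2
      then have t: "t \<in> {0..1}" using s1 s01 by auto
      then have "p s = p t" using pl_homeo_inj_on[OF \<Theta> order_refl] 2 p(3) s01(1) by (meson imageI inj_onD subsetD)
      then have "s = t" using p(2) t s01(1) by (meson inj_onD)
      then show False using 2 s1 by auto
    qed
  qed
  ultimately obtain \<rho> where \<rho>: "0 < \<rho>" "\<rho> \<le> 1" "\<And>x. x \<in> Y \<Longrightarrow> infnorm (x - north) \<ge> \<rho>"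
    using infnorm_away_from_north by blast
  define A where "A = \<omega> s1"
  have A0: "A \<ge> 0" using s1 by (simp add: A_def \<omega>_def)
  have Qs1: "Q s1 = north + A *\<^sub>R e" using Q\<omega>[of s1] s1 s01 by (simp add: A_def)
  have "Q s1 \<in> Y" unfolding Y_def using s1 by auto
  then have A: "A * infnorm e \<ge> \<rho>" using \<rho>(3)[of "Q s1"] Qs1 A0 by (simp add: infnorm_mul)
  define \<epsilon>2 where "\<epsilon>2 = min (s1 - s) (\<rho> / (M * (1 + infnorm e)))"
  have Me: "M * (1 + infnorm e) > 0" using M infnorm_pos_le[of e] by (simp add: add_pos_nonneg)
  have "\<epsilon>2 > 0" using s1 \<rho> Me by (simp add: \<epsilon>2_def)
  moreover have "\<exists>h. pl_homeo h \<and> (\<forall>z\<in>Z. h z = z) \<and> h ` p ` {s..1} = p ` {t..1} \<and> h (p s) = p t"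
    if t: "t \<in> {0..<1}" "\<bar>t - s\<bar> < \<epsilon>2" for t
  proof -
    have t1: "t < s1" "\<bar>t - s\<bar> < \<epsilon>1" "t \<in> {0..1}" using t s1 by (auto simp: \<epsilon>2_def)
    \<comment> \<open>Chosen so that \<open>north\<close> moves by
      \<open>\<kappa> * \<rho> = \<omega> t\<close>, the position of the new end.\<close>
    define \<kappa> where "\<kappa> = \<omega> t / \<rho>"
    have "\<bar>\<omega> t\<bar> \<le> M * \<bar>t - s\<bar>"
      using M mult_right_mono[OF M(2), of "t - s"] mult_right_mono[OF M(3), of "s - t"]
      by (auto simp: \<omega>_def max_def abs_mult)
    then have "\<bar>\<omega> t\<bar> * infnorm e \<le> M * \<bar>t - s\<bar> * infnorm e" by (intro mult_right_mono infnorm_pos_le)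
    also have "\<dots> \<le> \<bar>t - s\<bar> * (M * (1 + infnorm e))" using M by (simp add: algebra_simps)
    also have "\<dots> < \<rho>" using t(2) Me by (simp add: \<epsilon>2_def pos_less_divide_eq)
    finally have \<kappa>: "\<bar>\<kappa>\<bar> * infnorm e < 1" using \<rho>(1) by (simp add: \<kappa>_def)
    obtain h where h: "pl_homeo h" "\<And>x. infnorm (x - north) \<ge> \<rho> \<Longrightarrow> h x = x"
      "h north = north + (\<kappa> * \<rho>) *\<^sub>R e"
      "h ` (\<lambda>a. north + a *\<^sub>R e) ` {0..A} = (\<lambda>a. north + a *\<^sub>R e) ` {\<kappa> * \<rho>..A}"
      by (rule slide_homeo[OF e(1,2) \<rho>(1,2) \<kappa> A]) (rule that; assumption)
    have \<kappa>\<rho>: "\<kappa> * \<rho> = \<omega> t" using \<rho>(1) by (simp add: \<kappa>_def)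
    have seg: "Q ` {a..s1} = (\<lambda>a. north + a *\<^sub>R e) ` {\<omega> a..A}" if a: "a \<in> {0..1}" "\<bar>a - s\<bar> < \<epsilon>1" "a \<le> s1" for a
    proof -
      have "Q ` {a..s1} = (\<lambda>a. north + a *\<^sub>R e) ` \<omega> ` {a..s1}"
        unfolding image_image using a s1 by (intro image_cong refl Q\<omega>) auto
      also have "\<omega> ` {a..s1} = {\<omega> a..A}" unfolding A_def
        by (intro image_interval_mono a(3) \<omega>_cont \<omega>_mono)
      finally show ?thesis .
    qed
    have split: "Q ` {a..1} = Q ` {a..s1} \<union> Q ` {s1..1}" if "a \<le> s1" for a
    proof -
      have "{a..1} = {a..s1} \<union> {s1..1}" using that s1 by auto
      then show ?thesis by (simp only: image_Un)
    qed
    have "h ` Q ` {s..1} = h ` Q ` {s..s1} \<union> h ` Q ` {s1..1}"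
      using split[of s] s1 by (simp add: image_Un)
    also have "h ` Q ` {s1..1} = Q ` {s1..1}"
    proof -
      have "h x = x" if "x \<in> Q ` {s1..1}" for x using h(2) \<rho>(3)[of x] that unfolding Y_def by blast
      then show ?thesis by simp
    qed
    also have "h ` Q ` {s..s1} = Q ` {t..s1}"
      using seg[of s] seg[of t] s01 s1 \<epsilon>1(1) t1 h(4) \<omega>s \<kappa>\<rho> by simp
    also have "Q ` {t..s1} \<union> Q ` {s1..1} = Q ` {t..1}"
      using split[of t] t1 by simp
    finally have hQ: "h ` Q ` {s..1} = Q ` {t..1}" .
    obtain k where k: "pl_homeo k" "\<And>x. x \<in> S3 \<Longrightarrow> k (\<Theta> x) = x"
      by (rule pl_homeo_inv[OF \<Theta>]) (rule that; assumption)
    have kQ1: "k (Q x) = p x" if "x \<in> {0..1}" for x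
    proof -
      have "p x \<in> S3" using p(3) that by blast
      then show ?thesis unfolding Q_def by (rule k(2))
    qed
    have kQ: "k ` Q ` X = p ` X" if "X \<subseteq> {0..1}" for X
      unfolding image_image by (rule image_cong[OF refl]) (use kQ1 that in blast)
    show ?thesis
    proof (intro exI[of _ "\<lambda>x. k (h (\<Theta> x))"] conjI ballI)
      show "pl_homeo (\<lambda>x. k (h (\<Theta> x)))"
        by (rule pl_homeo_compose[OF pl_homeo_compose[OF \<Theta> h(1)] k(1)])
      show "k (h (\<Theta> z)) = z" if "z \<in> Z" for z
      proof -
        have "\<Theta> z \<in> Y" using that unfolding Y_def by blast
        then have "h (\<Theta> z) = \<Theta> z" using h(2) \<rho>(3) by blast
        then show ?thesis using k(2) that Z(2) by auto
      qed
      have "(\<lambda>x. k (h (\<Theta> x))) ` p ` {s..1} = k ` h ` Q ` {s..1}" unfolding image_image Q_def ..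
      also have "\<dots> = p ` {t..1}"
      proof -
        have "{t..1} \<subseteq> {0..1}" using t1(3) by auto
        then show ?thesis unfolding hQ by (rule kQ)
      qed
      finally show "(\<lambda>x. k (h (\<Theta> x))) ` p ` {s..1} = p ` {t..1}" .
      have "\<Theta> (p s) = north" using Q\<omega>[of s] s01 \<epsilon>1 \<omega>s by (simp add: Q_def)
      then have "k (h (\<Theta> (p s))) = k (Q t)" using h(3) \<kappa>\<rho> Q\<omega>[OF t1(3,2)] by simp
      then show "k (h (\<Theta> (p s))) = p t" using kQ1[OF t1(3)] by simp
    qed
  qed
  ultimately show thesis using that by blast
qed

text \<open>Being movable to each other is an equivalence relation with open classes on the connected set \<open>[0, 1)\<close>.\<close>

lemma drag_homeo:
  fixes p :: "real \<Rightarrow> real^4"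
  assumes p: "pl_on {0..1} p" "inj_on p {0..1}" "p ` {0..1} \<subseteq> S3"
    and Z: "closed Z" "Z \<subseteq> S3" "p ` {0..<1} \<inter> Z = {}" and s: "s \<in> {0..<1}"
  obtains h where "pl_homeo h" "\<And>z. z \<in> Z \<Longrightarrow> h z = z" "h ` p ` {0..1} = p ` {s..1}" "h (p 0) = p s"
proof -
  define R where "R s t \<longleftrightarrow> (\<exists>h. pl_homeo h \<and> (\<forall>z\<in>Z. h z = z) \<and> h ` p ` {s..1} = p ` {t..1} \<and> h (p s) = p t)" for s t
  have "R 0 s"
  proof (rule connected_equivalence_relation[of "{0..<1::real}"])
    show "R t s" if st: "R s t" "s \<in> {0..<1}" "t \<in> {0..<1}" for s t
    proof -
      from st(1) obtain h where h: "pl_homeo h" "\<forall>z\<in>Z. h z = z" "h ` p ` {s..1} = p ` {t..1}" "h (p s) = p t"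
        unfolding R_def by (elim exE conjE)
      obtain k where k: "pl_homeo k" "\<And>x. x \<in> S3 \<Longrightarrow> k (h x) = x"
        by (rule pl_homeo_inv[OF h(1)]) (rule that; assumption)
      have pS: "p ` {s..1} \<subseteq> S3" "p s \<in> S3" using p(3) st by (auto simp: image_subset_iff)
      have "k ` h ` p ` {s..1} = p ` {s..1}"
        unfolding image_image using pS(1) k(2) by (intro image_cong refl) (meson imageI subsetD)
      then have "k ` p ` {t..1} = p ` {s..1}" unfolding h(3) .
      moreover have "k z = z" if "z \<in> Z" for z using k(2)[of z] h(2) Z(2) that by auto
      moreover have "k (p t) = p s" using k(2)[OF pS(2)] h(4) by simp
      ultimately have "pl_homeo k \<and> (\<forall>z\<in>Z. k z = z) \<and> k ` p ` {t..1} = p ` {s..1} \<and> k (p t) = p s"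
        using k(1) by (intro conjI ballI)
      then show ?thesis unfolding R_def by (rule exI[where x = k])
    qed
    show "R a c" if ab: "R a b" "R b c" for a b c
    proof -
      from ab(1) obtain h where h: "pl_homeo h" "\<forall>z\<in>Z. h z = z" "h ` p ` {a..1} = p ` {b..1}" "h (p a) = p b"
        unfolding R_def by (elim exE conjE)
      from ab(2) obtain k where k: "pl_homeo k" "\<forall>z\<in>Z. k z = z" "k ` p ` {b..1} = p ` {c..1}" "k (p b) = p c"
        unfolding R_def by (elim exE conjE)
      have "(\<lambda>x. k (h x)) ` p ` {a..1} = p ` {c..1}" using h(3) k(3) by (metis image_image)
      moreover have "\<forall>z\<in>Z. k (h z) = z" "k (h (p a)) = p c" using h(2,4) k(2,4) by simp_all
      ultimately have "pl_homeo (\<lambda>x. k (h x)) \<and> (\<forall>z\<in>Z. k (h z) = z) \<and>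
          (\<lambda>x. k (h x)) ` p ` {a..1} = p ` {c..1} \<and> k (h (p a)) = p c"
        using pl_homeo_compose[OF h(1) k(1)] by (intro conjI)
      then show ?thesis unfolding R_def by (rule exI[where x = "\<lambda>x. k (h x)"])
    qed
    show "\<exists>T. openin (top_of_set {0..<1}) T \<and> a \<in> T \<and> (\<forall>x\<in>T. R a x)" if a: "a \<in> {0..<1}" for a
    proof -
      obtain \<epsilon> where "\<epsilon> > 0" "\<And>t. t \<in> {0..<1} \<Longrightarrow> \<bar>t - a\<bar> < \<epsilon> \<Longrightarrow> R a t"
      proof (rule drag_homeo_local[OF p Z a])
        fix \<epsilon> :: real
        assume \<epsilon>: "\<epsilon> > 0" and loc: "\<And>t. t \<in> {0..<1} \<Longrightarrow> \<bar>t - a\<bar> < \<epsilon> \<Longrightarrow>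
          \<exists>h. pl_homeo h \<and> (\<forall>z\<in>Z. h z = z) \<and> h ` p ` {a..1} = p ` {t..1} \<and> h (p a) = p t"
        have "R a t" if "t \<in> {0..<1}" "\<bar>t - a\<bar> < \<epsilon>" for t
          unfolding R_def by (rule loc[OF that])
        then show thesis using that[OF \<epsilon>] by simp
      qed
      then have "\<forall>x\<in>{0..<1} \<inter> ball a \<epsilon>. R a x" by (simp add: dist_real_def abs_minus_commute)
      moreover have "openin (top_of_set {0..<1}) ({0..<1} \<inter> ball a \<epsilon>)"
        by (intro openin_open_Int open_ball)
      ultimately show ?thesis using a \<open>\<epsilon> > 0\<close> by (intro exI[of _ "{0..<1} \<inter> ball a \<epsilon>"]) auto
    qed
  qed (use s in auto)
  then obtain h where "pl_homeo h" "\<forall>z\<in>Z. h z = z" "h ` p ` {0..1} = p ` {s..1}" "h (p 0) = p s"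
    unfolding R_def by (elim exE conjE)
  then show thesis by (intro that[of h]) simp_all
qed


section \<open>A planar tripod at the north pole\<close>

text \<open>\<open>n1\<close> and \<open>n2\<close> are dual to \<open>d1\<close> and
  \<open>d2\<close> and serve as coordinates in their plane. The bound 1/20 keeps the shears in the
  flat region: coordinates up to 5 contribute 5/20 each, and 1/4 is left for the direction off the
  plane. The bound on \<open>d1 + d2\<close> is the one for the third leg.\<close>

locale tripod_frame =
  fixes d1 d2 n1 n2 :: "real^4"
  assumes dual: "n1 \<bullet> d1 = 1" "n1 \<bullet> d2 = 0" "n2 \<bullet> d1 = 0" "n2 \<bullet> d2 = 1"
    and level: "d1 $ 4 = 0" "d2 $ 4 = 0"
    and small: "infnorm d1 \<le> 1/20" "infnorm d2 \<le> 1/20" "infnorm (d1 + d2) \<le> 1/20"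
begin

definition d3 :: "real^4" where "d3 = - d1 - d2"

definition s1 :: "real^4 \<Rightarrow> real" where "s1 x = n1 \<bullet> (x - north)"
definition s2 :: "real^4 \<Rightarrow> real" where "s2 x = n2 \<bullet> (x - north)"

text \<open>In the plane of the tripod, \<open>xa\<close> and \<open>xb\<close> are the coordinates along \<open>(d1 - d2) / 2\<close> and \<open>d3\<close>;
  in these coordinates the legs \<open>d1\<close> and \<open>d2\<close> form the graph of \<open>- \<bar>xa\<bar> / 2\<close> over \<open>[-1, 1]\<close>.\<close>

definition xa :: "real^4 \<Rightarrow> real" where "xa x = s1 x - s2 x"
definition xb :: "real^4 \<Rightarrow> real" where "xb x = - (1/2) * (s1 x + s2 x)"
text \<open>Vanishes exactly on the plane of the tripod: it is the size of the remainder after the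
  components along \<open>d1\<close> and \<open>d2\<close> are split off.\<close>

definition off :: "real^4 \<Rightarrow> real" where "off x = infnorm (x - north - s1 x *\<^sub>R d1 - s2 x *\<^sub>R d2)"
definition rho :: "real^4 \<Rightarrow> real" where "rho x = 1 - \<bar>xa x\<bar>"
text \<open>The height over \<open>xa\<close> of a bent line that joins the ends of the first two
  legs and has its apex at height \<open>c\<close>. The values -1/2, 0 and 1 of \<open>c\<close>
  give a side of the triangle, the two legs, and the other two sides.\<close>

definition base :: "real \<Rightarrow> real^4 \<Rightarrow> real" where "base c x = c * rho x - (1/2) * \<bar>xa x\<bar>"

definition pt :: "real \<Rightarrow> real \<Rightarrow> real^4" where
  "pt a b = north + ((1/2) * a - b) *\<^sub>R d1 + (- (1/2) * a - b) *\<^sub>R d2"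

lemma s_shift: "s1 (x + s *\<^sub>R d3) = s1 x - s" "s2 (x + s *\<^sub>R d3) = s2 x - s"
  by (simp_all add: s1_def s2_def d3_def inner_simps dual)

lemma shift [simp]:
  "xa (x + s *\<^sub>R d3) = xa x" "xb (x + s *\<^sub>R d3) = xb x + s" "rho (x + s *\<^sub>R d3) = rho x"
  "off (x + s *\<^sub>R d3) = off x" "base c (x + s *\<^sub>R d3) = base c x"
proof -
  show a: "xa (x + s *\<^sub>R d3) = xa x" "xb (x + s *\<^sub>R d3) = xb x + s"
    by (simp_all add: xa_def xb_def s_shift algebra_simps)
  show b: "rho (x + s *\<^sub>R d3) = rho x" by (simp add: rho_def a)
  show "off (x + s *\<^sub>R d3) = off x"
    unfolding off_def s_shift by (rule arg_cong[where f=infnorm]) (simp add: d3_def algebra_simps)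
  show "base c (x + s *\<^sub>R d3) = base c x" by (simp add: base_def a b)
qed

lemma s_pt: "s1 (pt a b) = (1/2) * a - b" "s2 (pt a b) = - (1/2) * a - b"
  by (simp_all add: s1_def s2_def pt_def inner_simps dual)

lemma pt_coords [simp]: "xa (pt a b) = a" "xb (pt a b) = b" "off (pt a b) = 0" "rho (pt a b) = 1 - \<bar>a\<bar>"
  "base c (pt a b) = c * (1 - \<bar>a\<bar>) - (1/2) * \<bar>a\<bar>"
  by (simp_all add: xa_def xb_def off_def rho_def base_def s_pt) (simp add: pt_def infnorm_0)

lemma off_0: "off x = 0 \<Longrightarrow> x = pt (xa x) (xb x)"
proof -
  assume "off x = 0"
  then have "x - north - s1 x *\<^sub>R d1 - s2 x *\<^sub>R d2 = 0" by (simp add: off_def infnorm_eq_0)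
  moreover have "(1/2) * xa x - xb x = s1 x" "- (1/2) * xa x - xb x = s2 x"
    by (simp_all add: xa_def xb_def algebra_simps)
  ultimately show ?thesis unfolding pt_def by (simp add: algebra_simps)
qed

lemma off_ge_0: "off x \<ge> 0" by (simp add: off_def infnorm_pos_le)

lemma pt_shift: "pt a b + m *\<^sub>R d3 = pt a (b + m)"
  by (simp add: pt_def d3_def algebra_simps)

lemma pt_ends: "pt 1 (-1/2) = north + d1" "pt (-1) (-1/2) = north + d2" "pt 0 c = north + c *\<^sub>R d3"
  by (simp_all add: pt_def d3_def algebra_simps)

lemma d3_level: "d3 $ 4 = 0" by (simp add: d3_def level)

lemma pl_coords:
  assumes "polyhedral X"
  shows "pl_on X s1" "pl_on X s2" "pl_on X xa" "pl_on X xb" "pl_on X off" "pl_on X rho" "pl_on X (base c)"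
proof -
  show s: "pl_on X s1" "pl_on X s2" unfolding s1_def s2_def
    by (intro pl_on_inner pl_on_diff pl_on_id pl_on_const assms)+
  show a: "pl_on X xa" "pl_on X xb" unfolding xa_def xb_def
    by (intro pl_on_mult pl_on_add pl_on_diff s)+
  show r: "pl_on X rho" unfolding rho_def by (intro pl_on_abs pl_on_diff pl_on_const assms a)
  show "pl_on X off" unfolding off_def
    by (intro pl_on_infnorm pl_on_diff pl_on_vector s pl_on_id pl_on_const assms)
  show "pl_on X (base c)" unfolding base_def by (intro pl_on_mult pl_on_abs pl_on_diff a r)
qed

lemma near_north_coords:
  assumes "\<bar>s1 x\<bar> \<le> 5" "\<bar>s2 x\<bar> \<le> 5" "off x \<le> 1/4"
  shows "infnorm (x - north) < 1"
proof -
  have "x - north = (x - north - s1 x *\<^sub>R d1 - s2 x *\<^sub>R d2) + (s1 x *\<^sub>R d1 + s2 x *\<^sub>R d2)" by simp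
  then have "infnorm (x - north) \<le> off x + infnorm (s1 x *\<^sub>R d1 + s2 x *\<^sub>R d2)"
    unfolding off_def using infnorm_triangle by metis
  also have "infnorm (s1 x *\<^sub>R d1 + s2 x *\<^sub>R d2) \<le> \<bar>s1 x\<bar> * infnorm d1 + \<bar>s2 x\<bar> * infnorm d2"
    using infnorm_triangle[of "s1 x *\<^sub>R d1" "s2 x *\<^sub>R d2"] by (simp add: infnorm_mul)
  also have "\<bar>s1 x\<bar> * infnorm d1 \<le> 5 * (1/20)" using assms(1) small infnorm_pos_le by (intro mult_mono) auto
  also have "\<bar>s2 x\<bar> * infnorm d2 \<le> 5 * (1/20)" using assms(2) small infnorm_pos_le by (intro mult_mono) auto
  finally show ?thesis using assms(3) by simp
qed

lemma pt_S3: assumes "\<bar>a\<bar> \<le> 1" "\<bar>b\<bar> \<le> 4" shows "pt a b \<in> S3"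
proof -
  have "infnorm (pt a b - north) < 1"
    by (rule near_north_coords) (use assms in \<open>auto simp: s_pt\<close>)
  moreover have "pt a b $ 4 = 1" by (simp add: pt_def level)
  ultimately show ?thesis using near_north_S3 by auto
qed

text \<open>Shearing by \<open>bump\<close> along \<open>d3\<close> moves the graph of \<open>base c0\<close> to the graph of \<open>base (c0 + c1)\<close>.\<close>

definition bump :: "real \<Rightarrow> real \<Rightarrow> real \<Rightarrow> real \<Rightarrow> real \<Rightarrow> real^4 \<Rightarrow> real" where
  "bump c0 c1 \<delta> K M x = max 0 (c1 * rho x - (1 - \<delta>) * max 0 (xb x - base c0 x)
      - K * max 0 (base c0 x - xb x) - M * off x)"

text \<open>\<open>\<delta> > 0\<close> keeps the decay above the graph slower than rate 1, which
  prevents overtaking; \<open>\<delta> \<le> 1/2\<close>, \<open>K \<ge> 1\<close> and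
  \<open>M \<ge> 4\<close> bound the support. Larger \<open>K\<close> and \<open>M\<close> make the
  bump thinner below the graph and off the plane.\<close>

definition bump_params :: "real \<Rightarrow> real \<Rightarrow> real \<Rightarrow> real \<Rightarrow> real \<Rightarrow> bool" where
  "bump_params c0 c1 \<delta> K M \<longleftrightarrow> \<bar>c0\<bar> \<le> 1 \<and> 0 < c1 \<and> c1 \<le> 1 \<and> 0 < \<delta> \<and> \<delta> \<le> 1/2 \<and> K \<ge> 1 \<and> M \<ge> 4"

text \<open>A positive bump forces \<open>0 < rho x \<le> 1\<close>, a height of less than 2 above
  and less than 1 below the graph, and \<open>off x < 1/4\<close>. So both plane coordinates stay
  below 5, as the bound in the frame permits.\<close>

lemma bump_support:
  assumes "bump_params c0 c1 \<delta> K M" "bump c0 c1 \<delta> K M x \<noteq> 0"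
  shows "infnorm (x - north) < 1"
proof -
  define u where "u = max 0 (xb x - base c0 x)"
  define v where "v = max 0 (base c0 x - xb x)"
  have p: "\<bar>c0\<bar> \<le> 1" "0 < c1" "c1 \<le> 1" "0 < \<delta>" "\<delta> \<le> 1/2" "K \<ge> 1" "M \<ge> 4"
    using assms(1) unfolding bump_params_def by auto
  have uv: "u \<ge> 0" "v \<ge> 0" by (auto simp: u_def v_def)
  have pos: "c1 * rho x > (1 - \<delta>) * u + K * v + M * off x"
    using assms(2) unfolding bump_def u_def v_def by (auto simp: max_def split: if_splits)
  have *: "(1/2) * u \<le> (1 - \<delta>) * u" "1 * v \<le> K * v" "4 * off x \<le> M * off x"
    using p uv off_ge_0 by (intro mult_right_mono; simp)+
  then have "c1 * rho x > 0" using pos uv off_ge_0[of x] by linarith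
  then have r: "rho x > 0" "rho x \<le> 1" using p by (auto simp: zero_less_mult_iff rho_def)
  have "c1 * rho x \<le> 1 * 1" using p r by (intro mult_mono) auto
  then have b: "u < 2" "v < 1" "off x < 1/4" using * pos uv off_ge_0[of x] by linarith+
  have "\<bar>c0 * rho x\<bar> \<le> 1 * 1" unfolding abs_mult using p r by (intro mult_mono) auto
  moreover have xa1: "\<bar>xa x\<bar> \<le> 1" using r by (simp add: rho_def)
  ultimately have bs: "\<bar>base c0 x\<bar> \<le> 3/2" "\<bar>xa x\<bar> \<le> 1" unfolding base_def by linarith+
  have "\<bar>xb x\<bar> \<le> 7/2" using b bs unfolding u_def v_def by linarith
  moreover have "s1 x = (1/2) * xa x - xb x" "s2 x = - (1/2) * xa x - xb x"
    by (simp_all add: xa_def xb_def algebra_simps)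
  ultimately have "\<bar>s1 x\<bar> \<le> 5" "\<bar>s2 x\<bar> \<le> 5" using bs(2) by linarith+
  then show ?thesis using b(3) by (intro near_north_coords) auto
qed

text \<open>Moving along \<open>d3\<close> changes only \<open>xb\<close>. The penalty below the
  graph does not grow, and the one above grows at rate at most \<open>1 - \<delta>\<close>, which is
  less than 1.\<close>

lemma bump_slope:
  assumes "bump_params c0 c1 \<delta> K M" "s > 0"
  shows "bump c0 c1 \<delta> K M x < bump c0 c1 \<delta> K M (x + s *\<^sub>R d3) + s"
proof -
  define u where "u t = max 0 (xb x + t - base c0 x)" for t
  define v where "v t = max 0 (base c0 x - (xb x + t))" for t
  have p: "0 < \<delta>" "\<delta> \<le> 1/2" "K \<ge> 1" using assms(1) unfolding bump_params_def by auto
  have "u s \<le> u 0 + s" "v s \<le> v 0" using assms(2) by (auto simp: u_def v_def)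
  then have "(1 - \<delta>) * u s \<le> (1 - \<delta>) * (u 0 + s)" "K * v s \<le> K * v 0"
    using p by (auto intro!: mult_left_mono)
  moreover have "(1 - \<delta>) * (u 0 + s) = (1 - \<delta>) * u 0 + s - \<delta> * s" "\<delta> * s > 0"
    using p assms(2) by (simp_all add: algebra_simps)
  ultimately have "c1 * rho x - (1 - \<delta>) * u 0 - K * v 0 - M * off x
      < c1 * rho x - (1 - \<delta>) * u s - K * v s - M * off x + s" by linarith
  then show ?thesis using assms(2) unfolding bump_def shift u_def v_def by (auto simp: max_def)
qed

lemma pl_bump: "polyhedral X \<Longrightarrow> pl_on X (bump c0 c1 \<delta> K M)"
  unfolding bump_def by (intro pl_on_max pl_on_diff pl_on_mult pl_on_const pl_coords)

lemma bump_homeo: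
  assumes "bump_params c0 c1 \<delta> K M"
  shows "pl_homeo (\<lambda>x. x + bump c0 c1 \<delta> K M x *\<^sub>R d3)"
proof (rule shear_homeo[OF pl_bump[OF polyhedral_S3] _ d3_level])
  show "bump c0 c1 \<delta> K M x = 0" if "1 \<le> infnorm (x - north)" for x
    using bump_support[OF assms, of x] that by fastforce
qed (rule bump_slope[OF assms])

lemma bump_isotopy:
  assumes "bump_params c0 c1 \<delta> K M" "L \<subseteq> S3"
  shows "ambient_isotopic L ((\<lambda>x. x + bump c0 c1 \<delta> K M x *\<^sub>R d3) ` L)"
proof (rule shear_isotopy[OF pl_bump[OF polyhedral_S3] _ d3_level])
  show "bump c0 c1 \<delta> K M x = 0" if "1 \<le> infnorm (x - north)" for x
    using bump_support[OF assms(1), of x] that by fastforce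
  show "bump c0 c1 \<delta> K M x \<ge> 0" for x by (simp add: bump_def)
qed (use bump_slope[OF assms(1)] assms(2) in auto)

text \<open>\<open>?E\<close> is zero exactly on the region swept between the two graphs, hence on
  \<open>R\<close> only where \<open>rho\<close> is nonpositive. The linear comparison gives
  \<open>m * (c1 * rho x) \<le> ?E x\<close> on \<open>R\<close>, and a bump with penalties steep
  enough in terms of \<open>m\<close> vanishes there. This also handles edges that run into the ends
  of the graph, however close to the swept region.\<close>

lemma bump_avoiding:
  assumes R: "polyhedral R" and c: "\<bar>c0\<bar> \<le> 1" "0 < c1" "c1 \<le> 1"
    and avoid: "\<And>x. x \<in> R \<Longrightarrow> off x = 0 \<Longrightarrow> base c0 x \<le> xb x \<Longrightarrow> xb x \<le> base c0 x + c1 * rho x \<Longrightarrow> rho x \<le> 0"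
  obtains \<delta> K M where "bump_params c0 c1 \<delta> K M" "\<And>x. x \<in> R \<Longrightarrow> bump c0 c1 \<delta> K M x = 0"
proof -
  let ?E = "\<lambda>x. max 0 (xb x - base c0 x - c1 * rho x) + max 0 (base c0 x - xb x) + off x"
  have E: "pl_on R ?E" by (intro pl_on_max pl_on_diff pl_on_mult pl_on_add pl_on_const pl_coords R)
  have B: "pl_on R (\<lambda>x. c1 * rho x)" by (intro pl_on_mult pl_coords R)
  have z: "c1 * rho x \<le> 0" if x: "x \<in> R" "?E x = 0" for x
  proof -
    have "max 0 (xb x - base c0 x - c1 * rho x) = 0" "max 0 (base c0 x - xb x) = 0" "off x = 0"
      using x(2) off_ge_0[of x] by linarith+
    then have "off x = 0" "base c0 x \<le> xb x" "xb x \<le> base c0 x + c1 * rho x" by linarith+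
    then have "rho x \<le> 0" using avoid x(1) by blast
    then show ?thesis using c(2) by (simp add: mult_nonneg_nonpos)
  qed
  have nonneg: "0 \<le> ?E x" for x using off_ge_0[of x] by simp
  obtain m where m: "m > 0" "\<And>x. x \<in> R \<Longrightarrow> m * (c1 * rho x) \<le> ?E x"
    by (rule pl_on_comparison[OF E B nonneg]) (rule z that; assumption)+
  \<comment> \<open>\<open>\<delta>\<close> is such that
    \<open>(1 - \<delta>) * (1 + m) \<ge> 1\<close>, as needed above the upper graph.
    \<open>M * m \<ge> 1\<close> is needed between the graphs, and together with
    \<open>K * m \<ge> 1\<close> below the lower one.\<close>
  define \<delta> K M where "\<delta> = min (1/2) (m / (1 + m))" and "K = max 1 (1 / m)" and "M = max 4 (1 / m)"
  have "0 < \<delta>" "\<delta> \<le> 1/2" using m(1) by (simp_all only: \<delta>_def min.cobounded1) simp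
  then have par: "bump_params c0 c1 \<delta> K M" using c by (simp add: bump_params_def K_def M_def)
  have \<delta>: "(1 - \<delta>) * (1 + m) \<ge> 1"
  proof -
    have "(1 - m / (1 + m)) * (1 + m) \<le> (1 - \<delta>) * (1 + m)"
      using m(1) by (intro mult_right_mono) (auto simp: \<delta>_def)
    then show ?thesis using m(1) by (simp add: field_simps)
  qed
  have KM: "K * m \<ge> 1" "M * m \<ge> 1" "M \<ge> 1" "0 \<le> 1 - \<delta>" "1 - \<delta> \<le> 1"
  proof -
    have "1 / m * m \<le> K * m" "1 / m * m \<le> M * m" using m(1) by (intro mult_right_mono; simp add: K_def M_def)+
    then show "K * m \<ge> 1" "M * m \<ge> 1" using m(1) by auto
  qed (use m(1) in \<open>auto simp: M_def \<delta>_def\<close>)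
  have "c1 * rho x - (1 - \<delta>) * max 0 (xb x - base c0 x) - K * max 0 (base c0 x - xb x) - M * off x \<le> 0"
    if x: "x \<in> R" for x
  proof -
    define r where "r = c1 * rho x"
    define t where "t = xb x - base c0 x"
    define z where "z = off x"
    have z: "z \<ge> 0" using off_ge_0 by (simp add: z_def)
    have mr: "m * r \<le> max 0 (t - r) + max 0 (- t) + z" using m(2)[OF x] by (simp add: r_def t_def z_def)
    have "r \<le> (1 - \<delta>) * max 0 t + K * max 0 (- t) + M * z"
    proof (cases "r \<le> 0")
      case True
      have "0 \<le> (1 - \<delta>) * max 0 t" "0 \<le> K * max 0 (- t)" "0 \<le> M * z"
        using KM z by (auto intro!: mult_nonneg_nonneg simp: K_def)
      then show ?thesis using True by linarith
    next
      case r: False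
      consider "t < 0" | "0 \<le> t" "t \<le> r" | "t > r" by linarith
      then show ?thesis
      proof cases
        case 1
        then have "m * r \<le> - t + z" using mr r by auto
        have "r = 1 * r" by simp
        also have "\<dots> \<le> (min K M * m) * r" using KM(1,2) r by (intro mult_right_mono) (auto simp: min_def)
        also have "\<dots> = min K M * (m * r)" by simp
        also have "\<dots> \<le> min K M * (- t + z)" using \<open>m * r \<le> - t + z\<close> by (intro mult_left_mono) (auto simp: K_def M_def)
        also have "\<dots> = min K M * (- t) + min K M * z" by (simp add: algebra_simps)
        also have "\<dots> \<le> K * (- t) + M * z" using 1 z by (intro add_mono mult_right_mono) auto
        finally show ?thesis using 1 by simp
      next
        case 2
        then have "m * r \<le> z" using mr by simp
        then have "M * (m * r) \<le> M * z" using KM(3) by (intro mult_left_mono) auto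
        moreover have "1 * r \<le> (M * m) * r" using KM(2) r by (intro mult_right_mono) auto
        moreover have "0 \<le> (1 - \<delta>) * t" using 2 KM by auto
        ultimately show ?thesis using 2 by (simp add: mult.assoc)
      next
        case 3
        then have "(1 + m) * r \<le> t + z" using mr r by (simp add: algebra_simps)
        then have "(1 - \<delta>) * ((1 + m) * r) \<le> (1 - \<delta>) * (t + z)" using KM by (intro mult_left_mono) auto
        moreover have "1 * r \<le> ((1 - \<delta>) * (1 + m)) * r" using \<delta> r by (intro mult_right_mono) auto
        moreover have "(1 - \<delta>) * z \<le> M * z" using KM z by (intro mult_right_mono) auto
        ultimately show ?thesis using 3 r by (simp add: algebra_simps)
      qed
    qed
    then show ?thesis by (simp add: r_def t_def z_def)
  qed
  then have "bump c0 c1 \<delta> K M x = 0" if "x \<in> R" for x using that unfolding bump_def by (simp add: max_absorb1)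
  then show thesis using that par by blast
qed

section \<open>Isotopies between bent arcs in the plane of the tripod\<close>

definition graph :: "real \<Rightarrow> (real^4) set" where
  "graph c = (\<lambda>a. pt a (c * (1 - \<bar>a\<bar>) - (1/2) * \<bar>a\<bar>)) ` {-1..1}"

lemma graph_S3: assumes "\<bar>c\<bar> \<le> 2" shows "graph c \<subseteq> S3"
proof -
  have "\<bar>c * (1 - \<bar>a\<bar>) - (1/2) * \<bar>a\<bar>\<bar> \<le> 4" if a: "\<bar>a\<bar> \<le> 1" for a
  proof -
    have "\<bar>c\<bar> * \<bar>1 - \<bar>a\<bar>\<bar> \<le> 2 * 1" using a assms by (intro mult_mono) auto
    then have "\<bar>c * (1 - \<bar>a\<bar>)\<bar> \<le> 2" by (simp add: abs_mult)
    then have "- 2 \<le> c * (1 - \<bar>a\<bar>)" "c * (1 - \<bar>a\<bar>) \<le> 2" by linarith+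
    then show ?thesis using a abs_ge_zero[of a] by (intro abs_leI) linarith+
  qed
  then show ?thesis unfolding graph_def by (auto intro!: pt_S3)
qed

text \<open>On \<open>graph c0\<close> the penalties vanish and the bump equals the vertical gap
  \<open>c1 * (1 - \<bar>a\<bar>)\<close>, so the shear carries one graph onto the other; on
  \<open>R\<close> it is the identity.\<close>

lemma graph_isotopic:
  assumes R: "polyhedral R" "R \<subseteq> S3" and c: "\<bar>c0\<bar> \<le> 1" "0 < c1" "c1 \<le> 1"
    and avoid: "\<And>x. x \<in> R \<Longrightarrow> off x = 0 \<Longrightarrow> base c0 x \<le> xb x \<Longrightarrow> xb x \<le> base c0 x + c1 * rho x \<Longrightarrow> rho x \<le> 0"
  shows "ambient_isotopic (graph c0 \<union> R) (graph (c0 + c1) \<union> R)"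
proof -
  obtain \<delta> K M where p: "bump_params c0 c1 \<delta> K M" "\<And>x. x \<in> R \<Longrightarrow> bump c0 c1 \<delta> K M x = 0"
    using bump_avoiding[OF R(1) c avoid] by blast
  let ?h = "\<lambda>x. x + bump c0 c1 \<delta> K M x *\<^sub>R d3"
  have "?h ` R = R" using p(2) by simp
  moreover have "?h ` graph c0 = graph (c0 + c1)"
    unfolding graph_def image_image
  proof (rule image_cong[OF refl])
    fix a :: real assume "a \<in> {-1..1}"
    then have "1 - \<bar>a\<bar> \<ge> 0" by auto
    then have b: "bump c0 c1 \<delta> K M (pt a (c0 * (1 - \<bar>a\<bar>) - (1/2) * \<bar>a\<bar>)) = c1 * (1 - \<bar>a\<bar>)"
      using c by (simp add: bump_def)
    show "?h (pt a (c0 * (1 - \<bar>a\<bar>) - (1/2) * \<bar>a\<bar>)) = pt a ((c0 + c1) * (1 - \<bar>a\<bar>) - (1/2) * \<bar>a\<bar>)"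
      unfolding b pt_shift by (rule arg_cong[where f="pt a"]) (simp add: algebra_simps)
  qed
  ultimately show ?thesis
    using bump_isotopy[OF p(1), of "graph c0 \<union> R"] graph_S3[of c0] R(2) c(1) by (simp add: image_Un)
qed

lemma graph_segments:
  "graph c = closed_segment (north + c *\<^sub>R d3) (north + d1) \<union> closed_segment (north + c *\<^sub>R d3) (north + d2)"
proof -
  let ?g = "\<lambda>a. pt a (c * (1 - \<bar>a\<bar>) - (1/2) * \<bar>a\<bar>)"
  have "{-1..1::real} = {0..1} \<union> uminus ` {0..1}" by auto
  then have "graph c = ?g ` {0..1} \<union> (\<lambda>u. ?g (- u)) ` {0..1}"
    unfolding graph_def by (simp only: image_Un image_image)
  also have "?g ` {0..1} = (\<lambda>u. (1 - u) *\<^sub>R (north + c *\<^sub>R d3) + u *\<^sub>R (north + d1)) ` {0..1}"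
    by (rule image_cong) (auto simp: pt_def d3_def algebra_simps)
  also have "(\<lambda>u. ?g (- u)) ` {0..1} = (\<lambda>u. (1 - u) *\<^sub>R (north + c *\<^sub>R d3) + u *\<^sub>R (north + d2)) ` {0..1}"
    by (rule image_cong) (auto simp: pt_def d3_def algebra_simps)
  finally show ?thesis by (simp add: closed_segment_image_interval)
qed

lemma base_side: "base (-1/2) x = -1/2"
  unfolding base_def rho_def by (simp add: right_diff_distrib)

lemma graph_legs: "graph 0 = closed_segment north (north + d1) \<union> closed_segment north (north + d2)"
  using graph_segments[of 0] by simp

lemma graph_side: "graph (-1/2) = closed_segment (north + d1) (north + d2)"
proof -
  \<comment> \<open>The apex is the midpoint of the side, so the two segments join to a straight
    one.\<close>
  have "north + (-1/2) *\<^sub>R d3 = midpoint (north + d1) (north + d2)"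
    by (simp add: midpoint_def d3_def vec_eq_iff field_simps)
  then show ?thesis
    using graph_segments[of "-1/2"] Un_closed_segment[OF midpoint_in_closed_segment(1)]
    by (metis closed_segment_commute)
qed

lemma graph_other_sides:
  "graph 1 = closed_segment (north + d3) (north + d1) \<union> closed_segment (north + d3) (north + d2)"
  using graph_segments[of 1] by simp

section \<open>Sliding arcs across the triangle\<close>

definition triangle :: "(real^4) set" where
  "triangle = convex hull {north + d1, north + d2, north + d3}"

lemma in_triangle:
  assumes "off x = 0" "-1/2 \<le> xb x" "xb x \<le> 1 - (3/2) * \<bar>xa x\<bar>"
  shows "x \<in> triangle"
proof -
  \<comment> \<open>Barycentric coordinates in terms of \<open>xa\<close> and \<open>xb\<close>; the
    bounds on \<open>xb\<close> say that they are nonnegative.\<close>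
  define t1 t2 t3 where "t1 = 1/3 + (1/2) * xa x - (1/3) * xb x" and "t2 = 1/3 - (1/2) * xa x - (1/3) * xb x"
    and "t3 = 1/3 + (2/3) * xb x"
  have "0 \<le> t1" "0 \<le> t2" "0 \<le> t3" "t1 + t2 + t3 = 1"
    using assms(2,3) unfolding t1_def t2_def t3_def by linarith+
  moreover have "x = t1 *\<^sub>R (north + d1) + t2 *\<^sub>R (north + d2) + t3 *\<^sub>R (north + d3)"
  proof -
    have "t1 *\<^sub>R (north + d1) + t2 *\<^sub>R (north + d2) + t3 *\<^sub>R (north + d3)
        = (t1 + t2 + t3) *\<^sub>R north + (t1 - t3) *\<^sub>R d1 + (t2 - t3) *\<^sub>R d2"
      by (simp add: d3_def algebra_simps)
    also have "t1 - t3 = (1/2) * xa x - xb x" unfolding t1_def t3_def by linarith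
    also have "t2 - t3 = - (1/2) * xa x - xb x" unfolding t2_def t3_def by linarith
    also have "(t1 + t2 + t3) *\<^sub>R north = north" using \<open>t1 + t2 + t3 = 1\<close> by simp
    also have "north + ((1/2) * xa x - xb x) *\<^sub>R d1 + (- (1/2) * xa x - xb x) *\<^sub>R d2 = pt (xa x) (xb x)"
      by (simp add: pt_def)
    finally show ?thesis using off_0[OF assms(1)] by simp
  qed
  ultimately show ?thesis unfolding triangle_def convex_hull_3 by blast
qed

lemma end_coords:
  "xa (north + d1) = 1" "xb (north + d1) = -1/2" "xa (north + d2) = -1" "xb (north + d2) = -1/2"
  "xa (north + d3) = 0" "xb (north + d3) = 1" "xa north = 0" "xb north = 0"
  "off (north + d1) = 0" "off (north + d2) = 0" "off (north + d3) = 0" "off north = 0"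
  using pt_coords[of 1 "-1/2"] pt_coords[of "-1" "-1/2"] pt_coords[of 0 1] pt_coords[of 0 0] pt_ends(3)[of 1] pt_ends(3)[of 0]
  unfolding pt_ends by simp_all

text \<open>The swept region lies between the side and the legs. It contains the corners at
  \<open>d1\<close> and \<open>d2\<close>, where \<open>rho\<close> is 0, but not the third corner,
  so \<open>R\<close> may pass through \<open>north + d3\<close>.\<close>

lemma side_isotopic_legs:
  assumes "polyhedral R" "R \<subseteq> S3" "R \<inter> triangle \<subseteq> {north + d1, north + d2, north + d3}"
  shows "ambient_isotopic (closed_segment (north + d1) (north + d2) \<union> R)
    (closed_segment north (north + d1) \<union> closed_segment north (north + d2) \<union> R)"
proof -
  have "ambient_isotopic (graph (-1/2) \<union> R) (graph (-1/2 + 1/2) \<union> R)"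
  proof (rule graph_isotopic[OF assms(1,2)])
    fix x assume x: "x \<in> R" "off x = 0" "base (-1/2) x \<le> xb x" "xb x \<le> base (-1/2) x + 1/2 * rho x"
    then have b: "-1/2 \<le> xb x" "xb x \<le> - (1/2) * \<bar>xa x\<bar>"
      using rho_def[of x] unfolding base_side by linarith+
    show "rho x \<le> 0"
    proof (rule ccontr)
      assume r: "\<not> rho x \<le> 0"
      then have "x \<in> triangle" using b unfolding rho_def by (intro in_triangle x) linarith+
      then have "x \<in> {north + d1, north + d2, north + d3}" using x(1) assms(3) by blast
      then show False using r b by (auto simp: rho_def end_coords)
    qed
  qed auto
  moreover have "-1/2 + 1/2 = (0::real)" by simp
  ultimately show ?thesis by (simp only: graph_side graph_legs)
qed

text \<open>Here the swept region has its apex at \<open>north + d3\<close>, so \<open>R\<close>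
  must miss that corner. For a cycle union that uses the two sides there, this holds because both of
  its edges at the vertex are taken.\<close>

lemma legs_isotopic_other_sides:
  assumes "polyhedral R" "R \<subseteq> S3" "R \<inter> triangle \<subseteq> {north + d1, north + d2}"
  shows "ambient_isotopic (closed_segment north (north + d1) \<union> closed_segment north (north + d2) \<union> R)
    (closed_segment (north + d3) (north + d1) \<union> closed_segment (north + d3) (north + d2) \<union> R)"
proof -
  have "ambient_isotopic (graph 0 \<union> R) (graph (0 + 1) \<union> R)"
  proof (rule graph_isotopic[OF assms(1,2)])
    fix x assume x: "x \<in> R" "off x = 0" "base 0 x \<le> xb x" "xb x \<le> base 0 x + 1 * rho x"
    then have b: "- (1/2) * \<bar>xa x\<bar> \<le> xb x" "xb x \<le> 1 - (3/2) * \<bar>xa x\<bar>"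
      using rho_def[of x] unfolding base_def by linarith+
    show "rho x \<le> 0"
    proof (rule ccontr)
      assume r: "\<not> rho x \<le> 0"
      then have "x \<in> triangle" using b by (intro in_triangle x) (auto simp: rho_def)
      then have "x \<in> {north + d1, north + d2}" using x(1) assms(3) by blast
      then show False using r by (auto simp: rho_def end_coords)
    qed
  qed auto
  then show ?thesis by (simp add: graph_other_sides graph_legs)
qed

definition sector :: "(real^4) set" where "sector = convex hull {north, north + d1, north + d2}"

lemma sector_coords:
  assumes "x \<in> sector" shows "off x = 0" "-1/2 \<le> xb x" "xb x \<le> - (1/2) * \<bar>xa x\<bar>" "\<bar>xa x\<bar> \<le> 1"
proof -
  obtain t u v where t: "0 \<le> t" "0 \<le> u" "0 \<le> v" "t + u + v = 1"
    "x = t *\<^sub>R north + u *\<^sub>R (north + d1) + v *\<^sub>R (north + d2)"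
    using assms unfolding sector_def convex_hull_3 by blast
  have "x = (t + u + v) *\<^sub>R north + u *\<^sub>R d1 + v *\<^sub>R d2" unfolding t(5) by (simp add: algebra_simps)
  also have "\<dots> = pt (u - v) (- (1/2) * (u + v))" unfolding t(4) pt_def by (simp add: field_simps)
  finally have x: "x = pt (u - v) (- (1/2) * (u + v))" .
  show "off x = 0" "-1/2 \<le> xb x" "xb x \<le> - (1/2) * \<bar>xa x\<bar>" "\<bar>xa x\<bar> \<le> 1"
    using t(1-4) unfolding x by auto
qed

text \<open>Expanding a thin neighbourhood of the two legs over the whole sector between them.\<close>

lemma clear_sector:
  assumes R: "polyhedral R" "R \<subseteq> S3"
    and legs: "R \<inter> (closed_segment north (north + d1) \<union> closed_segment north (north + d2)) \<subseteq> {north + d1, north + d2}"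
  obtains k where "pl_homeo k" "\<And>x. x \<in> S3 \<Longrightarrow> off x = 0 \<Longrightarrow> xb x \<ge> - (1/2) * \<bar>xa x\<bar> \<Longrightarrow> k x = x"
    "k ` R \<inter> sector \<subseteq> {north + d1, north + d2}"
proof -
  let ?E = "\<lambda>x. \<bar>xb x + (1/2) * \<bar>xa x\<bar>\<bar> + off x"
  have z: "rho x \<le> 0" if x: "x \<in> R" "?E x = 0" for x
  proof (rule ccontr)
    assume r: "\<not> rho x \<le> 0"
    have "off x = 0" "xb x = - (1/2) * \<bar>xa x\<bar>" using x(2) off_ge_0[of x] by linarith+
    then have "x = pt (xa x) (- (1/2) * \<bar>xa x\<bar>)" using off_0[of x] by simp
    then have "x \<in> graph 0" unfolding graph_def using r by (intro image_eqI[of _ _ "xa x"]) (auto simp: rho_def)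
    then have "x \<in> {north + d1, north + d2}" using legs x(1) unfolding graph_legs by blast
    then show False using r by (auto simp: rho_def end_coords)
  qed
  obtain m where m: "m > 0" "\<And>x. x \<in> R \<Longrightarrow> m * rho x \<le> ?E x"
  proof (rule pl_on_comparison[of R ?E rho])
    show "pl_on R ?E" by (intro pl_on_add pl_on_abs pl_on_mult pl_coords R)
    show "pl_on R rho" by (intro pl_coords R)
    show "0 \<le> ?E x" for x using off_ge_0[of x] by simp
  qed (use z in auto)
  define \<kappa> where "\<kappa> = min (m / 2) (1/4)"
  have \<kappa>: "0 < \<kappa>" "\<kappa> < m" "\<kappa> \<le> 1/4" using m(1) by (auto simp: \<kappa>_def)
  \<comment> \<open>With these parameters the height \<open>t\<close> over the side is sent to
    \<open>(1/2 - \<kappa>) * rho x + 2 * \<kappa> * t\<close>. So \<open>h\<close> squeezes the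
    sector into a strip of height \<open>\<kappa> * rho x\<close> under the legs, which is thin
    enough for \<open>R\<close> since \<open>\<kappa> < m\<close>; the inverse spreads the strip
    over the sector.\<close>
  have par: "bump_params (-1/2) (1/2 - \<kappa>) (2 * \<kappa>) 1 4" using \<kappa> by (auto simp: bump_params_def)
  let ?\<mu> = "bump (-1/2) (1/2 - \<kappa>) (2 * \<kappa>) 1 4"
  define h where "h x = x + ?\<mu> x *\<^sub>R d3" for x
  have h: "pl_homeo h" unfolding h_def by (rule bump_homeo[OF par])
  have \<mu>: "?\<mu> x = max 0 ((1/2 - \<kappa>) * rho x - (1 - 2 * \<kappa>) * (xb x + 1/2))"
    if "off x = 0" "-1/2 \<le> xb x" for x
    using that unfolding bump_def base_side by (simp add: max_def)
  \<comment> \<open>In the plane, everything on or above the legs stays fixed; this includes the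
    legs and the other two sectors.\<close>
  have fix': "h x = x" if x: "off x = 0" "xb x \<ge> - (1/2) * \<bar>xa x\<bar>" for x
  proof -
    have "?\<mu> x = 0"
    proof (cases "rho x \<le> 0")
      case True
      have "(1/2 - \<kappa>) * rho x \<le> 0" using True \<kappa> by (simp add: mult_nonneg_nonpos)
      moreover have "(1 - 2 * \<kappa>) * max 0 (xb x - base (-1/2) x) \<ge> 0" using \<kappa> by auto
      ultimately show ?thesis unfolding bump_def using x(1) by simp
    next
      case False
      have b: "xb x + 1/2 \<ge> (1/2) * rho x" using x(2) by (simp add: rho_def)
      then have "(1 - 2 * \<kappa>) * ((1/2) * rho x) \<le> (1 - 2 * \<kappa>) * (xb x + 1/2)" using \<kappa> by (intro mult_left_mono) auto
      moreover have "(1 - 2 * \<kappa>) * ((1/2) * rho x) = (1/2 - \<kappa>) * rho x" by (simp add: field_simps)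
      ultimately have "(1/2 - \<kappa>) * rho x - (1 - 2 * \<kappa>) * (xb x + 1/2) \<le> 0" by linarith
      moreover have "-1/2 \<le> xb x" using b False by linarith
      ultimately show ?thesis using \<mu>[OF x(1)] by (metis max_absorb1)
    qed
    then show ?thesis by (simp add: h_def)
  qed
  obtain k where k: "pl_homeo k" "\<And>x. x \<in> S3 \<Longrightarrow> k (h x) = x" "\<And>x. x \<in> S3 \<Longrightarrow> h (k x) = x"
    using pl_homeo_inv[OF h] by blast
  have "k ` R \<inter> sector \<subseteq> {north + d1, north + d2}"
  proof
    fix x assume x: "x \<in> k ` R \<inter> sector"
    then obtain r where r: "r \<in> R" "x = k r" by blast
    then have hx: "h x = r" using k(3) R(2) by blast
    note c = sector_coords[of x]
    have xs: "x \<in> sector" using x by blast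
    define \<mu>x where "\<mu>x = ?\<mu> x"
    have r_eq: "r = x + \<mu>x *\<^sub>R d3" using hx by (simp add: h_def \<mu>x_def)
    have rc: "xa r = xa x" "xb r = xb x + \<mu>x" "off r = 0" "rho r = rho x" unfolding r_eq using c(1)[OF xs] by simp_all
    have \<rho>: "rho x \<ge> 0" using c(4)[OF xs] by (simp add: rho_def)
    define t where "t = xb x + 1/2"
    have t: "t \<ge> 0" "t \<le> (1/2) * rho x" using c(2,3)[OF xs] by (auto simp: t_def rho_def)
    have \<mu>x: "\<mu>x = max 0 ((1/2 - \<kappa>) * rho x - (1 - 2 * \<kappa>) * t)"
      unfolding \<mu>x_def t_def by (rule \<mu>) (use c xs in auto)
    have "2 * \<kappa> * t \<ge> 0" "2 * \<kappa> * t \<le> 2 * \<kappa> * ((1/2) * rho x)" using t \<kappa> by (auto intro!: mult_left_mono)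
    moreover have "(1/2 - \<kappa>) * rho x = (1/2) * rho x - \<kappa> * rho x" "(1 - 2 * \<kappa>) * t = t - 2 * \<kappa> * t"
      "2 * \<kappa> * ((1/2) * rho x) = \<kappa> * rho x" by (simp_all add: algebra_simps)
    ultimately have "t + \<mu>x \<ge> (1/2) * rho x - \<kappa> * rho x" "t + \<mu>x \<le> (1/2) * rho x"
      using t \<mu>x by linarith+
    then have E: "?E r \<le> \<kappa> * rho x" unfolding rc t_def rho_def by (simp add: abs_le_iff algebra_simps)
    \<comment> \<open>As a point of \<open>R\<close>, \<open>r\<close> deviates from the legs by at
      least \<open>m * rho r\<close>; with \<open>\<kappa> < m\<close> only \<open>rho x = 0\<close>
      remains, which means an end of a leg.\<close>
    have "m * rho x \<le> \<kappa> * rho x" using m(2)[OF r(1)] E rc(4) by simp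
    then have "rho x \<le> 0" using \<kappa>(2) \<rho> by (metis mult_less_cancel_right not_le order_le_less)
    then have "rho x = 0" using \<rho> by simp
    then have "xa x = 1 \<or> xa x = -1" "xb x = -1/2" using t by (auto simp: rho_def t_def abs_if split: if_splits)
    then show "x \<in> {north + d1, north + d2}" using off_0[OF c(1)[OF xs]] pt_ends(1,2) by auto
  qed
  moreover have "k x = x" if "x \<in> S3" "off x = 0" "xb x \<ge> - (1/2) * \<bar>xa x\<bar>" for x
    using fix'[OF that(2,3)] k(2)[OF that(1)] by simp
  ultimately show thesis using that k(1) by blast
qed

end


text \<open>By injectivity, a homeomorphism that fixes \<open>F\<close> pointwise brings no new
  points into \<open>F\<close>; so a sector that has been cleared stays clear.\<close>

lemma pl_homeo_fixed_Int:
  assumes "pl_homeo k" "R \<subseteq> S3" "F \<subseteq> S3" "\<And>x. x \<in> F \<Longrightarrow> k x = x"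
  shows "k ` R \<inter> F \<subseteq> R"
proof
  fix x assume "x \<in> k ` R \<inter> F"
  then obtain r where r: "r \<in> R" "x = k r" "x \<in> F" by blast
  then have "k x = k r" using assms(4) by simp
  then have "x = r" using pl_homeo_inj_on[OF assms(1) order_refl] r assms(2,3) by (meson inj_onD subsetD)
  then show "x \<in> R" using r by simp
qed

lemma pl_homeo_image_Int:
  assumes "pl_homeo k" "A \<subseteq> S3" "B \<subseteq> S3"
  shows "k ` A \<inter> k ` B = k ` (A \<inter> B)"
  using inj_on_image_Int[OF pl_homeo_inj_on[OF assms(1) order_refl] assms(2,3)] by simp

section \<open>Clearing the three sectors of the triangle\<close>

context tripod_frame
begin

text \<open>The three legs play symmetric roles; \<open>n2 - n1\<close> and \<open>- n1\<close> are
  the functionals dual to \<open>d2\<close> and \<open>d3\<close>. Statements about one pair of legs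
  thereby transfer to every pair.\<close>

lemma rotate: "tripod_frame d2 d3 (n2 - n1) (- n1)"
proof
  have "infnorm d3 = infnorm (d1 + d2)" using infnorm_neg[of "d1 + d2"] by (simp add: d3_def)
  then show "infnorm d3 \<le> 1/20" using small by simp
  have "d2 + d3 = - d1" by (simp add: d3_def)
  then show "infnorm (d2 + d3) \<le> 1/20" using small by (simp add: infnorm_neg)
qed (use level small dual in \<open>simp_all add: d3_def inner_simps\<close>)

text \<open>In the plane these two sectors lie on or above the graph formed by the first two legs,
  which is the set left fixed when the sector between those legs is cleared.\<close>

lemma other_sectors:
  assumes "x \<in> convex hull {north, north + d2, north + d3} \<union> convex hull {north, north + d3, north + d1}"
  shows "x \<in> S3" "off x = 0" "xb x \<ge> - (1/2) * \<bar>xa x\<bar>"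
proof -
  have *: "x \<in> S3 \<and> off x = 0 \<and> xb x \<ge> - (1/2) * \<bar>xa x\<bar>"
    if "x = pt a (u - (1/2) * \<bar>a\<bar>)" "0 \<le> u" "u + \<bar>a\<bar> \<le> 1" for a u
    unfolding that(1) using that(2,3) by (auto intro!: pt_S3)
  have "\<exists>a u. x = pt a (u - (1/2) * \<bar>a\<bar>) \<and> 0 \<le> u \<and> u + \<bar>a\<bar> \<le> 1"
    using assms
  proof
    assume "x \<in> convex hull {north, north + d2, north + d3}"
    then obtain t u v where t: "0 \<le> t" "0 \<le> u" "0 \<le> v" "t + u + v = 1"
      "x = t *\<^sub>R north + u *\<^sub>R (north + d2) + v *\<^sub>R (north + d3)"
      unfolding convex_hull_3 by blast
    have "x = (t + u + v) *\<^sub>R north + (- v) *\<^sub>R d1 + (u - v) *\<^sub>R d2" unfolding t(5) by (simp add: d3_def algebra_simps)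
    also have "\<dots> = pt (- u) (v - (1/2) * \<bar>- u\<bar>)"
    proof -
      have e: "(1/2) * (- u) - (v - (1/2) * u) = - v" "- (1/2) * (- u) - (v - (1/2) * u) = u - v" by linarith+
      show ?thesis using t(2) unfolding t(4) pt_def by (simp only: abs_minus_cancel abs_of_nonneg e scaleR_one)
    qed
    finally show ?thesis using t(1-4) by (intro exI[of _ "-u"] exI[of _ v]) auto
  next
    assume "x \<in> convex hull {north, north + d3, north + d1}"
    then obtain t u v where t: "0 \<le> t" "0 \<le> u" "0 \<le> v" "t + u + v = 1"
      "x = t *\<^sub>R north + u *\<^sub>R (north + d3) + v *\<^sub>R (north + d1)"
      unfolding convex_hull_3 by blast
    have "x = (t + u + v) *\<^sub>R north + (v - u) *\<^sub>R d1 + (- u) *\<^sub>R d2" unfolding t(5) by (simp add: d3_def algebra_simps)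
    also have "\<dots> = pt v (u - (1/2) * \<bar>v\<bar>)"
    proof -
      have e: "(1/2) * v - (u - (1/2) * v) = v - u" "- (1/2) * v - (u - (1/2) * v) = - u" by linarith+
      show ?thesis using t(3) unfolding t(4) pt_def by (simp only: abs_of_nonneg e scaleR_one)
    qed
    finally show ?thesis using t(1-4) by (intro exI[of _ v] exI[of _ u]) auto
  qed
  then show "x \<in> S3" "off x = 0" "xb x \<ge> - (1/2) * \<bar>xa x\<bar>" using * by blast+
qed

lemma clear_one_sector:
  assumes R: "polyhedral R" "R \<subseteq> S3"
    and legs: "R \<inter> (closed_segment north (north + d1) \<union> closed_segment north (north + d2)) \<subseteq> {north + d1, north + d2}"
  obtains k where "pl_homeo k" "\<And>x. x \<in> convex hull {north, north + d2, north + d3} \<Longrightarrow> k x = x"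
    "\<And>x. x \<in> convex hull {north, north + d3, north + d1} \<Longrightarrow> k x = x"
    "k ` R \<inter> convex hull {north, north + d1, north + d2} \<subseteq> {north + d1, north + d2}"
proof (rule clear_sector[OF assms])
  fix k assume k: "pl_homeo k" "\<And>x. x \<in> S3 \<Longrightarrow> off x = 0 \<Longrightarrow> xb x \<ge> - (1/2) * \<bar>xa x\<bar> \<Longrightarrow> k x = x"
    "k ` R \<inter> sector \<subseteq> {north + d1, north + d2}"
  show thesis
    by (rule that[OF k(1)]) (use k(2) other_sectors k(3) in \<open>auto simp: sector_def\<close>)
qed

text \<open>\<open>north\<close> is the centroid of the triangle. Shifting the smallest barycentric
  weight of a point from all three corners to \<open>north\<close> exhibits the point in one of the
  sectors.\<close>

lemma triangle_sectors:
  "triangle \<subseteq> convex hull {north, north + d1, north + d2} \<union> convex hull {north, north + d2, north + d3}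
    \<union> convex hull {north, north + d3, north + d1}"
proof
  fix x assume "x \<in> triangle"
  then obtain t u v where t: "0 \<le> t" "0 \<le> u" "0 \<le> v" "t + u + v = 1"
      "x = t *\<^sub>R (north + d1) + u *\<^sub>R (north + d2) + v *\<^sub>R (north + d3)"
    unfolding triangle_def convex_hull_3 by blast
  have *: "x = (m + m + m) *\<^sub>R north + (t - m) *\<^sub>R (north + d1) + (u - m) *\<^sub>R (north + d2) + (v - m) *\<^sub>R (north + d3)" for m
    unfolding t(5) by (simp add: vec_eq_iff d3_def algebra_simps)
  consider "v \<le> t" "v \<le> u" | "t \<le> u" "t \<le> v" | "u \<le> t" "u \<le> v" by linarith
  then show "x \<in> convex hull {north, north + d1, north + d2} \<union> convex hull {north, north + d2, north + d3}
    \<union> convex hull {north, north + d3, north + d1}"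
  proof cases
    case 1
    have "x \<in> convex hull {north, north + d1, north + d2}"
      unfolding convex_hull_3 using 1 t(1-4) *[of v] by (intro CollectI exI[of _ "v + v + v"] exI[of _ "t - v"] exI[of _ "u - v"]) auto
    then show ?thesis by blast
  next
    case 2
    have "x \<in> convex hull {north, north + d2, north + d3}"
      unfolding convex_hull_3 using 2 t(1-4) *[of t] by (intro CollectI exI[of _ "t + t + t"] exI[of _ "u - t"] exI[of _ "v - t"]) auto
    then show ?thesis by blast
  next
    case 3
    have "x \<in> convex hull {north, north + d3, north + d1}"
      unfolding convex_hull_3 using 3 t(1-4) *[of u] by (intro CollectI exI[of _ "u + u + u"] exI[of _ "v - u"] exI[of _ "t - u"]) (auto simp: add_ac)
    then show ?thesis by blast
  qed
qed

text \<open>The sectors are cleared one after another in rotated frames. Each homeomorphism fixes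
  the other two sectors pointwise, so earlier work is preserved and the legs stay where they
  are.\<close>

lemma clear_triangle:
  assumes R: "polyhedral R" "R \<subseteq> S3"
    and legs: "R \<inter> closed_segment north (north + d1) \<subseteq> {north + d1}"
      "R \<inter> closed_segment north (north + d2) \<subseteq> {north + d2}"
      "R \<inter> closed_segment north (north + d3) \<subseteq> {north + d3}"
  obtains k where "pl_homeo k" "k ` R \<inter> triangle \<subseteq> {north + d1, north + d2, north + d3}"
    "\<And>x. x \<in> closed_segment north (north + d1) \<union> closed_segment north (north + d2) \<union> closed_segment north (north + d3) \<Longrightarrow> k x = x"
proof -
  interpret r: tripod_frame d2 d3 "n2 - n1" "- n1" by (rule rotate)
  have rd: "r.d3 = d1" by (subst r.d3_def) (simp add: d3_def)
  interpret t: tripod_frame d3 d1 "- n1 - (n2 - n1)" "- (n2 - n1)" using r.rotate unfolding rd .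
  have td: "t.d3 = d2" by (subst t.d3_def) (simp add: d3_def)
  let ?S12 = "convex hull {north, north + d1, north + d2}" and ?S23 = "convex hull {north, north + d2, north + d3}"
    and ?S31 = "convex hull {north, north + d3, north + d1}"
  let ?l1 = "closed_segment north (north + d1)" and ?l2 = "closed_segment north (north + d2)" and ?l3 = "closed_segment north (north + d3)"
  have l: "?l1 \<subseteq> ?S12" "?l1 \<subseteq> ?S31" "?l2 \<subseteq> ?S12" "?l2 \<subseteq> ?S23" "?l3 \<subseteq> ?S23" "?l3 \<subseteq> ?S31"
    unfolding segment_convex_hull by (intro hull_mono; blast)+
  have S: "?S23 \<subseteq> S3" "?S31 \<subseteq> S3" "?S12 \<subseteq> S3"
    using other_sectors(1) r.other_sectors(1) unfolding rd by blast+
  have "R \<inter> (?l1 \<union> ?l2) \<subseteq> {north + d1, north + d2}" using legs by blast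
  then obtain k1 where k1: "pl_homeo k1" "\<And>x. x \<in> ?S23 \<Longrightarrow> k1 x = x" "\<And>x. x \<in> ?S31 \<Longrightarrow> k1 x = x"
    "k1 ` R \<inter> ?S12 \<subseteq> {north + d1, north + d2}"
    by (rule clear_one_sector[OF R]) (rule that; assumption)
  define R1 where "R1 = k1 ` R"
  have R1: "polyhedral R1" "R1 \<subseteq> S3" unfolding R1_def by (rule pl_homeo_polyhedral pl_homeo_subset; fact)+
  have R1i: "R1 \<inter> ?S23 \<subseteq> R" "R1 \<inter> ?S31 \<subseteq> R"
    unfolding R1_def by (rule pl_homeo_fixed_Int; fact)+
  have "R1 \<inter> (?l2 \<union> ?l3) \<subseteq> {north + d2, north + d3}" using R1i l legs by blast
  then obtain k2 where k2: "pl_homeo k2" "\<And>x. x \<in> ?S31 \<Longrightarrow> k2 x = x" "\<And>x. x \<in> ?S12 \<Longrightarrow> k2 x = x"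
    "k2 ` R1 \<inter> ?S23 \<subseteq> {north + d2, north + d3}"
    by (rule r.clear_one_sector[OF R1, unfolded rd]) (rule that; assumption)
  define R2 where "R2 = k2 ` R1"
  have R2: "polyhedral R2" "R2 \<subseteq> S3" unfolding R2_def by (rule pl_homeo_polyhedral pl_homeo_subset; fact)+
  have R2i: "R2 \<inter> ?S31 \<subseteq> R1" "R2 \<inter> ?S12 \<subseteq> R1"
    unfolding R2_def by (rule pl_homeo_fixed_Int; fact)+
  have "R2 \<inter> (?l3 \<union> ?l1) \<subseteq> {north + d3, north + d1}" using R2i(1) R1i(2) l legs by blast
  then obtain k3 where k3: "pl_homeo k3" "\<And>x. x \<in> ?S12 \<Longrightarrow> k3 x = x" "\<And>x. x \<in> ?S23 \<Longrightarrow> k3 x = x"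
    "k3 ` R2 \<inter> ?S31 \<subseteq> {north + d3, north + d1}"
    by (rule t.clear_one_sector[OF R2, unfolded td]) (rule that; assumption)
  have R3i: "k3 ` R2 \<inter> ?S12 \<subseteq> R2" "k3 ` R2 \<inter> ?S23 \<subseteq> R2"
    by (rule pl_homeo_fixed_Int; fact)+
  have *: "k3 ` R2 \<inter> ?S12 \<subseteq> {north + d1, north + d2}" using R3i(1) R2i(2) k1(4) unfolding R1_def by blast
  have **: "k3 ` R2 \<inter> ?S23 \<subseteq> {north + d2, north + d3}" using R3i(2) k2(4) unfolding R2_def by blast
  show thesis
  proof (rule that[of "\<lambda>x. k3 (k2 (k1 x))"])
    show "pl_homeo (\<lambda>x. k3 (k2 (k1 x)))" by (rule pl_homeo_compose[OF pl_homeo_compose[OF k1(1) k2(1)] k3(1)])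
    have "(\<lambda>x. k3 (k2 (k1 x))) ` R = k3 ` R2" unfolding R1_def R2_def image_image ..
    then show "(\<lambda>x. k3 (k2 (k1 x))) ` R \<inter> triangle \<subseteq> {north + d1, north + d2, north + d3}"
      using triangle_sectors * ** k3(4) by blast
    fix x assume "x \<in> ?l1 \<union> ?l2 \<union> ?l3"
    then have "k1 x = x \<and> k2 x = x \<and> k3 x = x"
    proof (elim UnE)
      assume "x \<in> ?l1"
      then have x: "x \<in> ?S12" "x \<in> ?S31" using l(1,2) by auto
      show ?thesis using k1(3)[OF x(2)] k2(2)[OF x(2)] k3(2)[OF x(1)] by simp
    next
      assume "x \<in> ?l2"
      then have x: "x \<in> ?S12" "x \<in> ?S23" using l(3,4) by auto
      show ?thesis using k1(2)[OF x(2)] k2(3)[OF x(1)] k3(3)[OF x(2)] by simp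
    next
      assume "x \<in> ?l3"
      then have x: "x \<in> ?S23" "x \<in> ?S31" using l(5,6) by auto
      show ?thesis using k1(3)[OF x(2)] k2(2)[OF x(2)] k3(3)[OF x(1)] by simp
    qed
    then show "k3 (k2 (k1 x)) = x" by simp
  qed
qed

end

section \<open>Straightening a tripod\<close>

text \<open>The arc reaches \<open>north\<close> at parameter 1 and is straight near there;
  \<open>w\<close> points away from \<open>north\<close>, being the velocity of the reversed
  arc.\<close>

definition germ :: "(real \<Rightarrow> real^4) \<Rightarrow> real^4 \<Rightarrow> bool" where
  "germ p w \<longleftrightarrow> (\<exists>\<eta>>0. \<forall>t\<in>{0..1}. 1 - \<eta> < t \<longrightarrow> p t = north + (1 - t) *\<^sub>R w)"

text \<open>Near \<open>north\<close> the fold is positively homogeneous about \<open>north\<close>,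
  so straight germs stay straight.\<close>

lemma germ_fold:
  assumes "germ p w" "\<epsilon> > 0" and h: "\<And>x. dist north x < \<epsilon> \<Longrightarrow> h x = x + \<bar>n \<bullet> (x - north)\<bar> *\<^sub>R d"
  shows "germ (\<lambda>t. h (p t)) (w + \<bar>n \<bullet> w\<bar> *\<^sub>R d)"
proof -
  obtain \<eta> where \<eta>: "\<eta> > 0" "\<And>t. t \<in> {0..1} \<Longrightarrow> 1 - \<eta> < t \<Longrightarrow> p t = north + (1 - t) *\<^sub>R w"
    using assms(1) unfolding germ_def by blast
  have nw: "norm w + 1 > 0" by (simp add: add_nonneg_pos)
  show ?thesis unfolding germ_def
  proof (intro exI[of _ "min \<eta> (\<epsilon> / (norm w + 1))"] conjI ballI impI)
    show "min \<eta> (\<epsilon> / (norm w + 1)) > 0" using \<eta> assms(2) nw by simp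
    fix t :: real assume t: "t \<in> {0..1}" "1 - min \<eta> (\<epsilon> / (norm w + 1)) < t"
    then have p: "p t = north + (1 - t) *\<^sub>R w" using \<eta>(2) by simp
    have t1: "0 \<le> 1 - t" "1 - t < \<epsilon> / (norm w + 1)" using t by auto
    have "(1 - t) * norm w \<le> (1 - t) * (norm w + 1)" using t1 by (intro mult_left_mono) auto
    also have "\<dots> < \<epsilon>" using t1(2) nw by (simp add: pos_less_divide_eq)
    finally have "dist north (p t) < \<epsilon>" using t1 by (simp add: p dist_norm)
    then have "h (p t) = p t + \<bar>n \<bullet> (p t - north)\<bar> *\<^sub>R d" using h by blast
    also have "\<dots> = north + (1 - t) *\<^sub>R (w + \<bar>n \<bullet> w\<bar> *\<^sub>R d)"
      using t1(1) by (simp add: p abs_mult scaleR_add_right)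
    finally show "h (p t) = north + (1 - t) *\<^sub>R (w + \<bar>n \<bullet> w\<bar> *\<^sub>R d)" .
  qed
qed

lemma germ_nonzero:
  assumes "germ p w" "inj_on p {0..1}"
  shows "w \<noteq> 0"
proof
  assume w: "w = 0"
  obtain \<eta> where \<eta>: "\<eta> > 0" "\<And>t. t \<in> {0..1} \<Longrightarrow> 1 - \<eta> < t \<Longrightarrow> p t = north + (1 - t) *\<^sub>R w"
    using assms(1) unfolding germ_def by blast
  let ?t = "max 0 (1 - (1/2) * \<eta>)"
  have "?t \<in> {0..1}" "1 - \<eta> < ?t" "?t < 1" using \<eta>(1) by auto
  then have "p ?t = p 1" using \<eta>(2)[of ?t] \<eta>(2)[of 1] \<eta>(1) w by simp
  then have "?t = 1" using assms(2) \<open>?t \<in> {0..1}\<close> by (meson atLeastAtMost_iff inj_onD order_refl zero_le_one)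
  then show False using \<open>?t < 1\<close> by simp
qed

lemma germ_level:
  assumes "germ p w" "p ` {0..1} \<subseteq> S3"
  shows "w $ 4 = 0"
proof -
  obtain \<eta> where \<eta>: "\<eta> > 0" "\<And>t. t \<in> {0..1} \<Longrightarrow> 1 - \<eta> < t \<Longrightarrow> p t = north + (1 - t) *\<^sub>R w"
    using assms(1) unfolding germ_def by blast
  show ?thesis
  proof (rule north_direction_level[of "min \<eta> 1"])
    fix t :: real assume "0 < t" "t < min \<eta> 1"
    then have "p (1 - t) = north + t *\<^sub>R w" "1 - t \<in> {0..1}" using \<eta>(2)[of "1 - t"] by auto
    then show "north + t *\<^sub>R w \<in> S3" using assms(2) by (metis image_subset_iff)
  qed (use \<eta> in auto)
qed

text \<open>A positive multiple would make the two arcs overlap in a short segment at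
  \<open>north\<close>. Opposite directions are possible.\<close>

lemma germ_not_collinear:
  assumes p: "germ p w" "inj_on p {0..1}" and q: "germ q w'"
    and disj: "p ` {0..1} \<inter> q ` {0..1} \<subseteq> {north}" and t: "t > 0"
  shows "w' \<noteq> t *\<^sub>R w"
proof
  assume w': "w' = t *\<^sub>R w"
  obtain \<eta> where \<eta>: "\<eta> > 0" "\<And>t. t \<in> {0..1} \<Longrightarrow> 1 - \<eta> < t \<Longrightarrow> p t = north + (1 - t) *\<^sub>R w"
    using p(1) unfolding germ_def by blast
  obtain \<zeta> where \<zeta>: "\<zeta> > 0" "\<And>t. t \<in> {0..1} \<Longrightarrow> 1 - \<zeta> < t \<Longrightarrow> q t = north + (1 - t) *\<^sub>R w'"
    using q unfolding germ_def by blast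
  define m where "m = min (min \<eta> 1) (t * min \<zeta> 1)"
  have m: "m > 0" "m \<le> \<eta>" "m \<le> 1" "m \<le> t * \<zeta>" "m \<le> t * 1"
    using \<eta> \<zeta> t unfolding m_def by (auto simp: min_le_iff_disj mult_le_cancel_left)
  define \<tau> where "\<tau> = m / 2"
  have \<tau>: "0 < \<tau>" "\<tau> < \<eta>" "\<tau> < 1" "\<tau> < t * \<zeta>" "\<tau> < t * 1" using m unfolding \<tau>_def by linarith+
  have a: "0 < \<tau> / t" "\<tau> / t < \<zeta>" "\<tau> / t < 1" using \<tau> t by (simp_all add: pos_divide_less_eq mult.commute)
  have 1: "p (1 - \<tau>) = north + \<tau> *\<^sub>R w" "1 - \<tau> \<in> {0..1}" using \<eta>(2)[of "1 - \<tau>"] \<tau> by auto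
  have 2: "q (1 - \<tau> / t) = north + (\<tau> / t) *\<^sub>R w'" "1 - \<tau> / t \<in> {0..1}" using \<zeta>(2)[of "1 - \<tau> / t"] a by auto
  have "p (1 - \<tau>) = q (1 - \<tau> / t)" unfolding 1(1) 2(1) w' using t by simp
  then have "p (1 - \<tau>) \<in> q ` {0..1}" using imageI[OF 2(2), of q] by simp
  then have "p (1 - \<tau>) \<in> {north}" using disj imageI[OF 1(2), of p] by blast
  then have "p (1 - \<tau>) = north" by simp
  then have "w = 0" using 1(1) \<tau> by simp
  then show False using germ_nonzero[OF p] by simp
qed

text \<open>The component of \<open>v\<close> orthogonal to \<open>w\<close>, rescaled.\<close>

lemma dual_vector:
  fixes v w :: "'a::real_inner"
  assumes "w \<noteq> 0" "\<And>t. v \<noteq> t *\<^sub>R w"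
  obtains n where "n \<bullet> v = 1" "n \<bullet> w = 0"
proof -
  define u where "u = v - (v \<bullet> w / (w \<bullet> w)) *\<^sub>R w"
  have u0: "u \<noteq> 0" using assms(2)[of "v \<bullet> w / (w \<bullet> w)"] by (simp add: u_def)
  have uw: "u \<bullet> w = 0" using assms(1) by (simp add: u_def inner_diff_left)
  have "u \<bullet> v = u \<bullet> u" using uw by (simp add: u_def inner_diff_right inner_diff_left)
  then show thesis using that[of "u /\<^sub>R (u \<bullet> u)"] u0 uw by simp
qed


lemma germ_exists:
  assumes p: "pl_on {0..1} p" and p1: "p 1 = north"
  obtains w where "germ p w"
proof -
  have m: "1 \<in> {0..1::real}" by simp
  show thesis
  proof (rule pl_path_local[OF p m])
    fix \<eta> :: real and v w
    assume "\<eta> > 0" "\<And>t. t \<in> {0..1} \<Longrightarrow> t \<le> 1 \<Longrightarrow> 1 - \<eta> < t \<Longrightarrow> p t = p 1 + (1 - t) *\<^sub>R w"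
    then have "germ p w" unfolding germ_def p1 by auto
    then show thesis by (rule that)
  qed
qed

text \<open>The free end is at parameter 0 and the centre at parameter 1, to agree with dragging,
  which retracts an arc from its start.\<close>

definition leg :: "(real \<Rightarrow> real^4) \<Rightarrow> real^4 \<Rightarrow> bool" where
  "leg p c \<longleftrightarrow> pl_on {0..1} p \<and> inj_on p {0..1} \<and> p ` {0..1} \<subseteq> S3 \<and> p 1 = c"

lemma leg_homeo: assumes "pl_homeo h" "leg p c" shows "leg (\<lambda>t. h (p t)) (h c)"
proof -
  have p: "pl_on {0..1} p" "inj_on p {0..1}" "p ` {0..1} \<subseteq> S3" "p 1 = c" using assms(2) unfolding leg_def by auto
  have "pl_on {0..1} (\<lambda>t. h (p t))"
    using pl_on_compose[OF p(1) _ p(3)] assms(1) unfolding pl_homeo_def by blast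
  moreover have "inj_on (\<lambda>t. h (p t)) {0..1}"
    using comp_inj_on[OF p(2) pl_homeo_inj_on[OF assms(1) p(3)]] by (simp add: o_def)
  moreover have "(\<lambda>t. h (p t)) ` {0..1} \<subseteq> S3"
    using pl_homeo_subset[OF assms(1) p(3)] by (simp add: image_image)
  ultimately show ?thesis unfolding leg_def using p(4) by simp
qed

lemma legs_disjoint_homeo:
  assumes "pl_homeo h" "leg p c" "leg q c" "p ` {0..1} \<inter> q ` {0..1} \<subseteq> {c}"
  shows "(\<lambda>t. h (p t)) ` {0..1} \<inter> (\<lambda>t. h (q t)) ` {0..1} \<subseteq> {h c}"
proof -
  have "p ` {0..1} \<subseteq> S3" "q ` {0..1} \<subseteq> S3" using assms(2,3) unfolding leg_def by auto
  then have "h ` p ` {0..1} \<inter> h ` q ` {0..1} = h ` (p ` {0..1} \<inter> q ` {0..1})"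
    by (rule pl_homeo_image_Int[OF assms(1)])
  also have "\<dots> \<subseteq> {h c}" using assms(4) by blast
  finally show ?thesis by (simp add: image_image)
qed

text \<open>The speed \<open>l\<close> is separated from the direction \<open>d\<close> so that one
  radius \<open>r\<close> can serve three legs of different speeds.\<close>

lemma germ_segment:
  assumes "germ p (l *\<^sub>R d)" "l > 0"
  obtains r0 where "r0 > 0" "\<And>r. 0 < r \<Longrightarrow> r < r0 \<Longrightarrow> 1 - r / l \<in> {0..<1} \<and> p (1 - r / l) = north + r *\<^sub>R d
    \<and> p ` {1 - r / l..1} = closed_segment north (north + r *\<^sub>R d)"
proof -
  obtain \<eta> where \<eta>: "\<eta> > 0" "\<And>t. t \<in> {0..1} \<Longrightarrow> 1 - \<eta> < t \<Longrightarrow> p t = north + (1 - t) *\<^sub>R (l *\<^sub>R d)"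
    using assms(1) unfolding germ_def by blast
  show thesis
  proof (rule that[of "l * min \<eta> 1"])
    show "l * min \<eta> 1 > 0" using \<eta> assms(2) by simp
    fix r :: real assume r: "0 < r" "r < l * min \<eta> 1"
    have a: "0 < r / l" "r / l < min \<eta> 1"
      using r assms(2) by (simp, metis mult.commute pos_divide_less_eq)
    have tk: "0 \<le> t * (r / l)" "t * (r / l) \<le> r / l" if "t \<in> {0..1}" for t
    proof -
      show "0 \<le> t * (r / l)" by (rule mult_nonneg_nonneg) (use that a(1) in simp_all)
      have "t * (r / l) \<le> 1 * (r / l)" by (rule mult_right_mono) (use that a(1) in simp_all)
      then show "t * (r / l) \<le> r / l" by (simp only: mult_1)
    qed
    have p: "p t = north + (1 - t) *\<^sub>R (l *\<^sub>R d)" if "t \<in> {1 - r / l..1}" for t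
      using \<eta>(2)[of t] that a by auto
    have "p (1 - r / l) = north + r *\<^sub>R d" using p[of "1 - r / l"] a assms(2) by simp
    moreover have "p ` {1 - r / l..1} = closed_segment north (north + r *\<^sub>R d)"
    proof -
      have "(\<lambda>t. 1 - t * (r / l)) ` {0..1} = {1 - r / l..1}"
      proof
        show "(\<lambda>t. 1 - t * (r / l)) ` {0..1} \<subseteq> {1 - r / l..1}"
        proof (rule image_subsetI)
          fix t :: real assume "t \<in> {0..1}"
          from tk[OF this] show "1 - t * (r / l) \<in> {1 - r / l..1}" unfolding atLeastAtMost_iff by linarith
        qed
        show "{1 - r / l..1} \<subseteq> (\<lambda>t. 1 - t * (r / l)) ` {0..1}"
        proof
          fix s assume "s \<in> {1 - r / l..1}"
          then have s: "0 \<le> 1 - s" "1 - s \<le> r / l" by auto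
          have "(1 - s) / (r / l) \<le> 1" by (simp only: divide_le_eq_1_pos[OF a(1)] s(2))
          moreover have "0 \<le> (1 - s) / (r / l)" by (rule divide_nonneg_pos[OF s(1) a(1)])
          ultimately have "(1 - s) / (r / l) \<in> {0..1}" unfolding atLeastAtMost_iff by (intro conjI)
          moreover have "s = 1 - (1 - s) / (r / l) * (r / l)"
            using nonzero_eq_divide_eq[of "r / l" "(1 - s) / (r / l)" "1 - s"] a(1) by linarith
          ultimately show "s \<in> (\<lambda>t. 1 - t * (r / l)) ` {0..1}" by (rule_tac image_eqI)
        qed
      qed
      then have "p ` {1 - r / l..1} = p ` (\<lambda>t. 1 - t * (r / l)) ` {0..1}" by simp
      also have "\<dots> = (\<lambda>t. (1 - t) *\<^sub>R north + t *\<^sub>R (north + r *\<^sub>R d)) ` {0..1}"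
        unfolding image_image
      proof (rule image_cong[OF refl])
        fix t :: real assume "t \<in> {0..1}"
        then have "1 - t * (r / l) \<in> {1 - r / l..1}" using tk[of t] unfolding atLeastAtMost_iff by linarith
        from p[OF this] have "p (1 - t * (r / l)) = north + (t * (r / l)) *\<^sub>R (l *\<^sub>R d)"
          by (simp only: diff_diff_eq2 add_diff_cancel_left')
        also have "\<dots> = north + (t * r) *\<^sub>R d" using assms(2) by simp
        finally show "p (1 - t * (r / l)) = (1 - t) *\<^sub>R north + t *\<^sub>R (north + r *\<^sub>R d)" by (simp add: algebra_simps)
      qed
      finally show ?thesis by (simp add: closed_segment_image_interval)
    qed
    ultimately show "1 - r / l \<in> {0..<1} \<and> p (1 - r / l) = north + r *\<^sub>R d
      \<and> p ` {1 - r / l..1} = closed_segment north (north + r *\<^sub>R d)" using a by auto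
  qed
qed

text \<open>One fold makes the first two directions opposite, \<open>e\<close> and
  \<open>- e\<close> up to speed. The third direction \<open>w\<close> is then independent of
  \<open>e\<close>, since otherwise it would overlap one of them. A second fold adds
  \<open>- w / 2\<close> to both \<open>e\<close> and \<open>- e\<close> and keeps \<open>w\<close>,
  so that the three directions sum to 0.\<close>

lemma tripod_germ_standard:
  assumes p: "leg p1 c" "leg p2 c" "leg p3 c"
    and disj: "p1 ` {0..1} \<inter> p2 ` {0..1} \<subseteq> {c}" "p1 ` {0..1} \<inter> p3 ` {0..1} \<subseteq> {c}" "p2 ` {0..1} \<inter> p3 ` {0..1} \<subseteq> {c}"
    and c: "c \<in> S3"
  obtains h a1 a2 l1 l2 n1 n2 where "pl_homeo h" "h c = north" "l1 > 0" "l2 > 0"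
    "n1 \<bullet> a1 = 1" "n1 \<bullet> a2 = 0" "n2 \<bullet> a1 = 0" "n2 \<bullet> a2 = 1" "a1 $ 4 = 0" "a2 $ 4 = 0"
    "germ (\<lambda>t. h (p1 t)) (l1 *\<^sub>R a1)" "germ (\<lambda>t. h (p2 t)) (l2 *\<^sub>R a2)" "germ (\<lambda>t. h (p3 t)) (- a1 - a2)"
proof -
  obtain \<theta> where \<theta>: "pl_homeo \<theta>" "\<theta> c = north" using pl_homeo_to_north[OF c] .
  define q1 q2 q3 where "q1 = (\<lambda>t. \<theta> (p1 t))" and "q2 = (\<lambda>t. \<theta> (p2 t))" and "q3 = (\<lambda>t. \<theta> (p3 t))"
  have q: "leg q1 north" "leg q2 north" "leg q3 north"
    unfolding q1_def q2_def q3_def using leg_homeo[OF \<theta>(1) p(1)] leg_homeo[OF \<theta>(1) p(2)] leg_homeo[OF \<theta>(1) p(3)] \<theta>(2) by simp_all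
  have qd: "q1 ` {0..1} \<inter> q2 ` {0..1} \<subseteq> {north}" "q1 ` {0..1} \<inter> q3 ` {0..1} \<subseteq> {north}" "q2 ` {0..1} \<inter> q3 ` {0..1} \<subseteq> {north}"
    unfolding q1_def q2_def q3_def \<theta>(2)[symmetric] by (rule legs_disjoint_homeo[OF \<theta>(1)]; fact)+
  obtain w1 where w1: "germ q1 w1" using germ_exists q(1) unfolding leg_def by blast
  obtain w2 where w2: "germ q2 w2" using germ_exists q(2) unfolding leg_def by blast
  obtain w3 where w3: "germ q3 w3" using germ_exists q(3) unfolding leg_def by blast
  have inj: "inj_on q1 {0..1}" "inj_on q2 {0..1}" "inj_on q3 {0..1}" using q unfolding leg_def by auto
  have sub: "q1 ` {0..1} \<subseteq> S3" "q2 ` {0..1} \<subseteq> S3" "q3 ` {0..1} \<subseteq> S3" using q unfolding leg_def by auto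
  have w10: "w1 \<noteq> 0" and w20: "w2 \<noteq> 0" using germ_nonzero w1 w2 inj by blast+
  have unit: "w1 /\<^sub>R norm w1 \<noteq> w2 /\<^sub>R norm w2"
  proof
    assume "w1 /\<^sub>R norm w1 = w2 /\<^sub>R norm w2"
    then have "norm w2 *\<^sub>R (w1 /\<^sub>R norm w1) = w2" using w20 by simp
    then have "w2 = (norm w2 / norm w1) *\<^sub>R w1" by (simp add: divide_inverse)
    moreover have "norm w2 / norm w1 > 0" using w10 w20 by simp
    ultimately show False using germ_not_collinear[OF w1 inj(1) w2 qd(1)] by blast
  qed
  obtain \<sigma> n d e \<epsilon> where \<sigma>: "pl_homeo \<sigma>" "\<epsilon> > 0" "d $ 4 = 0"
    "\<And>x. dist north x < \<epsilon> \<Longrightarrow> \<sigma> x = x + \<bar>n \<bullet> (x - north)\<bar> *\<^sub>R d"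
    and e: "e \<noteq> 0" "e $ 4 = 0" "w1 + \<bar>n \<bullet> w1\<bar> *\<^sub>R d = norm w1 *\<^sub>R e" "w2 + \<bar>n \<bullet> w2\<bar> *\<^sub>R d = - (norm w2 *\<^sub>R e)"
    by (rule straighten_homeo[OF w10 germ_level[OF w1 sub(1)] w20 germ_level[OF w2 sub(2)] unit]) (rule that; assumption)
  have \<sigma>n: "\<sigma> north = north" using \<sigma>(4)[of north] \<sigma>(2) by simp
  define r1 r2 r3 where "r1 = (\<lambda>t. \<sigma> (q1 t))" and "r2 = (\<lambda>t. \<sigma> (q2 t))" and "r3 = (\<lambda>t. \<sigma> (q3 t))"
  define w where "w = w3 + \<bar>n \<bullet> w3\<bar> *\<^sub>R d"
  have g1: "germ r1 (norm w1 *\<^sub>R e)"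
    unfolding r1_def e(3)[symmetric] by (rule germ_fold[OF w1 \<sigma>(2,4)])
  have g2: "germ r2 (- (norm w2 *\<^sub>R e))"
    unfolding r2_def e(4)[symmetric] by (rule germ_fold[OF w2 \<sigma>(2,4)])
  have g3: "germ r3 w"
    unfolding r3_def w_def by (rule germ_fold[OF w3 \<sigma>(2,4)])
  note g = g1 g2 g3
  have r: "leg r1 north" "leg r2 north" "leg r3 north"
    unfolding r1_def r2_def r3_def using leg_homeo[OF \<sigma>(1) q(1)] leg_homeo[OF \<sigma>(1) q(2)] leg_homeo[OF \<sigma>(1) q(3)] \<sigma>n by simp_all
  have rd: "r1 ` {0..1} \<inter> r3 ` {0..1} \<subseteq> {north}" "r2 ` {0..1} \<inter> r3 ` {0..1} \<subseteq> {north}"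
    using legs_disjoint_homeo[OF \<sigma>(1) q(1) q(3) qd(2)] legs_disjoint_homeo[OF \<sigma>(1) q(2) q(3) qd(3)]
    unfolding r1_def r2_def r3_def \<sigma>n by blast+
  have rinj: "inj_on r1 {0..1}" "inj_on r2 {0..1}" "inj_on r3 {0..1}" "r3 ` {0..1} \<subseteq> S3" using r unfolding leg_def by auto
  have w0: "w \<noteq> 0" "w $ 4 = 0" using germ_nonzero[OF g(3) rinj(3)] germ_level[OF g(3) rinj(4)] by auto
  have we: "w \<noteq> t *\<^sub>R e" for t
  proof
    assume wt: "w = t *\<^sub>R e"
    consider "t = 0" | "t > 0" | "t < 0" by linarith
    then show False
    proof cases
      case 1 then show False using wt w0 by simp
    next
      case 2
      then have "w = (t / norm w1) *\<^sub>R (norm w1 *\<^sub>R e)" "t / norm w1 > 0" using wt w10 by auto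
      then show False using germ_not_collinear[OF g(1) rinj(1) g(3) rd(1)] by blast
    next
      case 3
      then have "- t / norm w2 > 0" using w20 by (intro divide_pos_pos) auto
      moreover have "w = (- t / norm w2) *\<^sub>R (- (norm w2 *\<^sub>R e))" using wt w20 by simp
      ultimately have "w = (- t / norm w2) *\<^sub>R (- (norm w2 *\<^sub>R e))" "- t / norm w2 > 0" by simp_all
      then show False using germ_not_collinear[OF g(2) rinj(2) g(3) rd(2)] by blast
    qed
  qed
  have ew: "e \<noteq> t *\<^sub>R w" for t
  proof
    assume et: "e = t *\<^sub>R w"
    then have "t \<noteq> 0" using e(1) by auto
    then have "w = inverse t *\<^sub>R e" using et by simp
    then show False using we by blast
  qed
  obtain n' where n': "n' \<bullet> e = 1" "n' \<bullet> w = 0" using dual_vector[OF w0(1) ew] .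
  obtain m' where m': "m' \<bullet> w = 1" "m' \<bullet> e = 0" using dual_vector[OF e(1) we] .
  define f where "f = (-1/2) *\<^sub>R w"
  have nf: "n' \<bullet> f = 0" "f $ 4 = 0" by (simp_all add: f_def n' w0)
  obtain \<phi> \<delta> where \<phi>: "pl_homeo \<phi>" "\<delta> > 0" "\<And>x. dist north x < \<delta> \<Longrightarrow> \<phi> x = x + \<bar>n' \<bullet> (x - north)\<bar> *\<^sub>R f"
    by (rule fold_homeo[OF nf]) (rule that; assumption)
  have \<phi>n: "\<phi> north = north" using \<phi>(3)[of north] \<phi>(2) by simp
  have k1: "germ (\<lambda>t. \<phi> (r1 t)) (norm w1 *\<^sub>R (e + f))"
    using germ_fold[OF g(1) \<phi>(2,3)] n' by (simp add: scaleR_add_right)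
  have k2: "germ (\<lambda>t. \<phi> (r2 t)) (norm w2 *\<^sub>R (- e + f))"
    using germ_fold[OF g(2) \<phi>(2,3)] n' by (simp add: scaleR_diff_right)
  have k3: "germ (\<lambda>t. \<phi> (r3 t)) (- (e + f) - (- e + f))"
  proof -
    have "- (e + f) - (- e + f) = w" unfolding f_def by (simp add: vec_eq_iff)
    then show ?thesis using germ_fold[OF g(3) \<phi>(2,3)] n' by simp
  qed
  show thesis
  \<comment> \<open>The dual vectors are combinations of \<open>n'\<close> and \<open>m'\<close>,
    which are dual to \<open>e\<close> and \<open>w\<close>; note that \<open>m'\<close> takes the
    value -1/2 on both \<open>e + f\<close> and \<open>- e + f\<close>.\<close>
  proof (rule that[of "\<lambda>x. \<phi> (\<sigma> (\<theta> x))" "norm w1" "norm w2" "(1/2) *\<^sub>R n' - m'" "e + f" "- e + f" "(-1/2) *\<^sub>R n' - m'"])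
    show "pl_homeo (\<lambda>x. \<phi> (\<sigma> (\<theta> x)))" by (rule pl_homeo_compose[OF pl_homeo_compose[OF \<theta>(1) \<sigma>(1)] \<phi>(1)])
    show "germ (\<lambda>t. \<phi> (\<sigma> (\<theta> (p1 t)))) (norm w1 *\<^sub>R (e + f))" using k1 by (simp add: r1_def q1_def)
    show "germ (\<lambda>t. \<phi> (\<sigma> (\<theta> (p2 t)))) (norm w2 *\<^sub>R (- e + f))" using k2 by (simp add: r2_def q2_def)
    show "germ (\<lambda>t. \<phi> (\<sigma> (\<theta> (p3 t)))) (- (e + f) - (- e + f))" using k3 by (simp add: r3_def q3_def)
  qed (use \<theta>(2) \<sigma>n \<phi>n w10 w20 n' m' e(2) w0(2) in \<open>simp_all add: f_def inner_simps\<close>)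
qed


lemma leg_avoid:
  assumes "leg p c" "p ` {0..1} \<inter> X \<subseteq> {c}"
  shows "p ` {0..<1} \<inter> X = {}"
proof -
  have p: "inj_on p {0..1}" "p 1 = c" using assms(1) unfolding leg_def by auto
  have "p t \<notin> X" if t: "t \<in> {0..<1}" for t
  proof
    assume "p t \<in> X"
    moreover have t01: "t \<in> {0..1}" "(1::real) \<in> {0..1}" using t by auto
    ultimately have "p t = p 1" using assms(2) imageI[of t "{0..1}" p] unfolding p(2) by blast
    then have "t = 1" using inj_onD[OF p(1) _ t01] by blast
    then show False using t by simp
  qed
  then show ?thesis by blast
qed

lemma drag_leg:
  assumes p: "leg p c" and Z: "closed Z" "Z \<subseteq> S3" "p ` {0..1} \<inter> Z \<subseteq> {c}" and s: "s \<in> {0..<1}"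
  obtains h where "pl_homeo h" "\<And>z. z \<in> Z \<Longrightarrow> h z = z" "h ` p ` {0..1} = p ` {s..1}" "h (p 0) = p s"
proof -
  have p': "pl_on {0..1} p" "inj_on p {0..1}" "p ` {0..1} \<subseteq> S3" using p unfolding leg_def by auto
  show thesis
    by (rule drag_homeo[OF p' Z(1,2) leg_avoid[OF p Z(3)] s]) (rule that; assumption)
qed

lemma leg_closed: "leg p c \<Longrightarrow> closed (p ` {0..1})"
  unfolding leg_def using pl_on_imp_continuous_on compact_continuous_image compact_imp_closed compact_Icc by metis

lemma leg_subset: "leg p c \<Longrightarrow> p ` {0..1} \<subseteq> S3"
  unfolding leg_def by simp


text \<open>Retracting each leg to a short straight piece at the centre gives a planar tripod, whose
  sectors can be cleared. The dragging need not fix \<open>R\<close>: it is carried along, and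
  homeomorphisms preserve the fact that \<open>R\<close> meets each leg at most in its free
  end.\<close>

proposition tripod_standard:
  assumes p: "leg p1 c" "leg p2 c" "leg p3 c" and c: "c \<in> S3"
    and disj: "p1 ` {0..1} \<inter> p2 ` {0..1} \<subseteq> {c}" "p1 ` {0..1} \<inter> p3 ` {0..1} \<subseteq> {c}" "p2 ` {0..1} \<inter> p3 ` {0..1} \<subseteq> {c}"
    and R: "polyhedral R" "R \<subseteq> S3" "R \<inter> p1 ` {0..1} \<subseteq> {p1 0}" "R \<inter> p2 ` {0..1} \<subseteq> {p2 0}" "R \<inter> p3 ` {0..1} \<subseteq> {p3 0}"
  obtains h d1 d2 n1 n2 where "pl_homeo h" "tripod_frame d1 d2 n1 n2"
    "h (p1 0) = north + d1" "h (p2 0) = north + d2" "h (p3 0) = north + tripod_frame.d3 d1 d2"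
    "h ` p1 ` {0..1} = closed_segment north (north + d1)" "h ` p2 ` {0..1} = closed_segment north (north + d2)"
    "h ` p3 ` {0..1} = closed_segment north (north + tripod_frame.d3 d1 d2)"
    "h ` R \<inter> tripod_frame.triangle d1 d2 \<subseteq> {north + d1, north + d2, north + tripod_frame.d3 d1 d2}"
proof -
  obtain h0 a1 a2 l1 l2 m1 m2 where h0: "pl_homeo h0" "h0 c = north" and l: "l1 > 0" "l2 > 0"
    and m: "m1 \<bullet> a1 = 1" "m1 \<bullet> a2 = 0" "m2 \<bullet> a1 = 0" "m2 \<bullet> a2 = 1" "a1 $ 4 = 0" "a2 $ 4 = 0"
    and g: "germ (\<lambda>t. h0 (p1 t)) (l1 *\<^sub>R a1)" "germ (\<lambda>t. h0 (p2 t)) (l2 *\<^sub>R a2)" "germ (\<lambda>t. h0 (p3 t)) (- a1 - a2)"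
    by (rule tripod_germ_standard[OF p disj c]) (rule that; assumption)
  define q1 q2 q3 where "q1 = (\<lambda>t. h0 (p1 t))" and "q2 = (\<lambda>t. h0 (p2 t))" and "q3 = (\<lambda>t. h0 (p3 t))"
  have q: "leg q1 north" "leg q2 north" "leg q3 north"
    unfolding q1_def q2_def q3_def using leg_homeo[OF h0(1) p(1)] leg_homeo[OF h0(1) p(2)] leg_homeo[OF h0(1) p(3)] h0(2) by simp_all
  have qd: "q1 ` {0..1} \<inter> q2 ` {0..1} \<subseteq> {north}" "q1 ` {0..1} \<inter> q3 ` {0..1} \<subseteq> {north}" "q2 ` {0..1} \<inter> q3 ` {0..1} \<subseteq> {north}"
    using legs_disjoint_homeo[OF h0(1) p(1,2) disj(1)] legs_disjoint_homeo[OF h0(1) p(1,3) disj(2)] legs_disjoint_homeo[OF h0(1) p(2,3) disj(3)]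
    unfolding q1_def q2_def q3_def h0(2) by simp_all
  define a3 where "a3 = - a1 - a2"
  have g3: "germ q3 (1 *\<^sub>R a3)" using g(3) unfolding q3_def a3_def by simp
  obtain e1 where e1: "e1 > 0" "\<And>r. 0 < r \<Longrightarrow> r < e1 \<Longrightarrow> 1 - r / l1 \<in> {0..<1} \<and> q1 (1 - r / l1) = north + r *\<^sub>R a1
    \<and> q1 ` {1 - r / l1..1} = closed_segment north (north + r *\<^sub>R a1)"
    by (rule germ_segment[OF g(1)[folded q1_def] l(1)]) (rule that; assumption)
  obtain e2 where e2: "e2 > 0" "\<And>r. 0 < r \<Longrightarrow> r < e2 \<Longrightarrow> 1 - r / l2 \<in> {0..<1} \<and> q2 (1 - r / l2) = north + r *\<^sub>R a2
    \<and> q2 ` {1 - r / l2..1} = closed_segment north (north + r *\<^sub>R a2)"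
    by (rule germ_segment[OF g(2)[folded q2_def] l(2)]) (rule that; assumption)
  obtain e3 where e3: "e3 > 0" "\<And>r. 0 < r \<Longrightarrow> r < e3 \<Longrightarrow> 1 - r / 1 \<in> {0..<1} \<and> q3 (1 - r / 1) = north + r *\<^sub>R a3
    \<and> q3 ` {1 - r / 1..1} = closed_segment north (north + r *\<^sub>R a3)"
    by (rule germ_segment[OF g3 zero_less_one]) (rule that; assumption)
  define A where "A = 1 + infnorm a1 + infnorm a2"
  have A: "A > 0" "infnorm a1 \<le> A" "infnorm a2 \<le> A" "infnorm (a1 + a2) \<le> A"
    using infnorm_pos_le[of a1] infnorm_pos_le[of a2] infnorm_triangle[of a1 a2] by (auto simp: A_def)
  \<comment> \<open>Small enough for the three straight pieces to exist and for the scaled vectors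
    to satisfy the bound 1/20.\<close>
  define M where "M = min (min e1 e2) (min e3 (1 / (20 * A)))"
  have M: "M > 0" "M \<le> e1" "M \<le> e2" "M \<le> e3" "M \<le> 1 / (20 * A)" using e1(1) e2(1) e3(1) A(1) by (auto simp: M_def)
  define r where "r = (1/2) * M"
  have r: "0 < r" "r < e1" "r < e2" "r < e3" "r \<le> 1 / (20 * A)" using M unfolding r_def by linarith+
  have rA: "r * A \<le> 1/20" using mult_right_mono[OF r(5), of A] A(1) by simp
  have small: "infnorm (r *\<^sub>R x) \<le> 1/20" if "infnorm x \<le> A" for x :: "real^4"
  proof -
    have "r * infnorm x \<le> r * A" by (rule mult_left_mono[OF that]) (use r(1) in simp)
    then have "r * infnorm x \<le> 1/20" using rA by linarith
    then show ?thesis using r(1) by (simp only: infnorm_mul abs_of_pos)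
  qed
  define d1 d2 d3 where "d1 = r *\<^sub>R a1" and "d2 = r *\<^sub>R a2" and "d3 = r *\<^sub>R a3"
  have "tripod_frame d1 d2 ((1 / r) *\<^sub>R m1) ((1 / r) *\<^sub>R m2)"
  proof
    have "d1 + d2 = r *\<^sub>R (a1 + a2)" by (simp add: d1_def d2_def scaleR_add_right)
    then show "infnorm (d1 + d2) \<le> 1/20" using small[OF A(4)] by simp
    show "infnorm d1 \<le> 1/20" "infnorm d2 \<le> 1/20" unfolding d1_def d2_def by (rule small, fact)+
  qed (use r(1) m in \<open>simp_all add: d1_def d2_def\<close>)
  then interpret tf: tripod_frame d1 d2 "(1 / r) *\<^sub>R m1" "(1 / r) *\<^sub>R m2" .
  have d3: "tf.d3 = d3" unfolding tf.d3_def by (simp add: d1_def d2_def d3_def a3_def scaleR_diff_right)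
  define t1 t2 t3 where "t1 = 1 - r / l1" and "t2 = 1 - r / l2" and "t3 = 1 - r / 1"
  have t: "t1 \<in> {0..<1}" "t2 \<in> {0..<1}" "t3 \<in> {0..<1}"
    and tp: "q1 t1 = north + d1" "q2 t2 = north + d2" "q3 t3 = north + d3"
    and seg: "q1 ` {t1..1} = closed_segment north (north + d1)" "q2 ` {t2..1} = closed_segment north (north + d2)"
      "q3 ` {t3..1} = closed_segment north (north + d3)"
    using e1(2)[OF r(1,2)] e2(2)[OF r(1,3)] e3(2)[OF r(1,4)]
    unfolding t1_def t2_def t3_def d1_def d2_def d3_def by blast+
  let ?s1 = "closed_segment north (north + d1)" and ?s2 = "closed_segment north (north + d2)" and ?s3 = "closed_segment north (north + d3)"
  have sq: "?s1 \<subseteq> q1 ` {0..1}" "?s2 \<subseteq> q2 ` {0..1}" "?s3 \<subseteq> q3 ` {0..1}"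
    unfolding seg[symmetric] using t by (intro image_mono; auto)+
  define Q1 Q2 Q3 where Q: "Q1 = q1 ` {0..1}" "Q2 = q2 ` {0..1}" "Q3 = q3 ` {0..1}"
  have QS: "Q1 \<subseteq> S3" "Q2 \<subseteq> S3" "Q3 \<subseteq> S3" and QC: "closed Q1" "closed Q2" "closed Q3"
    unfolding Q using leg_subset leg_closed q by auto
  note Qd = qd[folded Q] and sQ = sq[folded Q]
  obtain g1 where g1: "pl_homeo g1" "\<And>z. z \<in> Q2 \<union> Q3 \<Longrightarrow> g1 z = z"
    "g1 ` q1 ` {0..1} = q1 ` {t1..1}" "g1 (q1 0) = q1 t1"
  \<comment> \<open>Each dragging fixes the other two legs in their current state, so the legs can
    be shortened one by one.\<close>
  proof (rule drag_leg[OF q(1) _ _ _ t(1), of "Q2 \<union> Q3"])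
    show "closed (Q2 \<union> Q3)" using QC by (intro closed_Un)
    show "Q2 \<union> Q3 \<subseteq> S3" using QS by blast
    show "q1 ` {0..1} \<inter> (Q2 \<union> Q3) \<subseteq> {north}" unfolding Q(1)[symmetric] using Qd(1,2) by blast
  qed (rule that; assumption)
  obtain g2 where g2: "pl_homeo g2" "\<And>z. z \<in> ?s1 \<union> Q3 \<Longrightarrow> g2 z = z"
    "g2 ` q2 ` {0..1} = q2 ` {t2..1}" "g2 (q2 0) = q2 t2"
  proof (rule drag_leg[OF q(2) _ _ _ t(2), of "?s1 \<union> Q3"])
    show "closed (?s1 \<union> Q3)" using QC by (intro closed_Un closed_segment)
    show "?s1 \<union> Q3 \<subseteq> S3" using QS sQ by blast
    show "q2 ` {0..1} \<inter> (?s1 \<union> Q3) \<subseteq> {north}" unfolding Q(2)[symmetric] using Qd(1,3) sQ(1) by blast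
  qed (rule that; assumption)
  obtain g3 where g3: "pl_homeo g3" "\<And>z. z \<in> ?s1 \<union> ?s2 \<Longrightarrow> g3 z = z"
    "g3 ` q3 ` {0..1} = q3 ` {t3..1}" "g3 (q3 0) = q3 t3"
  proof (rule drag_leg[OF q(3) _ _ _ t(3), of "?s1 \<union> ?s2"])
    show "closed (?s1 \<union> ?s2)" by (intro closed_Un closed_segment)
    show "?s1 \<union> ?s2 \<subseteq> S3" using QS sQ by blast
    show "q3 ` {0..1} \<inter> (?s1 \<union> ?s2) \<subseteq> {north}" unfolding Q(3)[symmetric] using Qd(2,3) sQ by blast
  qed (rule that; assumption)
  define H where "H x = g3 (g2 (g1 (h0 x)))" for x
  have H: "pl_homeo H"
    unfolding H_def by (rule pl_homeo_compose[OF pl_homeo_compose[OF pl_homeo_compose[OF h0(1) g1(1)] g2(1)] g3(1)])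
  have fix_im: "f ` X = X" if "\<And>z. z \<in> X \<Longrightarrow> f z = z" for f and X :: "(real^4) set"
    using that by simp
  have g1Q: "g1 ` q2 ` {0..1} = q2 ` {0..1}" "g1 ` q3 ` {0..1} = q3 ` {0..1}"
    unfolding Q(2,3)[symmetric] by (rule fix_im, rule g1(2), simp)+
  have g2Q: "g2 ` q3 ` {0..1} = q3 ` {0..1}" "g2 ` ?s1 = ?s1"
    unfolding Q(3)[symmetric] by (rule fix_im, rule g2(2), simp)+
  have g3Q: "g3 ` ?s1 = ?s1" "g3 ` ?s2 = ?s2"
    by (rule fix_im, rule g3(2), simp)+
  have H1: "H ` p1 ` {0..1} = ?s1"
  proof -
    have "H ` p1 ` {0..1} = g3 ` g2 ` g1 ` q1 ` {0..1}" unfolding H_def q1_def image_image ..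
    then show ?thesis unfolding g1(3) seg(1) g2Q g3Q .
  qed
  have H2: "H ` p2 ` {0..1} = ?s2"
  proof -
    have "H ` p2 ` {0..1} = g3 ` g2 ` g1 ` q2 ` {0..1}" unfolding H_def q2_def image_image ..
    then show ?thesis unfolding g1Q g2(3) seg(2) g3Q .
  qed
  have H3: "H ` p3 ` {0..1} = ?s3"
  proof -
    have "H ` p3 ` {0..1} = g3 ` g2 ` g1 ` q3 ` {0..1}" unfolding H_def q3_def image_image ..
    then show ?thesis unfolding g1Q g2Q g3(3) seg(3) .
  qed
  have start: "q2 0 \<in> Q2" "q3 0 \<in> Q3" unfolding Q by simp_all
  have E1: "H (p1 0) = north + d1"
  proof -
    have "H (p1 0) = g3 (g2 (north + d1))" unfolding H_def using g1(4) tp(1) by (simp add: q1_def)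
    also have "g2 (north + d1) = north + d1" by (rule g2(2)) simp
    also have "g3 (north + d1) = north + d1" by (rule g3(2)) simp
    finally show ?thesis .
  qed
  have E2: "H (p2 0) = north + d2"
  proof -
    have "g1 (q2 0) = q2 0" by (rule g1(2)) (simp add: start)
    then have "H (p2 0) = g3 (north + d2)" unfolding H_def using g2(4) tp(2) by (simp add: q2_def)
    also have "g3 (north + d2) = north + d2" by (rule g3(2)) simp
    finally show ?thesis .
  qed
  have E3: "H (p3 0) = north + d3"
  proof -
    have "g1 (q3 0) = q3 0" by (rule g1(2)) (simp add: start)
    moreover have "g2 (q3 0) = q3 0" by (rule g2(2)) (simp add: start)
    ultimately show ?thesis unfolding H_def using g3(4) tp(3) by (simp add: q3_def)
  qed
  have RL: "H ` R \<inter> H ` p ` {0..1} \<subseteq> {H (p 0)}" if "R \<inter> p ` {0..1} \<subseteq> {p 0}" "leg p c" for p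
    unfolding pl_homeo_image_Int[OF H R(2) leg_subset[OF that(2)]] using image_mono[OF that(1), of H] by (simp only: image_insert image_empty)
  have RS: "H ` R \<inter> ?s1 \<subseteq> {north + d1}" "H ` R \<inter> ?s2 \<subseteq> {north + d2}" "H ` R \<inter> ?s3 \<subseteq> {north + d3}"
    using RL[OF R(3) p(1)] RL[OF R(4) p(2)] RL[OF R(5) p(3)] unfolding H1 H2 H3 E1 E2 E3 by simp_all
  obtain k where k: "pl_homeo k" "k ` H ` R \<inter> tf.triangle \<subseteq> {north + d1, north + d2, north + d3}"
    "\<And>x. x \<in> ?s1 \<union> ?s2 \<union> ?s3 \<Longrightarrow> k x = x"
    by (rule tf.clear_triangle[OF pl_homeo_polyhedral[OF H R(1,2)] pl_homeo_subset[OF H R(2)], unfolded d3, OF RS])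
      (rule that; assumption)
  show thesis
  proof (rule that[OF pl_homeo_compose[OF H k(1)] tf.tripod_frame_axioms, unfolded d3])
    show "k (H (p1 0)) = north + d1" "k (H (p2 0)) = north + d2" "k (H (p3 0)) = north + d3"
      unfolding E1 E2 E3 by (rule k(3); simp)+
    have "(\<lambda>x. k (H x)) ` p ` {0..1} = k ` H ` p ` {0..1}" for p :: "real \<Rightarrow> real^4" by (simp add: image_image)
    note ii = this
    show "(\<lambda>x. k (H x)) ` p1 ` {0..1} = ?s1" unfolding ii H1 by (rule fix_im) (rule k(3), simp)
    show "(\<lambda>x. k (H x)) ` p2 ` {0..1} = ?s2" unfolding ii H2 by (rule fix_im) (rule k(3), simp)
    show "(\<lambda>x. k (H x)) ` p3 ` {0..1} = ?s3" unfolding ii H3 by (rule fix_im) (rule k(3), simp)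
    have "(\<lambda>x. k (H x)) ` R = k ` H ` R" by (simp add: image_image)
    then show "(\<lambda>x. k (H x)) ` R \<inter> tf.triangle \<subseteq> {north + d1, north + d2, north + d3}" using k(2) by simp
  qed
qed


section \<open>Cycles of a spatial graph\<close>

lemma homeomorphic_space_top_of_set:
  "top_of_set S homeomorphic_space top_of_set T \<longleftrightarrow> S homeomorphic T"
proof
  assume "top_of_set S homeomorphic_space top_of_set T"
  then obtain f g where fg: "continuous_on S f" "f ` S \<subseteq> T" "continuous_on T g" "g ` T \<subseteq> S"
    "\<And>x. x \<in> S \<Longrightarrow> g (f x) = x" "\<And>y. y \<in> T \<Longrightarrow> f (g y) = y"
    unfolding homeomorphic_space_def homeomorphic_maps_def by (auto simp: image_subset_iff_funcset)
  then have "f ` S = T" "g ` T = S" by force+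
  then show "S homeomorphic T" using fg unfolding homeomorphic_def homeomorphism_def by blast
next
  assume "S homeomorphic T"
  then obtain f g where fg: "homeomorphism S T f g" unfolding homeomorphic_def by blast
  have "continuous_map (top_of_set S) (top_of_set T) f" "continuous_map (top_of_set T) (top_of_set S) g"
    using fg by (auto simp: homeomorphism_def)
  moreover have "\<forall>x\<in>S. g (f x) = x" "\<forall>y\<in>T. f (g y) = y" using fg by (simp_all add: homeomorphism_def)
  ultimately have "homeomorphic_maps (top_of_set S) (top_of_set T) f g"
    unfolding homeomorphic_maps_def by simp
  then show "top_of_set S homeomorphic_space top_of_set T" unfolding homeomorphic_space_def by blast
qed

lemma circle_punctured_connected:
  assumes "K homeomorphic sphere (0::complex) 1" "y \<in> K"
  shows "Topological_Spaces.connected (K - {y})"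
proof -
  obtain f g where fg: "homeomorphism K (sphere (0::complex) 1) f g" using assms(1) unfolding homeomorphic_def by blast
  have "f y \<in> sphere 0 1" using fg assms(2) unfolding homeomorphism_def by blast
  then have "sphere (0::complex) 1 - {f y} homeomorphic (UNIV :: real set)"
    by (intro homeomorphic_punctured_sphere_affine) auto
  then have "Topological_Spaces.connected (sphere (0::complex) 1 - {f y})"
    using homeomorphic_connectedness connected_UNIV by blast
  then have "Topological_Spaces.connected (g ` (sphere 0 1 - {f y}))"
    using fg unfolding homeomorphism_def by (intro connected_continuous_image) (auto intro: continuous_on_subset)
  moreover have "g ` (sphere 0 1 - {f y}) = K - {y}"
  proof
    show "g ` (sphere 0 1 - {f y}) \<subseteq> K - {y}"
    proof (rule image_subsetI)
      fix z assume z: "z \<in> sphere 0 1 - {f y}"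
      then have "g z \<in> K" "f (g z) = z" using fg unfolding homeomorphism_def by auto
      then show "g z \<in> K - {y}" using z by auto
    qed
    show "K - {y} \<subseteq> g ` (sphere 0 1 - {f y})"
    proof
      fix x assume x: "x \<in> K - {y}"
      have "g (f x) = x" "g (f y) = y" "f x \<in> sphere 0 1" using fg x assms(2) unfolding homeomorphism_def by auto
      then have "f x \<noteq> f y" using x by auto
      then show "x \<in> g ` (sphere 0 1 - {f y})"
        using \<open>g (f x) = x\<close> \<open>f x \<in> sphere 0 1\<close> by (intro image_eqI[of _ _ "f x"]) auto
    qed
  qed
  ultimately show ?thesis by simp
qed

lemma circle_connected: "K homeomorphic sphere (0::complex) 1 \<Longrightarrow> Topological_Spaces.connected K"
  using homeomorphic_connectedness connected_sphere[of "0::complex" 1] by auto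

lemma circle_not_singleton: "\<not> {x} homeomorphic sphere (0::complex) 1"
proof
  assume "{x} homeomorphic sphere (0::complex) 1"
  then obtain f g where fg: "homeomorphism {x} (sphere (0::complex) 1) f g" unfolding homeomorphic_def by blast
  have "1 \<in> sphere (0::complex) 1" "-1 \<in> sphere (0::complex) 1" by auto
  then have "1 \<in> f ` {x}" "-1 \<in> f ` {x}" using fg unfolding homeomorphism_def by auto
  then show False by auto
qed

text \<open>Near a point of the circle the height over the tangent direction is an injective coordinate,
  so two branches leaving the point on the same side must meet.\<close>

lemma circle_no_three_branches:
  fixes q :: "'i \<Rightarrow> real \<Rightarrow> 'a::metric_space"
  assumes K: "K homeomorphic sphere (0::complex) 1"
    and I: "card I = 3"
    and q: "\<And>i. i \<in> I \<Longrightarrow> continuous_on {0..1} (q i)" "\<And>i. i \<in> I \<Longrightarrow> q i ` {0..1} \<subseteq> K"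
      "\<And>i. i \<in> I \<Longrightarrow> q i 0 = x" "\<And>i. i \<in> I \<Longrightarrow> inj_on (q i) {0..1}"
    and disj: "\<And>i j s t. i \<in> I \<Longrightarrow> j \<in> I \<Longrightarrow> i \<noteq> j \<Longrightarrow> s \<in> {0<..1} \<Longrightarrow> t \<in> {0<..1} \<Longrightarrow> q i s \<noteq> q j t"
  shows False
proof -
  obtain h k where hk: "homeomorphism K (sphere (0::complex) 1) h k" using K unfolding homeomorphic_def by blast
  have h: "continuous_on K h" "\<And>y. y \<in> K \<Longrightarrow> norm (h y) = 1" "\<And>y. y \<in> K \<Longrightarrow> k (h y) = y"
    using hk unfolding homeomorphism_def by auto
  have hinj: "y = y'" if "y \<in> K" "y' \<in> K" "h y = h y'" for y y' using h(3) that by metis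
  have qK: "q i t \<in> K" if "i \<in> I" "t \<in> {0..1}" for i t using q(2) that by blast
  obtain i0 where "i0 \<in> I" using I by fastforce
  then have xK: "x \<in> K" using qK[of i0 0] q(3) by simp
  \<comment> \<open>The circle is rotated so that the branching point becomes 1; near 1 the sign of
    the imaginary part tells the two sides apart.\<close>
  define z where "z i t = h (q i t) / h x" for i t
  have hx: "h x \<noteq> 0" using h(2)[OF xK] by auto
  have z0: "z i 0 = 1" if "i \<in> I" for i using q(3)[OF that] hx by (simp add: z_def)
  have zn: "norm (z i t) = 1" if "i \<in> I" "t \<in> {0..1}" for i t
    using h(2)[OF qK[OF that]] h(2)[OF xK] by (simp add: z_def norm_divide)
  have zc: "continuous_on {0..1} (z i)" if "i \<in> I" for i
    unfolding z_def using hx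
    by (intro continuous_intros continuous_on_compose2[OF h(1) q(1)[OF that]] q(2)[OF that]) auto
  have zeq: "q i s = q j t" if "i \<in> I" "j \<in> I" "s \<in> {0..1}" "t \<in> {0..1}" "z i s = z j t" for i j s t
    using that hx by (intro hinj qK) (auto simp: z_def)
  have sq: "(Re (z i t))\<^sup>2 + (Im (z i t))\<^sup>2 = 1" if "i \<in> I" "t \<in> {0..1}" for i t
    using zn[OF that] by (metis cmod_power2 one_power2)
  have "\<exists>\<tau>. 0 < \<tau> \<and> \<tau> \<le> 1 \<and> (\<forall>t\<in>{0..\<tau>}. Re (z i t) > 0)" if i: "i \<in> I" for i
  proof -
    have "continuous_on {0..1} (\<lambda>t. Re (z i t))" by (intro continuous_intros zc i)
    then have "\<exists>d>0. \<forall>t\<in>{0..1}. dist t 0 < d \<longrightarrow> dist (Re (z i t)) (Re (z i 0)) < 1"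
      unfolding continuous_on_iff using zero_less_one atLeastAtMost_iff by (metis order_refl zero_le_one)
    then obtain d where d: "d > 0" "\<And>t. t \<in> {0..1} \<Longrightarrow> dist t 0 < d \<Longrightarrow> dist (Re (z i t)) 1 < 1"
      unfolding z0[OF i] by auto
    show ?thesis
    proof (intro exI[of _ "min 1 ((1/2) * d)"] conjI ballI)
      fix t assume "t \<in> {0..min 1 ((1/2) * d)}"
      then have "dist (Re (z i t)) 1 < 1" using d by (intro d(2)) (auto simp: dist_real_def)
      then show "Re (z i t) > 0" by (auto simp: dist_real_def abs_less_iff)
    qed (use d in auto)
  qed
  then obtain \<tau> where \<tau>: "\<And>i. i \<in> I \<Longrightarrow> 0 < \<tau> i \<and> \<tau> i \<le> 1 \<and> (\<forall>t\<in>{0..\<tau> i}. Re (z i t) > 0)" by metis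
  have fin: "finite I" using I card.infinite by fastforce
  \<comment> \<open>Three branches but only two signs: two of the branches leave on the same
    side.\<close>
  have "\<not> inj_on (\<lambda>i. Im (z i (\<tau> i)) > 0) I"
  proof
    assume "inj_on (\<lambda>i. Im (z i (\<tau> i)) > 0) I"
    then have "card I \<le> card (UNIV :: bool set)" by (intro card_inj_on_le) auto
    then show False using I by simp
  qed
  then obtain i j where ij: "i \<in> I" "j \<in> I" "i \<noteq> j" "(Im (z i (\<tau> i)) > 0) = (Im (z j (\<tau> j)) > 0)"
    unfolding inj_on_def by blast
  have nz: "Im (z i (\<tau> i)) \<noteq> 0" if i: "i \<in> I" for i
  proof
    assume im: "Im (z i (\<tau> i)) = 0"
    have t: "\<tau> i \<in> {0..1}" "Re (z i (\<tau> i)) > 0" using \<tau>[OF i] by auto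
    have "(Re (z i (\<tau> i)))\<^sup>2 = 1" using sq[OF i t(1)] im by simp
    then have "Re (z i (\<tau> i)) = 1" using t(2) by (simp add: power2_eq_1_iff)
    then have "z i (\<tau> i) = z i 0" using im z0[OF i] by (simp add: complex_eq_iff)
    then have "q i (\<tau> i) = q i 0" using zeq[OF i i t(1), of 0] by simp
    then have "\<tau> i = 0" using q(4)[OF i] t(1) by (meson atLeastAtMost_iff inj_onD order_refl zero_le_one)
    then show False using \<tau>[OF i] by simp
  qed
  define \<sigma> where "\<sigma> = (if Im (z i (\<tau> i)) > 0 then 1 else - 1 :: real)"
  have pos: "\<sigma> * Im (z i (\<tau> i)) > 0" "\<sigma> * Im (z j (\<tau> j)) > 0"
    using ij(4) nz[OF ij(1)] nz[OF ij(2)] by (auto simp: \<sigma>_def)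
  \<comment> \<open>A height that both branches reach by the intermediate value theorem. Where the
    real part is positive, equal heights mean equal points.\<close>
  define m where "m = min (\<sigma> * Im (z i (\<tau> i))) (\<sigma> * Im (z j (\<tau> j)))"
  have m: "m > 0" using pos by (simp add: m_def)
  have hit: "\<exists>t. 0 < t \<and> t \<le> \<tau> l \<and> \<sigma> * Im (z l t) = m" if l: "l \<in> {i, j}" for l
  proof -
    have lI: "l \<in> I" using l ij by auto
    have "continuous_on {0..\<tau> l} (\<lambda>t. \<sigma> * Im (z l t))"
      using zc[OF lI] \<tau>[OF lI] by (intro continuous_intros) (auto intro: continuous_on_subset)
    moreover have "m \<le> \<sigma> * Im (z l (\<tau> l))" using l by (auto simp: m_def)
    ultimately obtain t where t: "0 \<le> t" "t \<le> \<tau> l" "\<sigma> * Im (z l t) = m"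
      using IVT'[of "\<lambda>t. \<sigma> * Im (z l t)" 0 m "\<tau> l"] m z0[OF lI] \<tau>[OF lI] by auto
    moreover have "t \<noteq> 0" using t m z0[OF lI] by auto
    ultimately show ?thesis by (intro exI[of _ t]) auto
  qed
  obtain s where s: "0 < s" "s \<le> \<tau> i" "\<sigma> * Im (z i s) = m" using hit[of i] by auto
  obtain t where t: "0 < t" "t \<le> \<tau> j" "\<sigma> * Im (z j t) = m" using hit[of j] by auto
  have s01: "s \<in> {0<..1}" "s \<in> {0..1}" and t01: "t \<in> {0<..1}" "t \<in> {0..1}" using s t \<tau>[OF ij(1)] \<tau>[OF ij(2)] by auto
  have re: "Re (z i s) > 0" "Re (z j t) > 0" using s t \<tau>[OF ij(1)] \<tau>[OF ij(2)] by auto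
  have im: "Im (z i s) = Im (z j t)" using s(3) t(3) by (auto simp: \<sigma>_def split: if_splits)
  have "(Re (z i s))\<^sup>2 = (Re (z j t))\<^sup>2" using sq[OF ij(1) s01(2)] sq[OF ij(2) t01(2)] im by simp
  then have "Re (z i s) = Re (z j t)" using re by (simp add: power2_eq_iff)
  then have "z i s = z j t" using im by (simp add: complex_eq_iff)
  then have "q i s = q j t" by (rule zeq[OF ij(1,2) s01(2) t01(2)])
  then show False using disj[OF ij(1-3) s01(1) t01(1)] by simp
qed

section \<open>Concatenation and reversal of PL paths\<close>

lemma pl_joinpaths:
  fixes g1 g2 :: "real \<Rightarrow> 'a::euclidean_space"
  assumes "pl_on {0..1} g1" "pl_on {0..1} g2" "pathfinish g1 = pathstart g2"
  shows "pl_on {0..1} (g1 +++ g2)"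
proof -
  have a: "pl_on {0..1/2} (\<lambda>x::real. 2 * x)" by (intro pl_on_mult pl_on_id polyhedral_interval)
  have b: "pl_on {1/2..1} (\<lambda>x::real. 2 * x - 1)"
    by (intro pl_on_diff pl_on_mult pl_on_id pl_on_const polyhedral_interval)
  have "pl_on {0..1/2} (\<lambda>x. g1 (2 * x))" by (rule pl_on_compose[OF a assms(1)]) auto
  then have 1: "pl_on {0..1/2} (g1 +++ g2)" by (rule pl_on_cong) (simp add: joinpaths_def)
  have "pl_on {1/2..1} (\<lambda>x. g2 (2 * x - 1))" by (rule pl_on_compose[OF b assms(2)]) auto
  then have 2: "pl_on {1/2..1} (g1 +++ g2)"
  proof (rule pl_on_cong)
    fix x :: real assume x: "x \<in> {1/2..1}"
    show "g2 (2 * x - 1) = (g1 +++ g2) x"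
    proof (cases "x = 1/2")
      case True
      show ?thesis unfolding True using assms(3) by (simp add: joinpaths_def pathfinish_def pathstart_def)
    qed (use x in \<open>simp add: joinpaths_def\<close>)
  qed
  have "{0..1} = {0..1/2} \<union> {1/2..1::real}" by auto
  then show ?thesis using pl_on_Un[OF 1 2] by simp
qed

lemma pl_reversepath: "pl_on {0..1} g \<Longrightarrow> pl_on {0..1} (reversepath g)"
  for g :: "real \<Rightarrow> 'a::euclidean_space"
proof -
  assume g: "pl_on {0..1} g"
  have "pl_on {0..1} (\<lambda>x::real. 1 - x)" by (intro pl_on_diff pl_on_id pl_on_const polyhedral_interval)
  then have "pl_on {0..1} (\<lambda>x. g (1 - x))" by (rule pl_on_compose[OF _ g]) auto
  then show ?thesis by (simp add: reversepath_def[abs_def])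
qed


section \<open>Edges and the underlying space of a graph\<close>

definition closed_edge :: "('v, 'e) pre_digraph \<Rightarrow> 'e \<Rightarrow> ('v, 'e) gpoint set" where
  "closed_edge G e = edge_param G e ` {0..1}"

lemma edge_param_simps [simp]: "edge_param G e 0 = Vertex (tail G e)" "edge_param G e 1 = Vertex (head G e)"
  by (auto simp: edge_param_def)

lemma Vertex_edge_param: "Vertex v = edge_param G e t \<longleftrightarrow> (t = 0 \<and> v = tail G e) \<or> (t = 1 \<and> v = head G e)"
  by (auto simp: edge_param_def)

lemma edge_param_eq:
  "edge_param G e s = edge_param G e' t \<longleftrightarrow>
    (e = e' \<and> s = t) \<or> (s \<in> {0, 1} \<and> t \<in> {0, 1} \<and>
      (if s = 0 then tail G e else head G e) = (if t = 0 then tail G e' else head G e'))"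
  by (auto simp: edge_param_def)

lemma closed_edge_explicit:
  "closed_edge G e = {Vertex (tail G e), Vertex (head G e)} \<union> {Inner e t | t. 0 < t \<and> t < 1}"
proof
  show "closed_edge G e \<subseteq> {Vertex (tail G e), Vertex (head G e)} \<union> {Inner e t | t. 0 < t \<and> t < 1}"
    unfolding closed_edge_def by (auto simp: edge_param_def)
  have "Inner e t \<in> closed_edge G e" if "0 < t" "t < 1" for t
    unfolding closed_edge_def using that by (intro image_eqI[of _ _ t]) (auto simp: edge_param_def)
  moreover have "Vertex (tail G e) \<in> closed_edge G e" "Vertex (head G e) \<in> closed_edge G e"
    unfolding closed_edge_def by (metis atLeastAtMost_iff edge_param_simps image_eqI order_refl zero_le_one)+
  ultimately show "{Vertex (tail G e), Vertex (head G e)} \<union> {Inner e t | t. 0 < t \<and> t < 1} \<subseteq> closed_edge G e"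
    by auto
qed

lemma realization_eq:
  assumes "wf_digraph G"
  shows "realization G = Vertex ` verts G \<union> (\<Union>e\<in>arcs G. closed_edge G e)"
  unfolding realization_def closed_edge_explicit
  using wf_digraph.tail_in_verts[OF assms] wf_digraph.head_in_verts[OF assms] by auto

lemma realization_subgraph: "subgraph C G \<Longrightarrow> realization C \<subseteq> realization G"
  unfolding subgraph_def realization_def by auto

lemma subgraph_tail_head:
  assumes "subgraph C G" shows "tail C = tail G" "head C = head G"
  using assms unfolding subgraph_def compatible_def by auto

lemma subgraph_edge_param: "subgraph C G \<Longrightarrow> edge_param C = edge_param G"
  by (intro ext) (simp add: edge_param_def subgraph_tail_head)

lemma spatial_embedding_subgraph:
  assumes "spatial_embedding G f" "subgraph C G"
  shows "spatial_embedding C f"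
proof -
  have "arcs C \<subseteq> arcs G" using assms(2) unfolding subgraph_def by simp
  then show ?thesis
    using assms(1) realization_subgraph[OF assms(2)] inj_on_subset
    unfolding spatial_embedding_def subgraph_edge_param[OF assms(2)] by blast
qed

lemma subgraph_fin:
  assumes "subgraph C G" "fin_digraph G" shows "fin_digraph C"
proof -
  interpret G: fin_digraph G by fact
  interpret C: wf_digraph C using assms(1) unfolding subgraph_def by simp
  show ?thesis
    using assms(1) finite_subset[OF _ G.finite_verts] finite_subset[OF _ G.finite_arcs]
    by unfold_locales (auto simp: subgraph_def)
qed

lemma edge_path:
  assumes "spatial_embedding G f" "e \<in> arcs G"
  shows "pl_on {0..1} (\<lambda>t. f (edge_param G e t))" "continuous_on {0..1} (\<lambda>t. f (edge_param G e t))"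
  using assms pl_on_imp_continuous_on unfolding spatial_embedding_def by blast+

lemma closed_edge_image: "f ` closed_edge G e = (\<lambda>t. f (edge_param G e t)) ` {0..1}"
  unfolding closed_edge_def image_image ..

lemma polyhedral_edge: "spatial_embedding G f \<Longrightarrow> e \<in> arcs G \<Longrightarrow> polyhedral (f ` closed_edge G e)"
  unfolding closed_edge_image by (intro polyhedral_image edge_path)

lemma polyhedral_finite: "finite X \<Longrightarrow> polyhedral X"
  using polyhedral_UN[of X "\<lambda>x. {x}", OF _ polyhedral_sing] by simp

lemma topspace_realization [simp]: "topspace (realization_topology G) = realization G" if "wf_digraph G"
proof -
  have "edge_param G e t \<in> realization G" if "e \<in> arcs G" "t \<in> {0..1}" for e t
    unfolding realization_eq[OF \<open>wf_digraph G\<close>] closed_edge_def using that by blast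
  then have "{t \<in> {0..1}. edge_param G e t \<in> realization G} = {0..1}" if "e \<in> arcs G" for e
    using that by blast
  then have "openin (realization_topology G) (realization G)"
    unfolding openin_realization_topology by simp
  then show ?thesis
    by (meson openin_realization_topology openin_subset openin_topspace subset_antisym)
qed

text \<open>Continuity is built into the quotient topology. A closed set consists of finitely many
  vertices and compact parts of edges, so its image is compact; an injective closed continuous map
  is a homeomorphism onto its image. Thus cycles can be recognised from a single embedding.\<close>

lemma realization_homeomorphic_image:
  assumes f: "spatial_embedding G f" and G: "fin_digraph G"
  shows "realization_topology G homeomorphic_space top_of_set (f ` realization G)"
proof -
  interpret G: fin_digraph G by fact
  have wf: "wf_digraph G" by unfold_locales
  have top: "topspace (realization_topology G) = realization G" by (rule topspace_realization[OF wf])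
  have inj: "inj_on f (realization G)" using f unfolding spatial_embedding_def by simp
  have in_r: "edge_param G e t \<in> realization G" if "e \<in> arcs G" "t \<in> {0..1}" for e t
    unfolding realization_eq[OF wf] closed_edge_def using that by blast
  have "continuous_map (realization_topology G) (top_of_set (f ` realization G)) f"
    unfolding continuous_map_in_subtopology
  proof
    show "continuous_map (realization_topology G) euclidean f"
      unfolding continuous_map_alt
    proof (intro conjI allI impI)
      fix U :: "(real^4) set" assume U: "openin euclidean U"
      show "openin (realization_topology G) (f -` U \<inter> topspace (realization_topology G))"
        unfolding openin_realization_topology top
      proof (intro conjI ballI)
        fix e assume e: "e \<in> arcs G"
        have "{t \<in> {0..1}. edge_param G e t \<in> f -` U \<inter> realization G} = {0..1} \<inter> (\<lambda>t. f (edge_param G e t)) -` U"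
          using in_r[OF e] by auto
        then show "openin (top_of_set {0..1}) {t \<in> {0..1}. edge_param G e t \<in> f -` U \<inter> realization G}"
          using continuous_openin_preimage_gen[OF edge_path(2)[OF f e], of U] U by simp
      qed auto
    qed simp
  qed (simp add: top)
  moreover have "closed_map (realization_topology G) (top_of_set (f ` realization G)) f"
    unfolding closed_map_def
  proof (intro allI impI)
    fix S assume S: "closedin (realization_topology G) S"
    then have Sr: "S \<subseteq> realization G" using closedin_subset top by metis
    have cl: "compact {t \<in> {0..1}. edge_param G e t \<in> S}" if e: "e \<in> arcs G" for e
    proof -
      have "openin (realization_topology G) (realization G - S)" using S unfolding closedin_def top by simp
      then have "openin (top_of_set {0..1}) {t \<in> {0..1}. edge_param G e t \<in> realization G - S}"
        using e unfolding openin_realization_topology by simp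
      moreover have "{t \<in> {0..1}. edge_param G e t \<in> realization G - S} = {0..1} - {t \<in> {0..1}. edge_param G e t \<in> S}"
        using in_r[OF e] by auto
      ultimately have "openin (top_of_set {0..1}) ({0..1} - {t \<in> {0..1}. edge_param G e t \<in> S})" by simp
      then have "closedin (top_of_set {0..1}) {t \<in> {0..1}. edge_param G e t \<in> S}"
        unfolding closedin_def by auto
      then show ?thesis by (rule closedin_compact[OF compact_Icc])
    qed
    have "f ` S = f ` (S \<inter> Vertex ` verts G) \<union> (\<Union>e\<in>arcs G. (\<lambda>t. f (edge_param G e t)) ` {t \<in> {0..1}. edge_param G e t \<in> S})"
    proof -
      have "S = (S \<inter> Vertex ` verts G) \<union> (\<Union>e\<in>arcs G. edge_param G e ` {t \<in> {0..1}. edge_param G e t \<in> S})"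
        using Sr unfolding realization_eq[OF wf] closed_edge_def by blast
      then have "f ` S = f ` ((S \<inter> Vertex ` verts G) \<union> (\<Union>e\<in>arcs G. edge_param G e ` {t \<in> {0..1}. edge_param G e t \<in> S}))"
        by simp
      then show ?thesis unfolding image_Un image_UN image_image .
    qed
    moreover have "compact \<dots>"
    proof (intro compact_Un compact_UN G.finite_arcs compact_continuous_image cl)
      show "compact (f ` (S \<inter> Vertex ` verts G))" by (intro finite_imp_compact) simp
      show "continuous_on {t \<in> {0..1}. edge_param G e t \<in> S} (\<lambda>t. f (edge_param G e t))" if "e \<in> arcs G" for e
        by (rule continuous_on_subset[OF edge_path(2)[OF f that]]) auto
    qed
    ultimately have "closed (f ` S)" using compact_imp_closed by simp
    then show "closedin (top_of_set (f ` realization G)) (f ` S)" using Sr by (intro closed_subset) auto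
  qed
  ultimately have "homeomorphic_map (realization_topology G) (top_of_set (f ` realization G)) f"
    using inj by (intro bijective_closed_imp_homeomorphic_map) (simp_all add: top)
  then show ?thesis by (rule homeomorphic_map_imp_homeomorphic_space)
qed

lemma mem_cycles_iff:
  assumes "spatial_embedding G f" "fin_digraph G"
  shows "C \<in> cycles G \<longleftrightarrow> subgraph C G \<and> f ` realization C homeomorphic sphere (0::complex) 1"
proof (cases "subgraph C G")
  case True
  have "realization_topology C homeomorphic_space top_of_set (f ` realization C)"
    by (rule realization_homeomorphic_image[OF spatial_embedding_subgraph[OF assms(1) True] subgraph_fin[OF True assms(2)]])
  then have "realization_topology C homeomorphic_space top_of_set (sphere (0::complex) 1) \<longleftrightarrow>
      top_of_set (f ` realization C) homeomorphic_space top_of_set (sphere (0::complex) 1)"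
    by (meson homeomorphic_space_sym homeomorphic_space_trans)
  then show ?thesis using True by (simp add: cycles_def homeomorphic_space_top_of_set)
qed (simp add: cycles_def)

section \<open>Degrees of vertices\<close>

definition incid :: "('v, 'e) pre_digraph \<Rightarrow> 'e \<Rightarrow> 'v \<Rightarrow> nat" where
  "incid G e v = of_bool (tail G e = v) + of_bool (head G e = v)"

definition deg :: "('v, 'e) pre_digraph \<Rightarrow> 'e set \<Rightarrow> 'v \<Rightarrow> nat" where
  "deg G E v = (\<Sum>e\<in>E. incid G e v)"

text \<open>Half-edges: the flag selects head or tail, so a loop contributes two darts at its
  vertex, in agreement with its degree.\<close>

definition darts :: "('v, 'e) pre_digraph \<Rightarrow> 'v \<Rightarrow> ('e \<times> bool) set" where
  "darts G v = {(e, b). e \<in> arcs G \<and> (if b then head G e else tail G e) = v}"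

lemma card_darts:
  assumes "finite (arcs G)" shows "card (darts G v) = deg G (arcs G) v" "finite (darts G v)"
proof -
  have d: "darts G v = (\<lambda>e. (e, False)) ` {e \<in> arcs G. tail G e = v} \<union> (\<lambda>e. (e, True)) ` {e \<in> arcs G. head G e = v}"
    unfolding darts_def by auto
  show "finite (darts G v)" unfolding d using assms by simp
  have "card (darts G v) = card {e \<in> arcs G. tail G e = v} + card {e \<in> arcs G. head G e = v}"
    unfolding d using assms by (subst card_Un_disjoint) (auto simp: card_image inj_on_def)
  also have "\<dots> = deg G (arcs G) v"
    unfolding deg_def incid_def sum.distrib using assms by (simp add: of_bool_def sum.If_cases Int_def)
  finally show "card (darts G v) = deg G (arcs G) v" .
qed

text \<open>Three darts would give three branches leaving a point of the circle, no dart would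
  isolate a point of it, and a single dart would make the midpoint of its edge a cut point.\<close>

lemma deg_cycle:
  assumes f: "spatial_embedding G f" and G: "fin_digraph G"
    and circle: "f ` realization G homeomorphic sphere (0::complex) 1" and v: "v \<in> verts G"
  shows "deg G (arcs G) v = 2"
proof -
  interpret G: fin_digraph G by fact
  have wf: "wf_digraph G" by unfold_locales
  have inj: "inj_on f (realization G)" using f unfolding spatial_embedding_def by simp
  note r_eq = realization_eq[OF wf]
  have in_r: "edge_param G e t \<in> realization G" if "e \<in> arcs G" "t \<in> {0..1}" for e t
    unfolding r_eq closed_edge_def using that by blast
  have vr: "Vertex w \<in> realization G" if "w \<in> verts G" for w unfolding r_eq using that by blast
  note fin = card_darts[OF G.finite_arcs]
  have "\<not> card (darts G v) \<ge> 3"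
  proof
    assume "card (darts G v) \<ge> 3"
    then obtain I where I: "I \<subseteq> darts G v" "card I = 3" by (meson obtain_subset_with_card_n)
    \<comment> \<open>Only the third of the edge next to \<open>v\<close> is used, so that the two
      darts of a loop give disjoint branches.\<close>
    define u where "u b t = (if b then 1 - (1/3) * t else (1/3) * t)" for b and t :: real
    define q where "q i t = f (edge_param G (fst i) (u (snd i) t))" for i t
    have u01: "u b t \<in> {0..1}" if "t \<in> {0..1}" for b t using that by (auto simp: u_def)
    have uinj: "u b s = u b t \<Longrightarrow> s = t" for b s t by (auto simp: u_def split: if_splits)
    have u_in: "0 < u b t \<and> u b t < 1" if "t \<in> {0<..1}" for b t using that by (auto simp: u_def)
    have u0: "edge_param G e (u b 0) = Vertex (if b then head G e else tail G e)" for e b by (simp add: u_def)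
    have arc: "fst i \<in> arcs G" if "i \<in> I" for i using that I(1) unfolding darts_def by auto
    show False
    proof (rule circle_no_three_branches[OF circle I(2)])
      fix i assume i: "i \<in> I"
      have "continuous_on {0..1} (u (snd i))" unfolding u_def by (cases "snd i") (auto intro!: continuous_intros)
      then show "continuous_on {0..1} (q i)" unfolding q_def
        by (rule continuous_on_compose2[OF edge_path(2)[OF f arc[OF i]]]) (use u01 in blast)
      show "q i ` {0..1} \<subseteq> f ` realization G" unfolding q_def using in_r[OF arc[OF i] u01] by blast
      show "q i 0 = f (Vertex v)" unfolding q_def u0 using i I(1) by (auto simp: darts_def)
      show "inj_on (q i) {0..1}"
      proof (rule inj_onI)
        fix s t assume st: "s \<in> {0..1}" "t \<in> {0..1}" "q i s = q i t"
        then have "edge_param G (fst i) (u (snd i) s) = edge_param G (fst i) (u (snd i) t)"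
          unfolding q_def using inj_onD[OF inj _ in_r[OF arc[OF i] u01] in_r[OF arc[OF i] u01]] by blast
        moreover have "\<not> (u (snd i) s \<in> {0, 1} \<and> u (snd i) t \<in> {0, 1}) \<or> s = t"
        proof -
          have "u (snd i) x \<in> {0, 1} \<Longrightarrow> x = 0" if "x \<in> {0..1}" for x
            using u_in[of x "snd i"] that by (cases "x = 0") auto
          then show ?thesis using st by auto
        qed
        ultimately show "s = t" unfolding edge_param_eq using uinj by auto
      qed
    next
      fix i j s t assume ij: "i \<in> I" "j \<in> I" "i \<noteq> j" "s \<in> {0<..1::real}" "t \<in> {0<..1::real}"
      show "q i s \<noteq> q j t"
      proof
        assume "q i s = q j t"
        then have "edge_param G (fst i) (u (snd i) s) = edge_param G (fst j) (u (snd j) t)"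
          unfolding q_def using inj_onD[OF inj _ in_r[OF arc[OF ij(1)] u01] in_r[OF arc[OF ij(2)] u01]] ij(4,5) by auto
        then have *: "fst i = fst j" "u (snd i) s = u (snd j) t"
          unfolding edge_param_eq using u_in[OF ij(4), of "snd i"] by auto
        then have "snd i \<noteq> snd j" using ij(3) by (auto simp: prod_eq_iff)
        then show False using *(2) ij(4,5) by (auto simp: u_def split: if_splits)
      qed
    qed
  qed
  moreover have "card (darts G v) \<noteq> 0"
  proof
    assume "card (darts G v) = 0"
    then have "darts G v = {}" using fin(2) by simp
    then have "(e, False) \<notin> darts G v" "(e, True) \<notin> darts G v" for e by simp_all
    then have no: "tail G e \<noteq> v" "head G e \<noteq> v" if "e \<in> arcs G" for e
      using that by (simp_all add: darts_def)
    let ?B = "Vertex ` (verts G - {v}) \<union> (\<Union>e\<in>arcs G. closed_edge G e)"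
    have r: "realization G = insert (Vertex v) ?B" unfolding r_eq using v by auto
    have vB: "Vertex v \<notin> ?B" using no unfolding closed_edge_explicit by auto
    define K B where "K = f ` realization G" and "B = f ` ?B"
    have B: "closed B" unfolding B_def image_Un image_UN
      by (intro polyhedral_closed polyhedral_Un polyhedral_UN polyhedral_edge[OF f] polyhedral_finite) auto
    have fB: "f (Vertex v) \<notin> B" unfolding B_def
    proof -
      have sub: "?B \<subseteq> realization G" unfolding r by blast
      show "f (Vertex v) \<notin> f ` ?B" unfolding inj_on_image_mem_iff[OF inj vr[OF v] sub] by (rule vB)
    qed
    have K: "K = insert (f (Vertex v)) B" unfolding K_def B_def r by simp
    have "B \<noteq> {}"
      using circle_not_singleton[of "f (Vertex v)"] circle unfolding K_def[symmetric] K by auto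
    then have "{f (Vertex v)} \<inter> B \<inter> K = {}" "{f (Vertex v)} \<inter> K \<noteq> {}" "B \<inter> K \<noteq> {}" "K \<subseteq> {f (Vertex v)} \<union> B"
      using fB unfolding K by auto
    moreover have "Topological_Spaces.connected K" unfolding K_def by (rule circle_connected[OF circle])
    ultimately show False using B closed_singleton unfolding connected_closed by blast
  qed
  moreover have "card (darts G v) \<noteq> 1"
  proof
    assume "card (darts G v) = 1"
    then obtain e b where eb: "darts G v = {(e, b)}" by (metis card_1_singletonE surj_pair)
    then have "(e, b) \<in> darts G v" by simp
    then have e: "e \<in> arcs G" "(if b then head G e else tail G e) = v" by (auto simp: darts_def)
    have other: "tail G e' \<noteq> v" "head G e' \<noteq> v" if "e' \<in> arcs G" "e' \<noteq> e" for e'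
    proof -
      have "(e', False) \<notin> darts G v" "(e', True) \<notin> darts G v" using that(2) unfolding eb by auto
      then show "tail G e' \<noteq> v" "head G e' \<noteq> v" using that(1) by (auto simp: darts_def)
    qed
    have far: "(if b then tail G e else head G e) \<noteq> v"
    proof -
      have "(e, \<not> b) \<notin> darts G v" unfolding eb by simp
      then show ?thesis using e(1) by (cases b) (auto simp: darts_def)
    qed
    let ?y = "Inner e (1/2)"
    \<comment> \<open>\<open>A\<close> is the half of the edge at \<open>v\<close>, a dead end;
      removing the midpoint separates it from everything else.\<close>
    define A where "A = (if b then edge_param G e ` {1/2..1} else edge_param G e ` {0..1/2})"
    define A' where "A' = (if b then edge_param G e ` {0..1/2} else edge_param G e ` {1/2..1})"
    define B where "B = A' \<union> Vertex ` (verts G - {v}) \<union> (\<Union>e'\<in>arcs G - {e}. closed_edge G e')"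
    have AA': "closed_edge G e = A \<union> A'"
    proof -
      have "{0..1} = {0..1/2} \<union> {1/2..1::real}" by auto
      then show ?thesis unfolding closed_edge_def A_def A'_def by (simp add: image_Un Un_commute)
    qed
    have vA: "Vertex v \<in> A" using e(2) unfolding A_def by (auto simp: Vertex_edge_param split: if_splits)
    have wA': "Vertex (if b then tail G e else head G e) \<in> A'"
      unfolding A'_def by (auto simp: Vertex_edge_param)
    have r: "realization G = A \<union> B"
      unfolding r_eq B_def using AA' vA e(1) v by blast
    have AB: "A \<inter> B \<subseteq> {?y}"
    proof
      fix x assume x: "x \<in> A \<inter> B"
      have A_ex: "x = Vertex v \<or> (\<exists>t. x = Inner e t \<and> 0 < t \<and> t < 1 \<and> (if b then t \<ge> 1/2 else t \<le> 1/2))"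
        using x e(2) unfolding A_def by (auto simp: edge_param_def split: if_splits)
      show "x \<in> {?y}"
      proof (cases "x = Vertex v")
        case True
        then have "x \<notin> Vertex ` (verts G - {v})" "x \<notin> (\<Union>e'\<in>arcs G - {e}. closed_edge G e')"
          using other unfolding closed_edge_explicit by auto
        moreover have "x \<notin> A'" using True far e(2) unfolding A'_def by (auto simp: Vertex_edge_param split: if_splits)
        ultimately show ?thesis using x unfolding B_def by blast
      next
        case False
        then obtain t where t: "x = Inner e t" "0 < t" "t < 1" "if b then t \<ge> 1/2 else t \<le> 1/2" using A_ex by blast
        then have "x \<in> A'" using x unfolding B_def closed_edge_explicit by auto
        then have "if b then t \<le> 1/2 else t \<ge> 1/2" using t(1) unfolding A'_def by (auto simp: edge_param_def split: if_splits)
        then show ?thesis using t by (auto split: if_splits)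
      qed
    qed
    have half: "compact (f ` edge_param G e ` {0..1/2})" "compact (f ` edge_param G e ` {1/2..1})"
      unfolding image_image
      by (intro compact_continuous_image continuous_on_subset[OF edge_path(2)[OF f e(1)]]; auto)+
    then have clA: "closed (f ` A)" "closed (f ` A')" unfolding A_def A'_def by (auto simp: compact_imp_closed)
    have clB: "closed (f ` B)" unfolding B_def image_Un image_UN
      by (intro closed_Un clA polyhedral_closed polyhedral_UN polyhedral_edge[OF f] polyhedral_finite) auto
    have yr: "?y \<in> realization G" using in_r[OF e(1), of "1/2"] by (simp add: edge_param_def)
    have conn: "Topological_Spaces.connected (f ` realization G - {f ?y})"
      by (rule circle_punctured_connected[OF circle]) (use yr in blast)
    have fv: "f (Vertex v) \<in> f ` realization G - {f ?y}"
      using inj_onD[OF inj _ vr[OF v] yr] vr[OF v] by auto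
    have wv: "(if b then tail G e else head G e) \<in> verts G" using e(1) by simp
    have fw: "f (Vertex (if b then tail G e else head G e)) \<in> f ` realization G - {f ?y}"
      using inj_onD[OF inj _ vr[OF wv] yr] vr[OF wv] by auto
    have "f ` A \<inter> f ` B \<subseteq> {f ?y}"
    proof -
      have "f ` A \<inter> f ` B = f ` (A \<inter> B)"
        by (rule inj_on_image_Int[OF inj, symmetric]) (simp_all add: r)
      then show ?thesis using image_mono[OF AB, of f] by simp
    qed
    then have "f ` A \<inter> f ` B \<inter> (f ` realization G - {f ?y}) = {}" by blast
    moreover have "f ` realization G - {f ?y} \<subseteq> f ` A \<union> f ` B" unfolding r image_Un by simp
    moreover have "f ` A \<inter> (f ` realization G - {f ?y}) \<noteq> {}" using fv imageI[OF vA, of f] by auto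
    moreover have "f ` B \<inter> (f ` realization G - {f ?y}) \<noteq> {}"
    proof -
      have "f (Vertex (if b then tail G e else head G e)) \<in> f ` B" using wA' by (intro imageI) (simp add: B_def)
      then show ?thesis using fw by (metis IntI empty_iff)
    qed
    ultimately have "\<exists>A B. closed A \<and> closed B \<and> f ` realization G - {f ?y} \<subseteq> A \<union> B \<and>
        A \<inter> B \<inter> (f ` realization G - {f ?y}) = {} \<and> A \<inter> (f ` realization G - {f ?y}) \<noteq> {} \<and> B \<inter> (f ` realization G - {f ?y}) \<noteq> {}"
      using clA(1) clB by (intro exI[of _ "f ` A"] exI[of _ "f ` B"] conjI)
    then show False using conn unfolding connected_closed by simp
  qed
  ultimately show ?thesis using fin(1)[of v] by linarith
qed


lemma deg_insert: "finite E \<Longrightarrow> e \<notin> E \<Longrightarrow> deg G (insert e E) v = incid G e v + deg G E v"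
  by (simp add: deg_def)

lemma deg_mono: "finite F \<Longrightarrow> E \<subseteq> F \<Longrightarrow> deg G E v \<le> deg G F v"
  unfolding deg_def by (rule sum_mono2) auto

lemma deg_split: "finite F \<Longrightarrow> E \<subseteq> F \<Longrightarrow> deg G F v = deg G E v + deg G (F - E) v"
  unfolding deg_def using sum.subset_diff[of E F "\<lambda>e. incid G e v"] by simp

lemma deg_pos_iff: "finite E \<Longrightarrow> deg G E v > 0 \<longleftrightarrow> (\<exists>e\<in>E. v \<in> ends G e)"
proof -
  assume "finite E"
  then have "deg G E v = 0 \<longleftrightarrow> (\<forall>e\<in>E. incid G e v = 0)" unfolding deg_def by simp
  moreover have "incid G e v = 0 \<longleftrightarrow> v \<notin> ends G e" for e unfolding incid_def ends_def by auto
  ultimately show ?thesis by auto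
qed

lemma deg_pos: "finite E \<Longrightarrow> e \<in> E \<Longrightarrow> v \<in> ends G e \<Longrightarrow> deg G E v > 0"
  unfolding deg_pos_iff by (rule bexI)

lemma deg_zero:
  assumes "\<And>e. e \<in> E \<Longrightarrow> v \<notin> ends G e" shows "deg G E v = 0"
  unfolding deg_def by (rule sum.neutral) (use assms in \<open>auto simp: incid_def ends_def\<close>)

lemma incid_ends: "a \<noteq> b \<Longrightarrow> ends G e = {a, b} \<Longrightarrow> incid G e v = of_bool (v = a \<or> v = b)"
  unfolding ends_def incid_def by (auto simp: doubleton_eq_iff)

lemma incid_loop: "tail G e = head G e \<Longrightarrow> incid G e v = (if v = tail G e then 2 else 0)"
  unfolding incid_def by auto

section \<open>Two-regular subgraphs\<close>

text \<open>The combinatorial counterpart of a disjoint union of cycles; the graph without vertices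
  is included as the base of an induction.\<close>

definition two_regular :: "('v, 'e) pre_digraph \<Rightarrow> bool" where
  "two_regular G \<longleftrightarrow> (\<forall>v\<in>verts G. deg G (arcs G) v = 2)"

locale spatial_graph = fin_digraph G for G :: "('v, 'e) pre_digraph" +
  fixes f :: "('v, 'e) gpoint \<Rightarrow> real^4"
  assumes embedding: "spatial_embedding G f"
begin

lemma wf: "wf_digraph G" by unfold_locales

lemma inj: "inj_on f (realization G)" using embedding unfolding spatial_embedding_def by simp

lemma edge_in: "e \<in> arcs G \<Longrightarrow> closed_edge G e \<subseteq> realization G"
  unfolding realization_eq[OF wf] by blast

lemma edge_param_in: "e \<in> arcs G \<Longrightarrow> t \<in> {0..1} \<Longrightarrow> edge_param G e t \<in> realization G"
  using edge_in unfolding closed_edge_def by blast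

lemma ends_in: "e \<in> arcs G \<Longrightarrow> ends G e \<subseteq> verts G"
  unfolding ends_def by simp

lemma edges_meet:
  assumes "e \<in> arcs G" "e' \<in> arcs G" "e \<noteq> e'" "p \<in> f ` closed_edge G e" "p \<in> f ` closed_edge G e'"
  shows "\<exists>y\<in>ends G e \<inter> ends G e'. p = f (Vertex y)"
proof -
  obtain a where a: "a \<in> closed_edge G e" "p = f a" using assms(4) by (elim imageE)
  obtain a' where a': "a' \<in> closed_edge G e'" "p = f a'" using assms(5) by (elim imageE)
  have "a = a'"
    by (rule inj_onD[OF inj]) (use a a' edge_in[OF assms(1)] edge_in[OF assms(2)] in auto)
  then have m: "a \<in> closed_edge G e" "a \<in> closed_edge G e'" using a a' by simp_all
  show ?thesis
  proof (cases a)
    case (Vertex y)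
    then have "y \<in> ends G e" "y \<in> ends G e'" using m unfolding closed_edge_explicit ends_def by auto
    then show ?thesis using Vertex a(2) by blast
  next
    case (Inner e0 t)
    then have "e0 = e" "e0 = e'" using m unfolding closed_edge_explicit by auto
    then show ?thesis using assms(3) by simp
  qed
qed

lemma edge_arc:
  assumes e: "e \<in> arcs G" "ends G e = {a, b}" "a \<noteq> b"
  obtains g where "pl_on {0..1} g" "Path_Connected.arc g" "pathstart g = f (Vertex a)" "pathfinish g = f (Vertex b)"
    "path_image g = f ` closed_edge G e"
proof -
  define g where "g t = f (edge_param G e t)" for t
  have th: "tail G e \<noteq> head G e" using e(2,3) unfolding ends_def by auto
  have pl: "pl_on {0..1} g" unfolding g_def by (rule edge_path(1)[OF embedding e(1)])
  have "inj_on g {0..1}"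
  proof (rule inj_onI)
    fix s t :: real assume st: "s \<in> {0..1}" "t \<in> {0..1}" "g s = g t"
    have "edge_param G e s = edge_param G e t"
      using st(3) unfolding g_def by (rule inj_onD[OF inj _ edge_param_in[OF e(1) st(1)] edge_param_in[OF e(1) st(2)]])
    then show "s = t" using th unfolding edge_param_eq by (auto split: if_splits)
  qed
  then have g: "Path_Connected.arc g" unfolding Path_Connected.arc_def Path_Connected.path_def using pl_on_imp_continuous_on[OF pl] by simp
  have im: "path_image g = f ` closed_edge G e" unfolding path_image_def g_def[abs_def] closed_edge_image ..
  have se: "pathstart g = f (Vertex (tail G e))" "pathfinish g = f (Vertex (head G e))"
    by (simp_all add: pathstart_def pathfinish_def g_def)
  consider "a = tail G e" "b = head G e" | "a = head G e" "b = tail G e"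
    using e(2,3) unfolding ends_def by (auto simp: doubleton_eq_iff)
  then show thesis
  proof cases
    case 1
    show thesis by (rule that[OF pl g]) (use 1 se im in simp_all)
  next
    case 2
    show thesis
      by (rule that[of "reversepath g"]) (use 2 se im pl_reversepath[OF pl] arc_reversepath[OF g] in simp_all)
  qed
qed

lemma edge_loop:
  assumes e: "e \<in> arcs G" "tail G e = head G e"
  obtains g where "pl_on {0..1} g" "simple_path g" "pathfinish g = pathstart g" "path_image g = f ` closed_edge G e"
proof -
  define g where "g t = f (edge_param G e t)" for t
  have pl: "pl_on {0..1} g" unfolding g_def by (rule edge_path(1)[OF embedding e(1)])
  have "loop_free g"
    unfolding loop_free_def
  proof (intro ballI impI)
    fix s t :: real assume st: "s \<in> {0..1}" "t \<in> {0..1}" "g s = g t"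
    have "edge_param G e s = edge_param G e t"
      using st(3) unfolding g_def by (rule inj_onD[OF inj _ edge_param_in[OF e(1) st(1)] edge_param_in[OF e(1) st(2)]])
    then show "s = t \<or> s = 0 \<and> t = 1 \<or> s = 1 \<and> t = 0" unfolding edge_param_eq by auto
  qed
  then have "simple_path g" unfolding simple_path_def Path_Connected.path_def using pl_on_imp_continuous_on[OF pl] by simp
  moreover have "path_image g = f ` closed_edge G e" unfolding path_image_def g_def[abs_def] closed_edge_image ..
  ultimately show thesis using that pl e(2) by (simp add: pathstart_def pathfinish_def g_def)
qed

end

locale spatial_two_regular = spatial_graph G f
  for G :: "('v, 'e) pre_digraph" and f :: "('v, 'e) gpoint \<Rightarrow> real^4" +
  assumes reg: "two_regular G"
begin

text \<open>The state of a growing path: the arc \<open>q\<close> traverses exactly the edges in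
  \<open>E\<close>. By the degree conditions inner vertices are used up and each end has one
  incidence so far.\<close>

definition path_state :: "'e set \<Rightarrow> 'v \<Rightarrow> 'v \<Rightarrow> (real \<Rightarrow> real^4) \<Rightarrow> bool" where
  "path_state E a b q \<longleftrightarrow> E \<subseteq> arcs G \<and> a \<noteq> b \<and> pl_on {0..1} q \<and> Path_Connected.arc q \<and>
    pathstart q = f (Vertex a) \<and> pathfinish q = f (Vertex b) \<and> path_image q = (\<Union>e\<in>E. f ` closed_edge G e) \<and>
    deg G E a = 1 \<and> deg G E b = 1 \<and> (\<forall>y. y \<noteq> a \<longrightarrow> y \<noteq> b \<longrightarrow> deg G E y \<in> {0, 2})"

definition loop_state :: "'e set \<Rightarrow> (real \<Rightarrow> real^4) \<Rightarrow> bool" where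
  "loop_state E q \<longleftrightarrow> E \<subseteq> arcs G \<and> E \<noteq> {} \<and> pl_on {0..1} q \<and> simple_path q \<and> pathfinish q = pathstart q \<and>
    path_image q = (\<Union>e\<in>E. f ` closed_edge G e) \<and> (\<forall>y. deg G E y \<in> {0, 2})"

text \<open>In \<open>E\<close> the end \<open>b\<close> lacks exactly one of its two incidences, so
  the missing edge \<open>e\<close> is no loop. If its other end \<open>y\<close> is new, the path
  grows. Otherwise \<open>y\<close> cannot have degree 2 in \<open>E\<close>, since \<open>e\<close>
  would be a third edge there; so \<open>y = a\<close> and the path closes up.\<close>

lemma extend_path_state:
  assumes "path_state E a b q"
  shows "(\<exists>E' q'. loop_state E' q') \<or> (\<exists>E' y q'. path_state E' a y q' \<and> card E' = Suc (card E))"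
proof -
  have E: "E \<subseteq> arcs G" "a \<noteq> b" "pl_on {0..1} q" "Path_Connected.arc q" "pathstart q = f (Vertex a)" "pathfinish q = f (Vertex b)"
    "path_image q = (\<Union>e\<in>E. f ` closed_edge G e)" "deg G E a = 1" "deg G E b = 1"
    and Ey: "\<And>y. y \<noteq> a \<Longrightarrow> y \<noteq> b \<Longrightarrow> deg G E y \<in> {0, 2}"
    using assms unfolding path_state_def by auto
  have finE: "finite E" using finite_subset[OF E(1) finite_arcs] .
  have in_verts: "y \<in> verts G" if "deg G E y > 0" for y
  proof -
    from that obtain e where "e \<in> E" "y \<in> ends G e" unfolding deg_pos_iff[OF finE] by (elim bexE)
    then show ?thesis using E(1) ends_in[of e] by auto
  qed
  have "b \<in> verts G" using in_verts E(9) by simp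
  then have "deg G (arcs G) b = 2" using reg unfolding two_regular_def by blast
  then have rest: "deg G (arcs G - E) b = 1" using deg_split[OF finite_arcs E(1), of G b] E(9) by simp
  then obtain e where e: "e \<in> arcs G" "e \<notin> E" "b \<in> ends G e"
    using deg_pos_iff[of "arcs G - E" G b] finite_arcs by force
  \<comment> \<open>A loop would contribute 2, but only one incidence is left at
    \<open>b\<close>.\<close>
  have mle: "incid G e b \<le> 1"
  proof -
    have "deg G {e} b \<le> deg G (arcs G - E) b" using e finite_arcs by (intro deg_mono) auto
    then show ?thesis using rest by (simp add: deg_def)
  qed
  have nl: "tail G e \<noteq> head G e"
  proof
    assume l: "tail G e = head G e"
    then have "incid G e b = 2" using e(3) incid_loop[OF l, of b] unfolding ends_def by auto
    then show False using mle by simp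
  qed
  then obtain y where y: "ends G e = {b, y}" "b \<noteq> y" using e(3) unfolding ends_def by force
  have me: "incid G e z = of_bool (z = b \<or> z = y)" for z using incid_ends[OF y(2,1)] .
  have dI: "deg G (insert e E) z = of_bool (z = b \<or> z = y) + deg G E z" for z
    unfolding deg_insert[OF finE e(2)] me ..
  obtain g where g: "pl_on {0..1} g" "Path_Connected.arc g" "pathstart g = f (Vertex b)" "pathfinish g = f (Vertex y)"
    "path_image g = f ` closed_edge G e"
    by (rule edge_arc[OF e(1) y]) (rule that; assumption)
  have meet: "\<exists>z. (z = b \<or> z = y \<and> deg G E y > 0) \<and> p = f (Vertex z)" if p: "p \<in> path_image q \<inter> path_image g" for p
  proof -
    obtain e' where e': "e' \<in> E" "p \<in> f ` closed_edge G e'" using p unfolding E(7) by blast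
    have "p \<in> f ` closed_edge G e" using p unfolding g(5) by blast
    have "e' \<in> arcs G" "e' \<noteq> e" using e'(1) E(1) e(2) by auto
    from edges_meet[OF this(1) e(1) this(2) e'(2) \<open>p \<in> f ` closed_edge G e\<close>]
    obtain z where z: "z \<in> ends G e'" "z \<in> ends G e" "p = f (Vertex z)" by (elim bexE IntE)
    have "deg G E z > 0" unfolding deg_pos_iff[OF finE] using z(1) e'(1) by (intro bexI)
    moreover have "z = b \<or> z = y" using z(2) y(1) by simp
    ultimately show ?thesis using z(3) by (intro exI[of _ z]) auto
  qed
  have pl: "pl_on {0..1} (q +++ g)" by (rule pl_joinpaths[OF E(3) g(1)]) (simp add: E(6) g(3))
  have im: "path_image (q +++ g) = (\<Union>e\<in>insert e E. f ` closed_edge G e)"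
    using path_image_join[of q g] E(6,7) g(3,5) by auto
  show ?thesis
  proof (cases "deg G E y = 0")
    case True
    have ya: "y \<noteq> a" using True E(8) by auto
    have "path_image q \<inter> path_image g \<subseteq> {pathstart g}"
    proof
      fix p assume "p \<in> path_image q \<inter> path_image g"
      from meet[OF this] show "p \<in> {pathstart g}" using True unfolding g(3) by (elim exE) auto
    qed
    then have arc: "Path_Connected.arc (q +++ g)" using E(4,6) g(2,3) by (intro arc_join) simp_all
    have "path_state (insert e E) a y (q +++ g)"
      unfolding path_state_def
    proof (intro conjI allI impI)
      show "insert e E \<subseteq> arcs G" using e(1) E(1) by simp
      show "deg G (insert e E) a = 1" using dI E(2,8) ya by simp
      show "deg G (insert e E) y = 1" using dI True by simp
      show "deg G (insert e E) z \<in> {0, 2}" if "z \<noteq> a" "z \<noteq> y" for z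
        using dI[of z] Ey[of z] that E(9) by (cases "z = b") auto
    qed (use ya pl arc im E(5) g(4) in simp_all)
    moreover have "card (insert e E) = Suc (card E)" using finE e(2) by simp
    ultimately show ?thesis by blast
  next
    case False
    then have "y \<in> verts G" using in_verts by simp
    then have "deg G (arcs G) y = 2" using reg unfolding two_regular_def by blast
    moreover have "deg G (insert e E) y \<le> deg G (arcs G) y" using e(1) E(1) by (intro deg_mono finite_arcs) simp
    ultimately have "deg G E y \<noteq> 2" using dI[of y] by simp
    then have ya: "y = a" using Ey[of y] False y(2) by auto
    have meet': "path_image q \<inter> path_image g \<subseteq> {pathstart q, pathstart g}"
    proof
      fix p assume "p \<in> path_image q \<inter> path_image g"
      from meet[OF this] show "p \<in> {pathstart q, pathstart g}" using ya unfolding g(3) E(5) by (elim exE) auto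
    qed
    have simple: "simple_path (q +++ g)"
      by (rule simple_path_join_loop[OF E(4) g(2) _ _ meet']) (use E(5,6) g(3,4) ya in simp_all)
    have "loop_state (insert e E) (q +++ g)"
      unfolding loop_state_def
    proof (intro conjI allI)
      show "insert e E \<subseteq> arcs G" using e(1) E(1) by simp
      show "deg G (insert e E) z \<in> {0, 2}" for z
        using dI[of z] Ey[of z] E(8,9) ya by (cases "z = b"; cases "z = a") auto
    qed (use pl simple im ya E(5) g(4) in simp_all)
    then show ?thesis by blast
  qed
qed

text \<open>Each extension adds an edge, and the graph is finite, so the path must close up.\<close>

lemma loop_from_path_state: "path_state E a b q \<Longrightarrow> \<exists>E' q'. loop_state E' q'"
proof (induction "card (arcs G) - card E" arbitrary: E b q rule: less_induct)
  case less
  from extend_path_state[OF less.prems] show ?case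
  proof
    assume "\<exists>E' y q'. path_state E' a y q' \<and> card E' = Suc (card E)"
    then obtain E' y q' where E': "path_state E' a y q'" "card E' = Suc (card E)" by blast
    have "card E' \<le> card (arcs G)" using E'(1) card_mono[OF finite_arcs] unfolding path_state_def by blast
    then show ?thesis using less.hyps[OF _ E'(1)] E'(2) by simp
  qed
qed

lemma exists_loop:
  assumes "verts G \<noteq> {}"
  obtains E q where "loop_state E q"
proof -
  obtain v where v: "v \<in> verts G" using assms by blast
  then have "deg G (arcs G) v > 0" using reg unfolding two_regular_def by simp
  then obtain e where e: "e \<in> arcs G" "v \<in> ends G e" unfolding deg_pos_iff[OF finite_arcs] by (elim bexE)
  show thesis
  proof (cases "tail G e = head G e")
    case True
    obtain g where g: "pl_on {0..1} g" "simple_path g" "pathfinish g = pathstart g" "path_image g = f ` closed_edge G e"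
      by (rule edge_loop[OF e(1) True]) (rule that; assumption)
    have "loop_state {e} g" unfolding loop_state_def
      using g e(1) incid_loop[OF True] by (simp add: deg_def)
    then show thesis by (rule that)
  next
    case False
    obtain g where g: "pl_on {0..1} g" "Path_Connected.arc g" "pathstart g = f (Vertex (tail G e))" "pathfinish g = f (Vertex (head G e))"
      "path_image g = f ` closed_edge G e"
      by (rule edge_arc[OF e(1) ends_def False]) (rule that; assumption)
    have "path_state {e} (tail G e) (head G e) g" unfolding path_state_def
      using g e(1) False by (simp add: deg_def incid_def)
    from loop_from_path_state[OF this] obtain E q where "loop_state E q" by (elim exE)
    then show thesis by (rule that)
  qed
qed

text \<open>The loop uses both incidences at each of its vertices, so no other edge touches it;
  removing its vertices and edges leaves a two-regular graph.\<close>

lemma split_cycle: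
  assumes "verts G \<noteq> {}"
  obtains C H where "C \<in> cycles G" "knot (f ` realization C)" "subgraph H G" "two_regular H"
    "verts G = verts C \<union> verts H" "verts C \<inter> verts H = {}" "arcs G = arcs C \<union> arcs H" "card (arcs H) < card (arcs G)"
proof -
  obtain E q where "loop_state E q" using exists_loop[OF assms] .
  then have E: "E \<subseteq> arcs G" "E \<noteq> {}" "pl_on {0..1} q" "simple_path q" "pathfinish q = pathstart q"
    "path_image q = (\<Union>e\<in>E. f ` closed_edge G e)" and Ey: "\<And>y. deg G E y \<in> {0, 2}"
    unfolding loop_state_def by auto
  have finE: "finite E" using finite_subset[OF E(1) finite_arcs] .
  define V where "V = (\<Union>e\<in>E. ends G e)"
  define C where "C = \<lparr>verts = V, arcs = E, tail = tail G, head = head G\<rparr>"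
  define H where "H = \<lparr>verts = verts G - V, arcs = arcs G - E, tail = tail G, head = head G\<rparr>"
  have V: "V \<subseteq> verts G" unfolding V_def using ends_in E(1) by blast
  have dV: "deg G E y = 2" if "y \<in> V" for y
  proof -
    from that obtain e where "e \<in> E" "y \<in> ends G e" unfolding V_def by (elim UN_E)
    then have "deg G E y > 0" by (rule deg_pos[OF finE])
    then show ?thesis using Ey[of y] by simp
  qed
  have rest: "ends G e \<inter> V = {}" if e: "e \<in> arcs G - E" for e
  proof -
    have "y \<notin> V" if y: "y \<in> ends G e" for y
    proof
      assume "y \<in> V"
      then have "deg G E y = 2" "deg G (arcs G) y = 2" using dV V reg unfolding two_regular_def by auto
      then have "deg G (arcs G - E) y = 0" using deg_split[OF finite_arcs E(1), of G y] by simp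
      moreover have "deg G (arcs G - E) y > 0" by (rule deg_pos[OF _ e y]) (simp add: finite_arcs)
      ultimately show False by simp
    qed
    then show ?thesis by blast
  qed
  have subC: "subgraph C G"
    unfolding subgraph_def compatible_def using wf V E(1)
    by (auto simp: C_def wf_digraph_def V_def ends_def)
  have wfC: "wf_digraph C" using subC unfolding subgraph_def by simp
  have wfH: "wf_digraph H"
    unfolding wf_digraph_def using rest wf by (auto simp: H_def ends_def)
  have subH: "subgraph H G"
    unfolding subgraph_def compatible_def using wf wfH by (auto simp: H_def)
  have ep: "closed_edge C e = closed_edge G e" for e
    unfolding closed_edge_def subgraph_edge_param[OF subC] ..
  have "Vertex ` V \<subseteq> (\<Union>e\<in>E. closed_edge G e)"
    unfolding V_def ends_def closed_edge_explicit by auto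
  then have rC: "realization C = (\<Union>e\<in>E. closed_edge G e)"
    unfolding realization_eq[OF wfC] ep by (auto simp: C_def)
  have im: "f ` realization C = path_image q" unfolding rC image_UN E(6) ..
  have "f ` realization C \<subseteq> S3"
    using embedding realization_subgraph[OF subC] unfolding spatial_embedding_def by blast
  then have knot: "knot (f ` realization C)" unfolding knot_def using E(3-5) im by auto
  have "path_image q homeomorphic sphere (0::complex) 1"
    by (rule homeomorphic_simple_path_image_circle[OF E(4,5)]) simp
  then have cyc: "C \<in> cycles G"
    unfolding mem_cycles_iff[OF embedding fin_digraph_axioms] using subC im by simp
  have "deg H (arcs H) y = 2" if y: "y \<in> verts H" for y
  proof -
    have yV: "y \<in> verts G" "y \<notin> V" using y by (auto simp: H_def)
    have "deg G E y = 0" by (rule deg_zero) (use yV(2) in \<open>simp add: V_def\<close>)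
    then have "deg G (arcs G - E) y = 2"
      using deg_split[OF finite_arcs E(1), of G y] reg yV(1) unfolding two_regular_def by simp
    then show ?thesis by (simp add: H_def deg_def incid_def)
  qed
  then have "two_regular H" unfolding two_regular_def by blast
  moreover have "card (arcs H) < card (arcs G)"
  proof -
    have "arcs G - E \<subset> arcs G" using E(1,2) by blast
    then show ?thesis using psubset_card_mono[OF finite_arcs] by (simp add: H_def)
  qed
  ultimately show thesis
    by (intro that[OF cyc knot subH]) (use V E(1) in \<open>auto simp: C_def H_def\<close>)
qed

end

section \<open>Disjoint unions of cycles as two-regular subgraphs\<close>

lemma two_regular_decomposition:
  assumes "fin_digraph G" "spatial_embedding G f" "subgraph \<gamma> G" "two_regular \<gamma>"
  shows "\<exists>\<C>. finite \<C> \<and> \<C> \<subseteq> cycles G \<and> pairwise (\<lambda>C C'. disjnt (verts C) (verts C')) \<C> \<and>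
    verts \<gamma> = (\<Union>C\<in>\<C>. verts C) \<and> arcs \<gamma> = (\<Union>C\<in>\<C>. arcs C) \<and> (\<forall>C\<in>\<C>. knot (f ` realization C) \<and> verts C \<noteq> {})"
  using assms(3,4)
proof (induction "card (arcs \<gamma>)" arbitrary: \<gamma> rule: less_induct)
  case less
  have fin: "fin_digraph \<gamma>" by (rule subgraph_fin[OF less.prems(1) assms(1)])
  have emb: "spatial_embedding \<gamma> f" by (rule spatial_embedding_subgraph[OF assms(2) less.prems(1)])
  interpret fin_digraph \<gamma> by (rule fin)
  interpret s: spatial_two_regular \<gamma> f by unfold_locales (use emb less.prems in auto)
  show ?case
  proof (cases "verts \<gamma> = {}")
    case True
    then have "arcs \<gamma> = {}" using tail_in_verts by auto
    then show ?thesis using True by (intro exI[of _ "{}"]) (auto simp: pairwise_def)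
  next
    case False
    obtain C H where C: "C \<in> cycles \<gamma>" "knot (f ` realization C)" and H: "subgraph H \<gamma>" "two_regular H"
      and CH: "verts \<gamma> = verts C \<union> verts H" "verts C \<inter> verts H = {}" "arcs \<gamma> = arcs C \<union> arcs H"
      "card (arcs H) < card (arcs \<gamma>)"
      by (rule s.split_cycle[OF False]) (rule that; assumption)
    have sub_trans: "subgraph K G" if "subgraph K \<gamma>" for K
      using that less.prems(1) unfolding subgraph_def compatible_def by auto
    obtain \<C> where \<C>: "finite \<C>" "\<C> \<subseteq> cycles G" "pairwise (\<lambda>C C'. disjnt (verts C) (verts C')) \<C>"
      "verts H = (\<Union>C\<in>\<C>. verts C)" "arcs H = (\<Union>C\<in>\<C>. arcs C)" "\<forall>C\<in>\<C>. knot (f ` realization C) \<and> verts C \<noteq> {}"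
      using less.hyps[OF CH(4) sub_trans[OF H(1)] H(2)] by blast
    have cG: "C \<in> cycles G" using C(1) sub_trans unfolding cycles_def by blast
    have "realization C \<noteq> {}"
    proof
      assume "realization C = {}"
      then have "knot {}" using C(2) by simp
      then show False unfolding knot_def by (auto simp: path_image_def)
    qed
    then have cne: "verts C \<noteq> {}"
    proof -
      have "wf_digraph C" using cG unfolding cycles_def subgraph_def by simp
      then show ?thesis using \<open>realization C \<noteq> {}\<close> unfolding realization_def
        using wf_digraph.tail_in_verts by fastforce
    qed
    show ?thesis
    proof (intro exI[of _ "insert C \<C>"] conjI)
      have "disjnt (verts C) (verts C')" if "C' \<in> \<C>" for C'
        using CH(2) \<C>(4) that unfolding disjnt_def by blast
      then show "pairwise (\<lambda>C C'. disjnt (verts C) (verts C')) (insert C \<C>)"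
        using \<C>(3) by (auto simp: pairwise_insert disjnt_sym)
    qed (use \<C> cG CH C(2) cne in auto)
  qed
qed

lemma two_regular_link:
  assumes "fin_digraph G" "spatial_embedding G f" "subgraph \<gamma> G" "two_regular \<gamma>" "verts \<gamma> \<noteq> {}"
  shows "link (f ` realization \<gamma>)" "\<gamma> \<in> Gamma_bar G"
proof -
  obtain \<C> where \<C>: "finite \<C>" "\<C> \<subseteq> cycles G" "pairwise (\<lambda>C C'. disjnt (verts C) (verts C')) \<C>"
    "verts \<gamma> = (\<Union>C\<in>\<C>. verts C)" "arcs \<gamma> = (\<Union>C\<in>\<C>. arcs C)" "\<And>C. C \<in> \<C> \<Longrightarrow> knot (f ` realization C) \<and> verts C \<noteq> {}"
    using two_regular_decomposition[OF assms(1-4)] by metis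
  have ne: "\<C> \<noteq> {}" using \<C>(4) assms(5) by auto
  have sub: "subgraph C G" if "C \<in> \<C>" for C using \<C>(2) that unfolding cycles_def by blast
  have wfG: "wf_digraph \<gamma>" using assms(3) unfolding subgraph_def by simp
  have r: "realization \<gamma> = (\<Union>C\<in>\<C>. realization C)"
    unfolding realization_def \<C>(4,5) by auto
  have rd: "realization C \<inter> realization C' = {}" if "C \<in> \<C>" "C' \<in> \<C>" "C \<noteq> C'" for C C'
  proof -
    have d: "verts C \<inter> verts C' = {}" using \<C>(3) that unfolding pairwise_def disjnt_def by blast
    have "arcs C \<inter> arcs C' = {}"
    proof -
      have "tail G e \<in> verts C \<inter> verts C'" if "e \<in> arcs C \<inter> arcs C'" for e
        using that sub[OF \<open>C \<in> \<C>\<close>] sub[OF \<open>C' \<in> \<C>\<close>] wf_digraph.tail_in_verts[of C e] wf_digraph.tail_in_verts[of C' e]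
        unfolding subgraph_def compatible_def by auto
      then show ?thesis using d by blast
    qed
    then show ?thesis using d unfolding realization_def by auto
  qed
  have rsub: "realization C \<subseteq> realization G" if "C \<in> \<C>" for C using realization_subgraph[OF sub[OF that]] .
  have injG: "inj_on f (realization G)" using assms(2) unfolding spatial_embedding_def by simp
  show "link (f ` realization \<gamma>)"
    unfolding link_def
  proof (intro exI[of _ "(\<lambda>C. f ` realization C) ` \<C>"] conjI)
    show "pairwise disjnt ((\<lambda>C. f ` realization C) ` \<C>)"
    proof (rule pairwiseI)
      fix X Y assume X: "X \<in> (\<lambda>C. f ` realization C) ` \<C>" "Y \<in> (\<lambda>C. f ` realization C) ` \<C>" "X \<noteq> Y"
      then obtain C C' where C: "C \<in> \<C>" "C' \<in> \<C>" "X = f ` realization C" "Y = f ` realization C'" by blast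
      then have "C \<noteq> C'" using X(3) by auto
      then have "f ` realization C \<inter> f ` realization C' = {}"
        using inj_on_image_Int[OF injG rsub[OF C(1)] rsub[OF C(2)]] rd[OF C(1,2)] by simp
      then show "disjnt X Y" unfolding disjnt_def C(3,4) .
    qed
    show "f ` realization \<gamma> = \<Union>((\<lambda>C. f ` realization C) ` \<C>)" unfolding r by blast
  qed (use \<C>(1,6) ne in auto)
  have th: "tail \<gamma> = tail G" "head \<gamma> = head G" using subgraph_tail_head[OF assms(3)] by auto
  have "\<gamma> = \<lparr>verts = (\<Union>C\<in>\<C>. verts C), arcs = (\<Union>C\<in>\<C>. arcs C), tail = tail G, head = head G\<rparr>"
    using \<C>(4,5) th by (intro pre_digraph.equality) simp_all
  then have "\<gamma> \<in> cycle_unions (card \<C>) G" unfolding cycle_unions_def using \<C>(1-3) by blast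
  moreover have "card \<C> \<ge> 1" using ne \<C>(1) by (simp add: Suc_le_eq card_gt_0_iff)
  ultimately show "\<gamma> \<in> Gamma_bar G" unfolding Gamma_bar_def by blast
qed

text \<open>By disjointness every edge at a vertex of one cycle belongs to that cycle, so degrees
  can be computed inside the cycle, where they are 2.\<close>

lemma Gamma_bar_two_regular:
  assumes G: "fin_digraph G" and f: "spatial_embedding G f" and \<gamma>: "\<gamma> \<in> Gamma_bar G"
  shows "subgraph \<gamma> G" "two_regular \<gamma>" "verts \<gamma> \<noteq> {}"
proof -
  interpret fin_digraph G by fact
  have wfG: "wf_digraph G" by unfold_locales
  obtain \<C> where \<C>: "\<C> \<subseteq> cycles G" "finite \<C>" "card \<C> \<ge> 1" "pairwise (\<lambda>C C'. disjnt (verts C) (verts C')) \<C>"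
    and \<gamma>_eq: "\<gamma> = \<lparr>verts = (\<Union>C\<in>\<C>. verts C), arcs = (\<Union>C\<in>\<C>. arcs C), tail = tail G, head = head G\<rparr>"
    using \<gamma> unfolding Gamma_bar_def cycle_unions_def by auto
  have sub: "subgraph C G" and circ: "f ` realization C homeomorphic sphere (0::complex) 1" if "C \<in> \<C>" for C
    using \<C>(1) that mem_cycles_iff[OF f G] by blast+
  have C_sub: "verts C \<subseteq> verts G" "arcs C \<subseteq> arcs G" "wf_digraph C" "tail C = tail G" "head C = head G" if "C \<in> \<C>" for C
    using sub[OF that] unfolding subgraph_def compatible_def by auto
  have ends_C: "tail G e \<in> verts C" "head G e \<in> verts C" if "C \<in> \<C>" "e \<in> arcs C" for C e
    using wf_digraph.tail_in_verts[OF C_sub(3)[OF that(1)] that(2)] wf_digraph.head_in_verts[OF C_sub(3)[OF that(1)] that(2)]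
      C_sub(4,5)[OF that(1)] by auto
  have "tail \<gamma> e \<in> verts \<gamma> \<and> head \<gamma> e \<in> verts \<gamma>" if e: "e \<in> arcs \<gamma>" for e
  proof -
    obtain C where "C \<in> \<C>" "e \<in> arcs C" using e by (auto simp: \<gamma>_eq)
    then show ?thesis using ends_C[of C e] by (auto simp: \<gamma>_eq)
  qed
  then have "wf_digraph \<gamma>" unfolding wf_digraph_def by blast
  then show subg: "subgraph \<gamma> G"
    unfolding subgraph_def compatible_def using wfG C_sub(1,2) by (auto simp: \<gamma>_eq)
  have finA: "finite (arcs \<gamma>)" using subgraph_fin[OF subg G] by (simp add: fin_digraph.finite_arcs)
  show "two_regular \<gamma>"
    unfolding two_regular_def
  proof
    fix v assume "v \<in> verts \<gamma>"
    then obtain C where C: "C \<in> \<C>" "v \<in> verts C" by (auto simp: \<gamma>_eq)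
    have CA: "arcs C \<subseteq> arcs \<gamma>" using C(1) by (auto simp: \<gamma>_eq)
    have other: "v \<notin> ends \<gamma> e" if e: "e \<in> arcs \<gamma> - arcs C" for e
    proof
      assume v: "v \<in> ends \<gamma> e"
      obtain C' where C': "C' \<in> \<C>" "e \<in> arcs C'" using e by (auto simp: \<gamma>_eq)
      then have "C' \<noteq> C" using e by auto
      then have "verts C' \<inter> verts C = {}" using \<C>(4) C(1) C'(1) unfolding pairwise_def disjnt_def by blast
      moreover have "v \<in> verts C'" using v ends_C[OF C'] unfolding ends_def by (auto simp: \<gamma>_eq)
      ultimately show False using C(2) by blast
    qed
    have "deg \<gamma> (arcs \<gamma> - arcs C) v = 0"
      by (rule deg_zero) (rule other)
    then have "deg \<gamma> (arcs \<gamma>) v = deg \<gamma> (arcs C) v" using deg_split[OF finA CA, of \<gamma> v] by simp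
    also have "\<dots> = deg C (arcs C) v" using C_sub(4,5)[OF C(1)] by (simp add: deg_def incid_def \<gamma>_eq)
    also have "\<dots> = 2"
      by (rule deg_cycle[OF spatial_embedding_subgraph[OF f sub[OF C(1)]] subgraph_fin[OF sub[OF C(1)] G] circ[OF C(1)] C(2)])
    finally show "deg \<gamma> (arcs \<gamma>) v = 2" .
  qed
  obtain C where C: "C \<in> \<C>" using \<C>(3) by fastforce
  have "verts C \<noteq> {}"
  proof
    assume v: "verts C = {}"
    then have "arcs C = {}" using ends_C[OF C] by auto
    then have "realization C = {}" unfolding realization_def using v by simp
    then have "{} homeomorphic sphere (0::complex) 1" using circ[OF C] by simp
    then show False by (simp add: homeomorphic_empty)
  qed
  then show "verts \<gamma> \<noteq> {}" using C by (auto simp: \<gamma>_eq)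
qed

lemma finite_Gamma_bar:
  assumes "fin_digraph G" "spatial_embedding G f"
  shows "finite (Gamma_bar G)"
proof -
  interpret fin_digraph G by fact
  have "Gamma_bar G \<subseteq> (\<lambda>(V, E). \<lparr>verts = V, arcs = E, tail = tail G, head = head G\<rparr>) ` (Pow (verts G) \<times> Pow (arcs G))"
  proof
    fix \<gamma> assume "\<gamma> \<in> Gamma_bar G"
    then have "subgraph \<gamma> G" using Gamma_bar_two_regular[OF assms] by blast
    then have "verts \<gamma> \<subseteq> verts G" "arcs \<gamma> \<subseteq> arcs G" "tail \<gamma> = tail G" "head \<gamma> = head G"
      unfolding subgraph_def compatible_def by auto
    then show "\<gamma> \<in> (\<lambda>(V, E). \<lparr>verts = V, arcs = E, tail = tail G, head = head G\<rparr>) ` (Pow (verts G) \<times> Pow (arcs G))"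
      by (intro image_eqI[of _ _ "(verts \<gamma>, arcs \<gamma>)"]) auto
  qed
  then show ?thesis by (rule finite_subset) simp
qed


section \<open>Components and flat disks\<close>

lemma component_of_disjoint_closed:
  fixes K R :: "'a::topological_space set"
  assumes "Topological_Spaces.connected K" "K \<noteq> {}" "closed K" "closed R" "K \<inter> R = {}"
  shows "K \<in> components (K \<union> R)"
  unfolding in_components_maximal
proof (intro conjI allI impI)
  fix d assume d: "d \<noteq> {} \<and> K \<subseteq> d \<and> d \<subseteq> K \<union> R \<and> Topological_Spaces.connected d"
  have "d \<inter> R = {}"
  proof (rule ccontr)
    assume "d \<inter> R \<noteq> {}"
    moreover have "K \<inter> d \<noteq> {}" "K \<inter> R \<inter> d = {}" "d \<subseteq> K \<union> R" using d assms(2,5) by auto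
    ultimately have "\<exists>A B. closed A \<and> closed B \<and> d \<subseteq> A \<union> B \<and> A \<inter> B \<inter> d = {} \<and> A \<inter> d \<noteq> {} \<and> B \<inter> d \<noteq> {}"
      using assms(3,4) by (intro exI[of _ K] exI[of _ R]) auto
    then show False using d unfolding connected_closed by simp
  qed
  then show "d = K" using d by auto
qed (use assms in auto)

text \<open>Subtracting half of the smaller coordinate from both coordinates gives \<open>p\<close>
  and \<open>q\<close> whose sum is the larger coordinate. So the two sides of the square through
  (1,1) are carried to the edge from \<open>P2\<close> to \<open>P3\<close>, and the map is affine
  on either side of the diagonal.\<close>

lemma triangle_disk:
  fixes P1 P2 P3 :: "'a::euclidean_space"
  assumes nc: "\<not> collinear {P1, P2, P3}"
  obtains \<phi> :: "real \<times> real \<Rightarrow> 'a" where "pl_on (cbox (0,0) (1,1)) \<phi>" "inj_on \<phi> (cbox (0,0) (1,1))"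
    "\<phi> ` cbox (0,0) (1,1) = convex hull {P1, P2, P3}"
    "\<phi> ` frontier (cbox (0,0) (1,1)) = closed_segment P1 P2 \<union> closed_segment P2 P3 \<union> closed_segment P3 P1"
proof -
  let ?Q = "cbox (0,0) (1,1) :: (real \<times> real) set"
  define p where "p z = fst z - (1/2) * min (fst z) (snd z)" for z :: "real \<times> real"
  define q where "q z = snd z - (1/2) * min (fst z) (snd z)" for z :: "real \<times> real"
  define \<phi> where "\<phi> z = P1 + p z *\<^sub>R (P2 - P1) + q z *\<^sub>R (P3 - P1)" for z
  have Q: "z \<in> ?Q \<longleftrightarrow> 0 \<le> fst z \<and> fst z \<le> 1 \<and> 0 \<le> snd z \<and> snd z \<le> 1" for z
    by (cases z) (auto simp: cbox_Pair_eq)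
  have poly: "polyhedral ?Q" by (intro polyhedral_polytope polytope_interval)
  have "pl_on ?Q p" "pl_on ?Q q" unfolding p_def q_def
    by (intro pl_on_diff pl_on_mult pl_on_min pl_on_linear[OF poly] linear_fst linear_snd)+
  then have pl: "pl_on ?Q \<phi>" unfolding \<phi>_def by (intro pl_on_add pl_on_vector pl_on_const poly)
  have indep: "a = 0 \<and> b = 0" if ab: "a *\<^sub>R (P2 - P1) + b *\<^sub>R (P3 - P1) = 0" for a b
  proof -
    have "collinear {P2, P1, P3} \<longleftrightarrow> collinear {0, P2 - P1, P3 - P1}"
      by (rule collinear_3) (simp add: NO_MATCH_def)
    then have nc': "P2 - P1 \<noteq> 0" "\<And>c. P3 - P1 \<noteq> c *\<^sub>R (P2 - P1)"
      using nc unfolding collinear_lemma by (auto simp: insert_commute)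
    have "b = 0"
    proof (rule ccontr)
      assume b: "b \<noteq> 0"
      have "b *\<^sub>R (P3 - P1) = - (a *\<^sub>R (P2 - P1))" using ab by (simp add: add_eq_0_iff)
      then have "(1 / b) *\<^sub>R (b *\<^sub>R (P3 - P1)) = (1 / b) *\<^sub>R (- (a *\<^sub>R (P2 - P1)))" by simp
      then have "P3 - P1 = (- a / b) *\<^sub>R (P2 - P1)" using b by simp
      then show False using nc'(2) by blast
    qed
    then show ?thesis using ab nc'(1) by simp
  qed
  \<comment> \<open>The inverse: adding the smaller of \<open>p\<close> and \<open>q\<close> to both
    recovers the point.\<close>
  have rec: "fst z = p z + min (p z) (q z)" "snd z = q z + min (p z) (q z)" for z
    unfolding p_def q_def by (auto simp: min_def)
  have inj: "inj_on \<phi> ?Q"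
  proof (rule inj_onI)
    fix y z assume "\<phi> y = \<phi> z"
    then have "(p y - p z) *\<^sub>R (P2 - P1) + (q y - q z) *\<^sub>R (P3 - P1) = 0" unfolding \<phi>_def by (simp add: algebra_simps)
    then have "p y = p z" "q y = q z" using indep[of "p y - p z" "q y - q z"] by auto
    then show "y = z" using rec[of y] rec[of z] by (simp add: prod_eq_iff)
  qed
  have hull: "convex hull {P1, P2, P3} = {P1 + u *\<^sub>R (P2 - P1) + v *\<^sub>R (P3 - P1) | u v. 0 \<le> u \<and> 0 \<le> v \<and> u + v \<le> 1}"
    by (rule convex_hull_3_alt)
  have pq: "0 \<le> p z" "0 \<le> q z" "p z + q z = max (fst z) (snd z)" if "z \<in> ?Q" for z
    using that unfolding Q p_def q_def by (auto simp: min_def max_def)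
  have surj: "\<exists>z. p z = u \<and> q z = v \<and> fst z = u + min u v \<and> snd z = v + min u v" for u v
    by (intro exI[of _ "(u + min u v, v + min u v)"]) (auto simp: p_def q_def min_def)
  have im: "\<phi> ` ?Q = convex hull {P1, P2, P3}"
  proof
    show "\<phi> ` ?Q \<subseteq> convex hull {P1, P2, P3}"
    proof (rule image_subsetI)
      fix z assume z: "z \<in> ?Q"
      then have "p z + q z \<le> 1" using pq(3)[OF z] unfolding Q by simp
      then show "\<phi> z \<in> convex hull {P1, P2, P3}" unfolding hull \<phi>_def using pq[OF z] by blast
    qed
    show "convex hull {P1, P2, P3} \<subseteq> \<phi> ` ?Q"
    proof
      fix y assume "y \<in> convex hull {P1, P2, P3}"
      then obtain u v where uv: "y = P1 + u *\<^sub>R (P2 - P1) + v *\<^sub>R (P3 - P1)" "0 \<le> u" "0 \<le> v" "u + v \<le> 1"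
        unfolding hull by blast
      obtain z where z: "p z = u" "q z = v" "fst z = u + min u v" "snd z = v + min u v" using surj by blast
      then have "z \<in> ?Q" unfolding Q using uv by (auto simp: min_def)
      then show "y \<in> \<phi> ` ?Q" using uv(1) z by (intro image_eqI[of _ _ z]) (simp_all add: \<phi>_def)
    qed
  qed
  have "?Q = {0..1} \<times> {0..1}" by (auto simp: cbox_Pair_eq)
  then have "interior ?Q = {0<..<1} \<times> {0<..<1}" by (simp add: interior_Times)
  then have fr: "z \<in> frontier ?Q \<longleftrightarrow> z \<in> ?Q \<and> (fst z = 0 \<or> snd z = 0 \<or> max (fst z) (snd z) = 1)" for z
    unfolding frontier_def closure_closed[OF closed_cbox] by (cases z) (auto simp: cbox_Pair_eq max_def)
  have seg: "y \<in> closed_segment a b \<longleftrightarrow> (\<exists>u. 0 \<le> u \<and> u \<le> 1 \<and> y = a + u *\<^sub>R (b - a))" for y a b :: 'a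
    unfolding in_segment by (simp add: algebra_simps)
  have "\<phi> ` frontier ?Q = closed_segment P1 P2 \<union> closed_segment P2 P3 \<union> closed_segment P3 P1"
  proof
    show "\<phi> ` frontier ?Q \<subseteq> closed_segment P1 P2 \<union> closed_segment P2 P3 \<union> closed_segment P3 P1"
    proof (rule image_subsetI)
      fix z assume "z \<in> frontier ?Q"
      then have z: "z \<in> ?Q" "fst z = 0 \<or> snd z = 0 \<or> max (fst z) (snd z) = 1" unfolding fr by auto
      have z': "0 \<le> fst z" "fst z \<le> 1" "0 \<le> snd z" "snd z \<le> 1" using z(1) unfolding Q by auto
      from z(2) consider "fst z = 0" | "snd z = 0" | "max (fst z) (snd z) = 1" by blast
      then show "\<phi> z \<in> closed_segment P1 P2 \<union> closed_segment P2 P3 \<union> closed_segment P3 P1"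
      proof cases
        case 1
        then have "p z = 0" "q z = snd z" using z' by (auto simp: p_def q_def)
        then have "\<phi> z \<in> closed_segment P1 P3" unfolding \<phi>_def seg using z' by auto
        then show ?thesis by (simp add: closed_segment_commute)
      next
        case 2
        then have "q z = 0" "p z = fst z" using z' by (auto simp: p_def q_def)
        then have "\<phi> z \<in> closed_segment P1 P2" unfolding \<phi>_def seg using z' by auto
        then show ?thesis by simp
      next
        case 3
        then have pz: "p z = 1 - q z" using pq(3)[OF z(1)] by simp
        have "\<phi> z = P2 + q z *\<^sub>R (P3 - P2)" unfolding \<phi>_def pz by (simp add: algebra_simps)
        moreover have "0 \<le> q z" "q z \<le> 1" using pq(1,2)[OF z(1)] pz by linarith+
        ultimately have "\<phi> z \<in> closed_segment P2 P3" unfolding seg by blast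
        then show ?thesis by simp
      qed
    qed
    have hit: "P1 + u *\<^sub>R (P2 - P1) + v *\<^sub>R (P3 - P1) \<in> \<phi> ` frontier ?Q"
      if uv: "0 \<le> u" "0 \<le> v" "u + v \<le> 1" "u = 0 \<or> v = 0 \<or> u + v = 1" for u v
    proof -
      obtain z where z: "p z = u" "q z = v" "fst z = u + min u v" "snd z = v + min u v" using surj by blast
      then have zQ: "z \<in> ?Q" unfolding Q using uv by (auto simp: min_def)
      have "z \<in> frontier ?Q" unfolding fr using zQ pq(3)[OF zQ] z uv by auto
      then show ?thesis using z by (intro image_eqI[of _ _ z]) (simp_all add: \<phi>_def)
    qed
    show "closed_segment P1 P2 \<union> closed_segment P2 P3 \<union> closed_segment P3 P1 \<subseteq> \<phi> ` frontier ?Q"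
    proof (intro Un_least subsetI)
      fix y assume "y \<in> closed_segment P1 P2"
      then obtain u where "0 \<le> u" "u \<le> 1" "y = P1 + u *\<^sub>R (P2 - P1)" unfolding seg by blast
      then show "y \<in> \<phi> ` frontier ?Q" using hit[of u 0] by simp
    next
      fix y assume "y \<in> closed_segment P2 P3"
      then obtain u where u: "0 \<le> u" "u \<le> 1" "y = P2 + u *\<^sub>R (P3 - P2)" unfolding seg by blast
      then have "y = P1 + (1 - u) *\<^sub>R (P2 - P1) + u *\<^sub>R (P3 - P1)" by (simp add: algebra_simps)
      then show "y \<in> \<phi> ` frontier ?Q" using hit[of "1 - u" u] u by simp
    next
      fix y assume "y \<in> closed_segment P3 P1"
      then have "y \<in> closed_segment P1 P3" by (simp add: closed_segment_commute)
      then obtain u where "0 \<le> u" "u \<le> 1" "y = P1 + u *\<^sub>R (P3 - P1)" unfolding seg by blast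
      then show "y \<in> \<phi> ` frontier ?Q" using hit[of 0 u] by simp
    qed
  qed
  then show thesis using that pl inj im by blast
qed

lemma (in tripod_frame) triangle_not_collinear: "\<not> collinear {north + d1, north + d2, north + d3}"
proof
  assume "collinear {north + d1, north + d2, north + d3}"
  then obtain z where z: "\<forall>x\<in>{north + d1, north + d2, north + d3}. \<forall>y\<in>{north + d1, north + d2, north + d3}. \<exists>c. x - y = c *\<^sub>R z"
    unfolding collinear_def by blast
  then obtain c1 c2 where "(north + d1) - (north + d2) = c1 *\<^sub>R z" "(north + d1) - (north + d3) = c2 *\<^sub>R z" by blast
  then have c: "d1 - d2 = c1 *\<^sub>R z" "d1 + d1 + d2 = c2 *\<^sub>R z" by (simp_all add: d3_def)
  have "n1 \<bullet> (d1 - d2) = c1 * (n1 \<bullet> z)" "n2 \<bullet> (d1 - d2) = c1 * (n2 \<bullet> z)"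
    "n1 \<bullet> (d1 + d1 + d2) = c2 * (n1 \<bullet> z)" "n2 \<bullet> (d1 + d1 + d2) = c2 * (n2 \<bullet> z)" unfolding c by simp_all
  then have e: "1 = c1 * (n1 \<bullet> z)" "-1 = c1 * (n2 \<bullet> z)" "2 = c2 * (n1 \<bullet> z)" "1 = c2 * (n2 \<bullet> z)"
    unfolding inner_add_right inner_diff_right dual by linarith+
  have "c1 * (n1 \<bullet> z + n2 \<bullet> z) = 0" using e(1,2) by (simp add: distrib_left)
  moreover have "c1 \<noteq> 0" using e(1) by auto
  ultimately have "n1 \<bullet> z = - (n2 \<bullet> z)" by simp
  then have "c2 * (n1 \<bullet> z) = - (c2 * (n2 \<bullet> z))" by simp
  then show False using e(3,4) by linarith
qed

lemma (in tripod_frame) triangle_S3: "triangle \<subseteq> S3"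
proof
  interpret r: tripod_frame d2 d3 "n2 - n1" "- n1" by (rule rotate)
  have rd: "r.d3 = d1" by (subst r.d3_def) (simp add: d3_def)
  fix x assume "x \<in> triangle"
  then have "x \<in> convex hull {north, north + d2, north + d3} \<union> convex hull {north, north + d3, north + d1}
      \<union> (convex hull {north, north + d3, north + d1} \<union> convex hull {north, north + d1, north + d2})"
    using triangle_sectors by blast
  then show "x \<in> S3" using other_sectors(1)[of x] r.other_sectors(1)[of x, unfolded rd] by blast
qed


section \<open>The triangle-Y exchange\<close>

definition arc_subgraph :: "('v, 'e) pre_digraph \<Rightarrow> 'e set \<Rightarrow> ('v, 'e) pre_digraph" where
  "arc_subgraph G E = \<lparr>verts = (\<Union>e\<in>E. ends G e), arcs = E, tail = tail G, head = head G\<rparr>"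

definition even_set :: "('v, 'e) pre_digraph \<Rightarrow> 'e set \<Rightarrow> bool" where
  "even_set G E \<longleftrightarrow> E \<noteq> {} \<and> E \<subseteq> arcs G \<and> (\<forall>z. deg G E z \<in> {0, 2})"

lemma arc_subgraph_simps [simp]:
  "verts (arc_subgraph G E) = (\<Union>e\<in>E. ends G e)" "arcs (arc_subgraph G E) = E"
  "tail (arc_subgraph G E) = tail G" "head (arc_subgraph G E) = head G"
  by (simp_all add: arc_subgraph_def)

lemma wf_arc_subgraph: "wf_digraph (arc_subgraph G E)"
  unfolding wf_digraph_def by (auto simp: ends_def)

lemma realization_arc_subgraph: "realization (arc_subgraph G E) = (\<Union>e\<in>E. closed_edge G e)"
proof -
  have ce: "closed_edge (arc_subgraph G E) e = closed_edge G e" for e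
    unfolding closed_edge_explicit by simp
  have sub: "Vertex ` (\<Union>e\<in>E. ends G e) \<subseteq> (\<Union>e\<in>E. closed_edge G e)"
    unfolding ends_def closed_edge_explicit by auto
  show ?thesis
    unfolding realization_eq[OF wf_arc_subgraph] ce arc_subgraph_simps by (rule Un_absorb1[OF sub])
qed

text \<open>Every vertex of a cycle lies on one of its edges, so a member of
  \<open>Gamma_bar\<close> is determined by its edge set, and the two-regular decomposition tells
  which sets occur. The embedding enters because cycles are defined topologically.\<close>

lemma Gamma_bar_iff:
  assumes G: "fin_digraph G" and f: "spatial_embedding G f"
  shows "\<gamma> \<in> Gamma_bar G \<longleftrightarrow> (\<exists>E. even_set G E \<and> \<gamma> = arc_subgraph G E)"
    and "even_set G E \<Longrightarrow> link (f ` realization (arc_subgraph G E))"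
proof -
  interpret fin_digraph G by fact
  have wf: "wf_digraph G" by unfold_locales
  have *: "subgraph (arc_subgraph G E) G \<and> two_regular (arc_subgraph G E) \<and> verts (arc_subgraph G E) \<noteq> {}"
    if E: "even_set G E" for E
  proof (intro conjI)
    have EG: "E \<subseteq> arcs G" "E \<noteq> {}" "\<And>z. deg G E z \<in> {0, 2}" using E unfolding even_set_def by auto
    have finE: "finite E" using finite_subset[OF EG(1) finite_arcs] .
    show "subgraph (arc_subgraph G E) G"
      unfolding subgraph_def compatible_def using wf wf_arc_subgraph EG(1) by (auto simp: ends_def)
    show "verts (arc_subgraph G E) \<noteq> {}" using EG(2) by (auto simp: ends_def)
    show "two_regular (arc_subgraph G E)"
      unfolding two_regular_def
    proof
      fix z assume "z \<in> verts (arc_subgraph G E)"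
      then have "z \<in> (\<Union>e\<in>E. ends G e)" by simp
      then obtain e where "e \<in> E" "z \<in> ends G e" by (elim UN_E)
      then have "deg G E z > 0" by (rule deg_pos[OF finE])
      then have "deg G E z = 2" using EG(3)[of z] by simp
      then show "deg (arc_subgraph G E) (arcs (arc_subgraph G E)) z = 2" by (simp add: deg_def incid_def)
    qed
  qed
  show "link (f ` realization (arc_subgraph G E))" if "even_set G E" for E
    using two_regular_link(1)[OF G f] *[OF that] by blast
  show "\<gamma> \<in> Gamma_bar G \<longleftrightarrow> (\<exists>E. even_set G E \<and> \<gamma> = arc_subgraph G E)"
  proof
    assume "\<exists>E. even_set G E \<and> \<gamma> = arc_subgraph G E"
    then show "\<gamma> \<in> Gamma_bar G" using two_regular_link(2)[OF G f] * by blast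
  next
    assume "\<gamma> \<in> Gamma_bar G"
    note \<gamma> = Gamma_bar_two_regular[OF G f this]
    have sub: "verts \<gamma> \<subseteq> verts G" "arcs \<gamma> \<subseteq> arcs G" "wf_digraph \<gamma>" and th: "tail \<gamma> = tail G" "head \<gamma> = head G"
      using \<gamma>(1) unfolding subgraph_def compatible_def by auto
    have fin\<gamma>: "finite (arcs \<gamma>)" using finite_subset[OF sub(2) finite_arcs] .
    have dg: "deg \<gamma> (arcs \<gamma>) z = deg G (arcs \<gamma>) z" for z by (simp add: deg_def incid_def th)
    have ends: "ends G e \<subseteq> verts \<gamma>" if "e \<in> arcs \<gamma>" for e
      using wf_digraph.tail_in_verts[OF sub(3) that] wf_digraph.head_in_verts[OF sub(3) that] th
      by (simp add: ends_def)
    have in_ends: "\<exists>e\<in>arcs \<gamma>. z \<in> ends G e" if "z \<in> verts \<gamma>" for z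
    proof -
      have "deg G (arcs \<gamma>) z > 0" using \<gamma>(2) that dg unfolding two_regular_def by simp
      then show ?thesis unfolding deg_pos_iff[OF fin\<gamma>] .
    qed
    have "deg G (arcs \<gamma>) z \<in> {0, 2}" for z
    proof (cases "z \<in> verts \<gamma>")
      case True then show ?thesis using \<gamma>(2) dg unfolding two_regular_def by simp
    next
      case False
      then have "deg G (arcs \<gamma>) z = 0" by (intro deg_zero) (use ends in blast)
      then show ?thesis by simp
    qed
    moreover have "arcs \<gamma> \<noteq> {}" using \<gamma>(3) in_ends by auto
    ultimately have "even_set G (arcs \<gamma>)" unfolding even_set_def using sub(2) by simp
    moreover have "verts \<gamma> = (\<Union>e\<in>arcs \<gamma>. ends G e)" using ends in_ends by blast
    then have "\<gamma> = arc_subgraph G (arcs \<gamma>)"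
      unfolding arc_subgraph_def using th by (intro pre_digraph.equality) simp_all
    ultimately show "\<exists>E. even_set G E \<and> \<gamma> = arc_subgraph G E" by blast
  qed
qed

section \<open>Degrees under the exchange\<close>

locale triangle_Y =
  fixes Gtri GY :: "('v, 'e) pre_digraph" and u v w x :: 'v and uv vw wu ux vx wx :: 'e
  assumes fin_tri: "fin_digraph Gtri" and fin_Y: "fin_digraph GY"
    and tri_verts: "{u, v, w} \<subseteq> verts Gtri" and distinct: "u \<noteq> v" "v \<noteq> w" "w \<noteq> u"
    and tri_arcs: "{uv, vw, wu} \<subseteq> arcs Gtri"
    and tri_ends: "ends Gtri uv = {u, v}" "ends Gtri vw = {v, w}" "ends Gtri wu = {w, u}"
    and x_new: "x \<notin> verts Gtri" and Y_new: "{ux, vx, wx} \<inter> arcs Gtri = {}"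
    and verts_Y: "verts GY = insert x (verts Gtri)"
    and arcs_Y: "arcs GY = (arcs Gtri - {uv, vw, wu}) \<union> {ux, vx, wx}"
    and Y_ends: "ends GY ux = {u, x}" "ends GY vx = {v, x}" "ends GY wx = {w, x}"
    and common: "\<And>e. e \<in> arcs Gtri - {uv, vw, wu} \<Longrightarrow> tail GY e = tail Gtri e \<and> head GY e = head Gtri e"
begin

text \<open>Cyclic symmetry of the configuration; it reduces the case distinction over the sides of
  the triangle to the side \<open>uv\<close>.\<close>

lemma rotate_graphs: "triangle_Y Gtri GY v w u x vw wu uv vx wx ux"
proof -
  have e: "{vw, wu, uv} = {uv, vw, wu}" "{vx, wx, ux} = {ux, vx, wx}" "{v, w, u} = {u, v, w}" by auto
  show ?thesis
    by (rule triangle_Y.intro, unfold e)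
      (use fin_tri fin_Y tri_verts distinct tri_arcs tri_ends x_new Y_new verts_Y arcs_Y Y_ends common in auto)
qed

lemma tri_distinct: "uv \<noteq> vw" "vw \<noteq> wu" "wu \<noteq> uv"
proof -
  have "{u, v} \<noteq> {v, w}" "{v, w} \<noteq> {w, u}" "{w, u} \<noteq> {u, v}"
    using distinct by (simp_all add: doubleton_eq_iff)
  then show "uv \<noteq> vw" "vw \<noteq> wu" "wu \<noteq> uv" unfolding tri_ends[symmetric] by auto
qed

lemma x_distinct: "x \<noteq> u" "x \<noteq> v" "x \<noteq> w"
  using x_new tri_verts by auto

lemma Y_distinct: "ux \<noteq> vx" "vx \<noteq> wx" "wx \<noteq> ux"
proof -
  have "{u, x} \<noteq> {v, x}" "{v, x} \<noteq> {w, x}" "{w, x} \<noteq> {u, x}"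
    using distinct by (auto simp: doubleton_eq_iff)
  then show "ux \<noteq> vx" "vx \<noteq> wx" "wx \<noteq> ux" unfolding Y_ends[symmetric] by auto
qed

lemma outer:
  assumes "e \<in> arcs Gtri - {uv, vw, wu}"
  shows "ends GY e = ends Gtri e" "closed_edge GY e = closed_edge Gtri e" "edge_param GY e = edge_param Gtri e"
    "incid GY e z = incid Gtri e z"
proof -
  have th: "tail GY e = tail Gtri e" "head GY e = head Gtri e" using common[OF assms] by simp_all
  show "ends GY e = ends Gtri e" "closed_edge GY e = closed_edge Gtri e" "incid GY e z = incid Gtri e z"
    unfolding ends_def closed_edge_explicit incid_def th by (rule refl)+
  show "edge_param GY e = edge_param Gtri e" unfolding edge_param_def[abs_def] th by (rule refl)
qed

lemma ends_tri: "e \<in> arcs Gtri \<Longrightarrow> ends Gtri e \<subseteq> verts Gtri"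
  using fin_digraph.axioms(1)[OF fin_tri] wf_digraph.tail_in_verts wf_digraph.head_in_verts
  unfolding ends_def by fastforce

lemma deg_outer: "O' \<subseteq> arcs Gtri - {uv, vw, wu} \<Longrightarrow> deg GY O' z = deg Gtri O' z"
  unfolding deg_def by (intro sum.cong outer(4)) auto

lemma deg_x: "O' \<subseteq> arcs Gtri \<Longrightarrow> deg Gtri O' x = 0"
  using ends_tri x_new by (intro deg_zero) blast

lemma incid_tri:
  "incid Gtri uv z = of_bool (z = u \<or> z = v)" "incid Gtri vw z = of_bool (z = v \<or> z = w)"
  "incid Gtri wu z = of_bool (z = w \<or> z = u)"
  by (rule incid_ends; use distinct tri_ends in simp)+

lemma incid_Y:
  "incid GY ux z = of_bool (z = u \<or> z = x)" "incid GY vx z = of_bool (z = v \<or> z = x)"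
  "incid GY wx z = of_bool (z = w \<or> z = x)"
  by (rule incid_ends; use x_distinct Y_ends in simp)+

lemma finite_sub: "E \<subseteq> arcs Gtri \<Longrightarrow> finite E"
  using finite_subset fin_digraph.finite_arcs[OF fin_tri] by blast

text \<open>The part common to both graphs; it contains all vertices of \<open>Gtri\<close>, in
  particular the corners of the triangle.\<close>

definition old :: "('v, 'e) gpoint set" where
  "old = Vertex ` verts Gtri \<union> (\<Union>e\<in>arcs Gtri - {uv, vw, wu}. closed_edge Gtri e)"

lemma wf_tri: "wf_digraph Gtri" using fin_digraph.axioms(1)[OF fin_tri] .
lemma wf_Y: "wf_digraph GY" using fin_digraph.axioms(1)[OF fin_Y] .

lemma old_sub: "old \<subseteq> realization GY"
proof -
  have "closed_edge Gtri e \<subseteq> realization GY" if "e \<in> arcs Gtri - {uv, vw, wu}" for e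
    using that outer(2)[OF that] arcs_Y unfolding realization_eq[OF wf_Y] by auto
  then show ?thesis using verts_Y unfolding old_def realization_eq[OF wf_Y] by auto
qed

text \<open>If the set uses only \<open>uv\<close>, the contributions of this edge at
  \<open>u\<close> and \<open>v\<close> pass to \<open>ux\<close> and \<open>vx\<close>. If it uses
  \<open>vw\<close> and \<open>wu\<close>, these exhaust the degree at \<open>w\<close>, which drops
  to 0. In both cases the new vertex \<open>x\<close> gets degree 2.\<close>

lemma even_uv:
  assumes E: "even_set Gtri E" and S: "E \<inter> {uv, vw, wu} = {uv} \<or> E \<inter> {uv, vw, wu} = {vw, wu}"
  shows "even_set GY (insert ux (insert vx (E - {uv, vw, wu})))"
proof -
  define O' where "O' = E - {uv, vw, wu}"
  have EG: "E \<subseteq> arcs Gtri" "\<And>z. deg Gtri E z \<in> {0, 2}" using E unfolding even_set_def by auto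
  have O': "O' \<subseteq> arcs Gtri - {uv, vw, wu}" "finite O'" using EG(1) finite_sub[of O'] by (auto simp: O'_def)
  have vxO: "vx \<notin> O'" and uxO: "ux \<notin> insert vx O'" using O'(1) Y_new Y_distinct by auto
  have d: "deg GY (insert ux (insert vx O')) z = of_bool (z = u \<or> z = x) + of_bool (z = v \<or> z = x) + deg Gtri O' z" for z
    using deg_insert[OF _ uxO, of GY z] deg_insert[OF O'(2) vxO, of GY z] O'(2) deg_outer[OF O'(1), of z]
    unfolding incid_Y by simp
  have x0: "deg Gtri O' x = 0" using O'(1) by (intro deg_x) auto
  have "deg GY (insert ux (insert vx O')) z \<in> {0, 2}" for z
    using S
  proof
    assume S: "E \<inter> {uv, vw, wu} = {uv}"
    then have "E = insert uv O'" "uv \<notin> O'" by (auto simp: O'_def)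
    then have dE: "deg Gtri E z = of_bool (z = u \<or> z = v) + deg Gtri O' z" for z
      using deg_insert[OF O'(2), of uv Gtri z] incid_tri(1) by simp
    show ?thesis
    proof (cases "z = x")
      case True then show ?thesis using d[of x] x0 x_distinct by simp
    next
      case False
      then have "deg GY (insert ux (insert vx O')) z = deg Gtri E z"
        using d[of z] dE[of z] distinct by auto
      then show ?thesis using EG(2) by simp
    qed
  next
    assume S: "E \<inter> {uv, vw, wu} = {vw, wu}"
    then have EO: "E = insert vw (insert wu O')" "wu \<notin> O'" "vw \<notin> insert wu O'"
      using tri_distinct by (auto simp: O'_def)
    then have dE: "deg Gtri E z = of_bool (z = v \<or> z = w) + of_bool (z = w \<or> z = u) + deg Gtri O' z" for z
      using deg_insert[OF _ EO(3), of Gtri z] deg_insert[OF O'(2) EO(2), of Gtri z] O'(2) incid_tri by simp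
    have w0: "deg Gtri O' w = 0" using dE[of w] EG(2)[of w] by auto
    consider "z = x" | "z = w" | "z \<noteq> x" "z \<noteq> w" by blast
    then show ?thesis
    proof cases
      case 1 then show ?thesis using d[of x] x0 x_distinct by simp
    next
      case 2 then show ?thesis using d[of w] w0 x_distinct distinct by simp
    next
      case 3
      then have "deg GY (insert ux (insert vx O')) z = deg Gtri E z"
        using d[of z] dE[of z] distinct by auto
      then show ?thesis using EG(2) by simp
    qed
  qed
  then show ?thesis unfolding even_set_def O'_def[symmetric] using O'(1) arcs_Y by auto
qed

text \<open>The two sides of the triangle at \<open>w\<close> already account for the full degree
  2.\<close>

lemma deg_w_zero:
  assumes E: "even_set Gtri E" and S: "{vw, wu} \<subseteq> E"
  shows "deg Gtri (E - {vw, wu}) w = 0"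
proof -
  have EG: "E \<subseteq> arcs Gtri" "deg Gtri E w \<in> {0, 2}" using E unfolding even_set_def by auto
  have "deg Gtri E w = deg Gtri {vw, wu} w + deg Gtri (E - {vw, wu}) w"
    using deg_split[OF finite_sub[OF EG(1)] S] .
  moreover have "deg Gtri {vw, wu} w = 2" using tri_distinct incid_tri by (simp add: deg_def)
  ultimately show ?thesis using EG(2) by auto
qed

lemma even_zero:
  assumes E: "even_set Gtri E" and S: "E \<inter> {uv, vw, wu} = {}"
  shows "even_set GY E"
proof -
  have "E \<subseteq> arcs Gtri - {uv, vw, wu}" using E S unfolding even_set_def by auto
  then show ?thesis using E deg_outer[of E] arcs_Y unfolding even_set_def by auto
qed

text \<open>Among the new edges only \<open>ux\<close> ends at \<open>u\<close>, so an outer degree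
  of 1 must be completed by \<open>ux\<close>, and an outer degree of 0 or 2 excludes it. This is
  the source of the uniqueness behind \<open>Phi_bar\<close>.\<close>

lemma ux_iff:
  assumes E: "even_set GY E"
  shows "ux \<in> E \<longleftrightarrow> deg GY (E - {ux, vx, wx}) u = 1"
proof -
  have EG: "E \<subseteq> arcs GY" "deg GY E u \<in> {0, 2}" using E unfolding even_set_def by auto
  have finE: "finite E" using finite_subset[OF EG(1)] fin_digraph.finite_arcs[OF fin_Y] by blast
  have "deg GY E u = deg GY (E \<inter> {ux, vx, wx}) u + deg GY (E - {ux, vx, wx}) u"
    using deg_split[OF finE, of "E \<inter> {ux, vx, wx}" GY u] by (simp add: Diff_Int_distrib Diff_Int)
  moreover have "deg GY (E \<inter> {ux, vx, wx}) u = (\<Sum>e\<in>{ux, vx, wx}. if e \<in> E then incid GY e u else 0)"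
    unfolding deg_def Int_commute[of E] by (rule sum.inter_restrict) simp
  moreover have "\<dots> = of_bool (ux \<in> E)" using Y_distinct incid_Y distinct x_distinct by auto
  ultimately show ?thesis using EG(2) by (cases "ux \<in> E") auto
qed

end

text \<open>By rotation the outer edges decide about each of the three edges at
  \<open>x\<close>.\<close>

lemma (in triangle_Y) even_unique:
  assumes "even_set GY E" "even_set GY E'" "E - {ux, vx, wx} = E' - {ux, vx, wx}"
  shows "E = E'"
proof -
  interpret r1: triangle_Y Gtri GY v w u x vw wu uv vx wx ux by (rule rotate_graphs)
  interpret r2: triangle_Y Gtri GY w u v x wu uv vw wx ux vx by (rule r1.rotate_graphs)
  have e: "{vx, wx, ux} = {ux, vx, wx}" "{wx, ux, vx} = {ux, vx, wx}" by auto
  have "ux \<in> E \<longleftrightarrow> ux \<in> E'" "vx \<in> E \<longleftrightarrow> vx \<in> E'" "wx \<in> E \<longleftrightarrow> wx \<in> E'"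
    using ux_iff assms r1.ux_iff[unfolded e] r2.ux_iff[unfolded e] by simp_all
  then show ?thesis using assms(3) by blast
qed

section \<open>Replacing the tripod by the boundary of the triangle\<close>

definition tri_map :: "('v, 'e) pre_digraph \<Rightarrow> 'e set \<Rightarrow> (('v, 'e) gpoint \<Rightarrow> real^4) \<Rightarrow> ('v, 'e) gpoint \<Rightarrow> real^4" where
  "tri_map G A f p = (case p of Vertex a \<Rightarrow> f (Vertex a)
     | Inner e t \<Rightarrow> if e \<in> A then (1 - t) *\<^sub>R f (Vertex (tail G e)) + t *\<^sub>R f (Vertex (head G e)) else f (Inner e t))"

lemma tri_map_edge:
  "e \<in> A \<Longrightarrow> tri_map G A f (edge_param G e t) = (1 - t) *\<^sub>R f (Vertex (tail G e)) + t *\<^sub>R f (Vertex (head G e))"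
  "e \<notin> A \<Longrightarrow> tri_map G A f (edge_param G e t) = f (edge_param G e t)"
  by (auto simp: tri_map_def edge_param_def)

lemma tri_map_edge_image:
  assumes "e \<in> A" "ends G e = {a, b}"
  shows "tri_map G A f ` closed_edge G e = closed_segment (f (Vertex a)) (f (Vertex b))"
proof -
  have "tri_map G A f ` closed_edge G e = closed_segment (f (Vertex (tail G e))) (f (Vertex (head G e)))"
    unfolding closed_edge_image tri_map_edge(1)[OF assms(1)] closed_segment_image_interval ..
  moreover have "a = tail G e \<and> b = head G e \<or> a = head G e \<and> b = tail G e"
    using assms(2) unfolding ends_def by (auto simp: doubleton_eq_iff)
  ultimately show ?thesis by (elim disjE) (simp_all add: closed_segment_commute)
qed

definition isotopic_or_eq :: "(real^4) set \<Rightarrow> (real^4) set \<Rightarrow> bool" where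
  "isotopic_or_eq A B \<longleftrightarrow> ambient_isotopic A B \<or> ambient_isotopic B A \<or> A = B"

locale standard_Y = triangle_Y Gtri GY u v w x uv vw wu ux vx wx + tripod_frame d1 d2 n1 n2
  for Gtri GY :: "('v, 'e) pre_digraph" and u v w x :: 'v and uv vw wu ux vx wx :: 'e and d1 d2 n1 n2 :: "real^4" +
  fixes f :: "('v, 'e) gpoint \<Rightarrow> real^4"
  assumes emb: "spatial_embedding GY f"
    and corners: "f (Vertex u) = north + d1" "f (Vertex v) = north + d2" "f (Vertex w) = north + d3"
    and legs: "f ` closed_edge GY ux = closed_segment north (north + d1)"
      "f ` closed_edge GY vx = closed_segment north (north + d2)"
      "f ` closed_edge GY wx = closed_segment north (north + d3)"
    and clear: "f ` (Vertex ` verts Gtri \<union> (\<Union>e\<in>arcs Gtri - {uv, vw, wu}. closed_edge Gtri e)) \<inter> triangle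
      \<subseteq> {north + d1, north + d2, north + d3}"
begin

lemma rotate_standard: "standard_Y Gtri GY v w u x vw wu uv vx wx ux d2 d3 (n2 - n1) (- n1) f"
proof -
  interpret r1: triangle_Y Gtri GY v w u x vw wu uv vx wx ux by (rule rotate_graphs)
  interpret r: tripod_frame d2 d3 "n2 - n1" "- n1" by (rule rotate)
  have rd: "r.d3 = d1" by (subst r.d3_def) (simp add: d3_def)
  have e: "{vw, wu, uv} = {uv, vw, wu}" by auto
  have t: "r.triangle = triangle" unfolding r.triangle_def triangle_def rd by (simp add: insert_commute)
  have s: "{north + d2, north + d3, north + d1} = {north + d1, north + d2, north + d3}" by auto
  show ?thesis
    by (rule standard_Y.intro[OF r1.triangle_Y_axioms r.tripod_frame_axioms standard_Y_axioms.intro], unfold rd e t s)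
      (rule emb corners legs clear)+
qed

abbreviation g :: "('v, 'e) gpoint \<Rightarrow> real^4" where "g \<equiv> tri_map Gtri {uv, vw, wu} f"

lemma g_old: "p \<in> old \<Longrightarrow> g p = f p"
  unfolding old_def closed_edge_explicit tri_map_def by (auto split: if_splits)

lemma inj_f: "inj_on f (realization GY)" using emb unfolding spatial_embedding_def by simp

lemma realization_tri: "realization Gtri \<subseteq> old \<union> {Inner e t | e t. e \<in> {uv, vw, wu} \<and> 0 < t \<and> t < 1}"
  unfolding realization_def old_def closed_edge_explicit by auto

abbreviation P :: "'v \<Rightarrow> real^4" where "P a \<equiv> f (Vertex a)"

lemma sides_in_triangle:
  "closed_segment (P u) (P v) \<subseteq> triangle" "closed_segment (P v) (P w) \<subseteq> triangle" "closed_segment (P w) (P u) \<subseteq> triangle"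
  unfolding segment_convex_hull triangle_def corners by (intro hull_mono; auto)+

lemma not_col: "\<not> collinear {P u, P v, P w}"
  unfolding corners by (rule triangle_not_collinear)

lemma sides_meet:
  "closed_segment (P u) (P v) \<inter> closed_segment (P v) (P w) = {P v}"
  "closed_segment (P v) (P w) \<inter> closed_segment (P w) (P u) = {P w}"
  "closed_segment (P w) (P u) \<inter> closed_segment (P u) (P v) = {P u}"
  using not_col by (intro Int_closed_segment; simp add: insert_commute)+

lemma corners_distinct: "P u \<noteq> P v" "P v \<noteq> P w" "P w \<noteq> P u"
  using not_col by (auto simp: insert_commute)

lemma inner_side:
  assumes "e \<in> {uv, vw, wu}" "0 < t" "t < 1"
  shows "g (Inner e t) \<in> g ` closed_edge Gtri e" "g (Inner e t) \<in> triangle" "g (Inner e t) \<notin> {P u, P v, P w}"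
proof -
  show 1: "g (Inner e t) \<in> g ` closed_edge Gtri e" unfolding closed_edge_explicit using assms by blast
  have im: "g ` closed_edge Gtri uv = closed_segment (P u) (P v)" "g ` closed_edge Gtri vw = closed_segment (P v) (P w)"
    "g ` closed_edge Gtri wu = closed_segment (P w) (P u)"
    by (rule tri_map_edge_image; simp add: tri_ends)+
  show "g (Inner e t) \<in> triangle" using 1 assms(1) im sides_in_triangle by auto
  have th: "tail Gtri e \<noteq> head Gtri e" "{P (tail Gtri e), P (head Gtri e)} \<subseteq> {P u, P v, P w}"
    "P (tail Gtri e) \<noteq> P (head Gtri e)"
    using assms(1) tri_ends distinct corners_distinct unfolding ends_def by (auto simp: doubleton_eq_iff)
  have g: "g (Inner e t) = (1 - t) *\<^sub>R P (tail Gtri e) + t *\<^sub>R P (head Gtri e)"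
    using assms(1) by (auto simp: tri_map_def)
  have ne: "g (Inner e t) \<noteq> P (tail Gtri e)" "g (Inner e t) \<noteq> P (head Gtri e)"
  proof -
    have "g (Inner e t) - P (tail Gtri e) = t *\<^sub>R (P (head Gtri e) - P (tail Gtri e))"
      "g (Inner e t) - P (head Gtri e) = (1 - t) *\<^sub>R (P (tail Gtri e) - P (head Gtri e))"
      unfolding g by (simp_all add: algebra_simps)
    then show "g (Inner e t) \<noteq> P (tail Gtri e)" "g (Inner e t) \<noteq> P (head Gtri e)" using assms(2,3) th(3) by auto
  qed
  show "g (Inner e t) \<notin> {P u, P v, P w}"
  proof -
    have w: "P w \<notin> closed_segment (P u) (P v)" "P u \<notin> closed_segment (P v) (P w)" "P v \<notin> closed_segment (P w) (P u)"
      using sides_meet corners_distinct by (metis IntI ends_in_segment(1) ends_in_segment(2) singletonD)+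
    from assms(1) consider "e = uv" | "e = vw" | "e = wu" by blast
    then show ?thesis
    proof cases
      case 1
      have "{tail Gtri uv, head Gtri uv} = {u, v}" using tri_ends unfolding ends_def by simp
      then have "g (Inner e t) \<noteq> P u" "g (Inner e t) \<noteq> P v" using ne 1 by (auto simp: doubleton_eq_iff)
      moreover have "g (Inner e t) \<noteq> P w" using \<open>g (Inner e t) \<in> g ` closed_edge Gtri e\<close> w(1) im(1) 1 by metis
      ultimately show ?thesis by simp
    next
      case 2
      have "{tail Gtri vw, head Gtri vw} = {v, w}" using tri_ends unfolding ends_def by simp
      then have "g (Inner e t) \<noteq> P v" "g (Inner e t) \<noteq> P w" using ne 2 by (auto simp: doubleton_eq_iff)
      moreover have "g (Inner e t) \<noteq> P u" using \<open>g (Inner e t) \<in> g ` closed_edge Gtri e\<close> w(2) im(2) 2 by metis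
      ultimately show ?thesis by simp
    next
      case 3
      have "{tail Gtri wu, head Gtri wu} = {w, u}" using tri_ends unfolding ends_def by simp
      then have "g (Inner e t) \<noteq> P w" "g (Inner e t) \<noteq> P u" using ne 3 by (auto simp: doubleton_eq_iff)
      moreover have "g (Inner e t) \<noteq> P v" using \<open>g (Inner e t) \<in> g ` closed_edge Gtri e\<close> w(3) im(3) 3 by metis
      ultimately show ?thesis by simp
    qed
  qed
qed

lemma g_sides:
  "g ` closed_edge Gtri uv = closed_segment (P u) (P v)" "g ` closed_edge Gtri vw = closed_segment (P v) (P w)"
  "g ` closed_edge Gtri wu = closed_segment (P w) (P u)"
  by (rule tri_map_edge_image; simp add: tri_ends)+

text \<open>The old part meets the triangle only in corners, the open sides lie in the triangle and
  avoid the corners, and different sides meet only in corners.\<close>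

lemma g_inj: "inj_on g (realization Gtri)"
proof (rule inj_onI)
  fix p q assume p: "p \<in> realization Gtri" and q: "q \<in> realization Gtri" and eq: "g p = g q"
  have mixed: False if "p \<in> old" "q = Inner e t" "e \<in> {uv, vw, wu}" "0 < t" "t < 1" "g p = g q" for p q e t
  proof -
    have "g q \<in> f ` old" using g_old[OF that(1)] that(1,6) by (intro image_eqI[of _ _ p]) simp_all
    then have "g q \<in> {P u, P v, P w}" using clear inner_side(2)[OF that(3-5)] that(2) unfolding corners old_def by blast
    then show False using inner_side(3)[OF that(3-5)] that(2) by simp
  qed
  have "p \<in> old \<or> (\<exists>e t. p = Inner e t \<and> e \<in> {uv, vw, wu} \<and> 0 < t \<and> t < 1)"
    "q \<in> old \<or> (\<exists>e t. q = Inner e t \<and> e \<in> {uv, vw, wu} \<and> 0 < t \<and> t < 1)"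
    using realization_tri p q by auto
  then consider "p \<in> old" "q \<in> old" | e t where "p \<in> old" "q = Inner e t" "e \<in> {uv, vw, wu}" "0 < t" "t < 1"
    | e t where "q \<in> old" "p = Inner e t" "e \<in> {uv, vw, wu}" "0 < t" "t < 1"
    | e s e' t where "p = Inner e s" "e \<in> {uv, vw, wu}" "0 < s" "s < 1" "q = Inner e' t" "e' \<in> {uv, vw, wu}" "0 < t" "t < 1"
    by blast
  then show "p = q"
  proof cases
    case 1
    then have "f p = f q" using eq g_old by simp
    then show ?thesis using inj_onD[OF inj_f] 1 old_sub by blast
  next
    case 2 then show ?thesis using mixed[OF 2] eq by simp
  next
    case 3 then show ?thesis using mixed[OF 3] eq by simp
  next
    case (4 e s e' t)
    show ?thesis
    proof (cases "e = e'")
      case True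
      have ne: "P (tail Gtri e) \<noteq> P (head Gtri e)"
        using 4(2) tri_ends distinct corners_distinct unfolding ends_def by (auto simp: doubleton_eq_iff)
      have "(1 - s) *\<^sub>R P (tail Gtri e) + s *\<^sub>R P (head Gtri e) = (1 - t) *\<^sub>R P (tail Gtri e) + t *\<^sub>R P (head Gtri e)"
        using eq 4(1,2,5) True by (auto simp: tri_map_def)
      then have "(s - t) *\<^sub>R (P (head Gtri e) - P (tail Gtri e)) = 0" by (simp add: algebra_simps)
      then have "s = t" using ne by simp
      then show ?thesis using 4(1,5) True by simp
    next
      case False
      have m: "g p \<in> g ` closed_edge Gtri e \<inter> g ` closed_edge Gtri e'"
        using inner_side(1)[OF 4(2-4)] inner_side(1)[OF 4(6-8)] eq 4(1,5) by simp
      have "g ` closed_edge Gtri e \<inter> g ` closed_edge Gtri e' \<subseteq> {P u, P v, P w}"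
        using 4(2,6) False sides_meet unfolding g_sides by (elim insertE) (auto simp: g_sides)
      then show ?thesis using m inner_side(3)[OF 4(2-4)] 4(1) by blast
    qed
  qed
qed

lemma g_embedding: "spatial_embedding Gtri g"
  unfolding spatial_embedding_def
proof (intro conjI ballI)
  show "inj_on g (realization Gtri)" by (rule g_inj)
  have "g p \<in> S3" if "p \<in> realization Gtri" for p
  proof (cases "p \<in> old")
    case True
    then show ?thesis using g_old old_sub emb unfolding spatial_embedding_def by (metis image_subset_iff subsetD)
  next
    case False
    then have "p \<in> {Inner e t | e t. e \<in> {uv, vw, wu} \<and> 0 < t \<and> t < 1}" using that realization_tri by blast
    then obtain e t where "p = Inner e t" "e \<in> {uv, vw, wu}" "0 < t" "t < 1" by blast
    then show ?thesis using inner_side(2) triangle_S3 by blast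
  qed
  then show "g ` realization Gtri \<subseteq> S3" by blast
  fix e assume e: "e \<in> arcs Gtri"
  show "pl_on {0..1} (\<lambda>t. g (edge_param Gtri e t))"
  proof (cases "e \<in> {uv, vw, wu}")
    case True
    show ?thesis unfolding tri_map_edge(1)[OF True]
      by (intro pl_on_add pl_on_vector pl_on_diff pl_on_const pl_on_id polyhedral_interval)
  next
    case False
    then have "e \<in> arcs Gtri - {uv, vw, wu}" using e by simp
    then have "e \<in> arcs GY" "edge_param GY e = edge_param Gtri e" using arcs_Y outer(3) by auto
    then show ?thesis unfolding tri_map_edge(2)[OF False] using edge_path(1)[OF emb, of e] by simp
  qed
qed

lemma outer_image:
  assumes "O' \<subseteq> arcs Gtri - {uv, vw, wu}"
  shows "g ` (\<Union>e\<in>O'. closed_edge Gtri e) = f ` (\<Union>e\<in>O'. closed_edge GY e)"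
    "polyhedral (f ` (\<Union>e\<in>O'. closed_edge GY e))" "f ` (\<Union>e\<in>O'. closed_edge GY e) \<subseteq> S3"
    "f ` (\<Union>e\<in>O'. closed_edge GY e) \<inter> triangle \<subseteq> {north + d1, north + d2, north + d3}"
    "(\<Union>e\<in>O'. closed_edge GY e) \<subseteq> old"
proof -
  have ce: "closed_edge GY e = closed_edge Gtri e" if "e \<in> O'" for e using outer(2) assms that by blast
  then have U: "(\<Union>e\<in>O'. closed_edge GY e) = (\<Union>e\<in>O'. closed_edge Gtri e)" by simp
  show sub: "(\<Union>e\<in>O'. closed_edge GY e) \<subseteq> old" unfolding U old_def using assms by blast
  show "g ` (\<Union>e\<in>O'. closed_edge Gtri e) = f ` (\<Union>e\<in>O'. closed_edge GY e)"
    unfolding U using g_old sub[unfolded U] by (intro image_cong) auto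
  show "polyhedral (f ` (\<Union>e\<in>O'. closed_edge GY e))"
    unfolding image_UN using assms arcs_Y finite_sub[of O'] by (intro polyhedral_UN polyhedral_edge[OF emb]) auto
  show "f ` (\<Union>e\<in>O'. closed_edge GY e) \<subseteq> S3"
    using sub old_sub emb unfolding spatial_embedding_def by blast
  show "f ` (\<Union>e\<in>O'. closed_edge GY e) \<inter> triangle \<subseteq> {north + d1, north + d2, north + d3}"
    using clear image_mono[OF sub, of f] unfolding old_def by blast
qed

text \<open>By injectivity of \<open>f\<close>, a corner lies on the remaining edges only if one of
  them ends there, which the degree excludes.\<close>

lemma corner_avoided:
  assumes O': "O' \<subseteq> arcs Gtri - {uv, vw, wu}" and a: "a \<in> verts Gtri" "deg Gtri O' a = 0"
  shows "P a \<notin> f ` (\<Union>e\<in>O'. closed_edge GY e)"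
proof
  assume "P a \<in> f ` (\<Union>e\<in>O'. closed_edge GY e)"
  then obtain p where p: "P a = f p" "p \<in> (\<Union>e\<in>O'. closed_edge GY e)" by (elim imageE)
  have "Vertex a \<in> old" using a(1) unfolding old_def by blast
  then have "Vertex a = p" using inj_onD[OF inj_f p(1)] old_sub outer_image(5)[OF O'] p(2) by blast
  then obtain e where e: "e \<in> O'" "Vertex a \<in> closed_edge GY e" using p(2) by (elim UN_E) simp
  then have "a \<in> ends GY e" unfolding closed_edge_explicit ends_def by auto
  then have "a \<in> ends Gtri e" using outer(1)[of e] e(1) O' by blast
  moreover have "finite O'" using O' finite_sub[of O'] by auto
  ultimately show False using deg_pos[OF _ e(1)] a(2) by fastforce
qed

lemma realization_image:
  "g ` realization (arc_subgraph Gtri E) = (\<Union>e\<in>E \<inter> {uv, vw, wu}. g ` closed_edge Gtri e) \<union> g ` (\<Union>e\<in>E - {uv, vw, wu}. closed_edge Gtri e)"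
proof -
  have "E = (E \<inter> {uv, vw, wu}) \<union> (E - {uv, vw, wu})" by blast
  then have "realization (arc_subgraph Gtri E) = (\<Union>e\<in>(E \<inter> {uv, vw, wu}) \<union> (E - {uv, vw, wu}). closed_edge Gtri e)"
    unfolding realization_arc_subgraph by simp
  also have "\<dots> = (\<Union>e\<in>E \<inter> {uv, vw, wu}. closed_edge Gtri e) \<union> (\<Union>e\<in>E - {uv, vw, wu}. closed_edge Gtri e)"
    by (rule UN_Un)
  finally show ?thesis by (simp only: image_Un image_UN)
qed

text \<open>The sides in use are exchanged for \<open>ux\<close> and \<open>vx\<close>. The isotopy
  has to fix only the rest \<open>R\<close> of this cycle union, so it may sweep across the other
  leg of the tripod.\<close>

lemma corr_uv:
  assumes E: "even_set Gtri E" and S: "E \<inter> {uv, vw, wu} = {uv} \<or> E \<inter> {uv, vw, wu} = {vw, wu}"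
  shows "\<exists>E'. even_set GY E' \<and> E' - {ux, vx, wx} = E - {uv, vw, wu} \<and>
    isotopic_or_eq (g ` realization (arc_subgraph Gtri E)) (f ` realization (arc_subgraph GY E'))"
proof (intro exI conjI)
  define O' where "O' = E - {uv, vw, wu}"
  define R where "R = f ` (\<Union>e\<in>O'. closed_edge GY e)"
  have O': "O' \<subseteq> arcs Gtri - {uv, vw, wu}" using E unfolding even_set_def O'_def by auto
  note out = outer_image[OF O', folded R_def]
  show "even_set GY (insert ux (insert vx (E - {uv, vw, wu})))" by (rule even_uv[OF assms])
  show "insert ux (insert vx (E - {uv, vw, wu})) - {ux, vx, wx} = E - {uv, vw, wu}"
    using Y_new E unfolding even_set_def by auto
  have fY: "f ` realization (arc_subgraph GY (insert ux (insert vx (E - {uv, vw, wu})))) =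
      closed_segment north (north + d1) \<union> closed_segment north (north + d2) \<union> R"
    unfolding realization_arc_subgraph O'_def[symmetric] R_def UN_insert image_Un legs by (simp add: Un_assoc)
  show "isotopic_or_eq (g ` realization (arc_subgraph Gtri E))
      (f ` realization (arc_subgraph GY (insert ux (insert vx (E - {uv, vw, wu})))))"
    using S
  proof
    assume S: "E \<inter> {uv, vw, wu} = {uv}"
    have "g ` realization (arc_subgraph Gtri E) = closed_segment (north + d1) (north + d2) \<union> R"
      unfolding realization_image S O'_def[symmetric] out(1) using g_sides(1) by (simp add: corners)
    then show ?thesis unfolding isotopic_or_eq_def fY using side_isotopic_legs[OF out(2-4)] by simp
  next
    assume S: "E \<inter> {uv, vw, wu} = {vw, wu}"
    have gE: "g ` realization (arc_subgraph Gtri E) =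
        closed_segment (north + d3) (north + d1) \<union> closed_segment (north + d3) (north + d2) \<union> R"
      unfolding realization_image S O'_def[symmetric] out(1) using g_sides(2,3)
      by (simp add: corners closed_segment_commute[of "north + d2"] Un_ac)
    have "E - {vw, wu} = O'" using S unfolding O'_def by auto
    \<comment> \<open>With both edges at \<open>w\<close> in use, the rest of the cycle union misses
      the corner \<open>P w\<close>, which the slide from the legs to the other two sides
      reaches.\<close>
    then have "deg Gtri O' w = 0" using deg_w_zero[OF E] S by auto
    then have "P w \<notin> R" unfolding R_def using corner_avoided[OF O', of w] tri_verts by simp
    then have "R \<inter> triangle \<subseteq> {north + d1, north + d2}" using out(4) unfolding corners by blast
    from legs_isotopic_other_sides[OF out(2,3) this]
    show ?thesis unfolding isotopic_or_eq_def fY gE by simp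
  qed
qed

lemma corr:
  assumes E: "even_set Gtri E" and S: "\<not> {uv, vw, wu} \<subseteq> E"
  shows "\<exists>E'. even_set GY E' \<and> E' - {ux, vx, wx} = E - {uv, vw, wu} \<and>
    isotopic_or_eq (g ` realization (arc_subgraph Gtri E)) (f ` realization (arc_subgraph GY E'))"
proof -
  interpret r1: standard_Y Gtri GY v w u x vw wu uv vx wx ux d2 d3 "n2 - n1" "- n1" f by (rule rotate_standard)
  interpret r2: standard_Y Gtri GY w u v x wu uv vw wx ux vx d3 r1.d3 "- n1 - (n2 - n1)" "- (n2 - n1)" f
    by (rule r1.rotate_standard)
  have e: "{vw, wu, uv} = {uv, vw, wu}" "{wu, uv, vw} = {uv, vw, wu}" "{vx, wx, ux} = {ux, vx, wx}" "{wx, ux, vx} = {ux, vx, wx}"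
    by auto
  consider "E \<inter> {uv, vw, wu} = {}" | "E \<inter> {uv, vw, wu} = {uv} \<or> E \<inter> {uv, vw, wu} = {vw, wu}"
    | "E \<inter> {uv, vw, wu} = {vw} \<or> E \<inter> {uv, vw, wu} = {wu, uv}"
    | "E \<inter> {uv, vw, wu} = {wu} \<or> E \<inter> {uv, vw, wu} = {uv, vw}"
    using S by auto
  then show ?thesis
  proof cases
    case 1
    have EO: "E \<subseteq> arcs Gtri - {uv, vw, wu}" "E - {uv, vw, wu} = E" using E 1 unfolding even_set_def by auto
    have "E - {ux, vx, wx} = E" using EO(1) Y_new by auto
    moreover have "g ` realization (arc_subgraph Gtri E) = f ` realization (arc_subgraph GY E)"
      unfolding realization_arc_subgraph by (rule outer_image(1)[OF EO(1)])
    ultimately show ?thesis using even_zero[OF E 1] EO(2) unfolding isotopic_or_eq_def by (intro exI[of _ E]) simp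
  next
    case 2 then show ?thesis by (rule corr_uv[OF E])
  next
    case 3 then show ?thesis by (rule r1.corr_uv[OF E, unfolded e])
  next
    case 4 then show ?thesis by (rule r2.corr_uv[OF E, unfolded e])
  qed
qed

text \<open>The triangle takes both edges at each corner, so the rest of the cycle union misses all
  corners and, since the graph has been cleared off, the whole triangle.\<close>

lemma full_triangle:
  assumes E: "even_set Gtri E" and S: "{uv, vw, wu} \<subseteq> E"
  obtains R where "g ` realization (arc_subgraph Gtri E) =
      (closed_segment (P u) (P v) \<union> closed_segment (P v) (P w) \<union> closed_segment (P w) (P u)) \<union> R"
    "polyhedral R" "R \<subseteq> S3" "R \<inter> triangle = {}"
proof -
  interpret r1: triangle_Y Gtri GY v w u x vw wu uv vx wx ux by (rule rotate_graphs)
  interpret r2: triangle_Y Gtri GY w u v x wu uv vw wx ux vx by (rule r1.rotate_graphs)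
  define O' where "O' = E - {uv, vw, wu}"
  define R where "R = f ` (\<Union>e\<in>O'. closed_edge GY e)"
  have EG: "E \<subseteq> arcs Gtri" using E unfolding even_set_def by auto
  have O': "O' \<subseteq> arcs Gtri - {uv, vw, wu}" using EG unfolding O'_def by auto
  note out = outer_image[OF O', folded R_def]
  have less: "deg Gtri O' a = 0" if "deg Gtri (E - F) a = 0" "F \<subseteq> {uv, vw, wu}" for F a
  proof -
    have "deg Gtri O' a \<le> deg Gtri (E - F) a" using that(2) finite_sub[OF EG] by (intro deg_mono) (auto simp: O'_def)
    then show ?thesis using that(1) by simp
  qed
  have z: "deg Gtri O' w = 0" "deg Gtri O' u = 0" "deg Gtri O' v = 0"
    using less[OF deg_w_zero[OF E]] less[OF r1.deg_w_zero[OF E]] less[OF r2.deg_w_zero[OF E]] S by auto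
  have "R \<inter> triangle = {}"
    using out(4) corner_avoided[OF O' _ z(1)] corner_avoided[OF O' _ z(2)] corner_avoided[OF O' _ z(3)] tri_verts
    unfolding corners R_def[symmetric] by auto
  moreover have "E \<inter> {uv, vw, wu} = {uv, vw, wu}" using S by blast
  then have "g ` realization (arc_subgraph Gtri E) =
      (closed_segment (P u) (P v) \<union> closed_segment (P v) (P w) \<union> closed_segment (P w) (P u)) \<union> R"
    unfolding realization_image O'_def[symmetric] out(1) using g_sides by (simp add: Un_assoc)
  ultimately show thesis using that out(2,3) by blast
qed

end


section \<open>Returning to the given embedding\<close>

lemma spatial_embedding_pl_homeo:
  assumes "spatial_embedding G f" "pl_homeo h" and wf: "wf_digraph G"
  shows "spatial_embedding G (\<lambda>p. h (f p))"
proof -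
  have f: "f ` realization G \<subseteq> S3" "inj_on f (realization G)" using assms(1) unfolding spatial_embedding_def by auto
  have sub: "(\<lambda>p. h (f p)) ` realization G \<subseteq> S3" using pl_homeo_subset[OF assms(2) f(1)] by (simp add: image_image)
  have inj: "inj_on (\<lambda>p. h (f p)) (realization G)"
    using comp_inj_on[OF f(2) pl_homeo_inj_on[OF assms(2) f(1)]] by (simp add: o_def)
  have "pl_on {0..1} (\<lambda>t. h (f (edge_param G e t)))" if "e \<in> arcs G" for e
  proof -
    have "pl_on {0..1} (\<lambda>t. f (edge_param G e t))" by (rule edge_path(1)[OF assms(1) that])
    moreover have "pl_on S3 h" using assms(2) unfolding pl_homeo_def by simp
    moreover have "f ` closed_edge G e \<subseteq> f ` realization G"
      unfolding realization_eq[OF wf] by (rule image_mono) (use that in blast)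
    then have "(\<lambda>t. f (edge_param G e t)) ` {0..1} \<subseteq> S3"
      using f(1) unfolding closed_edge_image by (rule order_trans)
    ultimately show ?thesis by (rule pl_on_compose)
  qed
  then show ?thesis unfolding spatial_embedding_def using sub inj by simp
qed

lemma isotopic_or_eq_pl_homeo:
  assumes "pl_homeo k" "A \<subseteq> S3" "B \<subseteq> S3" "isotopic_or_eq A B"
  shows "isotopic_or_eq (k ` A) (k ` B)"
  using assms(4) ambient_isotopic_pl_homeo[OF assms(1,2)] ambient_isotopic_pl_homeo[OF assms(1,3)]
  unfolding isotopic_or_eq_def by auto

lemma link_invariant_isotopic_or_eq:
  assumes "link_invariant \<alpha>" "link A" "link B" "isotopic_or_eq A B"
  shows "\<alpha> A = \<alpha> B"
  using assms unfolding link_invariant_def isotopic_or_eq_def by metis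

lemma (in spatial_graph) edge_leg:
  assumes "e \<in> arcs G" "ends G e = {a, b}" "a \<noteq> b"
  obtains p where "leg p (f (Vertex b))" "p 0 = f (Vertex a)" "p ` {0..1} = f ` closed_edge G e"
proof -
  obtain p where p: "pl_on {0..1} p" "Path_Connected.arc p" "pathstart p = f (Vertex a)" "pathfinish p = f (Vertex b)"
    "path_image p = f ` closed_edge G e"
    by (rule edge_arc[OF assms]) (rule that; assumption)
  have "f ` closed_edge G e \<subseteq> f ` realization G" by (rule image_mono[OF edge_in[OF assms(1)]])
  then have "f ` closed_edge G e \<subseteq> S3" using embedding unfolding spatial_embedding_def by (meson order_trans)
  then have "leg p (f (Vertex b))"
    using p unfolding leg_def Path_Connected.arc_def path_image_def pathfinish_def by simp
  then show thesis using p that unfolding pathstart_def path_image_def by simp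
qed

text \<open>The boundary of the triangle is closed, connected and disjoint from the closed set
  \<open>R\<close>, hence a component; the triangle is a disk that meets the link only there. Both
  facts are carried over by \<open>k\<close>.\<close>

lemma compressing_disk:
  assumes k: "pl_homeo k" and nc: "\<not> collinear {P1, P2, P3}" and T: "convex hull {P1, P2, P3} \<subseteq> S3"
    and R: "polyhedral R" "R \<subseteq> S3" "R \<inter> convex hull {P1, P2, P3} = {}"
    and L: "L = k ` ((closed_segment P1 P2 \<union> closed_segment P2 P3 \<union> closed_segment P3 P1) \<union> R)"
  shows "\<exists>K D. K \<in> components L \<and> pl_disk_with_boundary D K \<and> D \<inter> L = K"
proof (intro exI conjI)
  define C where "C = closed_segment P1 P2 \<union> closed_segment P2 P3 \<union> closed_segment P3 P1"
  define D where "D = convex hull {P1, P2, P3}"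
  have CD: "C \<subseteq> D" unfolding C_def D_def segment_convex_hull by (intro Un_least hull_mono; blast)
  have CR: "C \<inter> R = {}" using CD R(3) unfolding D_def by blast
  have CS: "C \<subseteq> S3" "D \<subseteq> S3" using CD T unfolding D_def by blast+
  have plk: "pl_on S3 k" using k unfolding pl_homeo_def by simp
  have LE: "L = k ` C \<union> k ` R" unfolding L C_def image_Un by simp
  have "Topological_Spaces.connected C"
    unfolding C_def by (intro connected_Un connected_segment) auto
  then have conn: "Topological_Spaces.connected (k ` C)"
    using continuous_on_subset[OF pl_on_imp_continuous_on[OF plk] CS(1)] connected_continuous_image by blast
  have "polyhedral C" unfolding C_def by (intro polyhedral_Un polyhedral_closed_segment)
  then have cl: "closed (k ` C)" "closed (k ` R)"
    using pl_homeo_polyhedral[OF k] CS(1) R(1,2) polyhedral_closed by blast+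
  have "k ` C \<inter> k ` R = {}" using pl_homeo_image_Int[OF k CS(1) R(2)] CR by simp
  moreover have "k ` C \<noteq> {}" unfolding C_def by auto
  ultimately show "k ` C \<in> components L"
    unfolding LE using conn cl by (intro component_of_disjoint_closed)
  obtain \<phi> :: "real \<times> real \<Rightarrow> real^4" where \<phi>: "pl_on (cbox (0,0) (1,1)) \<phi>" "inj_on \<phi> (cbox (0,0) (1,1))"
    "\<phi> ` cbox (0,0) (1,1) = D" "\<phi> ` frontier (cbox (0,0) (1,1)) = C"
    by (rule triangle_disk[OF nc, folded D_def C_def]) (rule that; assumption)
  have im: "\<phi> ` cbox (0,0) (1,1) \<subseteq> S3" unfolding \<phi>(3) by (rule CS(2))
  show "pl_disk_with_boundary (k ` D) (k ` C)"
    unfolding pl_disk_with_boundary_def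
  proof (intro conjI exI[of _ "\<lambda>z. k (\<phi> z)"])
    show "k ` D \<subseteq> S3" by (rule pl_homeo_subset[OF k CS(2)])
    show "pl_on (cbox (0,0) (1,1)) (\<lambda>z. k (\<phi> z))" by (rule pl_on_compose[OF \<phi>(1) plk im])
    show "inj_on (\<lambda>z. k (\<phi> z)) (cbox (0,0) (1,1))"
      using comp_inj_on[OF \<phi>(2) pl_homeo_inj_on[OF k im]] by (simp only: o_def)
    show "(\<lambda>z. k (\<phi> z)) ` cbox (0,0) (1,1) = k ` D" unfolding \<phi>(3)[symmetric] image_image ..
    show "(\<lambda>z. k (\<phi> z)) ` frontier (cbox (0,0) (1,1)) = k ` C" unfolding \<phi>(4)[symmetric] image_image ..
  qed
  have "C \<union> R \<subseteq> S3" using CS(1) R(2) by simp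
  then have "k ` D \<inter> L = k ` (D \<inter> (C \<union> R))"
    unfolding L C_def[symmetric] by (rule pl_homeo_image_Int[OF k CS(2)])
  also have "D \<inter> (C \<union> R) = C" using CD R(3) unfolding D_def by blast
  finally show "k ` D \<inter> L = k ` C" .
qed

context triangle_Y
begin

lemma old_Y: "old \<inter> closed_edge GY ux \<subseteq> {Vertex u}" "old \<inter> closed_edge GY vx \<subseteq> {Vertex v}"
  "old \<inter> closed_edge GY wx \<subseteq> {Vertex w}"
proof -
  have *: "old \<inter> closed_edge GY e \<subseteq> {Vertex a}" if "ends GY e = {a, x}" "e \<notin> arcs Gtri" for e a
  proof
    fix p assume p: "p \<in> old \<inter> closed_edge GY e"
    then have "p \<in> {Vertex (tail GY e), Vertex (head GY e)} \<union> {Inner e t | t. 0 < t \<and> t < 1}"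
      unfolding closed_edge_explicit by simp
    moreover have "Vertex x \<notin> old" using x_new ends_tri unfolding old_def closed_edge_explicit ends_def by auto
    moreover have "Inner e t \<notin> old" for t using that(2) unfolding old_def closed_edge_explicit by auto
    moreover have "tail GY e \<in> {a, x}" "head GY e \<in> {a, x}" using that(1) unfolding ends_def by auto
    ultimately show "p \<in> {Vertex a}" using p by auto
  qed
  show "old \<inter> closed_edge GY ux \<subseteq> {Vertex u}" "old \<inter> closed_edge GY vx \<subseteq> {Vertex v}"
    "old \<inter> closed_edge GY wx \<subseteq> {Vertex w}"
    using *[OF Y_ends(1)] *[OF Y_ends(2)] *[OF Y_ends(3)] Y_new by auto
qed

lemma standardise:
  assumes emb: "spatial_embedding GY f"
  obtains h d1 d2 n1 n2 where "pl_homeo h" "standard_Y Gtri GY u v w x uv vw wu ux vx wx d1 d2 n1 n2 (\<lambda>p. h (f p))"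
proof -
  interpret Y: spatial_graph GY f using fin_Y emb by (intro spatial_graph.intro spatial_graph_axioms.intro)
  have in_Y: "ux \<in> arcs GY" "vx \<in> arcs GY" "wx \<in> arcs GY" using arcs_Y by auto
  obtain p1 where p1: "leg p1 (f (Vertex x))" "p1 0 = f (Vertex u)" "p1 ` {0..1} = f ` closed_edge GY ux"
    by (rule Y.edge_leg[OF in_Y(1) Y_ends(1) x_distinct(1)[symmetric]]) (rule that; assumption)
  obtain p2 where p2: "leg p2 (f (Vertex x))" "p2 0 = f (Vertex v)" "p2 ` {0..1} = f ` closed_edge GY vx"
    by (rule Y.edge_leg[OF in_Y(2) Y_ends(2) x_distinct(2)[symmetric]]) (rule that; assumption)
  obtain p3 where p3: "leg p3 (f (Vertex x))" "p3 0 = f (Vertex w)" "p3 ` {0..1} = f ` closed_edge GY wx"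
    by (rule Y.edge_leg[OF in_Y(3) Y_ends(3) x_distinct(3)[symmetric]]) (rule that; assumption)
  have meet: "f ` closed_edge GY e \<inter> f ` closed_edge GY e' \<subseteq> {f (Vertex x)}"
    if "e \<in> arcs GY" "e' \<in> arcs GY" "e \<noteq> e'" "ends GY e \<inter> ends GY e' \<subseteq> {x}" for e e'
  proof
    fix p assume "p \<in> f ` closed_edge GY e \<inter> f ` closed_edge GY e'"
    then have "\<exists>y\<in>ends GY e \<inter> ends GY e'. p = f (Vertex y)" using Y.edges_meet[OF that(1-3)] by blast
    then show "p \<in> {f (Vertex x)}" using that(4) by auto
  qed
  have m: "p1 ` {0..1} \<inter> p2 ` {0..1} \<subseteq> {f (Vertex x)}" "p1 ` {0..1} \<inter> p3 ` {0..1} \<subseteq> {f (Vertex x)}"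
    "p2 ` {0..1} \<inter> p3 ` {0..1} \<subseteq> {f (Vertex x)}"
    unfolding p1(3) p2(3) p3(3) using in_Y Y_distinct distinct Y_ends by (intro meet; auto)+
  \<comment> \<open>The whole common part of the two graphs is the obstacle, so that one triangle
    serves every cycle union.\<close>
  define R where "R = f ` old"
  have cS: "f (Vertex x) \<in> S3" using verts_Y emb unfolding spatial_embedding_def realization_def by auto
  have RS: "R \<subseteq> S3" using image_mono[OF old_sub, of f] emb unfolding R_def spatial_embedding_def by blast
  have polyR: "polyhedral R"
  proof -
    have *: "R = f ` Vertex ` verts Gtri \<union> (\<Union>e\<in>arcs Gtri - {uv, vw, wu}. f ` closed_edge GY e)"
      unfolding R_def old_def image_Un image_UN using outer(2) by simp
    show ?thesis unfolding *
    proof (rule polyhedral_Un)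
      show "polyhedral (f ` Vertex ` verts Gtri)"
        using fin_digraph.finite_verts[OF fin_tri] by (intro polyhedral_finite finite_imageI)
      show "polyhedral (\<Union>e\<in>arcs Gtri - {uv, vw, wu}. f ` closed_edge GY e)"
        using finite_sub[OF order_refl] arcs_Y by (intro polyhedral_UN polyhedral_edge[OF emb]) auto
    qed
  qed
  have RY: "R \<inter> f ` closed_edge GY e \<subseteq> {f (Vertex a)}"
    if "e \<in> arcs GY" "old \<inter> closed_edge GY e \<subseteq> {Vertex a}" for e a
  proof -
    have "R \<inter> f ` closed_edge GY e = f ` (old \<inter> closed_edge GY e)"
      unfolding R_def by (rule inj_on_image_Int[OF Y.inj old_sub Y.edge_in[OF that(1)], symmetric])
    then show ?thesis using image_mono[OF that(2), of f] by simp
  qed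
  have Rp: "R \<inter> p1 ` {0..1} \<subseteq> {p1 0}" "R \<inter> p2 ` {0..1} \<subseteq> {p2 0}" "R \<inter> p3 ` {0..1} \<subseteq> {p3 0}"
    unfolding p1(2,3) p2(2,3) p3(2,3) by (rule RY[OF in_Y(1) old_Y(1)] RY[OF in_Y(2) old_Y(2)] RY[OF in_Y(3) old_Y(3)])+
  obtain h d1 d2 n1 n2 where h: "pl_homeo h" "tripod_frame d1 d2 n1 n2"
    "h (p1 0) = north + d1" "h (p2 0) = north + d2" "h (p3 0) = north + tripod_frame.d3 d1 d2"
    "h ` p1 ` {0..1} = closed_segment north (north + d1)" "h ` p2 ` {0..1} = closed_segment north (north + d2)"
    "h ` p3 ` {0..1} = closed_segment north (north + tripod_frame.d3 d1 d2)"
    "h ` R \<inter> tripod_frame.triangle d1 d2 \<subseteq> {north + d1, north + d2, north + tripod_frame.d3 d1 d2}"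
    by (rule tripod_standard[OF p1(1) p2(1) p3(1) cS m polyR RS Rp]) (rule that; assumption)
  have ax: "standard_Y_axioms Gtri GY u v w uv vw wu ux vx wx d1 d2 (\<lambda>p. h (f p))"
  proof (rule standard_Y_axioms.intro)
    show "spatial_embedding GY (\<lambda>p. h (f p))" by (rule spatial_embedding_pl_homeo[OF emb h(1) wf_Y])
    show "h (f (Vertex u)) = north + d1" "h (f (Vertex v)) = north + d2" "h (f (Vertex w)) = north + tripod_frame.d3 d1 d2"
      using h(3-5) unfolding p1(2) p2(2) p3(2) by simp_all
    show "(\<lambda>p. h (f p)) ` closed_edge GY ux = closed_segment north (north + d1)"
      "(\<lambda>p. h (f p)) ` closed_edge GY vx = closed_segment north (north + d2)"
      "(\<lambda>p. h (f p)) ` closed_edge GY wx = closed_segment north (north + tripod_frame.d3 d1 d2)"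
      using h(6-8) unfolding p1(3) p2(3) p3(3) image_image by simp_all
    show "(\<lambda>p. h (f p)) ` (Vertex ` verts Gtri \<union> (\<Union>e\<in>arcs Gtri - {uv, vw, wu}. closed_edge Gtri e))
        \<inter> tripod_frame.triangle d1 d2 \<subseteq> {north + d1, north + d2, north + tripod_frame.d3 d1 d2}"
      using h(9) unfolding R_def image_image old_def by simp
  qed
  show thesis by (rule that[OF h(1) standard_Y.intro[OF triangle_Y_axioms h(2) ax]])
qed

text \<open>\<open>h\<close> may change the isotopy type of links. The standard picture is therefore
  used only to construct the new edges and the isotopies, and the inverse \<open>k\<close> carries
  everything back to the given \<open>f\<close>.\<close>

lemma exchange_embedding:
  assumes emb: "spatial_embedding GY f"
  obtains g where "spatial_embedding Gtri g"
    "\<And>E. even_set Gtri E \<Longrightarrow> \<not> {uv, vw, wu} \<subseteq> E \<Longrightarrow> \<exists>E'. even_set GY E' \<and> E' - {ux, vx, wx} = E - {uv, vw, wu} \<and>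
      isotopic_or_eq (g ` realization (arc_subgraph Gtri E)) (f ` realization (arc_subgraph GY E'))"
    "\<And>E L. even_set Gtri E \<Longrightarrow> {uv, vw, wu} \<subseteq> E \<Longrightarrow> L = g ` realization (arc_subgraph Gtri E) \<Longrightarrow>
      \<exists>K D. K \<in> components L \<and> pl_disk_with_boundary D K \<and> D \<inter> L = K"
proof -
  obtain h d1 d2 n1 n2 where h: "pl_homeo h" "standard_Y Gtri GY u v w x uv vw wu ux vx wx d1 d2 n1 n2 (\<lambda>p. h (f p))"
    by (rule standardise[OF emb]) (rule that; assumption)
  obtain k where k: "pl_homeo k" "\<And>x. x \<in> S3 \<Longrightarrow> k (h x) = x"
    by (rule pl_homeo_inv[OF h(1)]) (rule that; assumption)
  interpret s: standard_Y Gtri GY u v w x uv vw wu ux vx wx d1 d2 n1 n2 "\<lambda>p. h (f p)" by (rule h(2))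
  have fS: "f ` realization GY \<subseteq> S3" using emb unfolding spatial_embedding_def by simp
  have sub: "realization (arc_subgraph G E) \<subseteq> realization G" if "wf_digraph G" "even_set G E" for G :: "('v, 'e) pre_digraph" and E
    using that(2) unfolding realization_arc_subgraph realization_eq[OF that(1)] even_set_def by blast
  show thesis
  proof (rule that[of "\<lambda>p. k (s.g p)"])
    show "spatial_embedding Gtri (\<lambda>p. k (s.g p))" by (rule spatial_embedding_pl_homeo[OF s.g_embedding k(1) wf_tri])
  next
    fix E assume E: "even_set Gtri E" "\<not> {uv, vw, wu} \<subseteq> E"
    from s.corr[OF E] obtain E' where E': "even_set GY E'" "E' - {ux, vx, wx} = E - {uv, vw, wu}"
      "isotopic_or_eq (s.g ` realization (arc_subgraph Gtri E)) ((\<lambda>p. h (f p)) ` realization (arc_subgraph GY E'))"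
      by (elim exE conjE)
    have fE: "f ` realization (arc_subgraph GY E') \<subseteq> S3"
      using image_mono[OF sub[OF wf_Y E'(1)], of f] fS by simp
    have "s.g ` realization (arc_subgraph Gtri E) \<subseteq> S3"
      using image_mono[OF sub[OF wf_tri E(1)], of s.g] s.g_embedding unfolding spatial_embedding_def by (meson order_trans)
    moreover have "(\<lambda>p. h (f p)) ` realization (arc_subgraph GY E') \<subseteq> S3"
      using pl_homeo_subset[OF h(1) fE] unfolding image_image .
    ultimately have "isotopic_or_eq (k ` s.g ` realization (arc_subgraph Gtri E))
        (k ` (\<lambda>p. h (f p)) ` realization (arc_subgraph GY E'))"
      using E'(3) by (rule isotopic_or_eq_pl_homeo[OF k(1)])
    moreover have "k ` (\<lambda>p. h (f p)) ` realization (arc_subgraph GY E') = f ` realization (arc_subgraph GY E')"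
      unfolding image_image by (rule image_cong[OF refl], rule k(2)) (use fE in blast)
    ultimately have "isotopic_or_eq ((\<lambda>p. k (s.g p)) ` realization (arc_subgraph Gtri E)) (f ` realization (arc_subgraph GY E'))"
      unfolding image_image by simp
    then show "\<exists>E'. even_set GY E' \<and> E' - {ux, vx, wx} = E - {uv, vw, wu} \<and>
      isotopic_or_eq ((\<lambda>p. k (s.g p)) ` realization (arc_subgraph Gtri E)) (f ` realization (arc_subgraph GY E'))"
      using E'(1,2) by (intro exI conjI)
  next
    fix E and L :: "(real^4) set" assume E: "even_set Gtri E" "{uv, vw, wu} \<subseteq> E" and L: "L = (\<lambda>p. k (s.g p)) ` realization (arc_subgraph Gtri E)"
    obtain R where R: "s.g ` realization (arc_subgraph Gtri E) =
      (closed_segment (s.P u) (s.P v) \<union> closed_segment (s.P v) (s.P w) \<union> closed_segment (s.P w) (s.P u)) \<union> R"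
      "polyhedral R" "R \<subseteq> S3" "R \<inter> s.triangle = {}"
      by (rule s.full_triangle[OF E]) (rule that; assumption)
    have T: "s.triangle = convex hull {s.P u, s.P v, s.P w}" unfolding s.triangle_def s.corners ..
    have "L = k ` s.g ` realization (arc_subgraph Gtri E)" unfolding L image_image ..
    then have "L = k ` ((closed_segment (s.P u) (s.P v) \<union> closed_segment (s.P v) (s.P w) \<union> closed_segment (s.P w) (s.P u)) \<union> R)"
      unfolding R(1) .
    then show "\<exists>K D. K \<in> components L \<and> pl_disk_with_boundary D K \<and> D \<inter> L = K"
      by (rule compressing_disk[OF k(1) s.not_col s.triangle_S3[unfolded T] R(2,3) R(4)[unfolded T]])
  qed
qed

end

section \<open>The correspondence of cycle unions as an identity of point sets\<close>

lemma realization_Diff_eq_iff: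
  fixes G H G' H' :: "('v, 'e) pre_digraph"
  shows "realization G - realization H = realization G' - realization H' \<longleftrightarrow>
    verts G - verts H = verts G' - verts H' \<and> arcs G - arcs H = arcs G' - arcs H'"
proof -
  have "Inner e t \<in> realization G \<longleftrightarrow> e \<in> arcs G \<and> 0 < t \<and> t < 1" "Vertex z \<in> realization G \<longleftrightarrow> z \<in> verts G"
    for e t z and G :: "('v, 'e) pre_digraph"
    unfolding realization_def by auto
  \<comment> \<open>A vertex is detected by its own point and an edge by its midpoint.\<close>
  then have d: "verts G - verts H = {z. Vertex z \<in> realization G - realization H}"
    "arcs G - arcs H = {e. Inner e (1 / 2) \<in> realization G - realization H}"
    for G H :: "('v, 'e) pre_digraph"
    by auto
  have d': "realization G - realization H = Vertex ` (verts G - verts H) \<union> {Inner e t | e t. e \<in> arcs G - arcs H \<and> 0 < t \<and> t < 1}"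
    for G H :: "('v, 'e) pre_digraph"
    unfolding realization_def by auto
  show ?thesis
  proof (intro iffI conjI)
    assume eq: "realization G - realization H = realization G' - realization H'"
    show "verts G - verts H = verts G' - verts H'" unfolding d(1) eq ..
    show "arcs G - arcs H = arcs G' - arcs H'" unfolding d(2) eq ..
  next
    assume "verts G - verts H = verts G' - verts H' \<and> arcs G - arcs H = arcs G' - arcs H'"
    note eq = conjunct1[OF this] conjunct2[OF this]
    show "realization G - realization H = realization G' - realization H'" unfolding d' eq ..
  qed
qed

context triangle_Y
begin

lemma triangle_subgraph_iff:
  assumes "even_set Gtri E"
  shows "subgraph \<lparr>verts = {u, v, w}, arcs = {uv, vw, wu}, tail = tail Gtri, head = head Gtri\<rparr> (arc_subgraph Gtri E)
    \<longleftrightarrow> {uv, vw, wu} \<subseteq> E"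
proof -
  have in_ends: "tail Gtri e \<in> ends Gtri e" "head Gtri e \<in> ends Gtri e" for e unfolding ends_def by auto
  have "wf_digraph \<lparr>verts = {u, v, w}, arcs = {uv, vw, wu}, tail = tail Gtri, head = head Gtri\<rparr>"
    unfolding wf_digraph_def using in_ends[of uv] in_ends[of vw] in_ends[of wu] unfolding tri_ends by auto
  moreover have "{u, v, w} \<subseteq> (\<Union>e\<in>E. ends Gtri e)" if "{uv, vw, wu} \<subseteq> E" using that tri_ends by blast
  ultimately show ?thesis unfolding subgraph_def compatible_def using wf_arc_subgraph by auto
qed

text \<open>Vertices other than the corners and \<open>x\<close> are ends of outer edges, so
  equality of the outer edge sets already implies equality of the vertex sets; \<open>x\<close> is
  not an end of any outer edge.\<close>

lemma realization_Diff_iff: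
  assumes E: "even_set Gtri E" "even_set GY E'"
  shows "realization (arc_subgraph Gtri E) - realization \<lparr>verts = {u, v, w}, arcs = {uv, vw, wu}, tail = tail Gtri, head = head Gtri\<rparr>
      = realization (arc_subgraph GY E') - realization \<lparr>verts = {u, v, w, x}, arcs = {ux, vx, wx}, tail = tail GY, head = head GY\<rparr>
    \<longleftrightarrow> E - {uv, vw, wu} = E' - {ux, vx, wx}"
proof -
  have "(\<Union>e\<in>E. ends Gtri e) - {u, v, w} = (\<Union>e\<in>E'. ends GY e) - {u, v, w, x}"
    if eq: "E - {uv, vw, wu} = E' - {ux, vx, wx}"
  proof -
    define O' where "O' = E - {uv, vw, wu}"
    have O': "O' \<subseteq> arcs Gtri - {uv, vw, wu}" using E(1) unfolding O'_def even_set_def by blast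
    have "(\<Union>e\<in>E. ends Gtri e) - {u, v, w} = (\<Union>e\<in>O'. ends Gtri e) - {u, v, w}"
      unfolding O'_def using tri_ends by blast
    also have "\<dots> = (\<Union>e\<in>O'. ends Gtri e) - {u, v, w, x}"
    proof -
      have "x \<notin> (\<Union>e\<in>O'. ends Gtri e)" using O' ends_tri x_new by blast
      then show ?thesis by blast
    qed
    also have "(\<Union>e\<in>O'. ends Gtri e) = (\<Union>e\<in>O'. ends GY e)" using outer(1) O' by (intro SUP_cong) auto
    also have "\<dots> - {u, v, w, x} = (\<Union>e\<in>E'. ends GY e) - {u, v, w, x}"
      unfolding O'_def eq using Y_ends by blast
    finally show ?thesis .
  qed
  then show ?thesis unfolding realization_Diff_eq_iff by auto
qed

end

lemma delta_Y_exchangeE: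
  assumes "fin_digraph Gtri" "fin_digraph GY" "delta_Y_exchange Gtri T GY Y"
  obtains u v w x uv vw wu ux vx wx where "triangle_Y Gtri GY u v w x uv vw wu ux vx wx"
    "T = \<lparr>verts = {u, v, w}, arcs = {uv, vw, wu}, tail = tail Gtri, head = head Gtri\<rparr>"
    "Y = \<lparr>verts = {u, v, w, x}, arcs = {ux, vx, wx}, tail = tail GY, head = head GY\<rparr>"
  using assms(3) unfolding delta_Y_exchange_def
  by (elim exE conjE) (rule that, rule triangle_Y.intro[OF assms(1,2)], (assumption | (drule (1) bspec, assumption))+)

theorem theorem1p2:
  fixes Gtri T GY Y :: "('v, 'e) pre_digraph"
    and \<alpha> :: "('v, 'e) pre_digraph \<Rightarrow> (real^4) set \<Rightarrow> 'a::ab_group_add"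
    and c :: 'a
  assumes "fin_digraph Gtri" and "fin_digraph GY"
    and "delta_Y_exchange Gtri T GY Y"
    and "\<And>\<gamma>'. \<gamma>' \<in> Gamma_bar Gtri \<Longrightarrow> link_invariant (\<alpha> \<gamma>')"
    and "\<And>\<gamma>'. \<gamma>' \<in> Gamma_bar_containing T Gtri \<Longrightarrow> compressible (\<alpha> \<gamma>')"
    and "\<And>g. spatial_embedding Gtri g \<Longrightarrow>
           (\<Sum>\<gamma>' \<in> Gamma_bar Gtri. \<alpha> \<gamma>' (g ` realization \<gamma>')) = c"
    and "spatial_embedding GY f"
  shows "(\<Sum>\<gamma> \<in> Gamma_bar GY. alpha_tilde Gtri T GY Y \<alpha> \<gamma> (f ` realization \<gamma>)) = c"
proof -
  obtain u v w x uv vw wu ux vx wx where tY: "triangle_Y Gtri GY u v w x uv vw wu ux vx wx"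
    and T: "T = \<lparr>verts = {u, v, w}, arcs = {uv, vw, wu}, tail = tail Gtri, head = head Gtri\<rparr>"
    and Y: "Y = \<lparr>verts = {u, v, w, x}, arcs = {ux, vx, wx}, tail = tail GY, head = head GY\<rparr>"
    by (rule delta_Y_exchangeE[OF assms(1-3)]) (rule that; assumption)
  interpret triangle_Y Gtri GY u v w x uv vw wu ux vx wx by (rule tY)
  obtain g where g: "spatial_embedding Gtri g"
    "\<And>E. even_set Gtri E \<Longrightarrow> \<not> {uv, vw, wu} \<subseteq> E \<Longrightarrow> \<exists>E'. even_set GY E' \<and> E' - {ux, vx, wx} = E - {uv, vw, wu} \<and>
      isotopic_or_eq (g ` realization (arc_subgraph Gtri E)) (f ` realization (arc_subgraph GY E'))"
    "\<And>E L. even_set Gtri E \<Longrightarrow> {uv, vw, wu} \<subseteq> E \<Longrightarrow> L = g ` realization (arc_subgraph Gtri E) \<Longrightarrow>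
      \<exists>K D. K \<in> components L \<and> pl_disk_with_boundary D K \<and> D \<inter> L = K"
    by (rule exchange_embedding[OF assms(7)]) (rule that; assumption)
  note tri = Gamma_bar_iff[OF assms(1) g(1)] and Yi = Gamma_bar_iff[OF assms(2,7)]
  define A where "A = Gamma_bar Gtri - Gamma_bar_containing T Gtri"
  define \<Phi> where "\<Phi> = Phi_bar T GY Y"
  have fin: "finite (Gamma_bar Gtri)" "finite (Gamma_bar GY)" "finite A"
    using finite_Gamma_bar[OF assms(1) g(1)] finite_Gamma_bar[OF assms(2,7)] unfolding A_def by simp_all
  have \<Phi>: "\<Phi> \<gamma> \<in> Gamma_bar GY \<and> \<alpha> \<gamma> (f ` realization (\<Phi> \<gamma>)) = \<alpha> \<gamma> (g ` realization \<gamma>)" if \<gamma>: "\<gamma> \<in> A" for \<gamma>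
  proof -
    have "\<gamma> \<in> Gamma_bar Gtri" "\<not> subgraph T \<gamma>" using \<gamma> unfolding A_def Gamma_bar_containing_def by auto
    then obtain E where E: "even_set Gtri E" "\<gamma> = arc_subgraph Gtri E" unfolding tri(1) by (elim exE conjE)
    have nT: "\<not> {uv, vw, wu} \<subseteq> E" using \<open>\<not> subgraph T \<gamma>\<close> unfolding T E(2) triangle_subgraph_iff[OF E(1)] .
    from g(2)[OF E(1) nT] obtain E' where E': "even_set GY E'" "E' - {ux, vx, wx} = E - {uv, vw, wu}"
      "isotopic_or_eq (g ` realization (arc_subgraph Gtri E)) (f ` realization (arc_subgraph GY E'))"
      by (elim exE conjE)
    \<comment> \<open>Existence comes from the exchange of edge sets and uniqueness from
      \<open>even_unique\<close>; together they evaluate the definite description.\<close>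
    have "\<Phi> \<gamma> = arc_subgraph GY E'"
      unfolding \<Phi>_def Phi_bar_def
    proof (rule the_equality)
      show "arc_subgraph GY E' \<in> Gamma_bar GY \<and> realization \<gamma> - realization T = realization (arc_subgraph GY E') - realization Y"
        unfolding T Y E(2) realization_Diff_iff[OF E(1) E'(1)] using E'(1,2) Yi(1) by auto
    next
      fix \<gamma>2 assume 2: "\<gamma>2 \<in> Gamma_bar GY \<and> realization \<gamma> - realization T = realization \<gamma>2 - realization Y"
      then obtain E2 where E2: "even_set GY E2" "\<gamma>2 = arc_subgraph GY E2" unfolding Yi(1) by (elim exE conjE)
      have "E - {uv, vw, wu} = E2 - {ux, vx, wx}"
        using 2 unfolding T Y E(2) E2(2) realization_Diff_iff[OF E(1) E2(1)] by simp
      then have "E2 = E'" using even_unique[OF E2(1) E'(1)] E'(2) by simp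
      then show "\<gamma>2 = arc_subgraph GY E'" using E2(2) by simp
    qed
    moreover have "arc_subgraph GY E' \<in> Gamma_bar GY" using Yi(1) E'(1) by auto
    moreover have "\<alpha> \<gamma> (g ` realization (arc_subgraph Gtri E)) = \<alpha> \<gamma> (f ` realization (arc_subgraph GY E'))"
      by (rule link_invariant_isotopic_or_eq[OF assms(4)[OF \<open>\<gamma> \<in> Gamma_bar Gtri\<close>] tri(2)[OF E(1)] Yi(2)[OF E'(1)] E'(3)])
    ultimately show ?thesis using E(2) by simp
  qed
  have zero: "\<alpha> \<gamma> (g ` realization \<gamma>) = 0" if \<gamma>: "\<gamma> \<in> Gamma_bar_containing T Gtri" for \<gamma>
  proof -
    have "\<gamma> \<in> Gamma_bar Gtri" "subgraph T \<gamma>" using \<gamma> unfolding Gamma_bar_containing_def by auto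
    then obtain E where E: "even_set Gtri E" "\<gamma> = arc_subgraph Gtri E" unfolding tri(1) by (elim exE conjE)
    have "{uv, vw, wu} \<subseteq> E" using \<open>subgraph T \<gamma>\<close> unfolding T E(2) triangle_subgraph_iff[OF E(1)] .
    from g(3)[OF E(1) this refl] tri(2)[OF E(1)] show ?thesis
      using assms(5)[OF \<gamma>] unfolding compressible_def E(2)[symmetric] by blast
  qed
  have sub: "Gamma_bar_containing T Gtri \<subseteq> Gamma_bar Gtri" unfolding Gamma_bar_containing_def by blast
  have "(\<Sum>\<gamma> \<in> Gamma_bar GY. alpha_tilde Gtri T GY Y \<alpha> \<gamma> (f ` realization \<gamma>))
      = (\<Sum>\<gamma> \<in> Gamma_bar GY. \<Sum>\<gamma>' \<in> {\<gamma>' \<in> A. \<Phi> \<gamma>' = \<gamma>}. \<alpha> \<gamma>' (f ` realization (\<Phi> \<gamma>')))"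
    unfolding alpha_tilde_def A_def \<Phi>_def by (intro sum.cong refl) auto
  \<comment> \<open>The fibres of \<Phi> over \<open>Gamma_bar GY\<close> partition
    \<open>A\<close>, so the double sum is a sum over \<open>A\<close>.\<close>
  also have "\<dots> = (\<Sum>\<gamma>' \<in> A. \<alpha> \<gamma>' (f ` realization (\<Phi> \<gamma>')))"
    using fin \<Phi> by (intro sum.group) auto
  also have "\<dots> = (\<Sum>\<gamma>' \<in> A. \<alpha> \<gamma>' (g ` realization \<gamma>'))"
    using \<Phi> by (intro sum.cong refl) blast
  \<comment> \<open>The terms of the cycle unions containing the triangle are 0 and are added to
    complete the sum over \<open>Gamma_bar Gtri\<close>.\<close>
  also have "\<dots> = (\<Sum>\<gamma>' \<in> A. \<alpha> \<gamma>' (g ` realization \<gamma>')) + (\<Sum>\<gamma>' \<in> Gamma_bar_containing T Gtri. \<alpha> \<gamma>' (g ` realization \<gamma>'))"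
    using zero by simp
  also have "\<dots> = (\<Sum>\<gamma>' \<in> Gamma_bar Gtri. \<alpha> \<gamma>' (g ` realization \<gamma>'))"
    unfolding A_def by (rule sum.subset_diff[OF sub fin(1), symmetric])
  also have "\<dots> = c" by (rule assms(6)[OF g(1)])
  finally show ?thesis .
qed

end
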